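(* Consider the controlled system with default, the performance functional $J$, the set of admissible controls $\mathcal{A}$ and the Hamiltonian $\mathcal{H}$ described in the context. Let $\hat u\in\mathcal{A}$ with corresponding solution $\hat X=X^{\hat u}$ of the controlled SDE $$dX_t=b(t,X_t,u_t)\,dt+\sigma(t,X_t,u_t)\,dW_t+\gamma(t,X_{t^-},u_t)\,dM_t,\quad X_0=x_0,$$ (for $u=\hat u$), and let $(\hat p,\hat q,\hat w)\in S^2\times H^2\times H^2(\lambda)$ be the corresponding solution of the adjoint BSDE $$d\hat p_t=-\frac{\partial\mathcal{H}}{\partial x}(t,\hat X_t,\hat u_t,\hat p_t,\hat q_t,\hat w_t)\,dt+\hat q_t\,dW_t+\hat w_t\,dM_t,\quad \hat p_T=g'(\hat X_T).$$ Assume that: (i) the functions $x\mapsto g(x)$ on $\mathbb{R}$ and $(x,u)\mapsto\mathcal{H}(t,x,u,\hat p_t,\hat q_t,\hat w_t)$ on $\mathbb{R}\times\mathcal{V}$ are concave a.s. for every $t\in[0,T]$; (ii) $\displaystyle\max_{v\in\mathcal{V}}\mathcal{H}(t,\hat X_t,v,\hat p_t,\hat q_t,\hat w_t)=\mathcal{H}(t,\hat X_t,\hat u_t,\hat p_t,\hat q_t,\hat w_t)$, $dt\times P$-a.s. Then $\hat u$ is an optimal control, i.e. $J(u)\le J(\hat u)$ for all $u\in\mathcal{A}$.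
   Context: Probabilistic setting. Fix $T>0$. $(\Omega,\mathcal{G},P)$ is a complete probability space carrying a one-dimensional standard Brownian motion $W$ and the single jump process $H_t=\mathbf{1}_{\{\tau\le t\}}$, where $\tau$ is a positive random variable with $P(\tau\ge t)>0$ for all $t\ge0$. $\mathbb{G}=(\mathcal{G}_t)_{t\ge0}$ is the complete natural filtration of $W$ and $H$, and $W$ is assumed to be a $\mathbb{G}$-Brownian motion. The increasing process $H$ admits a predictable compensator $\Lambda_t=\int_0^t\lambda_s\,ds$, where $\lambda$ is a nonnegative $\mathbb{G}$-adapted process, called the intensity (it vanishes after $\tau$). The process $M_t=H_t-\int_0^t\lambda_s\,ds$ is a $\mathbb{G}$-martingale. Spaces. $S^2$: real $\mathbb{G}$-adapted càdlàg processes $Y$ on $[0,T]$ with $E[\sup_{t\in[0,T]}|Y_t|^2]<\infty$. $H^2$: real $\mathbb{G}$-predictable processes $Z$ with $E[\int_0^T|Z_t|^2dt]<\infty$. $H^2(\lambda)$: real $\mathbb{G}$-predictable processes $U$ with $E[\int_0^T\lambda_t|U_t|^2dt]<\infty$. Controls. $\mathcal{V}\subseteq\mathbb{R}$ is a given convex set and $\mathcal{A}$ is a given set of $\mathcal{V}$-valued $\mathbb{G}$-predictable processes in $L^2(\Omega\times[0,T])$ (admissible controls). State equation. For $u\in\mathcal{A}$, $X=X^u\in S^2$ denotes the unique solution of the controlled SDE in the claim, with $x_0\in\mathbb{R}$ and coefficients $b,\sigma,\gamma:\Omega\times[0,T]\times\mathbb{R}\times\mathcal{V}\to\mathbb{R}$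 (dependence on $\omega$ is suppressed) satisfying: (a) for each fixed $(\omega,t)$, $b,\sigma,\gamma$ are $C^1$ in $(x,u)$, and these functions and their first-order partial derivatives in $x,u$ are bounded (uniformly in all variables); (b) for each $(x,u)\in\mathbb{R}\times\mathcal{V}$, $b(\cdot,x,u),\sigma(\cdot,x,u),\gamma(\cdot,x,u)$ are $\mathbb{G}$-predictable; (c) they are Lipschitz in $x$ for each $u\in\mathcal{V}$, with a Lipschitz constant independent of $t,\omega$; (d) they have linear growth in $x$ for each $u\in\mathcal{V}$, with a constant independent of $t,\omega$. Performance functional (to be maximised over $\mathcal{A}$). $J(u)=E\big[\int_0^Th(t,X_t,u_t)\,dt+g(X_T)\big]$ with $X=X^u$, where $h:\Omega\times[0,T]\times\mathbb{R}\times\mathcal{V}\to\mathbb{R}$ is $\mathbb{G}$-predictable (for each fixed $(x,u)$), $g:\Omega\times\mathbb{R}\to\mathbb{R}$ is $\mathcal{G}_T$-measurable (for each fixed $x$), $h$ is $C^1$ in $(x,u)$ and $g$ is $C^1$ in $x$, with bounded derivatives, and $E\big[\int_0^Th^2(t,X_t,u_t)\,dt+g^2(X_T)\big]<\infty$ for every $u\in\mathcal{A}$. Hamiltonian. $\mathcal{H}(t,x,u,p,q,w)=h(t,x,u)+b(t,x,u)p+\sigma(t,x,u)q+\lambda_t\gamma(t,x,u)w$ (random through $h,b,\sigma,\gamma,\lambda$). When $\gamma$ is evaluated along the state process, $X_{t^-}$ is used in place of $X_t$ (which makes no difference $dt\times P$-a.e.). *)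

theory Defs
  imports "HOL-Probability.Probability"
begin

text \<open>A process is a function \<open>Y :: real \<Rightarrow> 'a \<Rightarrow> real\<close>, with time as first argument; only its values
  at times in \<open>[0, \<infinity>)\<close>, respectively \<open>[0, T]\<close>, and at \<open>\<omega> \<in> space P\<close> matter.  Random fields
  (the coefficients) take the arguments \<open>t \<omega> x v\<close> in this order.\<close>

definition default_indicator :: "('a \<Rightarrow> real) \<Rightarrow> real \<Rightarrow> 'a \<Rightarrow> real" where
  "default_indicator \<tau> t \<omega> = (if \<tau> \<omega> \<le> t then 1 else 0)"

definition default_filtration ::
  "'a measure \<Rightarrow> (real \<Rightarrow> 'a \<Rightarrow> real) \<Rightarrow> ('a \<Rightarrow> real) \<Rightarrow> real \<Rightarrow> 'a measure" where
  "default_filtration P W \<tau> t = sigma (space P)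
     ({W s -` B \<inter> space P | s B. 0 \<le> s \<and> s \<le> t \<and> B \<in> sets borel} \<union>
      {default_indicator \<tau> s -` B \<inter> space P | s B. 0 \<le> s \<and> s \<le> t \<and> B \<in> sets borel} \<union>
      null_sets P)"

definition predictable_sigma :: "'a measure \<Rightarrow> (real \<Rightarrow> 'a measure) \<Rightarrow> (real \<times> 'a) measure" where
  "predictable_sigma P F = sigma ({0..} \<times> space P)
     ({{0} \<times> A | A. A \<in> sets (F 0)} \<union>
      {{s<..t} \<times> A | s t A. 0 \<le> s \<and> s < t \<and> A \<in> sets (F s)})"

definition predictable_on ::
  "'a measure \<Rightarrow> (real \<Rightarrow> 'a measure) \<Rightarrow> real \<Rightarrow> (real \<Rightarrow> 'a \<Rightarrow> real) \<Rightarrow> bool" where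
  "predictable_on P F T Z \<longleftrightarrow> (\<lambda>(t, \<omega>). Z t \<omega>)
     \<in> borel_measurable (restrict_space (predictable_sigma P F) ({0..T} \<times> space P))"

definition brownian_motion ::
  "'a measure \<Rightarrow> (real \<Rightarrow> 'a measure) \<Rightarrow> (real \<Rightarrow> 'a \<Rightarrow> real) \<Rightarrow> bool" where
  "brownian_motion P F W \<longleftrightarrow>
     (\<forall>t\<ge>0. W t \<in> borel_measurable P \<and> W t \<in> borel_measurable (F t)) \<and>
     (AE \<omega> in P. W 0 \<omega> = 0) \<and>
     (AE \<omega> in P. continuous_on {0..} (\<lambda>t. W t \<omega>)) \<and>
     (\<forall>s t. 0 \<le> s \<and> s < t \<longrightarrow>
        distributed P lborel (\<lambda>\<omega>. W t \<omega> - W s \<omega>) (normal_density 0 (sqrt (t - s))) \<and>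
        prob_space.indep_set P (sets (F s))
          (sets (vimage_algebra (space P) (\<lambda>\<omega>. W t \<omega> - W s \<omega>) borel)))"

definition martingale ::
  "'a measure \<Rightarrow> (real \<Rightarrow> 'a measure) \<Rightarrow> (real \<Rightarrow> 'a \<Rightarrow> real) \<Rightarrow> bool" where
  "martingale P F N \<longleftrightarrow>
     (\<forall>t\<ge>0. N t \<in> borel_measurable (F t) \<and> integrable P (N t)) \<and>
     (\<forall>s t. 0 \<le> s \<and> s \<le> t \<longrightarrow> (AE \<omega> in P. real_cond_exp P (F s) (N t) \<omega> = N s \<omega>))"

text \<open>\<open>\<Lambda>\<^sub>t = \<integral>\<^sub>0\<^sup>t \<lambda>\<^sub>s ds\<close>; it vanishes for \<open>t < 0\<close>.\<close>

definition compensator :: "(real \<Rightarrow> 'a \<Rightarrow> real) \<Rightarrow> real \<Rightarrow> 'a \<Rightarrow> real" where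
  "compensator lam t \<omega> = (LBINT s:{0..t}. lam s \<omega>)"

text \<open>Joint measurability and local integrability of \<open>lam\<close> give a meaning to \<open>\<integral>\<^sub>0\<^sup>t \<lambda>\<^sub>s ds\<close>.\<close>

locale default_setting = prob_space P + complete_measure P for P :: "'a measure" +
  fixes W :: "real \<Rightarrow> 'a \<Rightarrow> real"
    and \<tau> :: "'a \<Rightarrow> real"
    and lam :: "real \<Rightarrow> 'a \<Rightarrow> real"
  assumes tau_measurable: "\<tau> \<in> borel_measurable P"
    and tau_positive: "\<And>\<omega>. \<omega> \<in> space P \<Longrightarrow> 0 < \<tau> \<omega>"
    and tau_tail: "\<And>t. 0 \<le> t \<Longrightarrow> 0 < measure P {\<omega> \<in> space P. t \<le> \<tau> \<omega>}"
    and brownian: "brownian_motion P (default_filtration P W \<tau>) W"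
    and lam_measurable:
      "(\<lambda>(t, \<omega>). lam t \<omega>) \<in> borel_measurable (restrict_space borel {0..} \<Otimes>\<^sub>M P)"
    and lam_adapted: "\<And>t. 0 \<le> t \<Longrightarrow> lam t \<in> borel_measurable (default_filtration P W \<tau> t)"
    and lam_nonneg: "\<And>t \<omega>. 0 \<le> t \<Longrightarrow> \<omega> \<in> space P \<Longrightarrow> 0 \<le> lam t \<omega>"
    and lam_integrable:
      "AE \<omega> in P. \<forall>t\<ge>0. set_integrable lborel {0..t} (\<lambda>s. lam s \<omega>)"
    and lam_after_tau: "AE \<omega> in P. \<forall>t>\<tau> \<omega>. lam t \<omega> = 0"
    and compensator_predictable:
      "(\<lambda>(t, \<omega>). compensator lam t \<omega>)
         \<in> borel_measurable (predictable_sigma P (default_filtration P W \<tau>))"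
    and compensated_martingale:
      "martingale P (default_filtration P W \<tau>)
         (\<lambda>t \<omega>. default_indicator \<tau> t \<omega> - compensator lam t \<omega>)"

definition cadlag_on :: "real \<Rightarrow> (real \<Rightarrow> real) \<Rightarrow> bool" where
  "cadlag_on T y \<longleftrightarrow>
     (\<forall>t\<in>{0..<T}. (y \<longlongrightarrow> y t) (at_right t)) \<and>
     (\<forall>t\<in>{0<..T}. \<exists>l. (y \<longlongrightarrow> l) (at_left t))"

definition S2 ::
  "'a measure \<Rightarrow> (real \<Rightarrow> 'a measure) \<Rightarrow> real \<Rightarrow> (real \<Rightarrow> 'a \<Rightarrow> real) set" where
  "S2 P F T = {Y. (\<forall>t\<in>{0..T}. Y t \<in> borel_measurable (F t)) \<and>
     (AE \<omega> in P. cadlag_on T (\<lambda>t. Y t \<omega>)) \<and>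
     (\<integral>\<^sup>+\<omega>. (SUP t\<in>{0..T}. ennreal (\<bar>Y t \<omega>\<bar>\<^sup>2)) \<partial>P) < \<infinity>}"

definition H2 ::
  "'a measure \<Rightarrow> (real \<Rightarrow> 'a measure) \<Rightarrow> real \<Rightarrow> (real \<Rightarrow> 'a \<Rightarrow> real) set" where
  "H2 P F T = {Z. predictable_on P F T Z \<and>
     (\<integral>\<^sup>+\<omega>. (\<integral>\<^sup>+t\<in>{0..T}. ennreal (\<bar>Z t \<omega>\<bar>\<^sup>2) \<partial>lborel) \<partial>P) < \<infinity>}"

definition H2_lam ::
  "'a measure \<Rightarrow> (real \<Rightarrow> 'a measure) \<Rightarrow> (real \<Rightarrow> 'a \<Rightarrow> real) \<Rightarrow> real
    \<Rightarrow> (real \<Rightarrow> 'a \<Rightarrow> real) set" where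
  "H2_lam P F lam T = {U. predictable_on P F T U \<and>
     (\<integral>\<^sup>+\<omega>. (\<integral>\<^sup>+t\<in>{0..T}. ennreal (lam t \<omega> * \<bar>U t \<omega>\<bar>\<^sup>2) \<partial>lborel) \<partial>P) < \<infinity>}"

text \<open>Simple predictable integrands \<open>\<Sum>\<^bsub>i<n\<^esub> \<xi>\<^sub>i 1\<^bsub>(t\<^sub>i, t\<^sub>i\<^sub>+\<^sub>1]\<^esub>\<close> with \<open>\<xi>\<^sub>i\<close> bounded and
  \<open>F t\<^sub>i\<close>-measurable, and their integrals up to time \<open>t\<close>.\<close>

definition simple_integrand ::
  "'a measure \<Rightarrow> (real \<Rightarrow> 'a measure) \<Rightarrow> real \<Rightarrow> nat \<Rightarrow> (nat \<Rightarrow> real) \<Rightarrow> (nat \<Rightarrow> 'a \<Rightarrow> real) \<Rightarrow> bool" where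
  "simple_integrand P F T n ts \<xi> \<longleftrightarrow>
     0 \<le> ts 0 \<and> ts n \<le> T \<and> (\<forall>i<n. ts i \<le> ts (Suc i)) \<and>
     (\<forall>i<n. \<xi> i \<in> borel_measurable (F (ts i)) \<and> (\<exists>C. \<forall>\<omega>\<in>space P. \<bar>\<xi> i \<omega>\<bar> \<le> C))"

definition simple_process ::
  "nat \<Rightarrow> (nat \<Rightarrow> real) \<Rightarrow> (nat \<Rightarrow> 'a \<Rightarrow> real) \<Rightarrow> real \<Rightarrow> 'a \<Rightarrow> real" where
  "simple_process n ts \<xi> t \<omega> = (\<Sum>i<n. \<xi> i \<omega> * indicator {ts i<..ts (Suc i)} t)"

definition simple_integral ::
  "(real \<Rightarrow> 'a \<Rightarrow> real) \<Rightarrow> nat \<Rightarrow> (nat \<Rightarrow> real) \<Rightarrow> (nat \<Rightarrow> 'a \<Rightarrow> real) \<Rightarrow> real \<Rightarrow> 'a \<Rightarrow> real" where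
  "simple_integral W n ts \<xi> t \<omega> =
     (\<Sum>i<n. \<xi> i \<omega> * (W (min t (ts (Suc i))) \<omega> - W (min t (ts i)) \<omega>))"

text \<open>\<open>I\<close> is (a continuous version of) the Ito integral process \<open>(\<integral>\<^sub>0\<^sup>t Z\<^sub>s dW\<^sub>s)\<^bsub>t \<in> [0, T]\<^esub>\<close>: the
  \<open>L\<^sup>2\<close>-limit of the integrals of simple integrands that approximate \<open>Z\<close> in \<open>L\<^sup>2(dt \<otimes> P)\<close>.
  \<open>Z\<close> itself need not be predictable, only equal \<open>dt \<otimes> P\<close>-a.e. to a predictable process, as is
  \<open>\<sigma>(t, X\<^sub>t, u\<^sub>t)\<close> for cadlag \<open>X\<close>.\<close>

definition has_ito_integral ::
  "'a measure \<Rightarrow> (real \<Rightarrow> 'a measure) \<Rightarrow> (real \<Rightarrow> 'a \<Rightarrow> real) \<Rightarrow> real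
    \<Rightarrow> (real \<Rightarrow> 'a \<Rightarrow> real) \<Rightarrow> (real \<Rightarrow> 'a \<Rightarrow> real) \<Rightarrow> bool" where
  "has_ito_integral P F W T Z I \<longleftrightarrow>
     (\<forall>t\<in>{0..T}. I t \<in> borel_measurable (F t)) \<and>
     (AE \<omega> in P. continuous_on {0..T} (\<lambda>t. I t \<omega>)) \<and>
     (\<exists>n ts \<xi>.
        (\<forall>k::nat. simple_integrand P F T (n k) (ts k) (\<xi> k)) \<and>
        (\<lambda>k. \<integral>\<^sup>+\<omega>. (\<integral>\<^sup>+t\<in>{0..T}.
            ennreal ((simple_process (n k) (ts k) (\<xi> k) t \<omega> - Z t \<omega>)\<^sup>2) \<partial>lborel) \<partial>P) \<longlonglongrightarrow> 0 \<and>
        (\<forall>t\<in>{0..T}. (\<lambda>k. \<integral>\<^sup>+\<omega>.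
            ennreal ((simple_integral W (n k) (ts k) (\<xi> k) t \<omega> - I t \<omega>)\<^sup>2) \<partial>P) \<longlonglongrightarrow> 0))"

text \<open>\<open>M = H - \<Lambda>\<close> is the difference of two increasing processes, so the integral \<open>\<integral>\<^bsub>(0, t]\<^esub> U\<^sub>s dM\<^sub>s\<close>
  is the pathwise Lebesgue--Stieltjes integral.\<close>

definition stieltjes_integrable ::
  "(real \<Rightarrow> 'a \<Rightarrow> real) \<Rightarrow> (real \<Rightarrow> 'a \<Rightarrow> real) \<Rightarrow> real \<Rightarrow> 'a \<Rightarrow> bool" where
  "stieltjes_integrable A U t \<omega> \<longleftrightarrow>
     set_integrable (interval_measure (\<lambda>s. A s \<omega>)) {0<..t} (\<lambda>s. U s \<omega>)"

definition stieltjes_integral ::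
  "(real \<Rightarrow> 'a \<Rightarrow> real) \<Rightarrow> (real \<Rightarrow> 'a \<Rightarrow> real) \<Rightarrow> real \<Rightarrow> 'a \<Rightarrow> real" where
  "stieltjes_integral A U t \<omega> = (LINT s:{0<..t}|interval_measure (\<lambda>s. A s \<omega>). U s \<omega>)"

definition jump_integral ::
  "('a \<Rightarrow> real) \<Rightarrow> (real \<Rightarrow> 'a \<Rightarrow> real) \<Rightarrow> (real \<Rightarrow> 'a \<Rightarrow> real) \<Rightarrow> real \<Rightarrow> 'a \<Rightarrow> real" where
  "jump_integral \<tau> lam U t \<omega> =
     stieltjes_integral (default_indicator \<tau>) U t \<omega> - stieltjes_integral (compensator lam) U t \<omega>"

text \<open>\<open>dY\<^sub>t = \<beta>\<^sub>t dt + \<zeta>\<^sub>t dW\<^sub>t + \<kappa>\<^sub>t dM\<^sub>t\<close> on \<open>[0, T]\<close>.\<close>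

definition has_stoch_differential ::
  "'a measure \<Rightarrow> (real \<Rightarrow> 'a \<Rightarrow> real) \<Rightarrow> ('a \<Rightarrow> real) \<Rightarrow> (real \<Rightarrow> 'a \<Rightarrow> real) \<Rightarrow> real
    \<Rightarrow> (real \<Rightarrow> 'a \<Rightarrow> real) \<Rightarrow> (real \<Rightarrow> 'a \<Rightarrow> real) \<Rightarrow> (real \<Rightarrow> 'a \<Rightarrow> real) \<Rightarrow> (real \<Rightarrow> 'a \<Rightarrow> real)
    \<Rightarrow> bool" where
  "has_stoch_differential P W \<tau> lam T Y \<beta> \<zeta> \<kappa> \<longleftrightarrow>
     (AE \<omega> in P. set_integrable lborel {0..T} (\<lambda>s. \<beta> s \<omega>)) \<and>
     (AE \<omega> in P. stieltjes_integrable (default_indicator \<tau>) \<kappa> T \<omega> \<and>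
                 stieltjes_integrable (compensator lam) \<kappa> T \<omega>) \<and>
     (\<exists>I. has_ito_integral P (default_filtration P W \<tau>) W T \<zeta> I \<and>
        (AE \<omega> in P. \<forall>t\<in>{0..T}.
           Y t \<omega> = Y 0 \<omega> + (LBINT s:{0..t}. \<beta> s \<omega>) + I t \<omega> + jump_integral \<tau> lam \<kappa> t \<omega>))"

definition left_limit :: "(real \<Rightarrow> 'a \<Rightarrow> real) \<Rightarrow> real \<Rightarrow> 'a \<Rightarrow> real" where
  "left_limit Y t \<omega> = (if t = 0 then Y 0 \<omega> else Lim (at_left t) (\<lambda>s. Y s \<omega>))"

text \<open>\<open>f\<close> is \<open>C\<^sup>1\<close> in \<open>(x, v) \<in> \<real> \<times> V\<close> for each \<open>(t, \<omega>)\<close>, with first-order partial derivatives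
  bounded uniformly in all variables.  As \<open>V\<close> need not be open, the derivative is
  taken within \<open>\<real> \<times> V\<close>.\<close>

definition C1_bounded_derivs ::
  "'a measure \<Rightarrow> real \<Rightarrow> real set \<Rightarrow> (real \<Rightarrow> 'a \<Rightarrow> real \<Rightarrow> real \<Rightarrow> real) \<Rightarrow> bool" where
  "C1_bounded_derivs P T V f \<longleftrightarrow> (\<exists>fx fv C. \<forall>t\<in>{0..T}. \<forall>\<omega>\<in>space P.
     continuous_on (UNIV \<times> V) (\<lambda>(x, v). fx t \<omega> x v) \<and>
     continuous_on (UNIV \<times> V) (\<lambda>(x, v). fv t \<omega> x v) \<and>
     (\<forall>x. \<forall>v\<in>V.
        ((\<lambda>(x, v). f t \<omega> x v) has_derivative (\<lambda>(dx, dv). fx t \<omega> x v * dx + fv t \<omega> x v * dv))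
          (at (x, v) within UNIV \<times> V) \<and>
        \<bar>fx t \<omega> x v\<bar> \<le> C \<and> \<bar>fv t \<omega> x v\<bar> \<le> C))"

definition state_coefficient ::
  "'a measure \<Rightarrow> (real \<Rightarrow> 'a measure) \<Rightarrow> real \<Rightarrow> real set
    \<Rightarrow> (real \<Rightarrow> 'a \<Rightarrow> real \<Rightarrow> real \<Rightarrow> real) \<Rightarrow> bool" where
  "state_coefficient P F T V f \<longleftrightarrow>
     C1_bounded_derivs P T V f \<and>
     (\<exists>C. \<forall>t\<in>{0..T}. \<forall>\<omega>\<in>space P. \<forall>x. \<forall>v\<in>V. \<bar>f t \<omega> x v\<bar> \<le> C) \<and>
     (\<forall>x. \<forall>v\<in>V. predictable_on P F T (\<lambda>t \<omega>. f t \<omega> x v)) \<and>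
     (\<forall>v\<in>V. \<exists>K. \<forall>t\<in>{0..T}. \<forall>\<omega>\<in>space P. lipschitz_on K UNIV (\<lambda>x. f t \<omega> x v)) \<and>
     (\<forall>v\<in>V. \<exists>K. \<forall>t\<in>{0..T}. \<forall>\<omega>\<in>space P. \<forall>x. \<bar>f t \<omega> x v\<bar> \<le> K * (1 + \<bar>x\<bar>))"

definition state_solution ::
  "'a measure \<Rightarrow> (real \<Rightarrow> 'a \<Rightarrow> real) \<Rightarrow> ('a \<Rightarrow> real) \<Rightarrow> (real \<Rightarrow> 'a \<Rightarrow> real) \<Rightarrow> real \<Rightarrow> real
    \<Rightarrow> (real \<Rightarrow> 'a \<Rightarrow> real \<Rightarrow> real \<Rightarrow> real) \<Rightarrow> (real \<Rightarrow> 'a \<Rightarrow> real \<Rightarrow> real \<Rightarrow> real)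
    \<Rightarrow> (real \<Rightarrow> 'a \<Rightarrow> real \<Rightarrow> real \<Rightarrow> real) \<Rightarrow> (real \<Rightarrow> 'a \<Rightarrow> real) \<Rightarrow> (real \<Rightarrow> 'a \<Rightarrow> real) \<Rightarrow> bool" where
  "state_solution P W \<tau> lam T x0 b \<sigma> \<gamma> u X \<longleftrightarrow>
     X \<in> S2 P (default_filtration P W \<tau>) T \<and>
     (AE \<omega> in P. X 0 \<omega> = x0) \<and>
     has_stoch_differential P W \<tau> lam T X
       (\<lambda>t \<omega>. b t \<omega> (X t \<omega>) (u t \<omega>))
       (\<lambda>t \<omega>. \<sigma> t \<omega> (X t \<omega>) (u t \<omega>))
       (\<lambda>t \<omega>. \<gamma> t \<omega> (left_limit X t \<omega>) (u t \<omega>))"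

text \<open>\<open>X u\<close> is the state process \<open>X\<^sup>u\<close> of the control \<open>u \<in> A\<close>, that is, the (unique up to
  indistinguishability) solution of the controlled equation.\<close>

locale default_control_problem = default_setting P W \<tau> lam
  for P :: "'a measure" and W :: "real \<Rightarrow> 'a \<Rightarrow> real" and \<tau> :: "'a \<Rightarrow> real"
    and lam :: "real \<Rightarrow> 'a \<Rightarrow> real" +
  fixes T :: real
    and V :: "real set"
    and A :: "(real \<Rightarrow> 'a \<Rightarrow> real) set"
    and x0 :: real
    and b \<sigma> \<gamma> :: "real \<Rightarrow> 'a \<Rightarrow> real \<Rightarrow> real \<Rightarrow> real"
    and h :: "real \<Rightarrow> 'a \<Rightarrow> real \<Rightarrow> real \<Rightarrow> real"
    and g :: "'a \<Rightarrow> real \<Rightarrow> real"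
    and X :: "(real \<Rightarrow> 'a \<Rightarrow> real) \<Rightarrow> real \<Rightarrow> 'a \<Rightarrow> real"
  assumes horizon_pos: "0 < T"
    and convex_V: "convex V"
    and admissible_values: "\<And>u t \<omega>. u \<in> A \<Longrightarrow> t \<in> {0..T} \<Longrightarrow> \<omega> \<in> space P \<Longrightarrow> u t \<omega> \<in> V"
    and admissible_predictable:
      "\<And>u. u \<in> A \<Longrightarrow> predictable_on P (default_filtration P W \<tau>) T u"
    and admissible_L2:
      "\<And>u. u \<in> A \<Longrightarrow> (\<integral>\<^sup>+\<omega>. (\<integral>\<^sup>+t\<in>{0..T}. ennreal (\<bar>u t \<omega>\<bar>\<^sup>2) \<partial>lborel) \<partial>P) < \<infinity>"
    and b_coefficient: "state_coefficient P (default_filtration P W \<tau>) T V b"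
    and sigma_coefficient: "state_coefficient P (default_filtration P W \<tau>) T V \<sigma>"
    and gamma_coefficient: "state_coefficient P (default_filtration P W \<tau>) T V \<gamma>"
    and h_C1: "C1_bounded_derivs P T V h"
    and h_predictable:
      "\<And>x v. v \<in> V \<Longrightarrow> predictable_on P (default_filtration P W \<tau>) T (\<lambda>t \<omega>. h t \<omega> x v)"
    and g_measurable: "\<And>x. (\<lambda>\<omega>. g \<omega> x) \<in> borel_measurable (default_filtration P W \<tau> T)"
    and g_C1: "\<And>\<omega>. \<omega> \<in> space P \<Longrightarrow>
      (\<forall>x. g \<omega> field_differentiable (at x)) \<and> continuous_on UNIV (deriv (g \<omega>))"
    and g_deriv_bounded: "\<exists>C. \<forall>\<omega>\<in>space P. \<forall>x. \<bar>deriv (g \<omega>) x\<bar> \<le> C"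
    and state: "\<And>u. u \<in> A \<Longrightarrow> state_solution P W \<tau> lam T x0 b \<sigma> \<gamma> u (X u)"
    and reward_L2: "\<And>u. u \<in> A \<Longrightarrow>
      (\<integral>\<^sup>+\<omega>. (\<integral>\<^sup>+t\<in>{0..T}. ennreal ((h t \<omega> (X u t \<omega>) (u t \<omega>))\<^sup>2) \<partial>lborel)
            + ennreal ((g \<omega> (X u T \<omega>))\<^sup>2) \<partial>P) < \<infinity>"

definition performance ::
  "'a measure \<Rightarrow> real \<Rightarrow> (real \<Rightarrow> 'a \<Rightarrow> real \<Rightarrow> real \<Rightarrow> real) \<Rightarrow> ('a \<Rightarrow> real \<Rightarrow> real)
    \<Rightarrow> ((real \<Rightarrow> 'a \<Rightarrow> real) \<Rightarrow> real \<Rightarrow> 'a \<Rightarrow> real) \<Rightarrow> (real \<Rightarrow> 'a \<Rightarrow> real) \<Rightarrow> real" where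
  "performance P T h g X u = prob_space.expectation P
     (\<lambda>\<omega>. (LBINT t:{0..T}. h t \<omega> (X u t \<omega>) (u t \<omega>)) + g \<omega> (X u T \<omega>))"

definition hamiltonian ::
  "(real \<Rightarrow> 'a \<Rightarrow> real)
    \<Rightarrow> (real \<Rightarrow> 'a \<Rightarrow> real \<Rightarrow> real \<Rightarrow> real) \<Rightarrow> (real \<Rightarrow> 'a \<Rightarrow> real \<Rightarrow> real \<Rightarrow> real)
    \<Rightarrow> (real \<Rightarrow> 'a \<Rightarrow> real \<Rightarrow> real \<Rightarrow> real) \<Rightarrow> (real \<Rightarrow> 'a \<Rightarrow> real \<Rightarrow> real \<Rightarrow> real)
    \<Rightarrow> real \<Rightarrow> 'a \<Rightarrow> real \<Rightarrow> real \<Rightarrow> real \<Rightarrow> real \<Rightarrow> real \<Rightarrow> real" where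
  "hamiltonian lam b \<sigma> \<gamma> h t \<omega> x v p q w =
     h t \<omega> x v + b t \<omega> x v * p + \<sigma> t \<omega> x v * q + lam t \<omega> * \<gamma> t \<omega> x v * w"

definition adjoint_solution ::
  "'a measure \<Rightarrow> (real \<Rightarrow> 'a \<Rightarrow> real) \<Rightarrow> ('a \<Rightarrow> real) \<Rightarrow> (real \<Rightarrow> 'a \<Rightarrow> real) \<Rightarrow> real
    \<Rightarrow> (real \<Rightarrow> 'a \<Rightarrow> real \<Rightarrow> real \<Rightarrow> real) \<Rightarrow> (real \<Rightarrow> 'a \<Rightarrow> real \<Rightarrow> real \<Rightarrow> real)
    \<Rightarrow> (real \<Rightarrow> 'a \<Rightarrow> real \<Rightarrow> real \<Rightarrow> real) \<Rightarrow> (real \<Rightarrow> 'a \<Rightarrow> real \<Rightarrow> real \<Rightarrow> real)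
    \<Rightarrow> ('a \<Rightarrow> real \<Rightarrow> real) \<Rightarrow> (real \<Rightarrow> 'a \<Rightarrow> real) \<Rightarrow> (real \<Rightarrow> 'a \<Rightarrow> real)
    \<Rightarrow> (real \<Rightarrow> 'a \<Rightarrow> real) \<Rightarrow> (real \<Rightarrow> 'a \<Rightarrow> real) \<Rightarrow> (real \<Rightarrow> 'a \<Rightarrow> real) \<Rightarrow> bool" where
  "adjoint_solution P W \<tau> lam T b \<sigma> \<gamma> h g u X p q w \<longleftrightarrow>
     p \<in> S2 P (default_filtration P W \<tau>) T \<and>
     q \<in> H2 P (default_filtration P W \<tau>) T \<and>
     w \<in> H2_lam P (default_filtration P W \<tau>) lam T \<and>
     has_stoch_differential P W \<tau> lam T p
       (\<lambda>t \<omega>. - deriv (\<lambda>x. hamiltonian lam b \<sigma> \<gamma> h t \<omega> x (u t \<omega>) (p t \<omega>) (q t \<omega>) (w t \<omega>)) (X t \<omega>))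
       q w \<and>
     (AE \<omega> in P. p T \<omega> = deriv (g \<omega>) (X T \<omega>))"

end

theory Submission
  imports Defs
begin

text \<open>Let \<open>X\<close>, \<open>Z\<close> be the states of a control \<open>u\<close> and of the candidate, and \<open>p\<close> the adjoint process.
  Concavity of \<open>g\<close> gives \<open>E[g(X\<^sub>T) - g(Z\<^sub>T)] \<le> E[p\<^sub>T (X\<^sub>T - Z\<^sub>T)]\<close>, and the product formula rewrites the right-hand
  side so that the difference of the two performances is at most
  \<open>E \<integral> (H(X, u) - H(Z, v) - H\<^sub>x(Z, v) (X - Z)) dt\<close>, where \<open>v\<close> is the candidate control and \<open>H\<close> the
  Hamiltonian at the adjoint processes.  The integrand is nonpositive: it is the concavity defect of \<open>H\<close>
  up to a derivative in the direction \<open>u - v\<close>, which has the right sign because \<open>v\<close> maximises \<open>H(Z, \<cdot>)\<close>.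

  The product formula is needed only in expectation, so no Ito formula is used.  Both processes are
  absolutely continuous up to a martingale; the drifts are integrated by parts pathwise, the mixed
  terms by the martingale property, and the product of the two martingales by the isometries of the
  integrals with respect to \<open>W\<close> and \<open>M\<close> and their orthogonality.\<close>

section \<open>Square-integrable limits and absolutely continuous functions\<close>

text \<open>The intensity \<lambda> is not bounded, so integrability of the mixed terms is the real
  obstacle. The compensation formula, which turns the \<lambda>-weighted integral of a nonnegative
  predictable \<phi> into E[\<phi>(\<tau>); \<tau> \<le> T], replaces boundedness. Applied to powers
  of the compensator \<Lambda> it yields E[\<Lambda>_T^n] \<le> n!; applied to left limits it bounds
  the \<lambda>-weighted square norm of a process in \<open>S2\<close> by its sup norm. The
  integrands of the state equation are bounded, so its jump integral is dominated by a multiple of 1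
  + \<Lambda>_T, which has all moments. The adjoint integrands lie only in H2 and H2(\<lambda>); in
  the jump isometry one factor stays bounded and the other is reached by truncation. The jump
  isometry itself needs no quadratic variation: \<lambda> vanishes after \<tau>, hence under
  \<lambda> dt the jump martingale equals minus its absolutely continuous part. The other obstacle
  is null sets. Processes in \<open>S2\<close> are cadlag only almost surely and coefficients are
  measurable only for fixed (x, v), so versions with all paths cadlag are substituted before
  anything is composed.\<close>

lemma caratheodory_measurable:
  fixes f :: "'m \<Rightarrow> 'b::{second_countable_topology, metric_space} \<Rightarrow> real"
  assumes f: "\<And>y. y \<in> S \<Longrightarrow> (\<lambda>m. f m y) \<in> borel_measurable M"
    and cont: "\<And>m. m \<in> space M \<Longrightarrow> continuous_on S (f m)"
    and Y: "Y \<in> borel_measurable M" "\<And>m. m \<in> space M \<Longrightarrow> Y m \<in> S"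
  shows "(\<lambda>m. f m (Y m)) \<in> borel_measurable M"
proof (cases "S = {}")
  case True
  then have "space M = {}" using Y by blast
  then show ?thesis by (simp add: measurable_def)
next
  case False
  \<comment> \<open>The dense set lies inside \<open>S\<close>, where alone \<open>f\<close> is
    known to be measurable and continuous. For the coefficients, \<open>S\<close> is the product of
    the line with the control set.\<close>
  obtain D where D: "countable D" "D \<subseteq> S" "S \<subseteq> closure D"
    using separable by blast
  have "D \<noteq> {}" using D False by auto
  define d where "d = from_nat_into D"
  have dD: "d i \<in> D" for i
    using \<open>D \<noteq> {}\<close> by (simp add: d_def from_nat_into)
  have ex: "\<exists>i. dist (d i) (Y m) < 1 / Suc n" if "m \<in> space M" for m n
  proof -
    have "Y m \<in> closure D" using Y D that by auto
    moreover have "0 < 1 / real (Suc n)" by simp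
    ultimately have "\<exists>y\<in>D. dist y (Y m) < 1 / Suc n" unfolding closure_approachable by (elim allE impE)
    then obtain y where y: "y \<in> D" "dist y (Y m) < 1 / Suc n" ..
    obtain i where "d i = y" using from_nat_into_surj[OF D(1) y(1)] unfolding d_def by blast
    with y(2) show ?thesis by blast
  qed
  \<comment> \<open>The least index of a nearby point is measurable with countably many values.
    Evaluating \<open>f\<close> there uses only measurability at fixed points, and continuity gives
    the limit.\<close>
  define idx where "idx = (\<lambda>n m. LEAST i. dist (d i) (Y m) < 1 / Suc n)"
  have idx: "dist (d (idx n m)) (Y m) < 1 / Suc n" if "m \<in> space M" for m n
    unfolding idx_def by (rule LeastI_ex) (use ex that in auto)
  have idx_meas: "idx n \<in> measurable M (count_space UNIV)" for n
    unfolding idx_def using Y(1) by measurable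
  show ?thesis
  proof (rule borel_measurable_LIMSEQ_real[where u="\<lambda>n m. f m (d (idx n m))"])
    fix n
    show "(\<lambda>m. f m (d (idx n m))) \<in> borel_measurable M"
      by (rule measurable_compose_countable[OF _ idx_meas]) (use dD D f in blast)
  next
    fix m assume m: "m \<in> space M"
    have "(\<lambda>n. dist (d (idx n m)) (Y m)) \<longlonglongrightarrow> 0"
    proof (rule tendsto_sandwich[of "\<lambda>_. 0"])
      show "(\<lambda>n. 1 / real (Suc n)) \<longlonglongrightarrow> 0" by (rule LIMSEQ_Suc) (rule lim_1_over_n)
    qed (use idx[OF m] in \<open>auto intro: always_eventually less_imp_le\<close>)
    then have "(\<lambda>n. d (idx n m)) \<longlonglongrightarrow> Y m" by (rule tendsto_dist_iff[THEN iffD2])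
    then show "(\<lambda>n. f m (d (idx n m))) \<longlonglongrightarrow> f m (Y m)"
    proof (rule continuous_on_tendsto_compose[OF cont[OF m]])
      have "d i \<in> S" for i using dD D(2) by blast
      then show "\<forall>\<^sub>F n in sequentially. d (idx n m) \<in> S" by simp
    qed (rule Y(2)[OF m])
  qed
qed

text \<open>If the left limit at t lies below the value, there are a rational a strictly between
  them and a rational r < t such that the path stays below a on (r, t). The pair (a, r) determines
  t: of two such points the earlier one would have a value both above and below a. Left limits above
  the value follow by negating the path.\<close>

lemma countable_left_discontinuities:
  fixes y l :: "real \<Rightarrow> real"
  assumes l: "\<And>t. t \<in> S \<Longrightarrow> (y \<longlongrightarrow> l t) (at_left t)"
  shows "countable {t \<in> S. l t \<noteq> y t}"
proof -
  have *: "countable {t \<in> S. l t < z t}" if "(\<forall>t\<in>S. (z \<longlongrightarrow> l t) (at_left t))" for z l :: "real \<Rightarrow> real"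
  proof -
    let ?A = "\<lambda>a r. {t. (r::real) < t \<and> z t > (a::real) \<and> (\<forall>s\<in>{r<..<t}. z s < a)}"
    have fin: "countable (?A a r)" for a r
    proof (rule countable_subset)
      show "?A a r \<subseteq> {THE t. t \<in> ?A a r}"
      proof
        fix t assume t: "t \<in> ?A a r"
        have "(THE t. t \<in> ?A a r) = t"
        proof (rule the_equality)
          show "t \<in> ?A a r" by (rule t)
        next
          fix s assume s: "s \<in> ?A a r"
          show "s = t"
          proof (rule linorder_cases[of s t])
            assume "s < t" then have "z s < a" using s t by auto
            then show ?thesis using s by auto
          next
            assume "t < s" then have "z t < a" using s t by auto
            then show ?thesis using t by auto
          qed
        qed
        then show "t \<in> {THE t. t \<in> ?A a r}" by simp
      qed
    qed simp
    have "{t \<in> S. l t < z t} \<subseteq> (\<Union>a\<in>\<rat>. \<Union>r\<in>\<rat>. ?A a r)"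
    proof
      fix t assume t: "t \<in> {t \<in> S. l t < z t}"
      then obtain a where a: "a \<in> \<rat>" "l t < a" "a < z t" using Rats_dense_in_real by blast
      have "eventually (\<lambda>s. z s < a) (at_left t)"
        using that t a by (intro order_tendstoD(2)[of z "l t"]) auto
      then obtain r where r: "r < t" "\<And>s. r < s \<Longrightarrow> s < t \<Longrightarrow> z s < a"
        unfolding eventually_at_left_field by blast
      obtain r' where "r' \<in> \<rat>" "r < r'" "r' < t" using Rats_dense_in_real r by blast
      then have "t \<in> ?A a r'" using a r by auto
      with a(1) \<open>r' \<in> \<rat>\<close> show "t \<in> (\<Union>a\<in>\<rat>. \<Union>r\<in>\<rat>. ?A a r)" by blast
    qed
    moreover have "countable (\<Union>a\<in>\<rat>. \<Union>r\<in>\<rat>. ?A a r)"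
      using fin by (intro countable_UN countable_rat) auto
    ultimately show ?thesis by (rule countable_subset)
  qed
  have "{t \<in> S. l t \<noteq> y t} = {t \<in> S. l t < y t} \<union> {t \<in> S. - l t < - y t}" by auto
  moreover have "countable {t \<in> S. l t < y t}" using * l by auto
  moreover have "countable {t \<in> S. - l t < - y t}"
    using *[of "\<lambda>t. - y t" "\<lambda>t. - l t"] l by (auto intro: tendsto_minus)
  ultimately show ?thesis by simp
qed

text \<open>Martingale properties are proved against test functions bounded by 1 but used against
  factors such as \<lambda>_t, for which only the product with \<open>Y\<close> is integrable.
  Truncate \<alpha> at level n, divide by n, and pass to the limit with the dominating function
  |\<alpha> Y|.\<close>

lemma integral_mult_eq_0_of_bounded:
  assumes sub: "subalgebra M G"
    and Y: "integrable M Y"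
    and orth: "\<And>\<xi>. \<xi> \<in> borel_measurable G \<Longrightarrow> (\<And>\<omega>. \<omega> \<in> space M \<Longrightarrow> \<bar>\<xi> \<omega>\<bar> \<le> 1) \<Longrightarrow> (\<integral>\<omega>. \<xi> \<omega> * Y \<omega> \<partial>M) = 0"
    and \<alpha>: "\<alpha> \<in> borel_measurable G" and int: "integrable M (\<lambda>\<omega>. \<alpha> \<omega> * Y \<omega>)"
  shows "(\<integral>\<omega>. \<alpha> \<omega> * Y \<omega> \<partial>M) = (0::real)"
proof -
  define a where "a = (\<lambda>(n::nat) \<omega>. max (- real n) (min (real n) (\<alpha> \<omega>)))"
  have aG: "a n \<in> borel_measurable G" for n using \<alpha> unfolding a_def by measurable
  then have aM: "a n \<in> borel_measurable M" for n by (rule measurable_from_subalg[OF sub])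
  have z: "(\<integral>\<omega>. a n \<omega> * Y \<omega> \<partial>M) = 0" for n
  proof (cases "n = 0")
    case False
    have "(\<integral>\<omega>. (a n \<omega> / n) * Y \<omega> \<partial>M) = 0"
      by (rule orth) (use aG False in \<open>auto simp: a_def field_simps abs_le_iff\<close>)
    then show ?thesis using False by simp
  qed (simp add: a_def)
  have "(\<lambda>n. \<integral>\<omega>. a n \<omega> * Y \<omega> \<partial>M) \<longlonglongrightarrow> (\<integral>\<omega>. \<alpha> \<omega> * Y \<omega> \<partial>M)"
  proof (rule integral_dominated_convergence[where w="\<lambda>\<omega>. \<bar>\<alpha> \<omega> * Y \<omega>\<bar>"])
    show "AE \<omega> in M. (\<lambda>n. a n \<omega> * Y \<omega>) \<longlonglongrightarrow> \<alpha> \<omega> * Y \<omega>"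
    proof (rule AE_I2)
      fix \<omega>
      have "eventually (\<lambda>n. a n \<omega> = \<alpha> \<omega>) sequentially"
        using eventually_ge_at_top[of "nat \<lceil>\<bar>\<alpha> \<omega>\<bar>\<rceil>"]
        by eventually_elim (auto simp: a_def)
      then show "(\<lambda>n. a n \<omega> * Y \<omega>) \<longlonglongrightarrow> \<alpha> \<omega> * Y \<omega>"
        by (intro tendsto_mult tendsto_const tendsto_eventually)
    qed
    have "\<bar>a n \<omega>\<bar> \<le> \<bar>\<alpha> \<omega>\<bar>" for n \<omega> by (auto simp: a_def)
    then show "AE x in M. norm (a n x * Y x) \<le> \<bar>\<alpha> x * Y x\<bar>" for n
      by (auto simp: abs_mult mult_right_mono)
    show "integrable M (\<lambda>x. \<bar>\<alpha> x * Y x\<bar>)" using int by auto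
  qed (use aM Y int in auto)
  then show ?thesis unfolding z using LIMSEQ_unique tendsto_const by blast
qed

section \<open>Square-integrable functions and convergence in L2\<close>

lemma nn_integral_power2_lessD:
  fixes f :: "'a \<Rightarrow> real"
  assumes "f \<in> borel_measurable M" "(\<integral>\<^sup>+x. ennreal ((f x)\<^sup>2) \<partial>M) < \<infinity>"
  shows "integrable M (\<lambda>x. (f x)\<^sup>2)"
  using assms by (intro integrableI_nonneg) auto

lemma integrable_mult_L2:
  fixes f g :: "'a \<Rightarrow> real"
  assumes [measurable]: "f \<in> borel_measurable M" "g \<in> borel_measurable M"
    and "integrable M (\<lambda>x. (f x)\<^sup>2)" "integrable M (\<lambda>x. (g x)\<^sup>2)"
  shows "integrable M (\<lambda>x. f x * g x)"
proof (rule Bochner_Integration.integrable_bound)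
  show "integrable M (\<lambda>x. (f x)\<^sup>2 + (g x)\<^sup>2)" using assms by auto
  show "AE x in M. norm (f x * g x) \<le> norm ((f x)\<^sup>2 + (g x)\<^sup>2)"
  proof (rule AE_I2)
    fix x
    have "2 * \<bar>f x * g x\<bar> \<le> (f x)\<^sup>2 + (g x)\<^sup>2"
      using sum_squares_bound[of "\<bar>f x\<bar>" "\<bar>g x\<bar>"] by (simp add: abs_mult)
    then show "norm (f x * g x) \<le> norm ((f x)\<^sup>2 + (g x)\<^sup>2)" by auto
  qed
qed auto

lemma L2_add_integrable:
  fixes f g :: "'a \<Rightarrow> real"
  assumes [measurable]: "f \<in> borel_measurable M" "g \<in> borel_measurable M"
    and "integrable M (\<lambda>x. (f x)\<^sup>2)" "integrable M (\<lambda>x. (g x)\<^sup>2)"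
  shows "integrable M (\<lambda>x. (f x + g x)\<^sup>2)" "integrable M (\<lambda>x. (f x - g x)\<^sup>2)"
  using assms integrable_mult_L2[OF assms] by (auto simp: power2_sum power2_diff mult.assoc)

text \<open>The error is a nonnegative integral, as in \<open>has_ito_integral\<close>, so the limit
  need not be known to be square integrable in advance; that is derived in
  \<open>L2_tendsto_integrable\<close>.\<close>

definition L2_tendsto :: "'a measure \<Rightarrow> (nat \<Rightarrow> 'a \<Rightarrow> real) \<Rightarrow> ('a \<Rightarrow> real) \<Rightarrow> bool" where
  "L2_tendsto M fs f \<longleftrightarrow> f \<in> borel_measurable M \<and> (\<forall>k. fs k \<in> borel_measurable M) \<and>
     (\<forall>k. integrable M (\<lambda>x. (fs k x)\<^sup>2)) \<and>
     (\<lambda>k. \<integral>\<^sup>+x. ennreal ((fs k x - f x)\<^sup>2) \<partial>M) \<longlonglongrightarrow> 0"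

lemma L2_tendsto_integrable:
  assumes "L2_tendsto M fs f"
  shows "integrable M (\<lambda>x. (f x)\<^sup>2)"
proof -
  note [measurable] = assms[unfolded L2_tendsto_def, THEN conjunct1]
    assms[unfolded L2_tendsto_def, THEN conjunct2, THEN conjunct1, rule_format]
  have "eventually (\<lambda>k. (\<integral>\<^sup>+x. ennreal ((fs k x - f x)\<^sup>2) \<partial>M) < 1) sequentially"
    using assms unfolding L2_tendsto_def by (intro order_tendstoD(2)[of _ 0]) auto
  then obtain k where "(\<integral>\<^sup>+x. ennreal ((fs k x - f x)\<^sup>2) \<partial>M) < 1"
    by (auto simp: eventually_sequentially)
  then have "integrable M (\<lambda>x. (fs k x - f x)\<^sup>2)"
    by (intro nn_integral_power2_lessD) (auto intro: less_trans)
  moreover have "integrable M (\<lambda>x. (fs k x)\<^sup>2)" using assms by (auto simp: L2_tendsto_def)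
  ultimately show ?thesis using L2_add_integrable(2)[of "fs k" M "\<lambda>x. fs k x - f x"] by simp
qed

lemma L2_tendsto_integral:
  assumes "L2_tendsto M fs f"
  shows "(\<lambda>k. \<integral>x. (fs k x - f x)\<^sup>2 \<partial>M) \<longlonglongrightarrow> 0" "integrable M (\<lambda>x. (fs k x - f x)\<^sup>2)"
proof -
  note [measurable] = assms[unfolded L2_tendsto_def, THEN conjunct1]
    assms[unfolded L2_tendsto_def, THEN conjunct2, THEN conjunct1, rule_format]
  show I: "integrable M (\<lambda>x. (fs k x - f x)\<^sup>2)" for k
    using assms L2_tendsto_integrable[OF assms]
    by (intro L2_add_integrable) (auto simp: L2_tendsto_def)
  have "(\<integral>\<^sup>+x. ennreal ((fs k x - f x)\<^sup>2) \<partial>M) = ennreal (\<integral>x. (fs k x - f x)\<^sup>2 \<partial>M)" for k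
    using I by (intro nn_integral_eq_integral) auto
  then show "(\<lambda>k. \<integral>x. (fs k x - f x)\<^sup>2 \<partial>M) \<longlonglongrightarrow> 0"
    using assms tendsto_ennreal_iff[of "\<lambda>k. \<integral>x. (fs k x - f x)\<^sup>2 \<partial>M" sequentially 0]
    by (auto simp: L2_tendsto_def)
qed

lemma L2_Cauchy_Schwarz:
  fixes f g :: "'a \<Rightarrow> real"
  assumes [measurable]: "f \<in> borel_measurable M" "g \<in> borel_measurable M"
    and "integrable M (\<lambda>x. (f x)\<^sup>2)" "integrable M (\<lambda>x. (g x)\<^sup>2)"
  shows "\<bar>\<integral>x. f x * g x \<partial>M\<bar> \<le> sqrt (\<integral>x. (f x)\<^sup>2 \<partial>M) * sqrt (\<integral>x. (g x)\<^sup>2 \<partial>M)"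
proof -
  let ?a = "\<integral>x. (f x)\<^sup>2 \<partial>M" and ?b = "\<integral>x. f x * g x \<partial>M" and ?c = "\<integral>x. (g x)\<^sup>2 \<partial>M"
  note fg = integrable_mult_L2[OF assms]
  have pos: "0 \<le> ?a + (2 * r) * ?b + r\<^sup>2 * ?c" for r
  proof -
    have "0 \<le> (\<integral>x. (f x + r * g x)\<^sup>2 \<partial>M)" by simp
    also have "\<dots> = (\<integral>x. (f x)\<^sup>2 + (2 * r) * (f x * g x) + r\<^sup>2 * (g x)\<^sup>2 \<partial>M)"
      by (rule Bochner_Integration.integral_cong) (auto simp: power2_eq_square algebra_simps)
    also have "\<dots> = ?a + (2 * r) * ?b + r\<^sup>2 * ?c"
      using assms(3,4) fg by simp
    finally show ?thesis .
  qed
  have c0: "0 \<le> ?c" "0 \<le> ?a" by auto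
  have "?b\<^sup>2 \<le> ?a * ?c"
  proof (cases "?c = 0")
    case True
    have "?b = 0"
    proof (rule ccontr)
      assume "?b \<noteq> 0"
      \<comment> \<open>With \<open>?c = 0\<close> the quadratic is affine in \<open>r\<close>, and
        this \<open>r\<close> gives it the value -1.\<close>
      have "0 \<le> ?a + 2 * (- (?a + 1) / (2 * ?b)) * ?b"
        using pos[of "- (?a + 1) / (2 * ?b)"] True by simp
      also have "\<dots> = -1" using \<open>?b \<noteq> 0\<close> by (simp add: field_simps)
      finally show False by simp
    qed
    then show ?thesis using True by simp
  next
    case False
    \<comment> \<open>The minimiser of the quadratic in \<open>r\<close>.\<close>
    have "0 \<le> ?a + 2 * (- ?b / ?c) * ?b + (- ?b / ?c)\<^sup>2 * ?c" by (rule pos)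
    also have "\<dots> = ?a - ?b\<^sup>2 / ?c" using False by (simp add: field_simps power2_eq_square)
    finally show ?thesis using False c0 by (simp add: field_simps)
  qed
  then have "sqrt (?b\<^sup>2) \<le> sqrt (?a * ?c)" by (rule real_sqrt_le_mono)
  then show ?thesis by (simp add: real_sqrt_mult)
qed

lemma L2_tendsto_inner:
  assumes f: "L2_tendsto M fs f" and g: "L2_tendsto M gs g"
  shows "(\<lambda>k. \<integral>x. fs k x * gs k x \<partial>M) \<longlonglongrightarrow> (\<integral>x. f x * g x \<partial>M)"
proof -
  note [measurable] = f[unfolded L2_tendsto_def, THEN conjunct1]
    f[unfolded L2_tendsto_def, THEN conjunct2, THEN conjunct1, rule_format]
    g[unfolded L2_tendsto_def, THEN conjunct1]
    g[unfolded L2_tendsto_def, THEN conjunct2, THEN conjunct1, rule_format]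
  note sq = L2_tendsto_integrable[OF f] L2_tendsto_integrable[OF g]
    L2_tendsto_integral(2)[OF f] L2_tendsto_integral(2)[OF g]
  note li = L2_tendsto_integral(1)[OF f] L2_tendsto_integral(1)[OF g]
  let ?F = "\<lambda>k x. fs k x - f x" and ?G = "\<lambda>k x. gs k x - g x"
  have eq: "(\<integral>x. fs k x * gs k x \<partial>M) = (\<integral>x. ?F k x * ?G k x \<partial>M) + (\<integral>x. f x * ?G k x \<partial>M)
    + (\<integral>x. ?F k x * g x \<partial>M) + (\<integral>x. f x * g x \<partial>M)" for k
  proof -
    have "(\<integral>x. fs k x * gs k x \<partial>M) = (\<integral>x. ?F k x * ?G k x + f x * ?G k x + ?F k x * g x + f x * g x \<partial>M)"
      by (rule Bochner_Integration.integral_cong) (auto simp: algebra_simps)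
    moreover have "integrable M (\<lambda>x. ?F k x * ?G k x)" "integrable M (\<lambda>x. f x * ?G k x)"
      "integrable M (\<lambda>x. ?F k x * g x)" "integrable M (\<lambda>x. f x * g x)"
      using sq by (auto intro!: integrable_mult_L2)
    ultimately show ?thesis by simp
  qed
  have "(\<lambda>k. \<integral>x. ?F k x * ?G k x \<partial>M) \<longlonglongrightarrow> 0"
  proof (rule Lim_null_comparison)
    show "(\<lambda>k. sqrt (\<integral>x. (?F k x)\<^sup>2 \<partial>M) * sqrt (\<integral>x. (?G k x)\<^sup>2 \<partial>M)) \<longlonglongrightarrow> 0"
      using tendsto_mult[OF tendsto_real_sqrt[OF li(1)] tendsto_real_sqrt[OF li(2)]] by simp
  qed (use sq in \<open>auto intro!: always_eventually L2_Cauchy_Schwarz\<close>)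
  moreover have "(\<lambda>k. \<integral>x. f x * ?G k x \<partial>M) \<longlonglongrightarrow> 0"
  proof (rule Lim_null_comparison)
    show "(\<lambda>k. sqrt (\<integral>x. (f x)\<^sup>2 \<partial>M) * sqrt (\<integral>x. (?G k x)\<^sup>2 \<partial>M)) \<longlonglongrightarrow> 0"
      using tendsto_mult[OF tendsto_const tendsto_real_sqrt[OF li(2)]] by simp
  qed (use sq in \<open>auto intro!: always_eventually L2_Cauchy_Schwarz\<close>)
  moreover have "(\<lambda>k. \<integral>x. ?F k x * g x \<partial>M) \<longlonglongrightarrow> 0"
  proof (rule Lim_null_comparison)
    show "(\<lambda>k. sqrt (\<integral>x. (?F k x)\<^sup>2 \<partial>M) * sqrt (\<integral>x. (g x)\<^sup>2 \<partial>M)) \<longlonglongrightarrow> 0"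
      using tendsto_mult[OF tendsto_real_sqrt[OF li(1)] tendsto_const] by simp
  qed (use sq in \<open>auto intro!: always_eventually L2_Cauchy_Schwarz\<close>)
  ultimately have "(\<lambda>k. (\<integral>x. ?F k x * ?G k x \<partial>M) + (\<integral>x. f x * ?G k x \<partial>M)
    + (\<integral>x. ?F k x * g x \<partial>M) + (\<integral>x. f x * g x \<partial>M)) \<longlonglongrightarrow> 0 + 0 + 0 + (\<integral>x. f x * g x \<partial>M)"
    by (intro tendsto_add tendsto_const)
  then show ?thesis unfolding eq by simp
qed

lemma L2_tendsto_const: 
  "g \<in> borel_measurable M \<Longrightarrow> integrable M (\<lambda>x. (g x)\<^sup>2) \<Longrightarrow> L2_tendsto M (\<lambda>_. g) g"
  by (simp add: L2_tendsto_def)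

text \<open>Integration by parts for two indefinite integrals. Fubini is applied to a(s) c(r) on the
  square, split into r \<le> s and r > s, and the two triangles are integrated in opposite orders.
  The second claim is the integrability of an inner integral, again by Fubini.\<close>

lemma integral_mult_absolutely_continuous:
  fixes a c :: "real \<Rightarrow> real"
  assumes a: "set_integrable lborel {0..T} a" and c: "set_integrable lborel {0..T} c"
  shows "(LBINT s:{0..T}. a s) * (LBINT s:{0..T}. c s) =
    (LBINT s:{0..T}. a s * (LBINT r:{0..s}. c r)) + (LBINT s:{0..T}. c s * (LBINT r:{0..s}. a r))"
    "set_integrable lborel {0..T} (\<lambda>s. a s * (LBINT r:{0..s}. c r))"
proof -
  define a' where "a' = (\<lambda>s. indicator {0..T} s * a s)"
  define c' where "c' = (\<lambda>s. indicator {0..T} s * c s)"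
  have ai: "integrable lborel a'" and ci: "integrable lborel c'"
    using a c by (auto simp: a'_def c'_def set_integrable_def)
  have [measurable]: "a' \<in> borel_measurable borel" "c' \<in> borel_measurable borel"
    using ai ci by auto
  interpret pair_sigma_finite lborel lborel ..
  have gen: "integrable (lborel \<Otimes>\<^sub>M lborel) (\<lambda>(s, r). f s * g r)"
    if "integrable lborel f" "integrable lborel g" for f g :: "real \<Rightarrow> real"
    using that by (intro lborel_pair.Fubini_integrable) (auto simp: abs_mult integrable_mult_left)
  note int = gen[OF ai ci]
  have lo: "integrable (lborel \<Otimes>\<^sub>M lborel) (\<lambda>(s, r). (a' s * c' r) * indicator {..s} r)"
    by (rule Bochner_Integration.integrable_bound[OF int])
      (auto simp: split_beta' indicator_def intro!: AE_I2)
  have hi: "integrable (lborel \<Otimes>\<^sub>M lborel) (\<lambda>(s, r). (a' s * c' r) * indicator {s<..} r)"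
    by (rule Bochner_Integration.integrable_bound[OF int])
      (auto simp: split_beta' indicator_def intro!: AE_I2)
  have inn: "(LBINT r. f r * indicator {..s} r) = (LBINT r:{0..s}. h r)"
    if "f = (\<lambda>s. indicator {0..T} s * h s)" "s \<in> {0..T}" for f h :: "real \<Rightarrow> real" and s
    unfolding set_lebesgue_integral_def using that
    by (intro Bochner_Integration.integral_cong) (auto split: split_indicator)
  \<comment> \<open>The triangle r > s produces integrals over a half-line open at its end; the
    missing point is Lebesgue null.\<close>
  have inn': "(LBINT r. f r * indicator {..<s} r) = (LBINT r:{0..s}. h r)"
    if f: "f = (\<lambda>s. indicator {0..T} s * h s)" "s \<in> {0..T}" and [measurable]: "f \<in> borel_measurable borel"
    for f h :: "real \<Rightarrow> real" and s
  proof -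
    have "(LBINT r. f r * indicator {..<s} r) = (LBINT r. f r * indicator {..s} r)"
      by (rule integral_cong_AE; (measurable)?)
        (use AE_lborel_singleton[of s] in \<open>eventually_elim, auto split: split_indicator\<close>)
    then show ?thesis using inn[OF f] by simp
  qed
  have loe: "(\<integral>z. (case z of (s, r) \<Rightarrow> (a' s * c' r) * indicator {..s} r) \<partial>(lborel \<Otimes>\<^sub>M lborel))
     = (LBINT s:{0..T}. a s * (LBINT r:{0..s}. c r))"
  proof -
    have "(LBINT s. LBINT r. (a' s * c' r) * indicator {..s} r) = (LBINT s. a' s * (LBINT r. c' r * indicator {..s} r))"
      by (simp add: mult.assoc)
    also have "\<dots> = (LBINT s:{0..T}. a s * (LBINT r:{0..s}. c r))"
      unfolding set_lebesgue_integral_def[of _ "{0..T}"]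
    proof (intro Bochner_Integration.integral_cong refl)
      fix s show "a' s * (LBINT r. c' r * indicator {..s} r) = indicator {0..T} s *\<^sub>R (a s * (LBINT r:{0..s}. c r))"
        by (cases "s \<in> {0..T}") (simp_all only: inn[OF c'_def], simp_all add: a'_def)
    qed
    finally show ?thesis using lborel_pair.integral_fst[OF lo] by simp
  qed
  have hie: "(\<integral>z. (case z of (s, r) \<Rightarrow> (a' s * c' r) * indicator {s<..} r) \<partial>(lborel \<Otimes>\<^sub>M lborel))
     = (LBINT s:{0..T}. c s * (LBINT r:{0..s}. a r))"
  proof -
    have "(LBINT r. LBINT s. (a' s * c' r) * indicator {s<..} r) = (LBINT r. c' r * (LBINT s. a' s * indicator {..<r} s))"
    proof (intro Bochner_Integration.integral_cong refl)
      fix r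
      have "(LBINT s. (a' s * c' r) * indicator {s<..} r) = (LBINT s. c' r * (a' s * indicator {..<r} s))"
        by (intro Bochner_Integration.integral_cong refl) (auto split: split_indicator)
      then show "(LBINT s. (a' s * c' r) * indicator {s<..} r) = c' r * (LBINT s. a' s * indicator {..<r} s)"
        by simp
    qed
    also have "\<dots> = (LBINT s:{0..T}. c s * (LBINT r:{0..s}. a r))"
      unfolding set_lebesgue_integral_def[of _ "{0..T}"]
    proof (intro Bochner_Integration.integral_cong refl)
      fix s show "c' s * (LBINT r. a' r * indicator {..<s} r) = indicator {0..T} s *\<^sub>R (c s * (LBINT r:{0..s}. a r))"
        by (cases "s \<in> {0..T}") (simp_all only: inn'[OF a'_def _ \<open>a' \<in> borel_measurable borel\<close>], simp_all add: c'_def)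
    qed
    finally show ?thesis using lborel_pair.integral_snd[OF hi] by simp
  qed
  have "(LBINT s:{0..T}. a s) * (LBINT s:{0..T}. c s) = (LBINT s. a' s) * (LBINT s. c' s)"
    by (simp add: set_lebesgue_integral_def a'_def c'_def)
  also have "\<dots> = (LBINT s. LBINT r. a' s * c' r)" by simp
  also have "\<dots> = (\<integral>z. (case z of (s, r) \<Rightarrow> a' s * c' r) \<partial>(lborel \<Otimes>\<^sub>M lborel))"
    using lborel_pair.integral_fst[OF int] by simp
  also have "\<dots> = (\<integral>z. (case z of (s, r) \<Rightarrow> (a' s * c' r) * indicator {..s} r) + 
      (case z of (s, r) \<Rightarrow> (a' s * c' r) * indicator {s<..} r) \<partial>(lborel \<Otimes>\<^sub>M lborel))"
    by (intro Bochner_Integration.integral_cong) (auto simp: indicator_def)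
  also have "\<dots> = (LBINT s:{0..T}. a s * (LBINT r:{0..s}. c r)) + (LBINT s:{0..T}. c s * (LBINT r:{0..s}. a r))"
    using lo hi loe hie by simp
  finally show "(LBINT s:{0..T}. a s) * (LBINT s:{0..T}. c s) =
    (LBINT s:{0..T}. a s * (LBINT r:{0..s}. c r)) + (LBINT s:{0..T}. c s * (LBINT r:{0..s}. a r))" .
  have "integrable lborel (\<lambda>s. LBINT r. (a' s * c' r) * indicator {..s} r)"
    using lborel_pair.integrable_fst[OF lo] by simp
  also have "(\<lambda>s. LBINT r. (a' s * c' r) * indicator {..s} r) = (\<lambda>s. indicator {0..T} s *\<^sub>R (a s * (LBINT r:{0..s}. c r)))"
  proof
    fix s show "(LBINT r. (a' s * c' r) * indicator {..s} r) = indicator {0..T} s *\<^sub>R (a s * (LBINT r:{0..s}. c r))"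
      by (cases "s \<in> {0..T}") (simp_all only: inn[OF c'_def] mult.assoc integral_mult_right_zero, simp_all add: a'_def)
  qed
  finally show "set_integrable lborel {0..T} (\<lambda>s. a s * (LBINT r:{0..s}. c r))"
    unfolding set_integrable_def .
qed

section \<open>Predictable and cadlag processes on a finite horizon\<close>

text \<open>The filtration is kept abstract. Having the null sets already in \<open>F 0\<close>
  means that a process can be changed on a null set without losing adaptedness.\<close>

locale finite_horizon = prob_space P for P :: "'a measure" +
  fixes F :: "real \<Rightarrow> 'a measure" and T :: real
  assumes T_pos: "0 < T"
    and F_subalgebra: "\<And>t. 0 \<le> t \<Longrightarrow> subalgebra P (F t)"
    and F_mono: "\<And>s t. 0 \<le> s \<Longrightarrow> s \<le> t \<Longrightarrow> sets (F s) \<subseteq> sets (F t)"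
    and F_null: "null_sets P \<subseteq> sets (F 0)"
begin

text \<open>\<open>R\<close> is the measure dt \<otimes> P on the horizon, with time as first
  coordinate. \<open>PR\<close> serves only as a measurable space: the trace of the predictable
  \<sigma>-algebra.\<close>

abbreviation "lbT \<equiv> restrict_space lborel {0..T}"
abbreviation "R \<equiv> lbT \<Otimes>\<^sub>M P"
abbreviation "PR \<equiv> restrict_space (predictable_sigma P F) ({0..T} \<times> space P)"

lemma space_F: "0 \<le> t \<Longrightarrow> space (F t) = space P"
  using F_subalgebra by (auto simp: subalgebra_def)

lemma sets_F: "0 \<le> t \<Longrightarrow> A \<in> sets (F t) \<Longrightarrow> A \<in> sets P"
  using F_subalgebra[of t] by (auto simp: subalgebra_def)

lemma F_measurable: "0 \<le> t \<Longrightarrow> f \<in> measurable (F t) N \<Longrightarrow> f \<in> measurable P N"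
  using measurable_from_subalg[OF F_subalgebra] by blast

lemma F_measurable_mono:
  assumes "0 \<le> s" "s \<le> t" "f \<in> measurable (F s) N" shows "f \<in> measurable (F t) N"
proof (rule measurable_from_subalg[OF _ assms(3)])
  show "subalgebra (F t) (F s)"
    using F_mono[OF assms(1,2)] assms by (auto simp: subalgebra_def space_F)
qed

lemma null_in_F: "0 \<le> t \<Longrightarrow> N \<in> null_sets P \<Longrightarrow> N \<in> sets (F t)"
  using F_null F_mono[of 0 t] by auto

lemma space_predictable[simp]: "space (predictable_sigma P F) = {0..} \<times> space P"
  by (simp add: predictable_sigma_def space_measure_of_conv)

lemma predictable_generator_subset:
  "{{0} \<times> A | A. A \<in> sets (F 0)} \<union>
      {{s<..t} \<times> A | s t A. 0 \<le> s \<and> s < t \<and> A \<in> sets (F s)} \<subseteq> Pow ({0..} \<times> space P)"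
  using sets.sets_into_space[of _ "F _"] by (fastforce simp: space_F)

lemma sets_predictable:
  "sets (predictable_sigma P F) = sigma_sets ({0..} \<times> space P) ({{0} \<times> A | A. A \<in> sets (F 0)} \<union>
      {{s<..t} \<times> A | s t A. 0 \<le> s \<and> s < t \<and> A \<in> sets (F s)})"
  unfolding predictable_sigma_def by (rule sets_measure_of) (rule predictable_generator_subset)

lemma predictable_rectangle:
  "0 \<le> s \<Longrightarrow> s < t \<Longrightarrow> A \<in> sets (F s) \<Longrightarrow> {s<..t} \<times> A \<in> sets (predictable_sigma P F)"
  unfolding sets_predictable by (rule sigma_sets.Basic) blast

lemma predictable_zero: "A \<in> sets (F 0) \<Longrightarrow> {0} \<times> A \<in> sets (predictable_sigma P F)"
  unfolding sets_predictable by (rule sigma_sets.Basic) blast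

lemma measurable_predictableI:
  assumes "\<And>x. x \<in> space M \<Longrightarrow> 0 \<le> fst (f x) \<and> snd (f x) \<in> space P"
    and "\<And>A. A \<in> sets (F 0) \<Longrightarrow> f -` ({0} \<times> A) \<inter> space M \<in> sets M"
    and "\<And>s t A. 0 \<le> s \<Longrightarrow> s < t \<Longrightarrow> A \<in> sets (F s) \<Longrightarrow> f -` ({s<..t} \<times> A) \<inter> space M \<in> sets M"
  shows "f \<in> measurable M (predictable_sigma P F)"
  unfolding predictable_sigma_def
  by (rule measurable_measure_of[OF predictable_generator_subset])
    (use assms in \<open>auto simp: mem_Times_iff\<close>)

lemma space_R[simp]: "space R = {0..T} \<times> space P"
  by (simp add: space_pair_measure space_restrict_space)

lemma space_PR[simp]: "space PR = {0..T} \<times> space P"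
  by (auto simp: space_restrict_space)

lemma sets_LT: "A \<in> sets borel \<Longrightarrow> A \<inter> {0..T} \<in> sets lbT"
  by (auto simp: sets_restrict_space)

lemma predictable_measurable_R:
  assumes "f \<in> measurable PR N" shows "f \<in> measurable R N"
proof -
  have "(\<lambda>x. x) \<in> measurable R PR"
  proof (rule measurable_restrict_space2)
    show "(\<lambda>x. x) \<in> measurable R (predictable_sigma P F)"
    proof (rule measurable_predictableI)
      fix A assume A: "A \<in> sets (F 0)"
      have "(\<lambda>x. x) -` ({0} \<times> A) \<inter> space R = ({0} \<inter> {0..T}) \<times> A"
        using sets_F[OF _ A] sets.sets_into_space by force
      then show "(\<lambda>x. x) -` ({0} \<times> A) \<inter> space R \<in> sets R"
        using sets_F[OF _ A] sets_LT[of "{0}"] by (auto intro!: pair_measureI)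
    next
      fix s t A assume st: "0 \<le> s" "s < (t::real)" and A: "A \<in> sets (F s)"
      have "(\<lambda>x. x) -` ({s<..t} \<times> A) \<inter> space R = ({s<..t} \<inter> {0..T}) \<times> A"
        using sets_F[OF st(1) A] sets.sets_into_space by force
      then show "(\<lambda>x. x) -` ({s<..t} \<times> A) \<inter> space R \<in> sets R"
        using sets_F[OF st(1) A] sets_LT[of "{s<..t}"] by (auto intro!: pair_measureI)
    qed auto
  qed auto
  from measurable_compose[OF this assms] show ?thesis .
qed

text \<open>Predictable processes are adapted: at time t a generating rectangle (s, r] \<times> A
  has section A only if s < t, and then A lies in \<open>F s\<close>, hence in \<open>F t\<close>;
  otherwise the section is empty. The rectangles at time 0 behave likewise.\<close>

lemma predictable_section:
  assumes f: "f \<in> measurable PR N" and t: "t \<in> {0..T}"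
  shows "(\<lambda>\<omega>. f (t, \<omega>)) \<in> measurable (F t) N"
proof -
  have "(\<lambda>\<omega>. (t, \<omega>)) \<in> measurable (F t) PR"
  proof (rule measurable_restrict_space2)
    show "(\<lambda>\<omega>. (t, \<omega>)) \<in> measurable (F t) (predictable_sigma P F)"
    proof (rule measurable_predictableI)
      fix A assume "A \<in> sets (F 0)"
      then have "A \<in> sets (F t)" using F_mono[of 0 t] t by auto
      moreover have "(\<lambda>\<omega>. (t, \<omega>)) -` ({0} \<times> A) \<inter> space (F t) = (if t = 0 then A else {})"
        using sets.sets_into_space[OF calculation] by auto
      ultimately show "(\<lambda>\<omega>. (t, \<omega>)) -` ({0} \<times> A) \<inter> space (F t) \<in> sets (F t)" by auto
    next
      fix s r A assume st: "0 \<le> s" "s < (r::real)" and A: "A \<in> sets (F s)"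
      show "(\<lambda>\<omega>. (t, \<omega>)) -` ({s<..r} \<times> A) \<inter> space (F t) \<in> sets (F t)"
      proof (cases "s < t \<and> t \<le> r")
        case True
        then have "A \<in> sets (F t)" using F_mono[of s t] st A by auto
        moreover have "(\<lambda>\<omega>. (t, \<omega>)) -` ({s<..r} \<times> A) \<inter> space (F t) = A"
          using sets.sets_into_space[OF calculation] True by auto
        ultimately show ?thesis by simp
      next
        case False
        then have "(\<lambda>\<omega>. (t, \<omega>)) -` ({s<..r} \<times> A) \<inter> space (F t) = {}" by auto
        then show ?thesis by (metis sets.empty_sets)
      qed
    qed (use t space_F in auto)
  qed (use t space_F in auto)
  from measurable_compose[OF this f] show ?thesis .
qed

lemma sets_PR_I: "S \<in> sets (predictable_sigma P F) \<Longrightarrow> S \<inter> ({0..T} \<times> space P) \<in> sets PR"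
  by (auto simp: sets_restrict_space)

lemma predictable_greater:
  assumes "0 \<le> s" "A \<in> sets (F s)"
  shows "({s<..T} \<times> A) \<in> sets PR"
proof (cases "s < T")
  case True
  have "({s<..T} \<times> A) \<inter> ({0..T} \<times> space P) = {s<..T} \<times> A"
    using assms sets_F sets.sets_into_space by fastforce
  then show ?thesis using sets_PR_I[OF predictable_rectangle[OF assms(1) True assms(2)]] by simp
qed simp

lemma predictable_step:
  assumes "0 \<le> s" and \<xi>: "\<xi> \<in> borel_measurable (F s)"
  shows "(\<lambda>(t, \<omega>). if s < t then \<xi> \<omega> else (0::real)) \<in> borel_measurable PR"
proof (rule borel_measurableI_greater)
  fix a :: real
  have gt: "{\<omega> \<in> space P. a < \<xi> \<omega>} \<in> sets (F s)" "{\<omega> \<in> space P. \<not> a < \<xi> \<omega>} \<in> sets (F s)"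
    using \<xi> assms(1) by (simp_all flip: space_F)
  show "{w \<in> space PR. a < (case w of (t, \<omega>) \<Rightarrow> if s < t then \<xi> \<omega> else 0)} \<in> sets PR"
  proof (cases "0 \<le> a")
    case True
    then have "{w \<in> space PR. a < (case w of (t, \<omega>) \<Rightarrow> if s < t then \<xi> \<omega> else 0)} 
        = {s<..T} \<times> {\<omega> \<in> space P. a < \<xi> \<omega>}"
      using assms(1) by (auto split: if_splits)
    then show ?thesis using predictable_greater[OF assms(1) gt(1)] by simp
  next
    \<comment> \<open>For negative \<open>a\<close> the superlevel set also contains the times up to
      \<open>s\<close>, where the process is 0, so its complement is the rectangle.\<close>
    case False
    then have "{w \<in> space PR. a < (case w of (t, \<omega>) \<Rightarrow> if s < t then \<xi> \<omega> else 0)} 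
        = space PR - {s<..T} \<times> {\<omega> \<in> space P. \<not> a < \<xi> \<omega>}"
      using assms(1) by (auto split: if_splits)
    then show ?thesis using sets.compl_sets[OF predictable_greater[OF assms(1) gt(2)]] by simp
  qed
qed

lemma fst_predictable[measurable]: "fst \<in> borel_measurable PR"
proof (rule borel_measurableI_greater)
  fix a :: real
  show "{w \<in> space PR. a < fst w} \<in> sets PR"
  proof (cases "0 \<le> a")
    case True
    have "space P \<in> sets (F a)" using space_F[OF True] sets.top[of "F a"] by simp
    moreover have "{w \<in> space PR. a < fst w} = {a<..T} \<times> space P" using True by auto
    ultimately show ?thesis using predictable_greater[OF True] by simp
  next
    case False
    then have "{w \<in> space PR. a < fst w} = space PR" by auto
    then show ?thesis using sets.top[of PR] by simp
  qed
qed

section \<open>Cadlag paths: left limits, joint measurability and predictability\<close>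

lemma cadlag_left_limit:
  assumes c: "cadlag_on T (\<lambda>t. Y t \<omega>)" and t: "t \<in> {0<..T}"
  shows "((\<lambda>s. Y s \<omega>) \<longlongrightarrow> left_limit Y t \<omega>) (at_left t)"
proof -
  obtain l where l: "((\<lambda>s. Y s \<omega>) \<longlongrightarrow> l) (at_left t)" using c t unfolding cadlag_on_def by blast
  then have "Lim (at_left t) (\<lambda>s. Y s \<omega>) = l" by (intro tendsto_Lim) auto
  then show ?thesis using l t by (simp add: left_limit_def)
qed

text \<open>A path with left limits differs from them at countably many times only, and at time 0
  \<open>left_limit\<close> is the value itself by convention.\<close>

lemma AE_left_limit_eq:
  assumes c: "cadlag_on T (\<lambda>t. Y t \<omega>)"
  shows "AE t in lbT. left_limit Y t \<omega> = Y t \<omega>"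
proof -
  have "countable {t \<in> {0<..T}. left_limit Y t \<omega> \<noteq> Y t \<omega>}"
    by (rule countable_left_discontinuities) (use cadlag_left_limit[where Y=Y and \<omega>=\<omega>, OF c] in auto)
  then have "{t \<in> {0<..T}. left_limit Y t \<omega> \<noteq> Y t \<omega>} \<in> null_sets lborel"
    by (rule countable_imp_null_set_lborel)
  then have "AE t in lborel. t \<notin> {t \<in> {0<..T}. left_limit Y t \<omega> \<noteq> Y t \<omega>}" by (rule AE_not_in)
  then have "AE t in lborel. t \<in> {0..T} \<longrightarrow> left_limit Y t \<omega> = Y t \<omega>"
    by eventually_elim (auto simp: left_limit_def)
  then show ?thesis by (subst AE_restrict_space_iff) auto
qed

text \<open>Grid points strictly after and strictly before t. Strictness is what lets the one-sided
  limits of a cadlag path be used even when t is itself a grid point; hence floor plus one and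
  ceiling minus one.\<close>

lemma floor_grid: "(\<lambda>n. (real_of_int \<lfloor>real (Suc n) * t\<rfloor> + 1) / real (Suc n)) \<longlonglongrightarrow> t"
  and floor_grid_gt: "t < (real_of_int \<lfloor>real (Suc n) * t\<rfloor> + 1) / real (Suc n)"
  and ceiling_grid: "(\<lambda>n. (real_of_int \<lceil>real (Suc n) * t\<rceil> - 1) / real (Suc n)) \<longlonglongrightarrow> t"
  and ceiling_grid_less: "(real_of_int \<lceil>real (Suc n) * t\<rceil> - 1) / real (Suc n) < t"
proof -
  have lim: "(\<lambda>n. 1 / real (Suc n)) \<longlonglongrightarrow> 0" by (rule LIMSEQ_Suc) (rule lim_1_over_n)
  have a: "t < (real_of_int \<lfloor>real (Suc n) * t\<rfloor> + 1) / real (Suc n)" for n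
    unfolding less_divide_eq using floor_correct[of "real (Suc n) * t"] by (simp add: mult.commute)
  have b: "(real_of_int \<lfloor>real (Suc n) * t\<rfloor> + 1) / real (Suc n) \<le> t + 1 / real (Suc n)" for n
    using of_int_floor_le[of "real (Suc n) * t"] by (simp add: field_simps del: of_nat_Suc)
  have c: "(real_of_int \<lceil>real (Suc n) * t\<rceil> - 1) / real (Suc n) < t" for n
    unfolding divide_less_eq using ceiling_correct[of "real (Suc n) * t"] by (simp add: mult.commute)
  have d: "t - 1 / real (Suc n) \<le> (real_of_int \<lceil>real (Suc n) * t\<rceil> - 1) / real (Suc n)" for n
    using le_of_int_ceiling[of "real (Suc n) * t"] by (simp add: field_simps del: of_nat_Suc)
  show "t < (real_of_int \<lfloor>real (Suc n) * t\<rfloor> + 1) / real (Suc n)" by (rule a)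
  show "(real_of_int \<lceil>real (Suc n) * t\<rceil> - 1) / real (Suc n) < t" by (rule c)
  show "(\<lambda>n. (real_of_int \<lfloor>real (Suc n) * t\<rfloor> + 1) / real (Suc n)) \<longlonglongrightarrow> t"
  proof (rule tendsto_sandwich[of "\<lambda>_. t" _ _ "\<lambda>n. t + 1 / real (Suc n)"])
    show "(\<lambda>n. t + 1 / real (Suc n)) \<longlonglongrightarrow> t"
      using tendsto_add[OF tendsto_const[of t] lim] by (simp del: of_nat_Suc)
  qed (intro always_eventually allI less_imp_le a b tendsto_const)+
  show "(\<lambda>n. (real_of_int \<lceil>real (Suc n) * t\<rceil> - 1) / real (Suc n)) \<longlonglongrightarrow> t"
  proof (rule tendsto_sandwich[of "\<lambda>n. t - 1 / real (Suc n)" _ _ "\<lambda>_. t"])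
    show "(\<lambda>n. t - 1 / real (Suc n)) \<longlonglongrightarrow> t"
      using tendsto_diff[OF tendsto_const[of t] lim] by (simp del: of_nat_Suc)
  qed (intro always_eventually allI less_imp_le c d tendsto_const)+
qed

text \<open>The path sampled at the next grid point after t converges to Y_t by right-continuity,
  and the sampled process is measurable because the grid index is integer valued. Clamping the grid
  point to the horizon makes the sample exact at t = T.\<close>

lemma cadlag_measurable_R:
  assumes ad: "\<And>t. t \<in> {0..T} \<Longrightarrow> Y t \<in> borel_measurable P"
    and c: "\<And>\<omega>. \<omega> \<in> space P \<Longrightarrow> cadlag_on T (\<lambda>t. Y t \<omega>)"
  shows "(\<lambda>(t, \<omega>). Y t \<omega>) \<in> borel_measurable R"
proof -
  let ?r = "\<lambda>(n::nat) (i::int). max 0 (min T ((real_of_int i + 1) / real (Suc n)))"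
  show ?thesis
  proof (rule borel_measurable_LIMSEQ_real[where u="\<lambda>n w. Y (?r n \<lfloor>real (Suc n) * fst w\<rfloor>) (snd w)"])
    fix n
    show "(\<lambda>w. Y (?r n \<lfloor>real (Suc n) * fst w\<rfloor>) (snd w)) \<in> borel_measurable R"
    proof (rule measurable_compose_countable[where f="\<lambda>i w. Y (?r n i) (snd w)"])
      fix i :: int
      have "Y (?r n i) \<in> borel_measurable P" using T_pos by (intro ad) auto
      then show "(\<lambda>w. Y (?r n i) (snd w)) \<in> borel_measurable R" by simp
      have [measurable]: "(\<lambda>x. x) \<in> borel_measurable lbT" by (rule measurable_restrict_space1) simp
      show "(\<lambda>w. \<lfloor>real (Suc n) * fst w\<rfloor>) \<in> measurable R (count_space UNIV)"
        using measurable_compose[OF measurable_fst \<open>(\<lambda>x. x) \<in> borel_measurable lbT\<close>] by measurable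
    qed
  next
    fix w assume "w \<in> space R"
    then obtain t \<omega> where w: "w = (t, \<omega>)" "0 \<le> t" "t \<le> T" "\<omega> \<in> space P" by auto
    show "(\<lambda>n. Y (?r n \<lfloor>real (Suc n) * fst w\<rfloor>) (snd w)) \<longlonglongrightarrow> (case w of (t, \<omega>) \<Rightarrow> Y t \<omega>)"
    proof (cases "t = T")
      case True
      have "?r n \<lfloor>real (Suc n) * T\<rfloor> = T" for n
        using floor_grid_gt[of T n] T_pos by (simp add: max_def min_def del: of_nat_Suc)
      then show ?thesis using True w by simp
    next
      case False
      then have "t < T" using w by simp
      have g: "?r n \<lfloor>real (Suc n) * t\<rfloor> > t" for n
        using floor_grid_gt[of t n] \<open>t < T\<close> by (simp add: less_max_iff_disj del: of_nat_Suc)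
      have "(\<lambda>n. ?r n \<lfloor>real (Suc n) * t\<rfloor>) \<longlonglongrightarrow> max 0 (min T t)"
        by (intro tendsto_max tendsto_min tendsto_const floor_grid)
      then have "filterlim (\<lambda>n. ?r n \<lfloor>real (Suc n) * t\<rfloor>) (at_right t) sequentially"
        unfolding filterlim_at using g w by (auto intro!: always_eventually less_imp_neq[THEN not_sym] simp del: of_nat_Suc)
      moreover have "((\<lambda>t. Y t \<omega>) \<longlongrightarrow> Y t \<omega>) (at_right t)"
        using c[OF w(4)] w \<open>t < T\<close> by (auto simp: cadlag_on_def)
      ultimately show ?thesis using w by (auto intro: filterlim_compose)
    qed
  qed
qed

text \<open>The path sampled at the last grid point before t is constant in time on each (i/n,
  (i+1)/n] and known at time i/n, so it is predictable; it converges to the left limit. At t = 0 the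
  maximum with 0 makes the sample Y_0.\<close>

lemma left_limit_predictable:
  assumes ad: "\<And>t. t \<in> {0..T} \<Longrightarrow> Y t \<in> borel_measurable (F t)"
    and c: "\<And>\<omega>. \<omega> \<in> space P \<Longrightarrow> cadlag_on T (\<lambda>t. Y t \<omega>)"
  shows "(\<lambda>(t, \<omega>). left_limit Y t \<omega>) \<in> borel_measurable PR"
proof -
  let ?r = "\<lambda>(n::nat) (t::real). max 0 ((real_of_int \<lceil>real (Suc n) * t\<rceil> - 1) / real (Suc n))"
  show ?thesis
  proof (rule borel_measurable_LIMSEQ_real[where u="\<lambda>n w. Y (?r n (fst w)) (snd w)"])
    fix n
    show "(\<lambda>w. Y (?r n (fst w)) (snd w)) \<in> borel_measurable PR"
    proof (rule measurableI)
      fix B :: "real set" assume B: "B \<in> sets borel"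
      \<comment> \<open>Sampling times are cut at \<open>T\<close>, since adaptedness is known only
        on the horizon. The event is then known at an even earlier time than the one
        required.\<close>
      define A where "A = (\<lambda>i::nat. Y (min T (real i / real (Suc n))) -` B \<inter> space P)"
      have AF: "A i \<in> sets (F (real i / real (Suc n)))" for i
      proof -
        have "A i \<in> sets (F (min T (real i / real (Suc n))))"
          unfolding A_def using measurable_sets[OF ad B, of "min T (real i / real (Suc n))"] T_pos
            space_F[of "min T (real i / real (Suc n))"] by auto
        then show ?thesis using F_mono[of "min T (real i / real (Suc n))" "real i / real (Suc n)"] T_pos by auto
      qed
      have i_iff: "real i / real (Suc n) < t \<and> t \<le> real (Suc i) / real (Suc n) \<longleftrightarrow> \<lceil>real (Suc n) * t\<rceil> = int i + 1" for i t
        by (simp add: ceiling_eq_iff field_simps del: of_nat_Suc) (simp add: algebra_simps)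
      have "(\<lambda>w. Y (?r n (fst w)) (snd w)) -` B \<inter> space PR = 
         (({0} \<times> A 0) \<union> (\<Union>i. {real i / real (Suc n)<..real (Suc i) / real (Suc n)} \<times> A i)) \<inter> ({0..T} \<times> space P)"
        (is "?L = ?Q")
      proof (intro set_eqI iffI)
        fix w assume w: "w \<in> ?L"
        then obtain t \<omega> where t: "w = (t, \<omega>)" "0 \<le> t" "t \<le> T" "\<omega> \<in> space P" "Y (?r n t) \<omega> \<in> B" by auto
        show "w \<in> ?Q"
        proof (cases "t = 0")
          case True
          then show ?thesis using t T_pos by (simp add: A_def)
        next
          case False
          define i where "i = nat (\<lceil>real (Suc n) * t\<rceil> - 1)"
          have "0 < real (Suc n) * t" using False t by simp
          then have i: "\<lceil>real (Suc n) * t\<rceil> = int i + 1" by (simp add: i_def)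
          then have r: "?r n t = real i / real (Suc n)" by simp
          have "real i / real (Suc n) < t" "t \<le> real (Suc i) / real (Suc n)" using i_iff i by auto
          moreover have "Y (real i / real (Suc n)) \<omega> \<in> B" using t(5) unfolding r .
          then have "\<omega> \<in> A i" using t(3,4) calculation by (simp add: A_def min_def del: of_nat_Suc)
          ultimately show ?thesis using t by auto
        qed
      next
        fix w assume w: "w \<in> ?Q"
        then obtain t \<omega> where t: "w = (t, \<omega>)" "0 \<le> t" "t \<le> T" "\<omega> \<in> space P" by auto
        have "Y (?r n t) \<omega> \<in> B"
        proof (cases "t = 0")
          case True
          have "\<not> (real i / real (Suc n) < t)" for i using True by (simp add: not_less)
          then show ?thesis using w t True T_pos by (auto simp: A_def)
        next
          case False
          then obtain i where i: "real i / real (Suc n) < t" "t \<le> real (Suc i) / real (Suc n)" "\<omega> \<in> A i"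
            using w t by auto
          then have "\<lceil>real (Suc n) * t\<rceil> = int i + 1" using i_iff by blast
          then have r: "?r n t = real i / real (Suc n)" by simp
          show ?thesis unfolding r using i t by (simp add: A_def min_def del: of_nat_Suc)
        qed
        then show "w \<in> ?L" using t by auto
      qed
      moreover have "?Q \<in> sets PR"
      proof (rule sets_PR_I, intro sets.Un predictable_zero sets.countable_UN'' predictable_rectangle)
        show "A 0 \<in> sets (F 0)" using AF[of 0] by simp
      qed (use AF in \<open>auto simp: divide_strict_right_mono\<close>)
      ultimately show "(\<lambda>w. Y (?r n (fst w)) (snd w)) -` B \<inter> space PR \<in> sets PR" by simp
    qed simp
  next
    fix w assume "w \<in> space PR"
    then obtain t \<omega> where w: "w = (t, \<omega>)" "0 \<le> t" "t \<le> T" "\<omega> \<in> space P" by auto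
    show "(\<lambda>n. Y (?r n (fst w)) (snd w)) \<longlonglongrightarrow> (case w of (t, \<omega>) \<Rightarrow> left_limit Y t \<omega>)"
    proof (cases "t = 0")
      case True
      then show ?thesis using w by (simp add: left_limit_def)
    next
      case False
      then have t: "t \<in> {0<..T}" using w by auto
      have g: "?r n t < t" for n
        using ceiling_grid_less[of n t] t by (simp del: of_nat_Suc)
      have "(\<lambda>n. ?r n t) \<longlonglongrightarrow> max 0 t"
        by (intro tendsto_max tendsto_const ceiling_grid)
      then have "filterlim (\<lambda>n. ?r n t) (at_left t) sequentially"
        unfolding filterlim_at using g w less_imp_neq[OF g] by (auto intro!: always_eventually simp del: of_nat_Suc)
      from filterlim_compose[OF cadlag_left_limit[where Y=Y and \<omega>=\<omega>, OF c[OF w(4)] t] this]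
      show ?thesis using w by simp
    qed
  qed
qed

text \<open>Replacing the process by 0 on the exceptional null set makes every path cadlag.
  Adaptedness survives because the null set belongs to every \<open>F t\<close>.\<close>

lemma S2_regular_version:
  assumes "Y \<in> S2 P F T"
  obtains N where "N \<in> null_sets P"
    "\<And>t. t \<in> {0..T} \<Longrightarrow> (\<lambda>\<omega>. if \<omega> \<in> N then 0 else Y t \<omega>) \<in> borel_measurable (F t)"
    "\<And>\<omega>. cadlag_on T (\<lambda>t. if \<omega> \<in> N then 0 else Y t \<omega>) \<or> \<omega> \<notin> space P"
proof -
  have ae: "AE \<omega> in P. cadlag_on T (\<lambda>t. Y t \<omega>)" and ad: "\<And>t. t \<in> {0..T} \<Longrightarrow> Y t \<in> borel_measurable (F t)"
    using assms by (auto simp: S2_def)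
  obtain N where N: "{\<omega> \<in> space P. \<not> cadlag_on T (\<lambda>t. Y t \<omega>)} \<subseteq> N" "N \<in> null_sets P"
    using AE_E[OF ae] by (metis null_setsI)
  show ?thesis
  proof (rule that[OF N(2)])
    fix t assume t: "t \<in> {0..T}"
    have "N \<in> sets (F t)" using null_in_F[OF _ N(2)] t by auto
    then show "(\<lambda>\<omega>. if \<omega> \<in> N then 0 else Y t \<omega>) \<in> borel_measurable (F t)"
      using ad[OF t] by (intro measurable_If_set) auto
  next
    fix \<omega>
    show "cadlag_on T (\<lambda>t. if \<omega> \<in> N then 0 else Y t \<omega>) \<or> \<omega> \<notin> space P"
    proof (cases "\<omega> \<in> N")
      case False
      then have "cadlag_on T (\<lambda>t. Y t \<omega>) \<or> \<omega> \<notin> space P" using N(1) by blast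
      then show ?thesis using False by simp
    qed (auto simp: cadlag_on_def intro!: tendsto_const)
  qed
qed

end

section \<open>The compensation formula\<close>

context finite_horizon begin

lemma finite_measure_lbT: "finite_measure lbT"
  by (rule finite_measureI) (use emeasure_lborel_Icc[of 0 T] T_pos in \<open>simp add: emeasure_restrict_space space_restrict_space\<close>)

sublocale TP: pair_sigma_finite lbT P
  using finite_measure_lbT by (simp add: finite_measure.sigma_finite_measure pair_sigma_finite_def sigma_finite_measure_axioms)

lemma nn_integral_R:
  assumes "f \<in> borel_measurable R"
  shows "(\<integral>\<^sup>+w. f w \<partial>R) = (\<integral>\<^sup>+\<omega>. \<integral>\<^sup>+t. f (t, \<omega>) \<partial>lbT \<partial>P)"
    and "(\<integral>\<^sup>+w. f w \<partial>R) = (\<integral>\<^sup>+t. \<integral>\<^sup>+\<omega>. f (t, \<omega>) \<partial>P \<partial>lbT)"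
  using TP.nn_integral_snd[of f] assms nn_integral_fst[of f lbT] by auto

lemma integral_R:
  fixes f :: "real \<times> 'a \<Rightarrow> real"
  assumes f: "integrable R f"
  shows "(\<integral>w. f w \<partial>R) = (\<integral>\<omega>. \<integral>t. f (t, \<omega>) \<partial>lbT \<partial>P)"
    and "(\<integral>w. f w \<partial>R) = (\<integral>t. \<integral>\<omega>. f (t, \<omega>) \<partial>P \<partial>lbT)"
    and "AE t in lbT. integrable P (\<lambda>\<omega>. f (t, \<omega>))"
    and "AE \<omega> in P. integrable lbT (\<lambda>t. f (t, \<omega>))"
    and "integrable P (\<lambda>\<omega>. \<integral>t. f (t, \<omega>) \<partial>lbT)"
    and "integrable lbT (\<lambda>t. \<integral>\<omega>. f (t, \<omega>) \<partial>P)"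
proof -
  have f': "integrable R (\<lambda>(t, \<omega>). f (t, \<omega>))" using f by simp
  show "(\<integral>w. f w \<partial>R) = (\<integral>\<omega>. \<integral>t. f (t, \<omega>) \<partial>lbT \<partial>P)"
    using TP.integral_snd[OF f'] by simp
  show "(\<integral>w. f w \<partial>R) = (\<integral>t. \<integral>\<omega>. f (t, \<omega>) \<partial>P \<partial>lbT)"
    using TP.integral_fst'[OF f] by simp
  show "AE t in lbT. integrable P (\<lambda>\<omega>. f (t, \<omega>))"
    using TP.AE_integrable_fst'[OF f] by simp
  show "AE \<omega> in P. integrable lbT (\<lambda>t. f (t, \<omega>))"
    using TP.AE_integrable_snd[OF f'] by simp
  show "integrable P (\<lambda>\<omega>. \<integral>t. f (t, \<omega>) \<partial>lbT)"
    using TP.integrable_snd[OF f'] by simp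
  show "integrable lbT (\<lambda>t. \<integral>\<omega>. f (t, \<omega>) \<partial>P)"
    using TP.integrable_fst'[OF f] by simp
qed

lemma set_integral_lbT:
  fixes f :: "real \<Rightarrow> real" assumes "t \<in> {0..T}"
  shows "(LBINT s:{0..t}. f s) = (\<integral>s. indicator {0..t} s * f s \<partial>lbT)"
    "(LBINT s:{0..T}. f s) = (\<integral>s. f s \<partial>lbT)"
    "set_integrable lborel {0..T} f \<longleftrightarrow> integrable lbT f"
proof -
  show "(LBINT s:{0..T}. f s) = (\<integral>s. f s \<partial>lbT)"
    by (simp add: set_lebesgue_integral_def integral_restrict_space)
  show "set_integrable lborel {0..T} f \<longleftrightarrow> integrable lbT f"
    by (simp add: set_integrable_def integrable_restrict_space)
  show "(LBINT s:{0..t}. f s) = (\<integral>s. indicator {0..t} s * f s \<partial>lbT)"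
    unfolding set_lebesgue_integral_def integral_restrict_space[of "{0..T}" lborel, simplified]
    using assms by (intro Bochner_Integration.integral_cong) (auto split: split_indicator)
qed

lemma nn_set_integral_lbT:
  "(\<integral>\<^sup>+s\<in>{0..T}. f s \<partial>lborel) = (\<integral>\<^sup>+s. f s \<partial>lbT)"
  by (simp add: nn_integral_restrict_space)

end

section \<open>The filtration of W and H, and the compensator\<close>

context default_setting begin

abbreviation F :: "real \<Rightarrow> 'a measure" where "F \<equiv> default_filtration P W \<tau>"

lemma indicator_measurable: "default_indicator \<tau> t \<in> borel_measurable P"
  using tau_measurable unfolding default_indicator_def by measurable

lemma default_filtration_generator:
  "{W s -` B \<inter> space P | s B. 0 \<le> s \<and> s \<le> t \<and> B \<in> sets borel} \<union>
      {default_indicator \<tau> s -` B \<inter> space P | s B. 0 \<le> s \<and> s \<le> t \<and> B \<in> sets borel} \<union>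
      null_sets P \<subseteq> sets P"
proof -
  have "W s \<in> borel_measurable P" if "0 \<le> s" for s
    using brownian that by (auto simp: brownian_motion_def)
  then show ?thesis using indicator_measurable by (auto intro: measurable_sets)
qed

lemma sets_default_filtration:
  "sets (F t) = sigma_sets (space P) ({W s -` B \<inter> space P | s B. 0 \<le> s \<and> s \<le> t \<and> B \<in> sets borel} \<union>
      {default_indicator \<tau> s -` B \<inter> space P | s B. 0 \<le> s \<and> s \<le> t \<and> B \<in> sets borel} \<union>
      null_sets P)"
  unfolding default_filtration_def
  by (rule sets_measure_of) (use default_filtration_generator[of t] sets.sets_into_space in blast)

lemma finite_horizon_default:
  assumes "0 < T" shows "finite_horizon P F T"
proof
  show "0 < T" by fact
  fix t :: real
  show "subalgebra P (F t)"
    unfolding subalgebra_def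
  proof
    show "space (F t) = space P" by (simp add: default_filtration_def space_measure_of_conv)
    show "sets (F t) \<subseteq> sets P"
      unfolding sets_default_filtration using default_filtration_generator by (rule sets.sigma_sets_subset)
  qed
  fix s :: real assume "s \<le> t"
  then show "sets (F s) \<subseteq> sets (F t)"
    unfolding sets_default_filtration by (intro sigma_sets_mono' Un_mono) fastforce+
next
  show "null_sets P \<subseteq> sets (F 0)"
    unfolding sets_default_filtration by (auto intro: sigma_sets.Basic)
qed

end

locale default_horizon = default_setting +
  fixes T :: real
  assumes horizon: "0 < T"

sublocale default_horizon \<subseteq> finite_horizon P "default_filtration P W \<tau>" T
  by (rule finite_horizon_default) (rule horizon)

context default_horizon begin

lemma lam_R[measurable]: "(\<lambda>w. lam (fst w) (snd w)) \<in> borel_measurable R"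
proof -
  have "(\<lambda>w. (fst w, snd w)) \<in> measurable R (restrict_space borel {0..} \<Otimes>\<^sub>M P)"
  proof (rule measurable_Pair)
    have "fst \<in> measurable R lbT" by simp
    moreover have "(\<lambda>x. x) \<in> measurable lbT (restrict_space borel {0..})"
      by (intro measurable_restrict_space2 measurable_restrict_space1) (auto simp: space_restrict_space)
    ultimately show "fst \<in> measurable R (restrict_space borel {0..})"
      using measurable_compose by blast
  qed simp
  from measurable_compose[OF this lam_measurable] show ?thesis by simp
qed

lemma compensator_zero: "compensator lam 0 \<omega> = 0"
proof -
  have "compensator lam 0 \<omega> = (LBINT s:{0}. lam s \<omega>)" by (simp add: compensator_def)
  also have "\<dots> = 0"
    unfolding set_lebesgue_integral_def
    by (rule integral_eq_zero_AE) (use AE_lborel_singleton[of 0] in \<open>eventually_elim, auto split: split_indicator\<close>)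
  finally show ?thesis .
qed

lemma AE_lam_integrable: "AE \<omega> in P. integrable lbT (\<lambda>t. lam t \<omega>)"
  using lam_integrable by eventually_elim (use T_pos set_integral_lbT(3)[of T] in force)

lemma AE_compensator_diff:
  "AE \<omega> in P. \<forall>s t. 0 \<le> s \<longrightarrow> s \<le> t \<longrightarrow> 
     ennreal (compensator lam t \<omega> - compensator lam s \<omega>) = (\<integral>\<^sup>+r. ennreal (lam r \<omega>) * indicator {s<..t} r \<partial>lborel) \<and>
     compensator lam s \<omega> \<le> compensator lam t \<omega>"
  using lam_integrable AE_space
proof eventually_elim
  fix \<omega> assume int: "\<forall>t\<ge>0. set_integrable lborel {0..t} (\<lambda>s. lam s \<omega>)" and \<omega>: "\<omega> \<in> space P"
  show "\<forall>s t. 0 \<le> s \<longrightarrow> s \<le> t \<longrightarrow> 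
     ennreal (compensator lam t \<omega> - compensator lam s \<omega>) = (\<integral>\<^sup>+r. ennreal (lam r \<omega>) * indicator {s<..t} r \<partial>lborel) \<and>
     compensator lam s \<omega> \<le> compensator lam t \<omega>"
  proof (intro allI impI)
    fix s t :: real assume st: "0 \<le> s" "s \<le> t"
    have i: "set_integrable lborel {0..s} (\<lambda>s. lam s \<omega>)" "set_integrable lborel {s<..t} (\<lambda>s. lam s \<omega>)"
      using int st by (auto intro: set_integrable_subset[of _ "{0..t}"])
    have "{0..t} = {0..s} \<union> {s<..t}" using st by auto
    then have "compensator lam t \<omega> - compensator lam s \<omega> = (LBINT r:{s<..t}. lam r \<omega>)"
      unfolding compensator_def using set_integral_Un[OF _ i] by (auto simp: ivl_disj_int)
    moreover have "ennreal (LBINT r:{s<..t}. lam r \<omega>) = (\<integral>\<^sup>+r. ennreal (lam r \<omega>) * indicator {s<..t} r \<partial>lborel)"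
      unfolding set_lebesgue_integral_def
      by (subst nn_integral_eq_integral[symmetric])
        (use i(2)[unfolded set_integrable_def] lam_nonneg \<omega> st in 
          \<open>auto intro!: nn_integral_cong split: split_indicator\<close>)
    moreover have "0 \<le> (LBINT r:{s<..t}. lam r \<omega>)"
      unfolding set_lebesgue_integral_def using lam_nonneg \<omega> st
      by (intro Bochner_Integration.integral_nonneg) (auto split: split_indicator)
    ultimately show "ennreal (compensator lam t \<omega> - compensator lam s \<omega>) = (\<integral>\<^sup>+r. ennreal (lam r \<omega>) * indicator {s<..t} r \<partial>lborel) \<and>
     compensator lam s \<omega> \<le> compensator lam t \<omega>" by simp
  qed
qed

lemma compensator_nonneg: 
  assumes "\<omega> \<in> space P" shows "0 \<le> compensator lam t \<omega>"
  unfolding compensator_def set_lebesgue_integral_def using lam_nonneg assms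
  by (intro Bochner_Integration.integral_nonneg) (auto split: split_indicator)

lemma indicator_integrable: "integrable P (default_indicator \<tau> t)"
  by (rule integrable_const_bound[where B=1]) (auto simp: indicator_measurable, auto simp: default_indicator_def)

lemma compensator_integrable:
  assumes "0 \<le> t" shows "integrable P (compensator lam t)"
proof -
  have "integrable P (\<lambda>\<omega>. default_indicator \<tau> t \<omega> - compensator lam t \<omega>)"
    using compensated_martingale assms by (auto simp: martingale_def)
  with indicator_integrable have "integrable P (\<lambda>\<omega>. default_indicator \<tau> t \<omega> - (default_indicator \<tau> t \<omega> - compensator lam t \<omega>))"
    by (rule Bochner_Integration.integrable_diff)
  then show ?thesis by simp
qed

text \<open>Conditional expectations are traded here for integrals over sets of \<open>F s\<close>;
  the martingale properties proved later all have this tested form.\<close>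

lemma compensator_martingale:
  assumes st: "0 \<le> s" "s \<le> t" and A: "A \<in> sets (F s)"
  shows "(\<integral>\<omega>. indicator A \<omega> * (default_indicator \<tau> t \<omega> - default_indicator \<tau> s \<omega>) \<partial>P)
    = (\<integral>\<omega>. indicator A \<omega> * (compensator lam t \<omega> - compensator lam s \<omega>) \<partial>P)"
proof -
  let ?N = "\<lambda>t \<omega>. default_indicator \<tau> t \<omega> - compensator lam t \<omega>"
  interpret S: sigma_finite_subalgebra P "F s"
    using F_subalgebra[OF st(1)] by (intro finite_measure_subalgebra_is_sigma_finite)
      (simp add: finite_measure_subalgebra_def finite_measure_axioms finite_measure_subalgebra_axioms_def)
  have Ni: "integrable P (?N r)" if "0 \<le> r" for r
    using compensated_martingale that by (auto simp: martingale_def)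
  have AP: "A \<in> sets P" using sets_F[OF st(1) A] .
  have "(\<integral>\<omega>\<in>A. ?N t \<omega> \<partial>P) = (\<integral>\<omega>\<in>A. real_cond_exp P (F s) (?N t) \<omega> \<partial>P)"
    by (rule S.real_cond_exp_intA) (use Ni st A in auto)
  also have "\<dots> = (\<integral>\<omega>\<in>A. ?N s \<omega> \<partial>P)"
    unfolding set_lebesgue_integral_def
  proof (rule integral_cong_AE)
    have "AE \<omega> in P. real_cond_exp P (F s) (?N t) \<omega> = ?N s \<omega>"
      using compensated_martingale st by (auto simp: martingale_def)
    then show "AE \<omega> in P. indicator A \<omega> *\<^sub>R real_cond_exp P (F s) (?N t) \<omega> = indicator A \<omega> *\<^sub>R ?N s \<omega>" by auto
  qed (use AP Ni[of s] st in auto)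
  finally have "(\<integral>\<omega>. indicator A \<omega> * ?N t \<omega> \<partial>P) = (\<integral>\<omega>. indicator A \<omega> * ?N s \<omega> \<partial>P)"
    by (simp add: set_lebesgue_integral_def)
  moreover have ci: "integrable P (\<lambda>\<omega>. indicator A \<omega> * compensator lam r \<omega>)" if "0 \<le> r" for r
    using integrable_mult_indicator[OF AP compensator_integrable[OF that]] by simp
  moreover have hi: "integrable P (\<lambda>\<omega>. indicator A \<omega> * default_indicator \<tau> r \<omega>)" for r
    using integrable_mult_indicator[OF AP indicator_integrable] by simp
  ultimately show ?thesis
    using st by (simp add: right_diff_distrib)
qed

text \<open>Evaluation of a predictable process at the default time becomes composition with this
  map. Since \<tau> is positive, its graph misses the rectangles at time 0.\<close>

lemma tau_predictable_map: "(\<lambda>\<omega>. (\<tau> \<omega>, \<omega>)) \<in> measurable P (predictable_sigma P F)"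
proof (rule measurable_predictableI)
  fix A assume "A \<in> sets (F 0)"
  have "(\<lambda>\<omega>. (\<tau> \<omega>, \<omega>)) -` ({0} \<times> A) \<inter> space P = {}" using tau_positive by force
  then show "(\<lambda>\<omega>. (\<tau> \<omega>, \<omega>)) -` ({0} \<times> A) \<inter> space P \<in> sets P" by (metis sets.empty_sets)
next
  fix s t A assume "0 \<le> s" "s < (t::real)" "A \<in> sets (F s)"
  then have "A \<in> sets P" using sets_F by blast
  moreover have "(\<lambda>\<omega>. (\<tau> \<omega>, \<omega>)) -` ({s<..t} \<times> A) \<inter> space P = {\<omega> \<in> space P. s < \<tau> \<omega> \<and> \<tau> \<omega> \<le> t} \<inter> A"
    using sets.sets_into_space[OF calculation] by auto
  ultimately show "(\<lambda>\<omega>. (\<tau> \<omega>, \<omega>)) -` ({s<..t} \<times> A) \<inter> space P \<in> sets P"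
    using tau_measurable by auto
qed (use tau_positive in \<open>auto simp: less_imp_le\<close>)

lemma time_interval_predictable: "{0..T} \<times> space P \<in> sets (predictable_sigma P F)"
proof -
  have "space P \<in> sets (F 0)" using sets.top[of "F 0"] by (simp add: space_F)
  then have "{0} \<times> space P \<union> {0<..T} \<times> space P \<in> sets (predictable_sigma P F)"
    using T_pos by (intro sets.Un predictable_zero predictable_rectangle) auto
  also have "{0} \<times> space P \<union> {0<..T} \<times> space P = {0..T} \<times> space P" using T_pos by auto
  finally show ?thesis .
qed

lemma measurable_at_default:
  assumes "\<phi> \<in> measurable PR N" "c \<in> space N"
  shows "(\<lambda>\<omega>. if \<tau> \<omega> \<le> T then \<phi> (\<tau> \<omega>, \<omega>) else c) \<in> measurable P N"
proof (rule measurable_If_restrict_space_iff[THEN iffD2])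
  show "{x \<in> space P. \<tau> x \<le> T} \<in> sets P" using tau_measurable by measurable
  have "(\<lambda>\<omega>. (\<tau> \<omega>, \<omega>)) \<in> measurable (restrict_space P {\<omega>. \<tau> \<omega> \<le> T}) PR"
    by (intro measurable_restrict_space2 measurable_restrict_space1 tau_predictable_map)
      (use tau_positive in \<open>auto simp: space_restrict_space less_imp_le\<close>)
  from measurable_compose[OF this assms(1)]
  show "(\<lambda>\<omega>. \<phi> (\<tau> \<omega>, \<omega>)) \<in> measurable (restrict_space P {\<omega>. \<tau> \<omega> \<le> T}) N \<and> (\<lambda>x. c) \<in> measurable (restrict_space P {x. \<not> \<tau> x \<le> T}) N"
    using assms(2) by simp
qed

lemma compensation_rectangle:
  assumes "0 \<le> s" "s < t" and A: "A \<in> sets (F s)"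
  shows "emeasure P {\<omega> \<in> A. \<tau> \<omega> \<le> T \<and> s < \<tau> \<omega> \<and> \<tau> \<omega> \<le> t} =
     (\<integral>\<^sup>+w. ennreal (lam (fst w) (snd w)) * indicator ({s<..t} \<times> A) w \<partial>R)"
proof -
  have AP[measurable]: "A \<in> sets P" using sets_F[OF _ A] assms by simp
  note [measurable] = tau_measurable
  have Asp: "\<omega> \<in> A \<Longrightarrow> \<omega> \<in> space P" for \<omega> using sets.sets_into_space[OF AP] by auto
  \<comment> \<open>The right end is cut at the horizon. The maximum with \<open>s\<close> covers
    rectangles starting after \<open>T\<close>, for which both sides are 0.\<close>
  define t' where "t' = max s (min T t)"
  have st': "0 \<le> s" "s \<le> t'" using assms by (auto simp: t'_def)
  have "ennreal (\<integral>\<omega>. indicator A \<omega> * (default_indicator \<tau> t' \<omega> - default_indicator \<tau> s \<omega>) \<partial>P)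
     = (\<integral>\<^sup>+\<omega>. indicator A \<omega> * (default_indicator \<tau> t' \<omega> - default_indicator \<tau> s \<omega>) \<partial>P)"
  proof (rule nn_integral_eq_integral[symmetric])
    show "integrable P (\<lambda>\<omega>. indicator A \<omega> * (default_indicator \<tau> t' \<omega> - default_indicator \<tau> s \<omega>))"
      using integrable_mult_indicator[OF AP Bochner_Integration.integrable_diff[OF indicator_integrable indicator_integrable]] by simp
  qed (use st' in \<open>auto simp: default_indicator_def split: split_indicator\<close>)
  also have "\<dots> = (\<integral>\<^sup>+\<omega>. indicator {\<omega> \<in> A. \<tau> \<omega> \<le> T \<and> s < \<tau> \<omega> \<and> \<tau> \<omega> \<le> t} \<omega> \<partial>P)"
    using st' by (intro nn_integral_cong) (auto simp: default_indicator_def t'_def min_def max_def split: split_indicator)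
  also have "\<dots> = emeasure P {\<omega> \<in> A. \<tau> \<omega> \<le> T \<and> s < \<tau> \<omega> \<and> \<tau> \<omega> \<le> t}"
    by (rule nn_integral_indicator) measurable
  finally have L: "emeasure P {\<omega> \<in> A. \<tau> \<omega> \<le> T \<and> s < \<tau> \<omega> \<and> \<tau> \<omega> \<le> t} =
    ennreal (\<integral>\<omega>. indicator A \<omega> * (compensator lam t' \<omega> - compensator lam s \<omega>) \<partial>P)"
    using compensator_martingale[OF st' A] by simp
  have "ennreal (\<integral>\<omega>. indicator A \<omega> * (compensator lam t' \<omega> - compensator lam s \<omega>) \<partial>P)
     = (\<integral>\<^sup>+\<omega>. indicator A \<omega> * (compensator lam t' \<omega> - compensator lam s \<omega>) \<partial>P)"
  proof (rule nn_integral_eq_integral[symmetric])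
    have "integrable P (\<lambda>\<omega>. compensator lam t' \<omega> - compensator lam s \<omega>)"
      using compensator_integrable st' by auto
    then show "integrable P (\<lambda>\<omega>. indicator A \<omega> * (compensator lam t' \<omega> - compensator lam s \<omega>))"
      using integrable_mult_indicator[OF AP, of "\<lambda>\<omega>. compensator lam t' \<omega> - compensator lam s \<omega>"] by simp
    show "AE \<omega> in P. 0 \<le> indicator A \<omega> * (compensator lam t' \<omega> - compensator lam s \<omega>)"
      using AE_compensator_diff by eventually_elim (use st' in \<open>auto split: split_indicator\<close>)
  qed
  also have "\<dots> = (\<integral>\<^sup>+\<omega>. \<integral>\<^sup>+r. ennreal (lam r \<omega>) * indicator ({s<..t} \<times> A) (r, \<omega>) \<partial>lbT \<partial>P)"
  proof (rule nn_integral_cong_AE)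
    show "AE \<omega> in P. ennreal (indicator A \<omega> * (compensator lam t' \<omega> - compensator lam s \<omega>))
       = (\<integral>\<^sup>+r. ennreal (lam r \<omega>) * indicator ({s<..t} \<times> A) (r, \<omega>) \<partial>lbT)"
      using AE_compensator_diff
    proof eventually_elim
      case (elim \<omega>)
      have "(\<integral>\<^sup>+r. ennreal (lam r \<omega>) * indicator {s<..t'} r \<partial>lborel)
        = (\<integral>\<^sup>+r. ennreal (lam r \<omega>) * indicator {s<..t} r \<partial>lbT)"
        unfolding nn_integral_restrict_space[of "{0..T}" lborel, simplified]
        using st' by (intro nn_integral_cong) (auto simp: t'_def split: split_indicator)
      then show ?case using elim st' by (cases "\<omega> \<in> A") (simp_all add: indicator_times)
    qed
  qed
  also have "\<dots> = (\<integral>\<^sup>+w. ennreal (lam (fst w) (snd w)) * indicator ({s<..t} \<times> A) w \<partial>R)"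
  proof (subst nn_integral_R(1))
    have "{s<..t} \<times> A \<in> sets (predictable_sigma P F)" using predictable_rectangle assms by blast
    then have "({s<..t} \<times> A) \<inter> ({0..T} \<times> space P) \<in> sets PR" by (rule sets_PR_I)
    then have "(\<lambda>w. indicator (({s<..t} \<times> A) \<inter> ({0..T} \<times> space P)) w :: ennreal) \<in> borel_measurable R"
      by (intro predictable_measurable_R) simp
    then have "(\<lambda>w. ennreal (lam (fst w) (snd w)) * indicator (({s<..t} \<times> A) \<inter> ({0..T} \<times> space P)) w) \<in> borel_measurable R"
      by measurable
    then show "(\<lambda>w. ennreal (lam (fst w) (snd w)) * indicator ({s<..t} \<times> A) w) \<in> borel_measurable R"
      by (rule measurable_cong[THEN iffD1, rotated]) (auto split: split_indicator)
  qed simp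
  finally show ?thesis using L by simp
qed

text \<open>The two predictable measures \<open>E[1\<^sub>G(\<tau>, \<cdot>) 1(\<tau> \<le> T)]\<close> and \<open>E \<integral> 1\<^sub>G \<lambda> dt\<close> agree on the
  generating rectangles by the martingale property of \<open>H - \<Lambda>\<close>.\<close>

theorem compensation_formula_nn:
  fixes \<phi> :: "real \<times> 'a \<Rightarrow> ennreal"
  assumes \<phi>: "\<phi> \<in> borel_measurable PR"
  shows "(\<integral>\<^sup>+\<omega>. (if \<tau> \<omega> \<le> T then \<phi> (\<tau> \<omega>, \<omega>) else 0) \<partial>P) = (\<integral>\<^sup>+w. \<phi> w * ennreal (lam (fst w) (snd w)) \<partial>R)"
proof -
  note [measurable] = tau_measurable
  let ?PS = "predictable_sigma P F"
  \<comment> \<open>\<open>\<mu>\<close> is the law of (\<tau>, \<omega>) on the event \<tau> \<le>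
    T and \<open>\<nu>\<close> is \<lambda> dt \<otimes> P, both regarded on predictable sets only.
    The mass of \<open>\<mu>\<close> is at most 1, which supplies the finiteness required for
    uniqueness.\<close>
  define \<mu> where "\<mu> = distr (density P (indicator {\<omega>. \<tau> \<omega> \<le> T})) ?PS (\<lambda>\<omega>. (\<tau> \<omega>, \<omega>))"
  define \<nu> where "\<nu> = distr (density R (\<lambda>w. ennreal (lam (fst w) (snd w)))) ?PS (\<lambda>w. w)"
  have mp[measurable]: "(\<lambda>\<omega>. (\<tau> \<omega>, \<omega>)) \<in> measurable P ?PS" by (rule tau_predictable_map)
  have idm[measurable]: "(\<lambda>w. w) \<in> measurable R ?PS"
    by (rule predictable_measurable_R) (simp add: measurable_restrict_space1)
  have Imeas[measurable]: "(\<lambda>\<omega>. indicator {\<omega>. \<tau> \<omega> \<le> T} \<omega> :: ennreal) \<in> borel_measurable P"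
    by (rule borel_measurable_indicator') measurable
  have \<mu>I: "(\<integral>\<^sup>+w. f w \<partial>\<mu>) = (\<integral>\<^sup>+\<omega>. indicator {\<omega>. \<tau> \<omega> \<le> T} \<omega> * f (\<tau> \<omega>, \<omega>) \<partial>P)" 
    if [measurable]: "f \<in> borel_measurable ?PS" for f
    unfolding \<mu>_def by (subst nn_integral_distr) (auto intro!: nn_integral_density)
  have \<nu>I: "(\<integral>\<^sup>+w. f w \<partial>\<nu>) = (\<integral>\<^sup>+w. ennreal (lam (fst w) (snd w)) * f w \<partial>R)" 
    if f: "f \<in> borel_measurable ?PS" for f
  proof -
    have "f \<in> borel_measurable R" using measurable_compose[OF idm f] .
    then show ?thesis
      unfolding \<nu>_def using f by (subst nn_integral_distr) (auto intro!: nn_integral_density)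
  qed
  let ?E = "{{0} \<times> A | A. A \<in> sets (F 0)} \<union>
      {{s<..t} \<times> A | s t A. 0 \<le> s \<and> s < t \<and> A \<in> sets (F s)}"
  have EP: "X \<in> sets ?PS" if "X \<in> ?E" for X
    unfolding sets_predictable using that by (rule sigma_sets.Basic)
  have em\<mu>: "emeasure \<mu> X = (\<integral>\<^sup>+\<omega>. indicator {\<omega>. \<tau> \<omega> \<le> T} \<omega> * indicator X (\<tau> \<omega>, \<omega>) \<partial>P)"
    and em\<nu>: "emeasure \<nu> X = (\<integral>\<^sup>+w. ennreal (lam (fst w) (snd w)) * indicator X w \<partial>R)"
    if "X \<in> sets ?PS" for X
    using \<mu>I[of "indicator X"] \<nu>I[of "indicator X"] that by (auto simp: \<mu>_def \<nu>_def)
  have eq: "emeasure \<mu> X = emeasure \<nu> X" if X: "X \<in> ?E" for X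
  proof -
    consider A where "X = {0} \<times> A" "A \<in> sets (F 0)"
      | s t A where "X = {s<..t} \<times> A" "0 \<le> s" "s < t" "A \<in> sets (F s)" using X by blast
    then show ?thesis
    proof cases
      case 1
      have "(\<integral>\<^sup>+\<omega>. indicator {\<omega>. \<tau> \<omega> \<le> T} \<omega> * indicator X (\<tau> \<omega>, \<omega>) \<partial>P) = (\<integral>\<^sup>+\<omega>. 0 \<partial>P)"
        using 1 tau_positive by (intro nn_integral_cong) (force split: split_indicator)
      moreover have "(\<integral>\<^sup>+w. ennreal (lam (fst w) (snd w)) * indicator X w \<partial>R) = 0"
      proof -
        have XR: "(\<lambda>w. indicator X w :: ennreal) \<in> borel_measurable R"
          using measurable_compose[OF idm, of "indicator X"] EP[OF X] by simp
        have "(\<integral>\<^sup>+w. ennreal (lam (fst w) (snd w)) * indicator X w \<partial>R) = 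
          (\<integral>\<^sup>+\<omega>. \<integral>\<^sup>+t. ennreal (lam t \<omega>) * indicator X (t, \<omega>) \<partial>lbT \<partial>P)"
          by (subst nn_integral_R(1)) (use XR in auto)
        also have "\<dots> = (\<integral>\<^sup>+\<omega>. 0 \<partial>P)"
        proof (intro nn_integral_cong)
          fix \<omega>
          have "AE t in lbT. t \<noteq> 0"
            by (subst AE_restrict_space_iff) (use AE_lborel_singleton[of 0] in auto)
          then have "AE t in lbT. ennreal (lam t \<omega>) * indicator X (t, \<omega>) = 0"
            by eventually_elim (auto simp: 1 split: split_indicator)
          then have "(\<integral>\<^sup>+t. ennreal (lam t \<omega>) * indicator X (t, \<omega>) \<partial>lbT) = (\<integral>\<^sup>+t. 0 \<partial>lbT)"
            by (rule nn_integral_cong_AE)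
          then show "(\<integral>\<^sup>+t. ennreal (lam t \<omega>) * indicator X (t, \<omega>) \<partial>lbT) = 0" by simp
        qed
        finally show ?thesis by simp
      qed
      ultimately show ?thesis using em\<mu> em\<nu> EP[OF X] by simp
    next
      case 2
      have AP[measurable]: "A \<in> sets P" using sets_F 2 by blast
      have "(\<integral>\<^sup>+\<omega>. indicator {\<omega>. \<tau> \<omega> \<le> T} \<omega> * indicator X (\<tau> \<omega>, \<omega>) \<partial>P) = 
        (\<integral>\<^sup>+\<omega>. indicator {\<omega> \<in> A. \<tau> \<omega> \<le> T \<and> s < \<tau> \<omega> \<and> \<tau> \<omega> \<le> t} \<omega> \<partial>P)"
        using 2 by (intro nn_integral_cong) (auto split: split_indicator)
      also have "\<dots> = emeasure P {\<omega> \<in> A. \<tau> \<omega> \<le> T \<and> s < \<tau> \<omega> \<and> \<tau> \<omega> \<le> t}"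
        by (rule nn_integral_indicator) measurable
      also have "\<dots> = emeasure \<nu> X"
        using compensation_rectangle[OF 2(2-4)] em\<nu>[OF EP[OF X]] 2 by simp
      finally show ?thesis using em\<mu>[OF EP[OF X]] by simp
    qed
  qed
  have \<Omega>F: "space P \<in> sets (F 0)" using sets.top[of "F 0"] by (simp add: space_F)
  have "\<mu> = \<nu>"
  \<comment> \<open>The exhausting sequence must consist of generators. The slice at time 0 is not
    contained in any (0, n] and is therefore its first member.\<close>
  proof (rule measure_eqI_generator_eq[where A="\<lambda>n. if n = 0 then {0} \<times> space P else {0<..real n} \<times> space P" and E="?E" and \<Omega>="{0..} \<times> space P"])
    show "Int_stable ?E"
    proof (rule Int_stableI)
      fix a b assume ab: "a \<in> ?E" "b \<in> ?E"
      have rect: "{s<..t} \<times> A \<inter> {s'<..t'} \<times> B \<in> ?E"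
        if h: "0 \<le> s" "s < t" "A \<in> sets (F s)" "0 \<le> s'" "s' < t'" "B \<in> sets (F s')" for s t s' t' :: real and A B
      proof -
        have eq: "{s<..t} \<times> A \<inter> {s'<..t'} \<times> B = {max s s'<..min t t'} \<times> (A \<inter> B)" by auto
        show ?thesis
        proof (cases "max s s' < min t t'")
          case True
          have "A \<inter> B \<in> sets (F (max s s'))"
            using F_mono[of s "max s s'"] F_mono[of s' "max s s'"] h by auto
          then show ?thesis unfolding eq using True h
            by (intro UnI2 CollectI exI[of _ "max s s'"] exI[of _ "min t t'"] exI[of _ "A \<inter> B"]) simp
        next
          case False
          \<comment> \<open>Generators (s, t] require s < t, so an empty intersection is presented
            as a rectangle at time 0 over the empty set.\<close>
          then have "{s<..t} \<times> A \<inter> {s'<..t'} \<times> B = {0} \<times> {}" unfolding eq by auto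
          then show ?thesis by (intro UnI1 CollectI exI[of _ "{}"]) simp
        qed
      qed
      have zz: "{0} \<times> A \<inter> {0} \<times> B \<in> ?E" if "A \<in> sets (F 0)" "B \<in> sets (F 0)" for A B
      proof -
        have "{0::real} \<times> A \<inter> {0} \<times> B = {0} \<times> (A \<inter> B)" by auto
        then show ?thesis using that by blast
      qed
      have zr: "{0} \<times> A \<inter> {s<..t} \<times> B \<in> ?E" "{s<..t} \<times> B \<inter> {0} \<times> A \<in> ?E" if "0 \<le> s" for A B :: "'a set" and s t :: real
      proof -
        have "{0} \<times> A \<inter> {s<..t} \<times> B = {0} \<times> {}" "{s<..t} \<times> B \<inter> {0} \<times> A = {0} \<times> {}" using that by auto
        then show "{0} \<times> A \<inter> {s<..t} \<times> B \<in> ?E" "{s<..t} \<times> B \<inter> {0} \<times> A \<in> ?E"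
          by (intro UnI1 CollectI exI[of _ "{}"], simp)+
      qed
      from ab(1) show "a \<inter> b \<in> ?E"
      proof
        assume "a \<in> {{0} \<times> A | A. A \<in> sets (F 0)}"
        then obtain A where A: "a = {0} \<times> A" "A \<in> sets (F 0)" by blast
        from ab(2) show ?thesis
        proof
          assume "b \<in> {{0} \<times> A | A. A \<in> sets (F 0)}"
          then show ?thesis using A zz by auto
        next
          assume "b \<in> {{s<..t} \<times> A | s t A. 0 \<le> s \<and> s < t \<and> A \<in> sets (F s)}"
          then obtain s t B where b: "b = {s<..t} \<times> B" "0 \<le> s" by blast
          show ?thesis unfolding A b(1) by (rule zr(1)[OF b(2)])
        qed
      next
        assume "a \<in> {{s<..t} \<times> A | s t A. 0 \<le> s \<and> s < t \<and> A \<in> sets (F s)}"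
        then obtain s t A where A: "a = {s<..t} \<times> A" "0 \<le> s" "s < t" "A \<in> sets (F s)" by blast
        from ab(2) show ?thesis
        proof
          assume "b \<in> {{0} \<times> A | A. A \<in> sets (F 0)}"
          then obtain B where b: "b = {0} \<times> B" by blast
          show ?thesis unfolding A(1) b by (rule zr(2)[OF A(2)])
        next
          assume "b \<in> {{s<..t} \<times> A | s t A. 0 \<le> s \<and> s < t \<and> A \<in> sets (F s)}"
          then obtain s' t' B where b: "b = {s'<..t'} \<times> B" "0 \<le> s'" "s' < t'" "B \<in> sets (F s')" by blast
          show ?thesis unfolding A(1) b(1) by (rule rect[OF A(2-4) b(2-4)])
        qed
      qed
    qed
    show "range (\<lambda>n. if n = 0 then {0} \<times> space P else {0<..real n} \<times> space P) \<subseteq> ?E"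
    proof (rule image_subsetI)
      fix n :: nat
      show "(if n = 0 then {0} \<times> space P else {0<..real n} \<times> space P) \<in> ?E"
      proof (cases "n = 0")
        case False
        then have "{0<..real n} \<times> space P \<in> {{s<..t} \<times> A | s t A. 0 \<le> s \<and> s < t \<and> A \<in> sets (F s)}"
          using \<Omega>F by (intro CollectI exI[of _ 0] exI[of _ "real n"] exI[of _ "space P"]) simp
        then show ?thesis using False by simp
      qed (use \<Omega>F in auto)
    qed
    show "(\<Union>n. if n = 0 then {0::real} \<times> space P else {0<..real n} \<times> space P) = {0..} \<times> space P"
    proof (intro set_eqI iffI)
      fix w :: "real \<times> 'a" assume "w \<in> {0..} \<times> space P"
      then obtain t \<omega> where w: "w = (t, \<omega>)" "0 \<le> t" "\<omega> \<in> space P" by auto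
      obtain n :: nat where n: "t < real n" using reals_Archimedean2 by blast
      have "w \<in> (if (if t = 0 then 0 else n) = 0 then {0} \<times> space P else {0<..real (if t = 0 then 0 else n)} \<times> space P)"
        using w n by (cases "t = 0") auto
      then show "w \<in> (\<Union>n. if n = 0 then {0::real} \<times> space P else {0<..real n} \<times> space P)" by blast
    qed (auto split: if_splits)
    show "emeasure \<mu> (if n = 0 then {0} \<times> space P else {0<..real n} \<times> space P) \<noteq> \<infinity>" for n
    proof -
      have "emeasure \<mu> X \<le> 1" if "X \<in> sets ?PS" for X
      proof -
        have "emeasure \<mu> X \<le> (\<integral>\<^sup>+\<omega>. 1 \<partial>P)"
          unfolding em\<mu>[OF that] by (intro nn_integral_mono) (auto split: split_indicator)
        then show ?thesis by (simp add: emeasure_space_1)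
      qed
      then have le: "emeasure \<mu> X \<le> 1" if "X \<in> sets ?PS" for X using that .
      have "sets \<mu> = sets ?PS" by (simp add: \<mu>_def)
      then have "emeasure \<mu> X \<le> 1" for X
        using le[of X] emeasure_notin_sets[of X \<mu>] by (cases "X \<in> sets ?PS") auto
      then have "emeasure \<mu> X < \<infinity>" for X by (rule le_less_trans) simp
      then show ?thesis by (simp add: less_top)
    qed
  qed (use eq predictable_generator_subset sets_predictable in \<open>auto simp: \<mu>_def \<nu>_def\<close>)
  \<comment> \<open>Both measures live on the whole half-line, so \<open>\<phi>\<close> is extended
    by 0 beyond the horizon.\<close>
  define \<psi> where "\<psi> = (\<lambda>w. \<phi> w * indicator ({0..T} \<times> space P) w)"
  have "{0..T} \<times> space P \<inter> {0..} \<times> space P = {0..T} \<times> space P" by auto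
  then have \<psi>: "\<psi> \<in> borel_measurable ?PS"
    unfolding \<psi>_def using \<phi> time_interval_predictable
    by (subst borel_measurable_restrict_space_iff_ennreal[symmetric]) simp_all
  have "(\<integral>\<^sup>+\<omega>. (if \<tau> \<omega> \<le> T then \<phi> (\<tau> \<omega>, \<omega>) else 0) \<partial>P) = (\<integral>\<^sup>+w. \<psi> w \<partial>\<mu>)"
    unfolding \<mu>I[OF \<psi>] by (intro nn_integral_cong)
      (use tau_positive in \<open>auto simp: \<psi>_def less_imp_le split: split_indicator\<close>)
  also have "\<dots> = (\<integral>\<^sup>+w. \<phi> w * ennreal (lam (fst w) (snd w)) \<partial>R)"
    unfolding \<open>\<mu> = \<nu>\<close> \<nu>I[OF \<psi>] by (intro nn_integral_cong) (auto simp: \<psi>_def mult.commute)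
  finally show ?thesis .
qed

lemma compensation_formula:
  fixes \<phi> :: "real \<times> 'a \<Rightarrow> real"
  assumes \<phi>: "\<phi> \<in> borel_measurable PR"
    and int: "integrable R (\<lambda>w. \<phi> w * lam (fst w) (snd w))"
  shows "integrable P (\<lambda>\<omega>. if \<tau> \<omega> \<le> T then \<phi> (\<tau> \<omega>, \<omega>) else 0)" (is ?A)
    and "(\<integral>\<omega>. (if \<tau> \<omega> \<le> T then \<phi> (\<tau> \<omega>, \<omega>) else 0) \<partial>P) = (\<integral>w. \<phi> w * lam (fst w) (snd w) \<partial>R)"
proof -
  let ?a = "\<lambda>\<omega>. if \<tau> \<omega> \<le> T then \<phi> (\<tau> \<omega>, \<omega>) else 0"
  have l0: "w \<in> space R \<Longrightarrow> 0 \<le> lam (fst w) (snd w)" for w using lam_nonneg by auto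
  \<comment> \<open>\<open>f\<close> will be the norm, the identity and the negation. They commute
    with the nonnegative factor \<lambda>, and together give integrability and the positive and
    negative parts of the integral.\<close>
  have gen: "(\<integral>\<^sup>+\<omega>. ennreal (f (?a \<omega>)) \<partial>P) = (\<integral>\<^sup>+w. ennreal (f (\<phi> w * lam (fst w) (snd w))) \<partial>R)"
    if f: "f \<in> borel_measurable borel" "f 0 = 0" "\<And>x y. 0 \<le> y \<Longrightarrow> f (x * y) = f x * y" for f :: "real \<Rightarrow> real"
  proof -
    have "(\<integral>\<^sup>+\<omega>. ennreal (f (?a \<omega>)) \<partial>P) = (\<integral>\<^sup>+\<omega>. (if \<tau> \<omega> \<le> T then ennreal (f (\<phi> (\<tau> \<omega>, \<omega>))) else 0) \<partial>P)"
      by (intro nn_integral_cong) (auto simp: f(2))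
    also have "\<dots> = (\<integral>\<^sup>+w. ennreal (f (\<phi> w)) * ennreal (lam (fst w) (snd w)) \<partial>R)"
      by (rule compensation_formula_nn) (rule measurable_compose[OF measurable_compose[OF \<phi> f(1)] measurable_ennreal])
    also have "\<dots> = (\<integral>\<^sup>+w. ennreal (f (\<phi> w * lam (fst w) (snd w))) \<partial>R)"
      using l0 by (intro nn_integral_cong) (simp add: f(3) ennreal_mult'')
    finally show ?thesis .
  qed
  have am: "?a \<in> borel_measurable P" by (rule measurable_at_default[OF \<phi>]) simp
  have "(\<integral>\<^sup>+\<omega>. ennreal (norm (?a \<omega>)) \<partial>P) = (\<integral>\<^sup>+w. ennreal (norm (\<phi> w * lam (fst w) (snd w))) \<partial>R)"
    using gen[of norm] by (auto simp: abs_mult)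
  also have "\<dots> < \<infinity>" using int by (simp add: integrable_iff_bounded)
  finally show A: ?A using am by (simp add: integrable_iff_bounded)
  show "(\<integral>\<omega>. ?a \<omega> \<partial>P) = (\<integral>w. \<phi> w * lam (fst w) (snd w) \<partial>R)"
    unfolding real_lebesgue_integral_def[OF A] real_lebesgue_integral_def[OF int]
    using gen[of "\<lambda>x. x"] gen[of uminus] by simp
qed

end

section \<open>The compensated jump integral\<close>

context finite_horizon begin

lemma fst_R[measurable]: "fst \<in> borel_measurable R"
  by (rule predictable_measurable_R) (rule fst_predictable)

lemma lbT_integrable_indicator:
  fixes f :: "real \<Rightarrow> real"
  assumes f: "integrable lbT f" and B: "B \<in> sets borel"
  shows "integrable lbT (\<lambda>r. indicator B r * f r)"
proof (rule Bochner_Integration.integrable_cong[THEN iffD1, OF refl])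
  show "integrable lbT (\<lambda>r. indicator (B \<inter> {0..T}) r *\<^sub>R f r)"
    by (rule integrable_mult_indicator[OF sets_LT[OF B] f])
qed (auto simp: space_restrict_space split: split_indicator)

lemma time_integral_measurable:
  fixes f :: "real \<times> 'a \<Rightarrow> real"
  assumes f: "f \<in> borel_measurable R"
  shows "(\<lambda>\<omega>. \<integral>t. f (t, \<omega>) \<partial>lbT) \<in> borel_measurable P"
proof -
  have "(\<lambda>(\<omega>, t). f (t, \<omega>)) \<in> borel_measurable (P \<Otimes>\<^sub>M lbT)"
    using measurable_compose[OF measurable_pair_swap' f] by (simp add: split_def)
  then show ?thesis
    using finite_measure_lbT
    by (intro sigma_finite_measure.borel_measurable_lebesgue_integral) (auto intro: finite_measure.sigma_finite_measure)
qed

lemma running_integral_measurable: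
  fixes f :: "real \<times> 'a \<Rightarrow> real"
  assumes f: "f \<in> borel_measurable R"
  shows "(\<lambda>(t, \<omega>). LBINT s:{0..t}. f (s, \<omega>)) \<in> borel_measurable R"
proof -
  have s: "snd \<in> borel_measurable (R \<Otimes>\<^sub>M lbT)"
    by (rule measurable_compose[OF measurable_snd]) (simp add: measurable_restrict_space1)
  have t: "(\<lambda>z. fst (fst z)) \<in> borel_measurable (R \<Otimes>\<^sub>M lbT)"
    by (rule measurable_compose[OF measurable_fst fst_R])
  have "(\<lambda>z. (snd z, snd (fst z))) \<in> measurable (R \<Otimes>\<^sub>M lbT) R"
    by (intro measurable_Pair measurable_snd measurable_compose[OF measurable_fst measurable_snd])
  from measurable_compose[OF this f]
  have "(\<lambda>z. indicat_real {0..fst (fst z)} (snd z) * f (snd z, snd (fst z))) \<in> borel_measurable (R \<Otimes>\<^sub>M lbT)"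
    using s t unfolding indicator_def atLeastAtMost_iff by measurable
  then have "(\<lambda>(w, s). indicat_real {0..fst w} s * f (s, snd w)) \<in> borel_measurable (R \<Otimes>\<^sub>M lbT)"
    by (simp add: split_def)
  then have "(\<lambda>w. \<integral>s. indicat_real {0..fst w} s * f (s, snd w) \<partial>lbT) \<in> borel_measurable R"
    using finite_measure_lbT
    by (intro sigma_finite_measure.borel_measurable_lebesgue_integral) (auto intro: finite_measure.sigma_finite_measure)
  then show ?thesis
    by (rule measurable_cong[THEN iffD1, rotated]) (auto simp: set_integral_lbT(1))
qed

end

lemma set_integrable_Icc_mono:
  fixes f :: "real \<Rightarrow> real"
  assumes "set_integrable lborel {0..T} f" "t \<le> T" shows "set_integrable lborel {0..t} f"
  using assms by (auto intro: set_integrable_subset)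

section \<open>Moments of the compensator and the jump integral as a martingale\<close>

context default_horizon begin

abbreviation "lamw \<equiv> \<lambda>w. lam (fst w) (snd w)"

lemma lamw_nonneg: "w \<in> space R \<Longrightarrow> 0 \<le> lamw w"
  using lam_nonneg by auto

text \<open>The chain rule for powers of an absolutely continuous function, by induction on the
  exponent: \<Lambda>^(n+1) and \<Lambda> are both indefinite integrals, and the integration by
  parts formula turns their product into n + 2 copies of the same integral.\<close>

lemma compensator_power:
  assumes i: "set_integrable lborel {0..T} (\<lambda>s. lam s \<omega>)" and t: "t \<in> {0..T}"
  shows "set_integrable lborel {0..t} (\<lambda>s. compensator lam s \<omega> ^ n * lam s \<omega>) \<and>
    compensator lam t \<omega> ^ Suc n = real (Suc n) * (LBINT s:{0..t}. compensator lam s \<omega> ^ n * lam s \<omega>)"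
  using t
proof (induction n arbitrary: t)
  case 0
  then show ?case using set_integrable_Icc_mono[OF i] by (simp add: compensator_def)
next
  case (Suc n)
  let ?\<Lambda> = "\<lambda>s. compensator lam s \<omega>" and ?l = "\<lambda>s. lam s \<omega>"
  let ?a = "\<lambda>s. real (Suc n) * (?\<Lambda> s ^ n * ?l s)"
  have a: "set_integrable lborel {0..t} ?a"
    using Suc.IH[OF Suc.prems] by (intro set_integrable_mult_right) auto
  have l: "set_integrable lborel {0..t} ?l" using set_integrable_Icc_mono[OF i] Suc.prems by auto
  have A: "(LBINT r:{0..s}. ?a r) = ?\<Lambda> s ^ Suc n" if "s \<in> {0..t}" for s
    using Suc.IH[of s] that Suc.prems by (simp del: of_nat_Suc power_Suc)
  note m = integral_mult_absolutely_continuous[OF a l]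
  have "set_integrable lborel {0..t} (\<lambda>s. inverse (real (Suc n)) * (?a s * (LBINT r:{0..s}. ?l r)))"
    using m(2) by (intro set_integrable_mult_right) auto
  also have "(\<lambda>s. inverse (real (Suc n)) * (?a s * (LBINT r:{0..s}. ?l r))) = (\<lambda>s. ?\<Lambda> s ^ Suc n * ?l s)"
    by (auto simp: compensator_def fun_eq_iff field_simps simp del: of_nat_Suc)
  finally have I: "set_integrable lborel {0..t} (\<lambda>s. ?\<Lambda> s ^ Suc n * ?l s)" .
  have e1: "(LBINT s:{0..t}. ?a s * (LBINT r:{0..s}. ?l r)) = (LBINT s:{0..t}. real (Suc n) * (?\<Lambda> s ^ Suc n * ?l s))"
    by (intro set_lebesgue_integral_cong) (auto simp: compensator_def simp del: of_nat_Suc)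
  have e2: "(LBINT s:{0..t}. ?l s * (LBINT r:{0..s}. ?a r)) = (LBINT s:{0..t}. ?\<Lambda> s ^ Suc n * ?l s)"
  proof (intro set_lebesgue_integral_cong allI impI)
    fix s assume "s \<in> {0..t}" then show "?l s * (LBINT r:{0..s}. ?a r) = ?\<Lambda> s ^ Suc n * ?l s"
      by (simp only: A) simp
  qed simp
  have "?\<Lambda> t ^ Suc (Suc n) = ?\<Lambda> t ^ Suc n * ?\<Lambda> t" by simp
  also have "\<dots> = (LBINT r:{0..t}. ?a r) * (LBINT r:{0..t}. ?l r)"
    using A[of t] Suc.prems by (simp add: compensator_def)
  also have "\<dots> = (LBINT s:{0..t}. real (Suc n) * (?\<Lambda> s ^ Suc n * ?l s)) + (LBINT s:{0..t}. ?\<Lambda> s ^ Suc n * ?l s)"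
    unfolding m(1) e1 e2 ..
  also have "\<dots> = real (Suc (Suc n)) * (LBINT s:{0..t}. ?\<Lambda> s ^ Suc n * ?l s)"
    by (simp only: set_integral_mult_right) (simp add: distrib_right)
  finally show ?case using I by blast
qed

lemma compensator_predictable_PR: "(\<lambda>w. compensator lam (fst w) (snd w)) \<in> borel_measurable PR"
  using measurable_restrict_space1[OF compensator_predictable] by (simp add: split_def)

lemma compensator_measurable[measurable]: "compensator lam T \<in> borel_measurable P"
  using compensator_integrable[of T] T_pos by auto

lemma AE_lam_set_integrable: "AE \<omega> in P. set_integrable lborel {0..T} (\<lambda>t. lam t \<omega>)"
  using lam_integrable T_pos by auto

text \<open>E[\<Lambda>_T^(n+1)] is (n+1) times E \<integral> \<Lambda>^n \<lambda> dt, which by the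
  compensation formula is (n+1) E[\<Lambda>_\<tau>^n; \<tau> \<le> T], at most (n+1)
  E[\<Lambda>_T^n] by monotonicity. So integrability of \<lambda> alone gives all moments, with the
  factorials of an exponential variable.\<close>

lemma compensator_moment_nn: "(\<integral>\<^sup>+\<omega>. ennreal (compensator lam T \<omega> ^ n) \<partial>P) \<le> fact n"
proof (induction n)
  case 0
  then show ?case by (simp add: emeasure_space_1)
next
  case (Suc n)
  have "(\<integral>\<^sup>+\<omega>. ennreal (compensator lam T \<omega> ^ Suc n) \<partial>P) 
      = (\<integral>\<^sup>+\<omega>. ennreal (real (Suc n)) * (\<integral>\<^sup>+t. ennreal (compensator lam t \<omega> ^ n) * ennreal (lam t \<omega>) \<partial>lbT) \<partial>P)"
  proof (rule nn_integral_cong_AE)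
    show "AE \<omega> in P. ennreal (compensator lam T \<omega> ^ Suc n) =
      ennreal (real (Suc n)) * (\<integral>\<^sup>+t. ennreal (compensator lam t \<omega> ^ n) * ennreal (lam t \<omega>) \<partial>lbT)"
      using AE_lam_set_integrable AE_space
    proof eventually_elim
      case (elim \<omega>)
      have Tin: "T \<in> {0..T}" using T_pos by auto
      note p = compensator_power[OF elim(1) Tin, of n]
      have pos: "t \<in> {0..T} \<Longrightarrow> 0 \<le> compensator lam t \<omega> ^ n * lam t \<omega>" for t
        using compensator_nonneg[OF elim(2)] lam_nonneg[of t \<omega>] elim by auto
      have "(\<integral>\<^sup>+t. ennreal (compensator lam t \<omega> ^ n) * ennreal (lam t \<omega>) \<partial>lbT)
        = (\<integral>\<^sup>+t. ennreal (compensator lam t \<omega> ^ n * lam t \<omega>) \<partial>lbT)"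
        using lam_nonneg elim by (intro nn_integral_cong) (simp add: ennreal_mult'' space_restrict_space)
      also have "\<dots> = ennreal (\<integral>t. compensator lam t \<omega> ^ n * lam t \<omega> \<partial>lbT)"
        using p pos by (intro nn_integral_eq_integral) (auto simp: set_integral_lbT(3)[OF Tin] space_restrict_space intro!: AE_I2)
      finally show ?case using p 
        by (simp add: set_integral_lbT(2)[OF Tin] ennreal_mult' del: of_nat_Suc power_Suc)
    qed
  qed
  also have "\<dots> = ennreal (real (Suc n)) * (\<integral>\<^sup>+\<omega>. \<integral>\<^sup>+t. ennreal (compensator lam t \<omega> ^ n) * ennreal (lam t \<omega>) \<partial>lbT \<partial>P)"
  proof (rule nn_integral_cmult)
    have "(\<lambda>(\<omega>, t). ennreal (compensator lam t \<omega> ^ n) * ennreal (lam t \<omega>)) \<in> borel_measurable (P \<Otimes>\<^sub>M lbT)"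
    proof -
      have "(\<lambda>w. ennreal (compensator lam (fst w) (snd w) ^ n) * ennreal (lamw w)) \<in> borel_measurable R"
        using predictable_measurable_R[OF compensator_predictable_PR] lam_R by measurable
      from measurable_compose[OF measurable_pair_swap' this] show ?thesis by (simp add: split_def)
    qed
    then show "(\<lambda>\<omega>. \<integral>\<^sup>+t. ennreal (compensator lam t \<omega> ^ n) * ennreal (lam t \<omega>) \<partial>lbT) \<in> borel_measurable P"
      using finite_measure_lbT
      by (intro sigma_finite_measure.borel_measurable_nn_integral) (auto intro: finite_measure.sigma_finite_measure)
  qed
  also have "(\<integral>\<^sup>+\<omega>. \<integral>\<^sup>+t. ennreal (compensator lam t \<omega> ^ n) * ennreal (lam t \<omega>) \<partial>lbT \<partial>P)
     = (\<integral>\<^sup>+w. ennreal (compensator lam (fst w) (snd w) ^ n) * ennreal (lamw w) \<partial>R)"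
    using predictable_measurable_R[OF compensator_predictable_PR] lam_R by (subst nn_integral_R(1)) auto
  also have "\<dots> = (\<integral>\<^sup>+\<omega>. (if \<tau> \<omega> \<le> T then ennreal (compensator lam (\<tau> \<omega>) \<omega> ^ n) else 0) \<partial>P)"
    using compensator_predictable_PR
      compensation_formula_nn[of "\<lambda>w. ennreal (compensator lam (fst w) (snd w) ^ n)"] by (simp cong: if_cong)
  also have "\<dots> \<le> (\<integral>\<^sup>+\<omega>. ennreal (compensator lam T \<omega> ^ n) \<partial>P)"
  proof (rule nn_integral_mono_AE)
    show "AE \<omega> in P. (if \<tau> \<omega> \<le> T then ennreal (compensator lam (\<tau> \<omega>) \<omega> ^ n) else 0) \<le> ennreal (compensator lam T \<omega> ^ n)"
      using AE_compensator_diff AE_space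
      by eventually_elim (use tau_positive compensator_nonneg in \<open>auto intro!: ennreal_leI power_mono simp: less_imp_le\<close>)
  qed
  also have "\<dots> \<le> fact n" by (rule Suc.IH)
  finally have "(\<integral>\<^sup>+\<omega>. ennreal (compensator lam T \<omega> ^ Suc n) \<partial>P) \<le> ennreal (real (Suc n)) * fact n"
    by (simp add: mult_left_mono del: of_nat_Suc power_Suc)
  also have "ennreal (real (Suc n)) * fact n = fact (Suc n)" by (simp only: fact_Suc ennreal_of_nat_eq_real_of_nat)
  finally show ?case .
qed

lemma compensator_moment_integrable: "integrable P (\<lambda>\<omega>. compensator lam T \<omega> ^ n)"
proof (rule integrableI_nonneg)
  have "(\<integral>\<^sup>+\<omega>. ennreal (compensator lam T \<omega> ^ n) \<partial>P) \<le> of_nat (fact n)"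
    using compensator_moment_nn[of n] by simp
  then show "(\<integral>\<^sup>+\<omega>. ennreal (compensator lam T \<omega> ^ n) \<partial>P) < \<infinity>"
    by (rule le_less_trans) (use of_nat_less_top[of "fact n"] in simp)
  show "AE \<omega> in P. 0 \<le> compensator lam T \<omega> ^ n"
    using compensator_nonneg by (intro AE_I2) auto
qed measurable

lemma AE_compensator_total: "AE \<omega> in P. (\<integral>\<^sup>+t. ennreal (lam t \<omega>) \<partial>lbT) = ennreal (compensator lam T \<omega>)"
  using AE_lam_set_integrable AE_space
proof eventually_elim
  case (elim \<omega>)
  have Tin: "T \<in> {0..T}" using T_pos by auto
  have "(\<integral>\<^sup>+t. ennreal (lam t \<omega>) \<partial>lbT) = ennreal (\<integral>t. lam t \<omega> \<partial>lbT)"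
    using elim lam_nonneg by (intro nn_integral_eq_integral) (auto simp: set_integral_lbT(3)[OF Tin] space_restrict_space intro!: AE_I2)
  then show ?case by (simp add: compensator_def set_integral_lbT(2)[OF Tin])
qed

lemma nn_integral_lam_mult:
  assumes Z[measurable]: "Z \<in> borel_measurable P"
  shows "(\<integral>\<^sup>+w. ennreal (lamw w) * Z (snd w) \<partial>R) = (\<integral>\<^sup>+\<omega>. ennreal (compensator lam T \<omega>) * Z \<omega> \<partial>P)"
proof -
  have "(\<integral>\<^sup>+w. ennreal (lamw w) * Z (snd w) \<partial>R) = (\<integral>\<^sup>+\<omega>. \<integral>\<^sup>+t. ennreal (lam t \<omega>) * Z \<omega> \<partial>lbT \<partial>P)"
    by (subst nn_integral_R(1)) auto
  also have "\<dots> = (\<integral>\<^sup>+\<omega>. ennreal (compensator lam T \<omega>) * Z \<omega> \<partial>P)"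
  proof (rule nn_integral_cong_AE)
    show "AE \<omega> in P. (\<integral>\<^sup>+t. ennreal (lam t \<omega>) * Z \<omega> \<partial>lbT) = ennreal (compensator lam T \<omega>) * Z \<omega>"
      using AE_compensator_total AE_lam_integrable
    proof eventually_elim
      case (elim \<omega>)
      have "(\<integral>\<^sup>+t. ennreal (lam t \<omega>) * Z \<omega> \<partial>lbT) = (\<integral>\<^sup>+t. ennreal (lam t \<omega>) \<partial>lbT) * Z \<omega>"
        using elim(2) by (intro nn_integral_multc) auto
      then show ?case using elim by simp
    qed
  qed
  finally show ?thesis .
qed

lemma integrable_lam_mult:
  fixes Z :: "'a \<Rightarrow> real"
  assumes Z[measurable]: "Z \<in> borel_measurable P" and i: "integrable P (\<lambda>\<omega>. compensator lam T \<omega> * Z \<omega>)"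
  shows "integrable R (\<lambda>w. lamw w * Z (snd w))"
proof (rule integrableI_bounded)
  have "(\<integral>\<^sup>+w. ennreal (norm (lamw w * Z (snd w))) \<partial>R) = (\<integral>\<^sup>+w. ennreal (lamw w) * ennreal \<bar>Z (snd w)\<bar> \<partial>R)"
    using lamw_nonneg by (intro nn_integral_cong) (auto simp: abs_mult ennreal_mult)
  also have "\<dots> = (\<integral>\<^sup>+\<omega>. ennreal (compensator lam T \<omega>) * ennreal \<bar>Z \<omega>\<bar> \<partial>P)"
    by (rule nn_integral_lam_mult) measurable
  also have "\<dots> = (\<integral>\<^sup>+\<omega>. ennreal (norm (compensator lam T \<omega> * Z \<omega>)) \<partial>P)"
    using compensator_nonneg by (intro nn_integral_cong) (auto simp: abs_mult ennreal_mult)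
  also have "\<dots> < \<infinity>" using i by (simp add: integrable_iff_bounded)
  finally show "(\<integral>\<^sup>+w. ennreal (norm (lamw w * Z (snd w))) \<partial>R) < \<infinity>" .
qed measurable

lemma integrable_lam: "integrable R lamw"
  using integrable_lam_mult[of "\<lambda>_. 1"] compensator_moment_integrable[of 1] by simp

lemma lam_section: "t \<in> {0..T} \<Longrightarrow> lam t \<in> borel_measurable (F t)"
  using lam_adapted by auto

definition kint :: "(real \<Rightarrow> 'a \<Rightarrow> real) \<Rightarrow> real \<Rightarrow> 'a \<Rightarrow> real" where
  "kint \<kappa> t \<omega> = (LBINT s:{0..t}. \<kappa> s \<omega> * lam s \<omega>)"

text \<open>The integral of \<kappa> against M for a single jump, written out without Stieltjes
  measures so that measurability can be read off. \<open>AE_jump_integral_eq\<close> identifies it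
  with \<open>jump_integral\<close>.\<close>

definition jmp :: "(real \<Rightarrow> 'a \<Rightarrow> real) \<Rightarrow> real \<Rightarrow> 'a \<Rightarrow> real" where
  "jmp \<kappa> t \<omega> = (if \<tau> \<omega> \<le> t then \<kappa> (\<tau> \<omega>) \<omega> else 0) - kint \<kappa> t \<omega>"

abbreviation "pred \<equiv> predictable_on P F T"

lemma pred_PR: "pred \<kappa> \<Longrightarrow> (\<lambda>w. \<kappa> (fst w) (snd w)) \<in> borel_measurable PR"
  by (simp add: predictable_on_def split_def)

lemma pred_R: "pred \<kappa> \<Longrightarrow> (\<lambda>w. \<kappa> (fst w) (snd w)) \<in> borel_measurable R"
  using pred_PR predictable_measurable_R by blast

lemma pred_section: "pred \<kappa> \<Longrightarrow> t \<in> {0..T} \<Longrightarrow> \<kappa> t \<in> borel_measurable (F t)"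
  using predictable_section[OF pred_PR] by simp

lemma kint_measurable_R:
  assumes "pred \<kappa>" shows "(\<lambda>w. kint \<kappa> (fst w) (snd w)) \<in> borel_measurable R"
proof -
  have "(\<lambda>w. \<kappa> (fst w) (snd w) * lamw w) \<in> borel_measurable R" using pred_R[OF assms] by measurable
  from running_integral_measurable[OF this] show ?thesis by (simp add: split_def kint_def)
qed

lemma kint_measurable:
  assumes "pred \<kappa>" "t \<in> {0..T}" shows "kint \<kappa> t \<in> borel_measurable P"
  using measurable_compose[OF measurable_Pair1' kint_measurable_R[OF assms(1)], of t] assms(2)
  by (simp add: space_restrict_space)

lemma jmp_measurable:
  assumes "pred \<kappa>" "t \<in> {0..T}" shows "jmp \<kappa> t \<in> borel_measurable P"
proof -
  note [measurable] = tau_measurable kint_measurable[OF assms]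
  have [measurable]: "(\<lambda>\<omega>. if \<tau> \<omega> \<le> T then \<kappa> (\<tau> \<omega>) \<omega> else 0) \<in> borel_measurable P"
    using measurable_at_default[OF pred_PR[OF assms(1)], of 0] by (simp cong: if_cong)
  have "(\<lambda>\<omega>. (if \<tau> \<omega> \<le> t then (if \<tau> \<omega> \<le> T then \<kappa> (\<tau> \<omega>) \<omega> else 0) else 0) - kint \<kappa> t \<omega>) \<in> borel_measurable P"
    by measurable
  also have "(\<lambda>\<omega>. (if \<tau> \<omega> \<le> t then (if \<tau> \<omega> \<le> T then \<kappa> (\<tau> \<omega>) \<omega> else 0) else 0) - kint \<kappa> t \<omega>) = jmp \<kappa> t"
    using assms(2) by (auto simp: jmp_def fun_eq_iff)
  finally show ?thesis .
qed

lemma AE_kint_diff: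
  assumes i: "integrable R (\<lambda>w. \<kappa> (fst w) (snd w) * lamw w)"
  shows "AE \<omega> in P. set_integrable lborel {0..T} (\<lambda>s. \<kappa> s \<omega> * lam s \<omega>) \<and> 
    (\<forall>s t. 0 \<le> s \<longrightarrow> s \<le> t \<longrightarrow> t \<le> T \<longrightarrow>
      kint \<kappa> t \<omega> - kint \<kappa> s \<omega> = (\<integral>r. indicator {s<..t} r * (\<kappa> r \<omega> * lam r \<omega>) \<partial>lbT))"
  using integral_R(4)[OF i]
proof eventually_elim
  case (elim \<omega>)
  have Tin: "T \<in> {0..T}" using T_pos by auto
  let ?k = "\<lambda>r. \<kappa> r \<omega> * lam r \<omega>"
  have k: "integrable lbT ?k" using elim by simp
  have "kint \<kappa> t \<omega> - kint \<kappa> s \<omega> = (\<integral>r. indicator {s<..t} r * ?k r \<partial>lbT)"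
    if st: "0 \<le> s" "s \<le> t" "t \<le> T" for s t
  proof -
    have ik: "integrable lbT (\<lambda>r. indicator {0..x} r * ?k r)" for x
      by (rule lbT_integrable_indicator[OF k]) simp
    have "kint \<kappa> t \<omega> - kint \<kappa> s \<omega> = (\<integral>r. indicator {0..t} r * ?k r - indicator {0..s} r * ?k r \<partial>lbT)"
      unfolding kint_def using st ik by (simp add: set_integral_lbT(1))
    also have "\<dots> = (\<integral>r. indicator {s<..t} r * ?k r \<partial>lbT)"
      using st by (intro Bochner_Integration.integral_cong) (auto split: split_indicator)
    finally show ?thesis .
  qed
  then show ?case using k set_integral_lbT(3)[OF Tin] by auto
qed

text \<open>The martingale property in tested form. With \<xi> known at time s, the process \<xi>
  \<kappa> on (s, t] is still predictable, and the compensation formula equates the means of its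
  value at \<tau> and of its \<lambda>-weighted time integral.\<close>

lemma jmp_orthogonal:
  assumes \<kappa>: "pred \<kappa>" and i: "integrable R (\<lambda>w. \<kappa> (fst w) (snd w) * lamw w)"
    and st: "0 \<le> s" "s \<le> t" "t \<le> T"
    and \<xi>: "\<xi> \<in> borel_measurable (F s)" "\<And>\<omega>. \<omega> \<in> space P \<Longrightarrow> \<bar>\<xi> \<omega>\<bar> \<le> C"
  shows "integrable P (\<lambda>\<omega>. \<xi> \<omega> * (jmp \<kappa> t \<omega> - jmp \<kappa> s \<omega>))"
    and "(\<integral>\<omega>. \<xi> \<omega> * (jmp \<kappa> t \<omega> - jmp \<kappa> s \<omega>) \<partial>P) = 0"
proof -
  let ?k = "\<lambda>w. \<kappa> (fst w) (snd w)"
  have \<xi>P[measurable]: "\<xi> \<in> borel_measurable P" using F_measurable[OF st(1) \<xi>(1)] .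
  define \<phi> where "\<phi> = (\<lambda>w. (if fst w \<le> t then (if s < fst w then \<xi> (snd w) else 0) * ?k w else 0))"
  have \<phi>: "\<phi> \<in> borel_measurable PR"
  proof -
    have [measurable]: "(\<lambda>w. if s < fst w then \<xi> (snd w) else 0) \<in> borel_measurable PR"
      using predictable_step[OF st(1) \<xi>(1)] by (simp add: split_def)
    note [measurable] = pred_PR[OF \<kappa>]
    show ?thesis unfolding \<phi>_def by measurable
  qed
  have \<phi>R: "\<phi> \<in> borel_measurable R" by (rule predictable_measurable_R[OF \<phi>])
  have int: "integrable R (\<lambda>w. \<phi> w * lamw w)"
  proof (rule Bochner_Integration.integrable_bound)
    show "integrable R (\<lambda>w. C * (?k w * lamw w))" using i by auto
    show "(\<lambda>w. \<phi> w * lamw w) \<in> borel_measurable R" using \<phi>R by measurable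
    show "AE w in R. norm (\<phi> w * lamw w) \<le> norm (C * (?k w * lamw w))"
    proof (rule AE_I2)
      fix w assume "w \<in> space R"
      then have "snd w \<in> space P" by auto
      then have "\<bar>\<xi> (snd w)\<bar> \<le> \<bar>C\<bar>" using \<xi>(2) abs_ge_self order_trans by blast
      then show "norm (\<phi> w * lamw w) \<le> norm (C * (?k w * lamw w))"
        by (auto simp: \<phi>_def abs_mult mult.assoc mult_right_mono)
    qed
  qed
  note cf = compensation_formula[OF \<phi> int]
  let ?a = "\<lambda>\<omega>. if \<tau> \<omega> \<le> T then \<phi> (\<tau> \<omega>, \<omega>) else 0"
  let ?b = "\<lambda>\<omega>. \<integral>r. \<phi> (r, \<omega>) * lam r \<omega> \<partial>lbT"
  have bi: "integrable P ?b" and be: "(\<integral>\<omega>. ?b \<omega> \<partial>P) = (\<integral>w. \<phi> w * lamw w \<partial>R)"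
    using integral_R(5)[OF int] integral_R(1)[OF int] by simp_all
  have eq: "AE \<omega> in P. ?a \<omega> - ?b \<omega> = \<xi> \<omega> * (jmp \<kappa> t \<omega> - jmp \<kappa> s \<omega>)"
    using AE_kint_diff[OF i]
  proof eventually_elim
    case (elim \<omega>)
    have "?b \<omega> = (\<integral>r. \<xi> \<omega> * (indicator {s<..t} r * (\<kappa> r \<omega> * lam r \<omega>)) \<partial>lbT)"
      by (intro Bochner_Integration.integral_cong) (auto simp: \<phi>_def split: split_indicator)
    also have "\<dots> = \<xi> \<omega> * (kint \<kappa> t \<omega> - kint \<kappa> s \<omega>)"
      using elim st by simp
    finally show ?case using st by (auto simp: jmp_def \<phi>_def algebra_simps)
  qed
  have m: "(\<lambda>\<omega>. \<xi> \<omega> * (jmp \<kappa> t \<omega> - jmp \<kappa> s \<omega>)) \<in> borel_measurable P"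
    using jmp_measurable[OF \<kappa>, of t] jmp_measurable[OF \<kappa>, of s] st by auto
  have di: "integrable P (\<lambda>\<omega>. ?a \<omega> - ?b \<omega>)" using cf(1) bi by auto
  show "integrable P (\<lambda>\<omega>. \<xi> \<omega> * (jmp \<kappa> t \<omega> - jmp \<kappa> s \<omega>))"
    using di by (rule integrable_cong_AE_imp[OF _ m]) (use eq in \<open>eventually_elim, simp\<close>)
  have "(\<integral>\<omega>. \<xi> \<omega> * (jmp \<kappa> t \<omega> - jmp \<kappa> s \<omega>) \<partial>P) = (\<integral>\<omega>. ?a \<omega> - ?b \<omega> \<partial>P)"
    using eq di m by (intro integral_cong_AE) auto
  also have "\<dots> = 0" using cf bi be by simp
  finally show "(\<integral>\<omega>. \<xi> \<omega> * (jmp \<kappa> t \<omega> - jmp \<kappa> s \<omega>) \<partial>P) = 0" .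
qed

lemma jmp_zero: "\<omega> \<in> space P \<Longrightarrow> jmp \<kappa> 0 \<omega> = 0"
proof -
  assume "\<omega> \<in> space P"
  then have "0 < \<tau> \<omega>" by (rule tau_positive)
  moreover have "kint \<kappa> 0 \<omega> = (LBINT s:{0}. \<kappa> s \<omega> * lam s \<omega>)" by (simp add: kint_def)
  moreover have "(LBINT s:{0}. \<kappa> s \<omega> * lam s \<omega>) = 0"
    unfolding set_lebesgue_integral_def
    by (rule integral_eq_zero_AE) (use AE_lborel_singleton[of 0] in \<open>eventually_elim, auto split: split_indicator\<close>)
  ultimately show ?thesis by (simp add: jmp_def)
qed

lemma jmp_integrable:
  assumes \<kappa>: "pred \<kappa>" and i: "integrable R (\<lambda>w. \<kappa> (fst w) (snd w) * lamw w)" and t: "t \<in> {0..T}"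
  shows "integrable P (jmp \<kappa> t)"
proof -
  have "integrable P (\<lambda>\<omega>. 1 * (jmp \<kappa> t \<omega> - jmp \<kappa> 0 \<omega>))"
    by (rule jmp_orthogonal(1)[OF \<kappa> i, where C=1]) (use t in auto)
  then show ?thesis
    by (subst Bochner_Integration.integrable_cong[OF refl, of _ _ "\<lambda>\<omega>. 1 * (jmp \<kappa> t \<omega> - jmp \<kappa> 0 \<omega>)"]) (auto simp: jmp_zero)
qed

text \<open>The class of \<gamma> along a state process and of truncated integrands. For it
  \<open>jmp\<close> is dominated by C (1 + \<Lambda>_T), which has all moments.\<close>

definition pbounded :: "real \<Rightarrow> (real \<Rightarrow> 'a \<Rightarrow> real) \<Rightarrow> bool" where
  "pbounded C \<kappa> \<longleftrightarrow> pred \<kappa> \<and> 0 \<le> C \<and> (\<forall>t\<in>{0..T}. \<forall>\<omega>\<in>space P. \<bar>\<kappa> t \<omega>\<bar> \<le> C)"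

lemma pbounded_integrable:
  assumes "pbounded C \<kappa>" shows "integrable R (\<lambda>w. \<kappa> (fst w) (snd w) * lamw w)"
proof (rule Bochner_Integration.integrable_bound)
  show "integrable R (\<lambda>w. C * lamw w)" using integrable_lam by auto
  have "pred \<kappa>" using assms by (simp add: pbounded_def)
  from pred_R[OF this] show "(\<lambda>w. \<kappa> (fst w) (snd w) * lamw w) \<in> borel_measurable R" by measurable
  show "AE w in R. norm (\<kappa> (fst w) (snd w) * lamw w) \<le> norm (C * lamw w)"
    using assms by (intro AE_I2) (auto simp: pbounded_def abs_mult intro!: mult_right_mono)
qed

lemma AE_kint_increment_bound:
  assumes b: "pbounded C \<kappa>"
  shows "AE \<omega> in P. \<forall>s t. 0 \<le> s \<longrightarrow> s \<le> t \<longrightarrow> t \<le> T \<longrightarrow> 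
    \<bar>kint \<kappa> t \<omega> - kint \<kappa> s \<omega>\<bar> \<le> C * (compensator lam t \<omega> - compensator lam s \<omega>)"
proof -
  have l1: "integrable R (\<lambda>w. 1 * lamw w)" using integrable_lam by simp
  show ?thesis
  using AE_kint_diff[OF pbounded_integrable[OF b]] AE_kint_diff[of "\<lambda>_ _. 1", OF l1] AE_space
proof eventually_elim
  case (elim \<omega>)
  have Tin: "T \<in> {0..T}" using T_pos by auto
  show ?case
  proof (intro allI impI)
    fix s t :: real assume st: "0 \<le> s" "s \<le> t" "t \<le> T"
    have il: "integrable lbT (\<lambda>t. lam t \<omega>)" using elim(2) by (simp add: set_integral_lbT(3)[OF Tin])
    have ii: "integrable lbT (\<lambda>r. C * (indicator {s<..t} r * lam r \<omega>))"
      by (intro integrable_mult_right lbT_integrable_indicator[OF il]) simp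
    have ik: "integrable lbT (\<lambda>r. indicator {s<..t} r * (\<kappa> r \<omega> * lam r \<omega>))"
      using elim(1) by (intro lbT_integrable_indicator) (auto simp: set_integral_lbT(3)[OF Tin])
    have "\<bar>kint \<kappa> t \<omega> - kint \<kappa> s \<omega>\<bar> = \<bar>\<integral>r. indicator {s<..t} r * (\<kappa> r \<omega> * lam r \<omega>) \<partial>lbT\<bar>"
      using elim(1) st by simp
    also have "\<dots> \<le> (\<integral>r. C * (indicator {s<..t} r * lam r \<omega>) \<partial>lbT)"
      using b elim(3) lam_nonneg
      by (intro integral_abs_bound_integral[OF ik ii])
        (auto simp: pbounded_def space_restrict_space abs_mult split: split_indicator intro!: mult_right_mono)
    also have "\<dots> = C * (kint (\<lambda>_ _. 1) t \<omega> - kint (\<lambda>_ _. 1) s \<omega>)" using elim(2) st by simp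
    finally show "\<bar>kint \<kappa> t \<omega> - kint \<kappa> s \<omega>\<bar> \<le> C * (compensator lam t \<omega> - compensator lam s \<omega>)"
      by (simp add: kint_def compensator_def)
  qed
  qed
qed

lemma AE_jmp_increment_bound:
  assumes b: "pbounded C \<kappa>"
  shows "AE \<omega> in P. \<forall>s t. 0 \<le> s \<longrightarrow> s \<le> t \<longrightarrow> t \<le> T \<longrightarrow> 
    \<bar>jmp \<kappa> t \<omega> - jmp \<kappa> s \<omega>\<bar> \<le> C * ((if s < \<tau> \<omega> \<and> \<tau> \<omega> \<le> t then 1 else 0) + (compensator lam t \<omega> - compensator lam s \<omega>))"
  using AE_kint_increment_bound[OF b] AE_space
proof eventually_elim
  case (elim \<omega>)
  show ?case
  proof (intro allI impI)
    fix s t :: real assume st: "0 \<le> s" "s \<le> t" "t \<le> T"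
    let ?i = "if s < \<tau> \<omega> \<and> \<tau> \<omega> \<le> t then 1 else 0 :: real"
    have e: "jmp \<kappa> t \<omega> - jmp \<kappa> s \<omega> = ?i * \<kappa> (\<tau> \<omega>) \<omega> - (kint \<kappa> t \<omega> - kint \<kappa> s \<omega>)"
      using st by (auto simp: jmp_def)
    have "\<bar>?i * \<kappa> (\<tau> \<omega>) \<omega>\<bar> \<le> C * ?i"
      using b elim(2) st by (auto simp: pbounded_def)
    moreover have "\<bar>kint \<kappa> t \<omega> - kint \<kappa> s \<omega>\<bar> \<le> C * (compensator lam t \<omega> - compensator lam s \<omega>)"
      using elim(1) st by blast
    ultimately show "\<bar>jmp \<kappa> t \<omega> - jmp \<kappa> s \<omega>\<bar> \<le> C * (?i + (compensator lam t \<omega> - compensator lam s \<omega>))"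
      unfolding e by (simp only: distrib_left)
  qed
qed

lemma AE_jmp_bound:
  assumes b: "pbounded C \<kappa>"
  shows "AE \<omega> in P. \<forall>t\<in>{0..T}. \<bar>jmp \<kappa> t \<omega>\<bar> \<le> C * (1 + compensator lam T \<omega>) \<and> \<bar>kint \<kappa> t \<omega>\<bar> \<le> C * (1 + compensator lam T \<omega>)"
  using AE_jmp_increment_bound[OF b] AE_kint_increment_bound[OF b] AE_compensator_diff AE_space
proof eventually_elim
  case (elim \<omega>)
  have C: "0 \<le> C" using b by (simp add: pbounded_def)
  have k0: "kint \<kappa> 0 \<omega> = 0" using jmp_zero[OF elim(4), of \<kappa>] tau_positive[OF elim(4)] by (simp add: jmp_def)
  show ?case
  proof
    fix t assume t: "t \<in> {0..T}"
    have le: "compensator lam t \<omega> \<le> compensator lam T \<omega>" using elim(3) t by auto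
    have "\<bar>jmp \<kappa> t \<omega>\<bar> \<le> C * ((if 0 < \<tau> \<omega> \<and> \<tau> \<omega> \<le> t then 1 else 0) + compensator lam t \<omega>)"
      using elim(1)[rule_format, of 0 t] t jmp_zero[OF elim(4), of \<kappa>] by (simp add: compensator_zero)
    also have "\<dots> \<le> C * (1 + compensator lam T \<omega>)" using le C by (intro mult_left_mono) auto
    finally have 1: "\<bar>jmp \<kappa> t \<omega>\<bar> \<le> C * (1 + compensator lam T \<omega>)" .
    have "\<bar>kint \<kappa> t \<omega>\<bar> \<le> C * compensator lam t \<omega>"
      using elim(2)[rule_format, of 0 t] t k0 by (simp add: compensator_zero)
    also have "\<dots> \<le> C * (1 + compensator lam T \<omega>)" using le C by (intro mult_left_mono) auto
    finally show "\<bar>jmp \<kappa> t \<omega>\<bar> \<le> C * (1 + compensator lam T \<omega>) \<and> \<bar>kint \<kappa> t \<omega>\<bar> \<le> C * (1 + compensator lam T \<omega>)"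
      using 1 by simp
  qed
qed

end

section \<open>The isometry of the compensated jump integral\<close>

context default_horizon begin

lemma power_compensator_integrable: "integrable P (\<lambda>\<omega>. (1 + compensator lam T \<omega>) ^ n)"
  unfolding binomial_ring by (intro Bochner_Integration.integrable_sum)
    (simp add: compensator_moment_integrable)

lemma integrable_compensator_bound:
  fixes Z :: "'a \<Rightarrow> real"
  assumes "Z \<in> borel_measurable P" "AE \<omega> in P. \<bar>Z \<omega>\<bar> \<le> c * (1 + compensator lam T \<omega>) ^ n"
  shows "integrable P Z"
proof (rule Bochner_Integration.integrable_bound)
  show "integrable P (\<lambda>\<omega>. c * (1 + compensator lam T \<omega>) ^ n)"
    using power_compensator_integrable by auto
  show "AE \<omega> in P. norm (Z \<omega>) \<le> norm (c * (1 + compensator lam T \<omega>) ^ n)"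
    using assms(2) by eventually_elim auto
qed (rule assms)

lemma jmp_square_integrable:
  assumes b: "pbounded C \<kappa>" and t: "t \<in> {0..T}"
  shows "integrable P (\<lambda>\<omega>. (jmp \<kappa> t \<omega>)\<^sup>2)"
proof (rule integrable_compensator_bound)
  have "pred \<kappa>" using b by (simp add: pbounded_def)
  from jmp_measurable[OF this t] show "(\<lambda>\<omega>. (jmp \<kappa> t \<omega>)\<^sup>2) \<in> borel_measurable P" by measurable
  show "AE \<omega> in P. \<bar>(jmp \<kappa> t \<omega>)\<^sup>2\<bar> \<le> C\<^sup>2 * (1 + compensator lam T \<omega>) ^ 2"
    using AE_jmp_bound[OF b]
  proof eventually_elim
    case (elim \<omega>)
    then have "\<bar>jmp \<kappa> t \<omega>\<bar> \<le> C * (1 + compensator lam T \<omega>)" using t by blast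
    then have "\<bar>jmp \<kappa> t \<omega>\<bar>\<^sup>2 \<le> (C * (1 + compensator lam T \<omega>))\<^sup>2" by (intro power_mono) auto
    then show ?case by (simp add: power_mult_distrib)
  qed
qed

lemma jmp_measurable_R:
  assumes \<kappa>: "pred \<kappa>" shows "(\<lambda>w. jmp \<kappa> (fst w) (snd w)) \<in> borel_measurable R"
proof -
  have [measurable]: "(\<lambda>\<omega>. if \<tau> \<omega> \<le> T then \<kappa> (\<tau> \<omega>) \<omega> else 0) \<in> borel_measurable P"
    using measurable_at_default[OF pred_PR[OF \<kappa>], of 0] by (simp cong: if_cong)
  note [measurable] = kint_measurable_R[OF \<kappa>] tau_measurable
  have "(\<lambda>w. (if \<tau> (snd w) \<le> fst w then (\<lambda>\<omega>. if \<tau> \<omega> \<le> T then \<kappa> (\<tau> \<omega>) \<omega> else 0) (snd w) else 0) - kint \<kappa> (fst w) (snd w))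
    \<in> borel_measurable R" by measurable
  then show ?thesis
    by (rule measurable_cong[THEN iffD1, rotated]) (auto simp: jmp_def)
qed

text \<open>Inside the \<lambda> dt integral the martingale property replaces the jump martingale at
  T by its value at t, because w_t \<lambda>_t is known at time t. As \<lambda> vanishes after
  \<tau>, only times up to \<tau> count; before \<tau> nothing has jumped and the martingale equals
  minus \<open>kint \<kappa> t\<close>.\<close>

lemma integral_kint_jmp:
  assumes b: "pbounded C \<kappa>" and b': "pbounded C' w"
  shows "(\<integral>\<omega>. kint w T \<omega> * jmp \<kappa> T \<omega> \<partial>P) = - (\<integral>\<omega>. \<integral>t. w t \<omega> * lam t \<omega> * kint \<kappa> t \<omega> \<partial>lbT \<partial>P)"
    and "integrable P (\<lambda>\<omega>. \<integral>t. w t \<omega> * lam t \<omega> * kint \<kappa> t \<omega> \<partial>lbT)"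
proof -
  have \<kappa>: "pred \<kappa>" and w: "pred w" and C: "0 \<le> C" "0 \<le> C'" using b b' by (auto simp: pbounded_def)
  have Tin: "T \<in> {0..T}" using T_pos by auto
  let ?k = "\<lambda>x. w (fst x) (snd x) * lamw x"
  note mR = pred_R[OF w] jmp_measurable_R[OF \<kappa>] jmp_measurable[OF \<kappa> Tin] kint_measurable_R[OF \<kappa>]
  note [measurable] = mR
  \<comment> \<open>One dominating function for all three integrands below: the jump martingale at T
    or at t, and its absolutely continuous part, are bounded by the same multiple of 1 +
    \<Lambda>_T.\<close>
  have iB: "integrable R (\<lambda>x. lamw x * (C' * (C * (1 + compensator lam T (snd x)))))"
  proof (rule integrable_lam_mult)
    show "integrable P (\<lambda>\<omega>. compensator lam T \<omega> * (C' * (C * (1 + compensator lam T \<omega>))))"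
    proof (rule integrable_compensator_bound[where c="C' * C" and n=2])
      show "AE \<omega> in P. \<bar>compensator lam T \<omega> * (C' * (C * (1 + compensator lam T \<omega>)))\<bar> \<le> C' * C * (1 + compensator lam T \<omega>)\<^sup>2"
      proof (rule AE_I2)
        fix \<omega> assume "\<omega> \<in> space P"
        then have p: "0 \<le> compensator lam T \<omega>" by (rule compensator_nonneg)
        then have "\<bar>compensator lam T \<omega> * (C' * (C * (1 + compensator lam T \<omega>)))\<bar> = C' * C * (compensator lam T \<omega> * (1 + compensator lam T \<omega>))"
          using C by (simp add: abs_mult)
        also have "\<dots> \<le> C' * C * ((1 + compensator lam T \<omega>) * (1 + compensator lam T \<omega>))"
          using p C by (intro mult_left_mono mult_right_mono) auto
        finally show "\<bar>compensator lam T \<omega> * (C' * (C * (1 + compensator lam T \<omega>)))\<bar> \<le> C' * C * (1 + compensator lam T \<omega>)\<^sup>2"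
          by (simp add: power2_eq_square)
      qed
    qed measurable
  qed measurable
  have bnd: "integrable R (\<lambda>x. ?k x * Z x)" 
    if [measurable]: "Z \<in> borel_measurable R" and Z: "AE \<omega> in P. \<forall>t\<in>{0..T}. \<bar>Z (t, \<omega>)\<bar> \<le> C * (1 + compensator lam T \<omega>)" for Z
  proof (rule Bochner_Integration.integrable_bound[OF iB])
    show "(\<lambda>x. ?k x * Z x) \<in> borel_measurable R" by measurable
    have mZ: "(\<lambda>x. norm (?k x * Z x) \<le> norm (lamw x * (C' * (C * (1 + compensator lam T (snd x))))))
      \<in> measurable R (count_space UNIV)" by measurable
    have "AE t in lbT. AE \<omega> in P. norm (?k (t, \<omega>) * Z (t, \<omega>)) \<le> norm (lamw (t, \<omega>) * (C' * (C * (1 + compensator lam T (snd (t, \<omega>))))))"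
    proof (rule AE_I2)
      fix t assume t: "t \<in> space lbT"
      show "AE \<omega> in P. norm (?k (t, \<omega>) * Z (t, \<omega>)) \<le> norm (lamw (t, \<omega>) * (C' * (C * (1 + compensator lam T (snd (t, \<omega>))))))"
        using Z AE_space
      proof eventually_elim
        case (elim \<omega>)
        have t': "t \<in> {0..T}" using t by (simp add: space_restrict_space)
        have "\<bar>w t \<omega>\<bar> \<le> C'" using b' t' elim by (simp add: pbounded_def)
        then have "\<bar>w t \<omega>\<bar> * \<bar>Z (t, \<omega>)\<bar> \<le> C' * \<bar>C * (1 + compensator lam T \<omega>)\<bar>"
          using elim(1) t' C by (intro mult_mono) (auto intro: order_trans[OF _ abs_ge_self])
        then have "\<bar>lam t \<omega>\<bar> * (\<bar>w t \<omega>\<bar> * \<bar>Z (t, \<omega>)\<bar>) \<le> \<bar>lam t \<omega>\<bar> * (C' * \<bar>C * (1 + compensator lam T \<omega>)\<bar>)"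
          by (rule mult_left_mono) simp
        then show ?case using C by (simp add: abs_mult mult_ac)
      qed
    qed
    then show "AE x in R. norm (?k x * Z x) \<le> norm (lamw x * (C' * (C * (1 + compensator lam T (snd x)))))"
      using mZ by (intro TP.AE_pair_measure) (simp_all add: pred_def)
  qed
  have i1: "integrable R (\<lambda>x. ?k x * jmp \<kappa> T (snd x))"
    by (rule bnd) (measurable, use AE_jmp_bound[OF b] Tin in auto)
  have i2: "integrable R (\<lambda>x. ?k x * jmp \<kappa> (fst x) (snd x))"
    by (rule bnd) (measurable, use AE_jmp_bound[OF b] in auto)
  have i3: "integrable R (\<lambda>x. ?k x * kint \<kappa> (fst x) (snd x))"
    by (rule bnd) (measurable, use AE_jmp_bound[OF b] in auto)
  show "integrable P (\<lambda>\<omega>. \<integral>t. w t \<omega> * lam t \<omega> * kint \<kappa> t \<omega> \<partial>lbT)"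
    using integral_R(5)[OF i3] by simp
  have "(\<integral>\<omega>. kint w T \<omega> * jmp \<kappa> T \<omega> \<partial>P) = (\<integral>x. ?k x * jmp \<kappa> T (snd x) \<partial>R)"
    unfolding integral_R(1)[OF i1] by (simp add: kint_def set_integral_lbT(2)[OF Tin])
  also have "\<dots> = (\<integral>t. \<integral>\<omega>. ?k (t, \<omega>) * jmp \<kappa> T \<omega> \<partial>P \<partial>lbT)"
    unfolding integral_R(2)[OF i1] by simp
  also have "\<dots> = (\<integral>t. \<integral>\<omega>. ?k (t, \<omega>) * jmp \<kappa> t \<omega> \<partial>P \<partial>lbT)"
  proof (rule integral_cong_AE)
    show "AE t in lbT. (\<integral>\<omega>. ?k (t, \<omega>) * jmp \<kappa> T \<omega> \<partial>P) = (\<integral>\<omega>. ?k (t, \<omega>) * jmp \<kappa> t \<omega> \<partial>P)"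
      using integral_R(3)[OF i1] integral_R(3)[OF i2] AE_space
    proof eventually_elim
      case (elim t)
      have t: "t \<in> {0..T}" using elim by (simp add: space_restrict_space)
      have "(\<integral>\<omega>. ?k (t, \<omega>) * (jmp \<kappa> T \<omega> - jmp \<kappa> t \<omega>) \<partial>P) = 0"
      proof (rule integral_mult_eq_0_of_bounded)
        show "subalgebra P (F t)" using F_subalgebra t by auto
        show "integrable P (\<lambda>\<omega>. jmp \<kappa> T \<omega> - jmp \<kappa> t \<omega>)"
          using jmp_integrable[OF \<kappa> pbounded_integrable[OF b]] t Tin by auto
        show "(\<lambda>\<omega>. ?k (t, \<omega>)) \<in> borel_measurable (F t)"
          using pred_section[OF w t] lam_section[OF t] by simp
        show "integrable P (\<lambda>\<omega>. ?k (t, \<omega>) * (jmp \<kappa> T \<omega> - jmp \<kappa> t \<omega>))"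
          using elim by (simp add: right_diff_distrib)
      qed (rule jmp_orthogonal(2)[OF \<kappa> pbounded_integrable[OF b], where C=1], use t in auto)
      then show ?case using elim by (simp add: right_diff_distrib)
    qed
  qed (use integral_R(6)[OF i1] integral_R(6)[OF i2] in auto)
  also have "\<dots> = (\<integral>\<omega>. \<integral>t. ?k (t, \<omega>) * jmp \<kappa> t \<omega> \<partial>lbT \<partial>P)"
    using integral_R(1,2)[OF i2] by simp
  also have "\<dots> = (\<integral>\<omega>. - (\<integral>t. ?k (t, \<omega>) * kint \<kappa> t \<omega> \<partial>lbT) \<partial>P)"
  proof (rule integral_cong_AE)
    show "AE \<omega> in P. (\<integral>t. ?k (t, \<omega>) * jmp \<kappa> t \<omega> \<partial>lbT) = - (\<integral>t. ?k (t, \<omega>) * kint \<kappa> t \<omega> \<partial>lbT)"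
      using lam_after_tau integral_R(4)[OF i2] integral_R(4)[OF i3]
    proof eventually_elim
      case (elim \<omega>)
      have "(\<integral>t. ?k (t, \<omega>) * jmp \<kappa> t \<omega> \<partial>lbT) = (\<integral>t. - (?k (t, \<omega>) * kint \<kappa> t \<omega>) \<partial>lbT)"
      proof (rule integral_cong_AE)
        have "AE t in lbT. t \<noteq> \<tau> \<omega>"
          by (subst AE_restrict_space_iff) (use AE_lborel_singleton[of "\<tau> \<omega>"] in \<open>auto elim: eventually_mono\<close>)
        then show "AE t in lbT. ?k (t, \<omega>) * jmp \<kappa> t \<omega> = - (?k (t, \<omega>) * kint \<kappa> t \<omega>)"
          by eventually_elim (use elim(1) in \<open>auto simp: jmp_def not_le\<close>)
      qed (use elim in auto)
      then show ?case by simp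
    qed
  qed (use integral_R(5)[OF i2] integral_R(5)[OF i3] in auto)
  finally show "(\<integral>\<omega>. kint w T \<omega> * jmp \<kappa> T \<omega> \<partial>P) = - (\<integral>\<omega>. \<integral>t. w t \<omega> * lam t \<omega> * kint \<kappa> t \<omega> \<partial>lbT \<partial>P)"
    by simp
qed

text \<open>Write each integral as J = D - K, with D the value at \<tau> and K absolutely
  continuous. There is only one jump, so D'D is the jump part belonging to the product w \<kappa>,
  and the compensation formula gives its mean. In J'J = D'D - J'K - K'K - K'J the last three means
  cancel, by integration by parts for K'K and \<open>integral_kint_jmp\<close> for the other
  two.\<close>

lemma jmp_isometry_bounded:
  assumes b: "pbounded C \<kappa>" and b': "pbounded C' w"
  shows "(\<integral>\<omega>. jmp w T \<omega> * jmp \<kappa> T \<omega> \<partial>P) = (\<integral>x. w (fst x) (snd x) * \<kappa> (fst x) (snd x) * lamw x \<partial>R)"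
    and "integrable R (\<lambda>x. w (fst x) (snd x) * \<kappa> (fst x) (snd x) * lamw x)"
proof -
  have \<kappa>: "pred \<kappa>" and w: "pred w" and C: "0 \<le> C" "0 \<le> C'" using b b' by (auto simp: pbounded_def)
  have Tin: "T \<in> {0..T}" using T_pos by auto
  have pw: "pred (\<lambda>t \<omega>. w t \<omega> * \<kappa> t \<omega>)"
    using pred_PR[OF w] pred_PR[OF \<kappa>] by (simp add: predictable_on_def split_def)
  have bw: "pbounded (C' * C) (\<lambda>t \<omega>. w t \<omega> * \<kappa> t \<omega>)"
    using b b' pw by (auto simp: pbounded_def abs_mult intro!: mult_mono)
  show iw: "integrable R (\<lambda>x. w (fst x) (snd x) * \<kappa> (fst x) (snd x) * lamw x)"
    using pbounded_integrable[OF bw] by simp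
  note cf = compensation_formula[OF pred_PR[OF pw], unfolded fst_conv snd_conv, OF iw]
  let ?K = "kint \<kappa> T" and ?K' = "kint w T" and ?J = "jmp \<kappa> T" and ?J' = "jmp w T"
  let ?D = "\<lambda>\<omega>. if \<tau> \<omega> \<le> T then w (\<tau> \<omega>) \<omega> * \<kappa> (\<tau> \<omega>) \<omega> else 0"
  note m = kint_measurable[OF \<kappa> Tin] kint_measurable[OF w Tin] jmp_measurable[OF \<kappa> Tin] jmp_measurable[OF w Tin]
  have prod: "integrable P (\<lambda>\<omega>. f \<omega> * g \<omega>)"
    if [measurable]: "f \<in> borel_measurable P" "g \<in> borel_measurable P"
      and fg: "AE \<omega> in P. \<bar>f \<omega>\<bar> \<le> C' * (1 + compensator lam T \<omega>)" "AE \<omega> in P. \<bar>g \<omega>\<bar> \<le> C * (1 + compensator lam T \<omega>)" for f g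
  proof (rule integrable_compensator_bound[where c="C' * C" and n=2])
    show "AE \<omega> in P. \<bar>f \<omega> * g \<omega>\<bar> \<le> C' * C * (1 + compensator lam T \<omega>)\<^sup>2"
      using fg
    proof eventually_elim
      case (elim \<omega>)
      have "\<bar>f \<omega>\<bar> * \<bar>g \<omega>\<bar> \<le> (C' * (1 + compensator lam T \<omega>)) * (C * (1 + compensator lam T \<omega>))"
        using elim by (intro mult_mono) (auto intro: order_trans[OF abs_ge_zero])
      then show ?case by (simp add: abs_mult power2_eq_square mult_ac)
    qed
  qed measurable
  have B: "AE \<omega> in P. \<bar>?K \<omega>\<bar> \<le> C * (1 + compensator lam T \<omega>)" "AE \<omega> in P. \<bar>?J \<omega>\<bar> \<le> C * (1 + compensator lam T \<omega>)"
    using AE_jmp_bound[OF b] Tin by auto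
  have B': "AE \<omega> in P. \<bar>?K' \<omega>\<bar> \<le> C' * (1 + compensator lam T \<omega>)" "AE \<omega> in P. \<bar>?J' \<omega>\<bar> \<le> C' * (1 + compensator lam T \<omega>)"
    using AE_jmp_bound[OF b'] Tin by auto
  note I = prod[OF m(4,1) B'(2) B(1)] prod[OF m(2,1) B'(1) B(1)] prod[OF m(2,3) B'(1) B(2)]
  note A1 = integral_kint_jmp[OF b b'] and A2 = integral_kint_jmp[OF b' b]
  have "(\<integral>\<omega>. ?J' \<omega> * ?J \<omega> \<partial>P) = (\<integral>\<omega>. ?D \<omega> - ?J' \<omega> * ?K \<omega> - ?K' \<omega> * ?K \<omega> - ?K' \<omega> * ?J \<omega> \<partial>P)"
    by (rule Bochner_Integration.integral_cong) (auto simp: jmp_def algebra_simps)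
  also have "\<dots> = (\<integral>\<omega>. ?D \<omega> \<partial>P) - (\<integral>\<omega>. ?J' \<omega> * ?K \<omega> \<partial>P) - (\<integral>\<omega>. ?K' \<omega> * ?K \<omega> \<partial>P) - (\<integral>\<omega>. ?K' \<omega> * ?J \<omega> \<partial>P)"
    using I cf(1) by simp
  also have "(\<integral>\<omega>. ?K' \<omega> * ?K \<omega> \<partial>P) = (\<integral>\<omega>. (\<integral>t. w t \<omega> * lam t \<omega> * kint \<kappa> t \<omega> \<partial>lbT) + (\<integral>t. \<kappa> t \<omega> * lam t \<omega> * kint w t \<omega> \<partial>lbT) \<partial>P)"
  proof (rule integral_cong_AE)
    show "AE \<omega> in P. ?K' \<omega> * ?K \<omega> = (\<integral>t. w t \<omega> * lam t \<omega> * kint \<kappa> t \<omega> \<partial>lbT) + (\<integral>t. \<kappa> t \<omega> * lam t \<omega> * kint w t \<omega> \<partial>lbT)"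
      using AE_kint_diff[OF pbounded_integrable[OF b]] AE_kint_diff[OF pbounded_integrable[OF b']]
    proof eventually_elim
      case (elim \<omega>)
      show ?case
        using integral_mult_absolutely_continuous(1)[of T "\<lambda>s. w s \<omega> * lam s \<omega>" "\<lambda>s. \<kappa> s \<omega> * lam s \<omega>"] elim
        by (simp add: kint_def set_integral_lbT(2)[OF Tin])
    qed
  qed (use A1(2) A2(2) m in auto)
  also have "\<dots> = (\<integral>\<omega>. \<integral>t. w t \<omega> * lam t \<omega> * kint \<kappa> t \<omega> \<partial>lbT \<partial>P) + (\<integral>\<omega>. \<integral>t. \<kappa> t \<omega> * lam t \<omega> * kint w t \<omega> \<partial>lbT \<partial>P)"
    using A1(2) A2(2) by simp
  also have "(\<integral>\<omega>. ?J' \<omega> * ?K \<omega> \<partial>P) = (\<integral>\<omega>. ?K \<omega> * ?J' \<omega> \<partial>P)" by (simp add: mult.commute)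
  finally show "(\<integral>\<omega>. jmp w T \<omega> * jmp \<kappa> T \<omega> \<partial>P) = (\<integral>x. w (fst x) (snd x) * \<kappa> (fst x) (snd x) * lamw x \<partial>R)"
    using A1(1) A2(1) cf(2) by simp
qed

definition trunc :: "nat \<Rightarrow> (real \<Rightarrow> 'a \<Rightarrow> real) \<Rightarrow> real \<Rightarrow> 'a \<Rightarrow> real" where
  "trunc n w t \<omega> = (if \<bar>w t \<omega>\<bar> \<le> real n then w t \<omega> else 0)"

lemma trunc_pred: assumes "pred w" shows "pred (trunc n w)" "pred (\<lambda>t \<omega>. w t \<omega> - trunc n w t \<omega>)"
proof -
  note [measurable] = pred_PR[OF assms]
  show 1: "pred (trunc n w)" unfolding predictable_on_def split_def trunc_def by measurable
  show "pred (\<lambda>t \<omega>. w t \<omega> - trunc n w t \<omega>)"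
    using pred_PR[OF 1] unfolding predictable_on_def split_def by measurable
qed

lemma trunc_pbounded: "pred w \<Longrightarrow> pbounded (real n) (trunc n w)"
  using trunc_pred by (auto simp: pbounded_def trunc_def)

lemma eventually_trunc: "eventually (\<lambda>n. trunc n w t \<omega> = w t \<omega>) sequentially"
  using eventually_ge_at_top[of "nat \<lceil>\<bar>w t \<omega>\<bar>\<rceil>"] by eventually_elim (auto simp: trunc_def)

text \<open>From |y| \<le> 1 + y^2, since \<lambda> itself is integrable over
  \<open>R\<close>.\<close>

lemma integrable_lam_of_square:
  assumes w: "pred w" and i: "integrable R (\<lambda>x. (w (fst x) (snd x))\<^sup>2 * lamw x)"
  shows "integrable R (\<lambda>x. w (fst x) (snd x) * lamw x)"
proof (rule Bochner_Integration.integrable_bound)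
  show "integrable R (\<lambda>x. lamw x + (w (fst x) (snd x))\<^sup>2 * lamw x)" using i integrable_lam by auto
  show "(\<lambda>x. w (fst x) (snd x) * lamw x) \<in> borel_measurable R" using pred_R[OF w] by measurable
  show "AE x in R. norm (w (fst x) (snd x) * lamw x) \<le> norm (lamw x + (w (fst x) (snd x))\<^sup>2 * lamw x)"
  proof (rule AE_I2)
    fix x assume "x \<in> space R"
    then have l: "0 \<le> lamw x" by (rule lamw_nonneg)
    have "y \<le> 1 + y\<^sup>2" if "0 \<le> y" for y :: real
      using sum_squares_bound[of 1 y] that by simp
    from this[of "\<bar>w (fst x) (snd x)\<bar>"] have "\<bar>w (fst x) (snd x)\<bar> \<le> 1 + (w (fst x) (snd x))\<^sup>2" by simp
    from mult_right_mono[OF this l] show "norm (w (fst x) (snd x) * lamw x) \<le> norm (lamw x + (w (fst x) (snd x))\<^sup>2 * lamw x)"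
      using l by (simp add: abs_mult distrib_right)
  qed
qed

text \<open>Isometry for the truncations followed by Fatou's lemma. An inequality suffices, because
  it will be applied to the truncation errors, which tend to 0.\<close>

lemma jmp_square_le:
  assumes w: "pred w" and i: "integrable R (\<lambda>x. (w (fst x) (snd x))\<^sup>2 * lamw x)"
  shows "(\<integral>\<^sup>+\<omega>. ennreal ((jmp w T \<omega>)\<^sup>2) \<partial>P) \<le> (\<integral>\<^sup>+x. ennreal ((w (fst x) (snd x))\<^sup>2 * lamw x) \<partial>R)"
proof -
  have Tin: "T \<in> {0..T}" using T_pos by auto
  let ?c = "\<integral>\<^sup>+x. ennreal ((w (fst x) (snd x))\<^sup>2 * lamw x) \<partial>R"
  let ?J = "\<lambda>n. jmp (trunc n w) T"
  have le: "(\<integral>\<^sup>+\<omega>. ennreal ((?J n \<omega>)\<^sup>2) \<partial>P) \<le> ?c" for n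
  proof -
    note b = trunc_pbounded[OF w, of n]
    have "(\<integral>\<^sup>+\<omega>. ennreal ((?J n \<omega>)\<^sup>2) \<partial>P) = ennreal (\<integral>\<omega>. ?J n \<omega> * ?J n \<omega> \<partial>P)"
      using jmp_square_integrable[OF b Tin] by (subst nn_integral_eq_integral) (auto simp: power2_eq_square)
    also have "\<dots> = ennreal (\<integral>x. trunc n w (fst x) (snd x) * trunc n w (fst x) (snd x) * lamw x \<partial>R)"
      using jmp_isometry_bounded(1)[OF b b] by simp
    also have "\<dots> = (\<integral>\<^sup>+x. ennreal (trunc n w (fst x) (snd x) * trunc n w (fst x) (snd x) * lamw x) \<partial>R)"
      using jmp_isometry_bounded(2)[OF b b] lamw_nonneg
      by (intro nn_integral_eq_integral[symmetric] AE_I2) auto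
    also have "\<dots> \<le> ?c"
      using lamw_nonneg by (intro nn_integral_mono ennreal_leI mult_right_mono) (auto simp: trunc_def power2_eq_square)
    finally show ?thesis .
  qed
  note iw = integrable_lam_of_square[OF w i]
  have measT: "AE \<omega> in P. \<forall>n. (\<lambda>t. trunc n w t \<omega> * lam t \<omega>) \<in> borel_measurable lbT"
    unfolding AE_all_countable
  proof
    fix n
    show "AE \<omega> in P. (\<lambda>t. trunc n w t \<omega> * lam t \<omega>) \<in> borel_measurable lbT"
      using integral_R(4)[OF pbounded_integrable[OF trunc_pbounded[OF w, of n]]] by eventually_elim auto
  qed
  have conv: "AE \<omega> in P. (\<lambda>n. ?J n \<omega>) \<longlonglongrightarrow> jmp w T \<omega>"
    using integral_R(4)[OF iw] measT
  proof eventually_elim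
    case (elim \<omega>)
    have "(\<lambda>n. kint (trunc n w) T \<omega>) \<longlonglongrightarrow> kint w T \<omega>"
      unfolding kint_def set_integral_lbT(2)[OF Tin]
    proof (rule integral_dominated_convergence[where w="\<lambda>t. \<bar>w t \<omega> * lam t \<omega>\<bar>"])
      show "integrable lbT (\<lambda>t. \<bar>w t \<omega> * lam t \<omega>\<bar>)" using elim by simp
      show "AE t in lbT. (\<lambda>n. trunc n w t \<omega> * lam t \<omega>) \<longlonglongrightarrow> w t \<omega> * lam t \<omega>"
        by (intro AE_I2 tendsto_mult tendsto_const tendsto_eventually eventually_trunc)
      show "AE t in lbT. norm (trunc n w t \<omega> * lam t \<omega>) \<le> \<bar>w t \<omega> * lam t \<omega>\<bar>" for n
        by (rule AE_I2) (auto simp: trunc_def)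
      show m: "(\<lambda>t. w t \<omega> * lam t \<omega>) \<in> borel_measurable lbT" using elim by auto
      show "(\<lambda>t. trunc n w t \<omega> * lam t \<omega>) \<in> borel_measurable lbT" for n
        using elim(2) by blast
    qed
    moreover have "(\<lambda>n. if \<tau> \<omega> \<le> T then trunc n w (\<tau> \<omega>) \<omega> else 0) \<longlonglongrightarrow> (if \<tau> \<omega> \<le> T then w (\<tau> \<omega>) \<omega> else 0)"
      by (rule tendsto_eventually) (use eventually_trunc[of w "\<tau> \<omega>" \<omega>] in \<open>eventually_elim, simp\<close>)
    ultimately show ?case unfolding jmp_def by (rule tendsto_diff[rotated])
  qed
  have "(\<integral>\<^sup>+\<omega>. ennreal ((jmp w T \<omega>)\<^sup>2) \<partial>P) = (\<integral>\<^sup>+\<omega>. liminf (\<lambda>n. ennreal ((?J n \<omega>)\<^sup>2)) \<partial>P)"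
  proof (rule nn_integral_cong_AE)
    show "AE \<omega> in P. ennreal ((jmp w T \<omega>)\<^sup>2) = liminf (\<lambda>n. ennreal ((?J n \<omega>)\<^sup>2))"
      using conv
    proof eventually_elim
      case (elim \<omega>)
      then have "(\<lambda>n. ennreal ((?J n \<omega>)\<^sup>2)) \<longlonglongrightarrow> ennreal ((jmp w T \<omega>)\<^sup>2)"
        by (intro tendsto_ennrealI tendsto_power)
      then show ?case using lim_imp_Liminf[OF sequentially_bot] by metis
    qed
  qed
  also have "\<dots> \<le> liminf (\<lambda>n. \<integral>\<^sup>+\<omega>. ennreal ((?J n \<omega>)\<^sup>2) \<partial>P)"
    using jmp_measurable[OF trunc_pred(1)[OF w] Tin] by (intro nn_integral_liminf) auto
  also have "\<dots> \<le> liminf (\<lambda>n. ?c)" using le by (intro Liminf_mono always_eventually) auto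
  also have "\<dots> = ?c" by (intro Liminf_const) auto
  finally show ?thesis .
qed

text \<open>By linearity the error is the jump integral of w - \<open>trunc n w\<close>, whose
  \<lambda>-weighted square norm tends to 0 by dominated convergence.\<close>

lemma jmp_L2_tendsto:
  assumes w: "pred w" and i: "integrable R (\<lambda>x. (w (fst x) (snd x))\<^sup>2 * lamw x)"
  shows "L2_tendsto P (\<lambda>n. jmp (trunc n w) T) (jmp w T)"
proof -
  have Tin: "T \<in> {0..T}" using T_pos by auto
  let ?d = "\<lambda>n t \<omega>. w t \<omega> - trunc n w t \<omega>"
  note [measurable] = pred_R[OF w] pred_R[OF trunc_pred(2)[OF w]]
  have bd: "(?d n t \<omega>)\<^sup>2 * lam t \<omega> \<le> (w t \<omega>)\<^sup>2 * lam t \<omega>" if "(t, \<omega>) \<in> space R" for n t \<omega>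
    using lamw_nonneg[OF that] by (intro mult_right_mono) (auto simp: trunc_def)
  have id: "integrable R (\<lambda>x. (?d n (fst x) (snd x))\<^sup>2 * lamw x)" for n
    by (rule Bochner_Integration.integrable_bound[OF i])
      (measurable, use bd lamw_nonneg in \<open>auto intro!: AE_I2\<close>)
  have lim: "(\<lambda>n. \<integral>x. (?d n (fst x) (snd x))\<^sup>2 * lamw x \<partial>R) \<longlonglongrightarrow> (\<integral>x. 0 \<partial>R)"
  proof (rule integral_dominated_convergence[where w="\<lambda>x. (w (fst x) (snd x))\<^sup>2 * lamw x"])
    show "AE x in R. (\<lambda>n. (?d n (fst x) (snd x))\<^sup>2 * lamw x) \<longlonglongrightarrow> 0"
    proof (rule AE_I2, rule tendsto_eventually)
      fix x
      show "eventually (\<lambda>n. (?d n (fst x) (snd x))\<^sup>2 * lamw x = 0) sequentially"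
        using eventually_trunc[of w "fst x" "snd x"] by eventually_elim simp
    qed
    show "AE x in R. norm ((?d n (fst x) (snd x))\<^sup>2 * lamw x) \<le> (w (fst x) (snd x))\<^sup>2 * lamw x" for n
      using bd lamw_nonneg by (auto intro!: AE_I2)
  qed (use i in measurable)
  have diff: "AE \<omega> in P. jmp (?d n) T \<omega> = jmp w T \<omega> - jmp (trunc n w) T \<omega>" for n
    using integral_R(4)[OF integrable_lam_of_square[OF w i]]
      integral_R(4)[OF pbounded_integrable[OF trunc_pbounded[OF w, of n]]]
  proof eventually_elim
    case (elim \<omega>)
    then have "kint (?d n) T \<omega> = kint w T \<omega> - kint (trunc n w) T \<omega>"
      unfolding kint_def set_integral_lbT(2)[OF Tin] by (simp add: left_diff_distrib)
    then show ?case by (simp add: jmp_def)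
  qed
  have le: "(\<integral>\<^sup>+\<omega>. ennreal ((jmp (trunc n w) T \<omega> - jmp w T \<omega>)\<^sup>2) \<partial>P) \<le> ennreal (\<integral>x. (?d n (fst x) (snd x))\<^sup>2 * lamw x \<partial>R)" for n
  proof -
    have "(\<integral>\<^sup>+\<omega>. ennreal ((jmp (trunc n w) T \<omega> - jmp w T \<omega>)\<^sup>2) \<partial>P) = (\<integral>\<^sup>+\<omega>. ennreal ((jmp (?d n) T \<omega>)\<^sup>2) \<partial>P)"
      by (rule nn_integral_cong_AE) (use diff[of n] in \<open>eventually_elim, simp add: power2_commute\<close>)
    also have "\<dots> \<le> (\<integral>\<^sup>+x. ennreal ((?d n (fst x) (snd x))\<^sup>2 * lamw x) \<partial>R)"
      by (rule jmp_square_le[OF trunc_pred(2)[OF w] id])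
    also have "\<dots> = ennreal (\<integral>x. (?d n (fst x) (snd x))\<^sup>2 * lamw x \<partial>R)"
      using id lamw_nonneg by (intro nn_integral_eq_integral AE_I2) auto
    finally show ?thesis .
  qed
  have lim': "(\<lambda>n. ennreal (\<integral>x. (?d n (fst x) (snd x))\<^sup>2 * lamw x \<partial>R)) \<longlonglongrightarrow> 0"
    using tendsto_ennrealI[OF lim] by simp
  show ?thesis
    unfolding L2_tendsto_def
    using jmp_measurable[OF w Tin] jmp_measurable[OF trunc_pred(1)[OF w] Tin]
      jmp_square_integrable[OF trunc_pbounded[OF w] Tin]
      tendsto_sandwich[OF _ _ tendsto_const lim'] le
    by (auto intro!: tendsto_sandwich[OF _ _ tendsto_const lim'] always_eventually)
qed

text \<open>Only one factor has to be bounded: in the application w is the adjoint integrand in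
  H2(\<lambda>) and \<kappa> is \<gamma> along the state.\<close>

theorem jmp_isometry:
  assumes w: "pred w" and i: "integrable R (\<lambda>x. (w (fst x) (snd x))\<^sup>2 * lamw x)"
    and b: "pbounded C \<kappa>"
  shows "(\<integral>\<omega>. jmp w T \<omega> * jmp \<kappa> T \<omega> \<partial>P) = (\<integral>x. w (fst x) (snd x) * \<kappa> (fst x) (snd x) * lamw x \<partial>R)"
proof -
  have Tin: "T \<in> {0..T}" using T_pos by auto
  have \<kappa>: "pred \<kappa>" and C: "0 \<le> C" using b by (auto simp: pbounded_def)
  note [measurable] = pred_R[OF w] pred_R[OF trunc_pred(1)[OF w]] pred_R[OF \<kappa>]
  have "L2_tendsto P (\<lambda>n. jmp \<kappa> T) (jmp \<kappa> T)"
    by (rule L2_tendsto_const[OF jmp_measurable[OF \<kappa> Tin] jmp_square_integrable[OF b Tin]])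
  from L2_tendsto_inner[OF jmp_L2_tendsto[OF w i] this]
  have 1: "(\<lambda>n. \<integral>x. trunc n w (fst x) (snd x) * \<kappa> (fst x) (snd x) * lamw x \<partial>R) \<longlonglongrightarrow> (\<integral>\<omega>. jmp w T \<omega> * jmp \<kappa> T \<omega> \<partial>P)"
    using jmp_isometry_bounded(1)[OF b trunc_pbounded[OF w]] by simp
  have 2: "(\<lambda>n. \<integral>x. trunc n w (fst x) (snd x) * \<kappa> (fst x) (snd x) * lamw x \<partial>R) \<longlonglongrightarrow>
     (\<integral>x. w (fst x) (snd x) * \<kappa> (fst x) (snd x) * lamw x \<partial>R)"
  proof (rule integral_dominated_convergence[where w="\<lambda>x. C * \<bar>w (fst x) (snd x) * lamw x\<bar>"])
    show "integrable R (\<lambda>x. C * \<bar>w (fst x) (snd x) * lamw x\<bar>)"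
      using integrable_lam_of_square[OF w i] by auto
    show "AE x in R. (\<lambda>n. trunc n w (fst x) (snd x) * \<kappa> (fst x) (snd x) * lamw x) \<longlonglongrightarrow> w (fst x) (snd x) * \<kappa> (fst x) (snd x) * lamw x"
      by (intro AE_I2 tendsto_mult tendsto_const tendsto_eventually eventually_trunc)
    fix n
    show "AE x in R. norm (trunc n w (fst x) (snd x) * \<kappa> (fst x) (snd x) * lamw x) \<le> C * \<bar>w (fst x) (snd x) * lamw x\<bar>"
    proof (rule AE_I2)
      fix x assume x: "x \<in> space R"
      have "\<bar>\<kappa> (fst x) (snd x)\<bar> * (\<bar>trunc n w (fst x) (snd x)\<bar> * \<bar>lamw x\<bar>) \<le> C * (\<bar>w (fst x) (snd x)\<bar> * \<bar>lamw x\<bar>)"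
        using b x C by (intro mult_mono) (auto simp: pbounded_def trunc_def)
      then show "norm (trunc n w (fst x) (snd x) * \<kappa> (fst x) (snd x) * lamw x) \<le> C * \<bar>w (fst x) (snd x) * lamw x\<bar>"
        by (simp add: abs_mult mult_ac)
    qed
  qed measurable
  show ?thesis by (rule LIMSEQ_unique[OF 1 2])
qed

end

section \<open>Lebesgue-Stieltjes measures of H and of the compensator\<close>

lemma interval_measure_eqI:
  assumes M: "sets M = sets borel"
    and F: "\<And>x y. x \<le> y \<Longrightarrow> F x \<le> F y" "\<And>a. continuous (at_right a) F"
    and em: "\<And>a b. a \<le> b \<Longrightarrow> emeasure M {a<..b} = ennreal (F b - F a)"
  shows "interval_measure F = M"
proof (rule measure_eqI_generator_eq[where E="range (\<lambda>(a, b). {a<..b::real})" and \<Omega>=UNIV and A="\<lambda>n. {- real n<..real n}"])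
  show "Int_stable (range (\<lambda>(a, b). {a<..b::real}))"
  proof (rule Int_stableI)
    fix x y assume "x \<in> range (\<lambda>(a, b). {a<..b::real})" "y \<in> range (\<lambda>(a, b). {a<..b::real})"
    then obtain a b c d where "x = {a<..b}" "y = {c<..d}" by auto
    then have "x \<inter> y = (\<lambda>(a, b). {a<..b}) (max a c, min b d)" by auto
    then show "x \<inter> y \<in> range (\<lambda>(a, b). {a<..b::real})" by blast
  qed
  show "(\<Union>n. {- real n<..real n}) = UNIV"
  proof (intro set_eqI iffI UNIV_I)
    fix x :: real
    obtain n :: nat where "\<bar>x\<bar> < real n" using reals_Archimedean2 by blast
    then show "x \<in> (\<Union>n. {- real n<..real n})" by (intro UN_I[of n]) auto
  qed
  have s: "sets borel = sigma_sets UNIV (range (\<lambda>(a, b). {a<..b::real}))"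
    by (subst borel_sigma_sets_Ioc) (simp add: sets_measure_of)
  show "sets (interval_measure F) = sigma_sets UNIV (range (\<lambda>(a, b). {a<..b::real}))"
    "sets M = sigma_sets UNIV (range (\<lambda>(a, b). {a<..b::real}))"
    using s M by auto
  fix X assume "X \<in> range (\<lambda>(a, b). {a<..b::real})"
  then obtain a b where X: "X = {a<..b}" by auto
  show "emeasure (interval_measure F) X = emeasure M X"
    unfolding X using em[of a b] by (cases "a \<le> b") (simp_all add: emeasure_interval_measure_Ioc_eq[OF F])
next
  show "emeasure (interval_measure F) {- real n<..real n} \<noteq> \<infinity>" for n
    by (simp add: emeasure_interval_measure_Ioc_eq[OF F])
qed auto

context default_horizon begin

lemma interval_measure_indicator:
  assumes "\<omega> \<in> space P"
  shows "interval_measure (\<lambda>s. default_indicator \<tau> s \<omega>) = return borel (\<tau> \<omega>)"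
proof (rule interval_measure_eqI)
  fix a :: real
  show "continuous (at_right a) (\<lambda>s. default_indicator \<tau> s \<omega>)"
  proof (cases "\<tau> \<omega> \<le> a")
    case True
    have "eventually (\<lambda>s. default_indicator \<tau> s \<omega> = default_indicator \<tau> a \<omega>) (at_right a)"
      using eventually_at_right_less[of a] by eventually_elim (use True in \<open>auto simp: default_indicator_def\<close>)
    then show ?thesis unfolding continuous_within by (rule tendsto_eventually)
  next
    case False
    then have "eventually (\<lambda>s. s \<in> {a<..<\<tau> \<omega>}) (at_right a)" by (intro eventually_at_right_real) auto
    then have "eventually (\<lambda>s. default_indicator \<tau> s \<omega> = default_indicator \<tau> a \<omega>) (at_right a)"
      by eventually_elim (use False in \<open>auto simp: default_indicator_def\<close>)
    then show ?thesis unfolding continuous_within by (rule tendsto_eventually)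
  qed
qed (auto simp: default_indicator_def split: split_indicator)

lemma lam_path_measurable:
  assumes "\<omega> \<in> space P"
  shows "(\<lambda>r. indicator {0..} r * lam r \<omega>) \<in> borel_measurable borel"
proof -
  have "(\<lambda>t. lam t \<omega>) \<in> borel_measurable (restrict_space borel {0..})"
    using measurable_compose[OF measurable_Pair2'[OF assms] lam_measurable] by simp
  then show ?thesis by (subst (asm) borel_measurable_restrict_space_iff) (auto simp: mult.commute)
qed

lemma compensator_continuous:
  assumes i: "\<forall>t\<ge>0. set_integrable lborel {0..t} (\<lambda>s. lam s \<omega>)" and "0 \<le> c"
  shows "continuous_on {0..c} (\<lambda>t. compensator lam t \<omega>)"
proof -
  have eq: "integral {0..t} (\<lambda>s. lam s \<omega>) = compensator lam t \<omega>" if "t \<in> {0..c}" for t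
    unfolding compensator_def using i that by (intro set_borel_integral_eq_integral(2)[symmetric]) auto
  have "continuous_on {0..c} (\<lambda>t. integral {0..t} (\<lambda>s. lam s \<omega>))"
    using i assms(2) by (intro indefinite_integral_continuous_1 set_borel_integral_eq_integral) auto
  then show ?thesis by (rule continuous_on_eq) (rule eq)
qed

text \<open>The characterisation of \<open>interval_measure\<close> needs a function that is
  monotone and right-continuous on the whole line. Negative times are therefore treated separately:
  there the compensator is constantly 0, and intervals are clipped at 0.\<close>

lemma AE_interval_measure_compensator:
  "AE \<omega> in P. interval_measure (\<lambda>s. compensator lam s \<omega>) = density lborel (\<lambda>r. ennreal (indicator {0..} r * lam r \<omega>))"
  using lam_integrable AE_compensator_diff AE_space
proof eventually_elim
  case (elim \<omega>)
  let ?L = "\<lambda>s. compensator lam s \<omega>"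
  have neg: "?L s = 0" if "s < 0" for s
    using that by (simp add: compensator_def set_lebesgue_integral_def)
  have mon: "?L x \<le> ?L y" if "x \<le> y" for x y
    using that elim(2) neg compensator_nonneg[OF elim(3)] by (cases "x < 0") auto
  show ?case
  proof (rule interval_measure_eqI)
    fix a :: real
    show "continuous (at_right a) ?L"
    proof (cases "0 \<le> a")
      case True
      have "continuous (at a within {0..a + 1}) ?L"
        using compensator_continuous[OF elim(1), of "a + 1"] True
        by (simp add: continuous_on_eq_continuous_within)
      then have "continuous (at a within {a..a + 1}) ?L"
        by (rule continuous_within_subset) (use True in auto)
      then show ?thesis
        by (simp add: at_within_Icc_at_right)
    next
      case False
      then have "eventually (\<lambda>s. s \<in> {a<..<0}) (at_right a)" by (intro eventually_at_right_real) auto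
      then have "eventually (\<lambda>s. ?L s = ?L a) (at_right a)"
        by eventually_elim (use False neg in auto)
      then show ?thesis unfolding continuous_within by (rule tendsto_eventually)
    qed
  next
    fix a b :: real assume ab: "a \<le> b"
    have "emeasure (density lborel (\<lambda>r. ennreal (indicator {0..} r * lam r \<omega>))) {a<..b}
      = (\<integral>\<^sup>+r. ennreal (indicator {0..} r * lam r \<omega>) * indicator {a<..b} r \<partial>lborel)"
      using lam_path_measurable[OF elim(3)] by (intro emeasure_density) auto
    also have "\<dots> = (\<integral>\<^sup>+r. ennreal (lam r \<omega>) * indicator {max 0 a<..max 0 b} r \<partial>lborel)"
    proof (rule nn_integral_cong_AE)
      show "AE r in lborel. ennreal (indicator {0..} r * lam r \<omega>) * indicator {a<..b} r = ennreal (lam r \<omega>) * indicator {max 0 a<..max 0 b} r"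
        using AE_lborel_singleton[of 0] by eventually_elim (auto split: split_indicator)
    qed
    also have "\<dots> = ennreal (?L (max 0 b) - ?L (max 0 a))"
      using elim(2) ab by auto
    also have "\<dots> = ennreal (?L b - ?L a)"
      using neg compensator_zero[of \<omega>] by (auto simp: max_def not_le)
    finally show "emeasure (density lborel (\<lambda>r. ennreal (indicator {0..} r * lam r \<omega>))) {a<..b} = ennreal (?L b - ?L a)" .
  qed (use mon in auto)
qed

text \<open>The measure of H is a unit mass at \<tau> and that of \<Lambda> has density \<lambda>.
  Stieltjes integrability supplies the measurability of the path of \<kappa>, and the end point 0,
  which belongs to \<open>kint\<close> but not to the Stieltjes integral, is null.\<close>

lemma AE_jump_integral_eq:
  assumes "AE \<omega> in P. stieltjes_integrable (default_indicator \<tau>) \<kappa> T \<omega> \<and> stieltjes_integrable (compensator lam) \<kappa> T \<omega>"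
  shows "AE \<omega> in P. \<forall>t\<in>{0..T}. jump_integral \<tau> lam \<kappa> t \<omega> = jmp \<kappa> t \<omega>"
  using assms AE_interval_measure_compensator AE_space
proof eventually_elim
  case (elim \<omega>)
  show ?case
  proof
    fix t assume t: "t \<in> {0..T}"
    have "set_integrable (return borel (\<tau> \<omega>)) {0<..T} (\<lambda>s. \<kappa> s \<omega>)"
      using elim(1) by (simp add: stieltjes_integrable_def interval_measure_indicator[OF elim(3)])
    then have "set_integrable (return borel (\<tau> \<omega>)) {0<..t} (\<lambda>s. \<kappa> s \<omega>)"
      by (rule set_integrable_subset) (use t in auto)
    then have m: "(\<lambda>s. indicator {0<..t} s *\<^sub>R \<kappa> s \<omega>) \<in> borel_measurable borel"
      unfolding set_integrable_def by (auto dest: borel_measurable_integrable)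
    have "stieltjes_integral (default_indicator \<tau>) \<kappa> t \<omega> = indicator {0<..t} (\<tau> \<omega>) *\<^sub>R \<kappa> (\<tau> \<omega>) \<omega>"
      unfolding stieltjes_integral_def interval_measure_indicator[OF elim(3)] set_lebesgue_integral_def
      using m by (intro integral_return) auto
    also have "\<dots> = (if \<tau> \<omega> \<le> t then \<kappa> (\<tau> \<omega>) \<omega> else 0)"
      using tau_positive[OF elim(3)] by auto
    finally have 1: "stieltjes_integral (default_indicator \<tau>) \<kappa> t \<omega> = (if \<tau> \<omega> \<le> t then \<kappa> (\<tau> \<omega>) \<omega> else 0)" .
    have "stieltjes_integral (compensator lam) \<kappa> t \<omega> = (\<integral>r. (indicator {0..} r * lam r \<omega>) *\<^sub>R (indicator {0<..t} r *\<^sub>R \<kappa> r \<omega>) \<partial>lborel)"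
      unfolding stieltjes_integral_def elim(2) set_lebesgue_integral_def
      using m lam_path_measurable[OF elim(3)] lam_nonneg elim(3)
      by (intro integral_density) (auto intro!: AE_I2 split: split_indicator)
    also have "\<dots> = kint \<kappa> t \<omega>"
      unfolding kint_def set_lebesgue_integral_def
    proof (rule integral_cong_AE)
      show *: "AE r in lborel. (indicator {0..} r * lam r \<omega>) *\<^sub>R (indicator {0<..t} r *\<^sub>R \<kappa> r \<omega>) = indicator {0..t} r *\<^sub>R (\<kappa> r \<omega> * lam r \<omega>)"
        using AE_lborel_singleton[of 0] by eventually_elim (auto split: split_indicator)
      show 1: "(\<lambda>r. (indicator {0..} r * lam r \<omega>) *\<^sub>R (indicator {0<..t} r *\<^sub>R \<kappa> r \<omega>)) \<in> borel_measurable lborel"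
        using m lam_path_measurable[OF elim(3)] by simp
      \<comment> \<open>Measurability is known for the path on (0, t]; putting back the single value
        at 0 gives it on [0, t].\<close>
      have "(\<lambda>r. if r = 0 then indicator {0..t} 0 *\<^sub>R (\<kappa> 0 \<omega> * lam 0 \<omega>) else (indicator {0..} r * lam r \<omega>) *\<^sub>R (indicator {0<..t} r *\<^sub>R \<kappa> r \<omega>)) \<in> borel_measurable lborel"
        using 1 by measurable
      then show "(\<lambda>r. indicator {0..t} r *\<^sub>R (\<kappa> r \<omega> * lam r \<omega>)) \<in> borel_measurable lborel"
        by (rule measurable_cong[THEN iffD1, rotated]) (auto split: split_indicator)
    qed
    finally show "jump_integral \<tau> lam \<kappa> t \<omega> = jmp \<kappa> t \<omega>"
      using 1 by (simp add: jump_integral_def jmp_def)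
  qed
qed

end

section \<open>Elementary integrals and the Ito isometry\<close>

lemma L2_tendstoI:
  assumes "f \<in> borel_measurable M" "\<And>k. fs k \<in> borel_measurable M" "\<And>k. integrable M (\<lambda>x. (fs k x)\<^sup>2)"
    and le: "\<And>k. (\<integral>\<^sup>+x. ennreal ((fs k x - f x)\<^sup>2) \<partial>M) \<le> c k" and c: "c \<longlonglongrightarrow> 0"
  shows "L2_tendsto M fs f"
proof -
  have "(\<lambda>k. \<integral>\<^sup>+x. ennreal ((fs k x - f x)\<^sup>2) \<partial>M) \<longlonglongrightarrow> 0"
    by (rule tendsto_sandwich[OF _ _ tendsto_const c]) (use le in \<open>auto intro: always_eventually\<close>)
  then show ?thesis using assms by (simp add: L2_tendsto_def)
qed

lemma L2_tendsto_mult_bounded: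
  assumes L: "L2_tendsto M fs f" and m[measurable]: "m \<in> borel_measurable M" and c: "\<And>x. x \<in> space M \<Longrightarrow> \<bar>m x\<bar> \<le> c"
  shows "L2_tendsto M (\<lambda>k x. m x * fs k x) (\<lambda>x. m x * f x)"
proof (rule L2_tendstoI)
  note [measurable] = L[unfolded L2_tendsto_def, THEN conjunct1]
    L[unfolded L2_tendsto_def, THEN conjunct2, THEN conjunct1, rule_format]
  show "(\<lambda>x. m x * f x) \<in> borel_measurable M" "(\<lambda>x. m x * fs k x) \<in> borel_measurable M" for k by measurable
  have sq: "(m x * y)\<^sup>2 \<le> c\<^sup>2 * y\<^sup>2" if "x \<in> space M" for x and y :: real
    using power_mono[OF c[OF that], of 2] by (simp add: power_mult_distrib mult_right_mono)
  show "integrable M (\<lambda>x. (m x * fs k x)\<^sup>2)" for k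
  proof (rule Bochner_Integration.integrable_bound)
    show "integrable M (\<lambda>x. c\<^sup>2 * (fs k x)\<^sup>2)" using L by (simp add: L2_tendsto_def)
    show "AE x in M. norm ((m x * fs k x)\<^sup>2) \<le> norm (c\<^sup>2 * (fs k x)\<^sup>2)" using sq by (intro AE_I2) simp
  qed measurable
  show "(\<integral>\<^sup>+x. ennreal ((m x * fs k x - m x * f x)\<^sup>2) \<partial>M) \<le> ennreal (c\<^sup>2) * (\<integral>\<^sup>+x. ennreal ((fs k x - f x)\<^sup>2) \<partial>M)" for k
    by (subst nn_integral_cmult[symmetric], measurable)
      (use sq in \<open>auto intro!: nn_integral_mono simp: ennreal_mult'[symmetric] right_diff_distrib[symmetric]\<close>)
  have "(\<lambda>k. ennreal (c\<^sup>2) * (\<integral>\<^sup>+x. ennreal ((fs k x - f x)\<^sup>2) \<partial>M)) \<longlonglongrightarrow> ennreal (c\<^sup>2) * 0"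
    using L by (intro ennreal_tendsto_cmult) (auto simp: L2_tendsto_def)
  then show "(\<lambda>k. ennreal (c\<^sup>2) * (\<integral>\<^sup>+x. ennreal ((fs k x - f x)\<^sup>2) \<partial>M)) \<longlonglongrightarrow> 0" by simp
qed

lemma L2_tendsto_diff:
  assumes f: "L2_tendsto M fs f" and g: "L2_tendsto M gs g"
  shows "L2_tendsto M (\<lambda>k x. fs k x - gs k x) (\<lambda>x. f x - g x)"
proof (rule L2_tendstoI)
  note [measurable] = f[unfolded L2_tendsto_def, THEN conjunct1]
    f[unfolded L2_tendsto_def, THEN conjunct2, THEN conjunct1, rule_format]
    g[unfolded L2_tendsto_def, THEN conjunct1]
    g[unfolded L2_tendsto_def, THEN conjunct2, THEN conjunct1, rule_format]
  show "(\<lambda>x. f x - g x) \<in> borel_measurable M" "(\<lambda>x. fs k x - gs k x) \<in> borel_measurable M" for k by measurable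
  show "integrable M (\<lambda>x. (fs k x - gs k x)\<^sup>2)" for k
    using f g by (intro L2_add_integrable) (auto simp: L2_tendsto_def)
  have sq: "(fs k x - gs k x - (f x - g x))\<^sup>2 \<le> 2 * (fs k x - f x)\<^sup>2 + 2 * (gs k x - g x)\<^sup>2" for k x
    using zero_le_power2[of "(fs k x - f x) + (gs k x - g x)"] by (simp add: power2_eq_square algebra_simps)
  show "(\<integral>\<^sup>+x. ennreal ((fs k x - gs k x - (f x - g x))\<^sup>2) \<partial>M)
     \<le> 2 * (\<integral>\<^sup>+x. ennreal ((fs k x - f x)\<^sup>2) \<partial>M) + 2 * (\<integral>\<^sup>+x. ennreal ((gs k x - g x)\<^sup>2) \<partial>M)" for k
  proof -
    have "(\<integral>\<^sup>+x. ennreal ((fs k x - gs k x - (f x - g x))\<^sup>2) \<partial>M) \<le>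
       (\<integral>\<^sup>+x. 2 * ennreal ((fs k x - f x)\<^sup>2) + 2 * ennreal ((gs k x - g x)\<^sup>2) \<partial>M)"
      using sq[of k] by (intro nn_integral_mono) 
        (simp add: ennreal_plus[symmetric] ennreal_mult'[symmetric] ennreal_numeral[symmetric] del: ennreal_plus ennreal_numeral)
    also have "\<dots> = 2 * (\<integral>\<^sup>+x. ennreal ((fs k x - f x)\<^sup>2) \<partial>M) + 2 * (\<integral>\<^sup>+x. ennreal ((gs k x - g x)\<^sup>2) \<partial>M)"
      by (simp add: nn_integral_add nn_integral_cmult)
    finally show ?thesis .
  qed
  have "(\<lambda>k. 2 * (\<integral>\<^sup>+x. ennreal ((fs k x - f x)\<^sup>2) \<partial>M) + 2 * (\<integral>\<^sup>+x. ennreal ((gs k x - g x)\<^sup>2) \<partial>M)) \<longlonglongrightarrow> 2 * 0 + 2 * 0"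
    using f g by (intro tendsto_add ennreal_tendsto_cmult) (auto simp: L2_tendsto_def)
  then show "(\<lambda>k. 2 * (\<integral>\<^sup>+x. ennreal ((fs k x - f x)\<^sup>2) \<partial>M) + 2 * (\<integral>\<^sup>+x. ennreal ((gs k x - g x)\<^sup>2) \<partial>M)) \<longlonglongrightarrow> 0"
    by simp
qed

section \<open>Brownian increments and elementary integrals\<close>

locale brownian_horizon = finite_horizon P F T for P :: "'a measure" and F T +
  fixes W :: "real \<Rightarrow> 'a \<Rightarrow> real"
  assumes bm: "brownian_motion P F W"
begin

lemma W_measurable: "0 \<le> t \<Longrightarrow> W t \<in> borel_measurable P" 
  and W_adapted: "0 \<le> t \<Longrightarrow> W t \<in> borel_measurable (F t)"
  using bm by (auto simp: brownian_motion_def)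

lemma increment_measurable: "0 \<le> a \<Longrightarrow> a \<le> b \<Longrightarrow> (\<lambda>\<omega>. W b \<omega> - W a \<omega>) \<in> borel_measurable (F b)"
  using W_adapted[of b] F_measurable_mono[OF _ _ W_adapted[of a], of b] by auto

lemma increment_moment:
  assumes "0 \<le> a" "a < b"
  shows "integrable P (\<lambda>\<omega>. (W b \<omega> - W a \<omega>) ^ k)"
    and "(\<integral>\<omega>. (W b \<omega> - W a \<omega>) ^ k \<partial>P) = (\<integral>x. normal_density 0 (sqrt (b - a)) x * x ^ k \<partial>lborel)"
proof -
  have D: "distributed P lborel (\<lambda>\<omega>. W b \<omega> - W a \<omega>) (normal_density 0 (sqrt (b - a)))"
    using bm assms by (auto simp: brownian_motion_def)
  have s: "0 < sqrt (b - a)" using assms by simp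
  show "integrable P (\<lambda>\<omega>. (W b \<omega> - W a \<omega>) ^ k)"
    using distributed_integrable[OF D, of "\<lambda>x. x ^ k"] integrable_normal_moment[OF s, of 0 k] by simp
  show "(\<integral>\<omega>. (W b \<omega> - W a \<omega>) ^ k \<partial>P) = (\<integral>x. normal_density 0 (sqrt (b - a)) x * x ^ k \<partial>lborel)"
    using distributed_integral[OF D, of "\<lambda>x. x ^ k"] by simp
qed

lemma increment_moments:
  assumes "0 \<le> a" "a \<le> b"
  shows "integrable P (\<lambda>\<omega>. (W b \<omega> - W a \<omega>) ^ k)"
    and "(\<integral>\<omega>. W b \<omega> - W a \<omega> \<partial>P) = 0"
    and "(\<integral>\<omega>. (W b \<omega> - W a \<omega>)\<^sup>2 \<partial>P) = b - a"
    and "(\<integral>\<omega>. (W b \<omega> - W a \<omega>) ^ 4 \<partial>P) = 3 * (b - a)\<^sup>2"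
proof -
  show "integrable P (\<lambda>\<omega>. (W b \<omega> - W a \<omega>) ^ k)"
    using assms increment_moment(1)[of a b k] by (cases "a = b") (auto simp: power_0_left)
  show "(\<integral>\<omega>. W b \<omega> - W a \<omega> \<partial>P) = 0"
  proof (cases "a = b")
    case False
    then show ?thesis
      using assms increment_moment(2)[of a b 1] integral_normal_moment_odd[of "sqrt (b - a)" 0 0] by simp
  qed simp
  show "(\<integral>\<omega>. (W b \<omega> - W a \<omega>)\<^sup>2 \<partial>P) = b - a"
  proof (cases "a = b")
    case False
    then show ?thesis
      using assms increment_moment(2)[of a b 2] integral_normal_moment_even[of "sqrt (b - a)" 0 1] by simp
  qed simp
  show "(\<integral>\<omega>. (W b \<omega> - W a \<omega>) ^ 4 \<partial>P) = 3 * (b - a)\<^sup>2"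
  proof (cases "a = b")
    case False
    have "(fact 4 :: real) = 24" by (simp add: eval_nat_numeral)
    then show ?thesis
      using False assms increment_moment(2)[of a b 4] integral_normal_moment_even[of "sqrt (b - a)" 0 2]
      by (simp add: power2_eq_square)
  qed simp
qed

lemma increment_indep:
  assumes ab: "0 \<le> a" "a \<le> b" and Z: "Z \<in> borel_measurable (F a)" and i: "integrable P Z"
  shows "integrable P (\<lambda>\<omega>. Z \<omega> * (W b \<omega> - W a \<omega>) ^ k)"
    and "(\<integral>\<omega>. Z \<omega> * (W b \<omega> - W a \<omega>) ^ k \<partial>P) = (\<integral>\<omega>. Z \<omega> \<partial>P) * (\<integral>\<omega>. (W b \<omega> - W a \<omega>) ^ k \<partial>P)"
proof -
  let ?D = "\<lambda>\<omega>. W b \<omega> - W a \<omega>"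
  have ZP: "Z \<in> borel_measurable P" using F_measurable[OF ab(1) Z] .
  have DP: "?D \<in> borel_measurable P" using W_measurable[of a] W_measurable[of b] ab by auto
  have "indep_var borel Z borel (\<lambda>\<omega>. ?D \<omega> ^ k)" if "a < b"
  proof -
    have ind: "indep_set (sets (F a)) (sets (vimage_algebra (space P) ?D borel))"
      using bm ab that by (auto simp: brownian_motion_def)
    have "indep_var borel Z borel ?D"
      unfolding indep_var_eq
    proof (intro conjI ZP DP)
      show "indep_set (sigma_sets (space P) {Z -` A \<inter> space P |A. A \<in> sets borel})
        (sigma_sets (space P) {?D -` A \<inter> space P |A. A \<in> sets borel})"
        using ind unfolding indep_set_def
      proof (rule indep_sets_mono_sets)
        fix i :: bool
        have "sigma_sets (space P) {Z -` A \<inter> space P |A. A \<in> sets borel} \<subseteq> sets (F a)"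
        proof -
          have "{Z -` A \<inter> space P |A. A \<in> sets borel} \<subseteq> sets (F a)"
            using measurable_sets[OF Z] space_F[OF ab(1)] by auto
          then show ?thesis
            using sets.sigma_sets_subset[of _ "F a"] by (simp only: space_F[OF ab(1)])
        qed
        moreover have "sigma_sets (space P) {?D -` A \<inter> space P |A. A \<in> sets borel} \<subseteq> sets (vimage_algebra (space P) ?D borel)"
          by (simp add: sets_vimage_algebra)
        ultimately show "case_bool (sigma_sets (space P) {Z -` A \<inter> space P |A. A \<in> sets borel}) (sigma_sets (space P) {?D -` A \<inter> space P |A. A \<in> sets borel}) i
          \<subseteq> case_bool (sets (F a)) (sets (vimage_algebra (space P) ?D borel)) i"
          by (cases i) auto
      qed
    qed
    from indep_var_compose[OF this, of "\<lambda>x. x" borel "\<lambda>x. x ^ k" borel] show ?thesis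
      by (simp add: comp_def)
  qed
  note iv = this
  have "integrable P (\<lambda>\<omega>. Z \<omega> * ?D \<omega> ^ k) \<and> (\<integral>\<omega>. Z \<omega> * ?D \<omega> ^ k \<partial>P) = (\<integral>\<omega>. Z \<omega> \<partial>P) * (\<integral>\<omega>. ?D \<omega> ^ k \<partial>P)"
  proof (cases "a = b")
    case True
    then show ?thesis using i by (cases k) (auto simp: prob_space)
  next
    case False
    then show ?thesis
      using indep_var_integrable[OF iv i increment_moments(1)[OF ab]] indep_var_lebesgue_integral[OF iv i increment_moments(1)[OF ab]] ab
      by auto
  qed
  then show "integrable P (\<lambda>\<omega>. Z \<omega> * ?D \<omega> ^ k)"
    and "(\<integral>\<omega>. Z \<omega> * ?D \<omega> ^ k \<partial>P) = (\<integral>\<omega>. Z \<omega> \<partial>P) * (\<integral>\<omega>. ?D \<omega> ^ k \<partial>P)" by auto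
qed

lemma increment_mean_zero:
  assumes ab: "0 \<le> a" "a \<le> b" and Z: "Z \<in> borel_measurable (F a)" and i: "integrable P Z"
  shows "integrable P (\<lambda>\<omega>. Z \<omega> * (W b \<omega> - W a \<omega>))"
    and "(\<integral>\<omega>. Z \<omega> * (W b \<omega> - W a \<omega>) \<partial>P) = 0"
  using increment_indep[OF assms, of 1] increment_moments(2)[OF ab] by auto

text \<open>For a \<le> c, both increments are cut at \<open>k = min b c\<close> and
  \<open>m = max c (min b d)\<close>. The overlap [c, m] contributes the squared increment,
  independent of \<open>F c\<close>. Every other piece is an increment multiplied by something known
  at its starting time and has mean zero.\<close>

lemma increment_inner_aux:
  assumes ab: "0 \<le> a" "a \<le> b" "a \<le> c" "c \<le> d"
    and \<xi>: "\<xi> \<in> borel_measurable (F a)" "\<And>\<omega>. \<omega> \<in> space P \<Longrightarrow> \<bar>\<xi> \<omega>\<bar> \<le> C"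
    and \<eta>: "\<eta> \<in> borel_measurable (F c)" "\<And>\<omega>. \<omega> \<in> space P \<Longrightarrow> \<bar>\<eta> \<omega>\<bar> \<le> C'"
  shows "integrable P (\<lambda>\<omega>. (\<xi> \<omega> * (W b \<omega> - W a \<omega>)) * (\<eta> \<omega> * (W d \<omega> - W c \<omega>)))"
    and "(\<integral>\<omega>. (\<xi> \<omega> * (W b \<omega> - W a \<omega>)) * (\<eta> \<omega> * (W d \<omega> - W c \<omega>)) \<partial>P) 
      = (\<integral>\<omega>. \<xi> \<omega> * \<eta> \<omega> \<partial>P) * max 0 (min b d - max a c)"
proof -
  have c0: "0 \<le> c" using ab by simp
  have \<xi>c: "\<xi> \<in> borel_measurable (F c)" using F_measurable_mono[OF _ _ \<xi>(1)] ab by auto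
  let ?Z = "\<lambda>\<omega>. \<xi> \<omega> * \<eta> \<omega>"
  have Z: "?Z \<in> borel_measurable (F c)" using \<xi>c \<eta> by measurable
  have ZP: "?Z \<in> borel_measurable P" using F_measurable[OF c0 Z] .
  have Zb: "\<bar>?Z \<omega>\<bar> \<le> C * C'" if "\<omega> \<in> space P" for \<omega>
    unfolding abs_mult using \<xi>(2)[OF that] \<eta>(2)[OF that] by (intro mult_mono) auto
  have Zi: "integrable P (\<lambda>\<omega>. ?Z \<omega> * Y \<omega>)" if "integrable P Y" for Y
  proof (rule Bochner_Integration.integrable_bound)
    show "integrable P (\<lambda>\<omega>. (C * C') * Y \<omega>)" using that by simp
    show "AE \<omega> in P. norm (?Z \<omega> * Y \<omega>) \<le> norm (C * C' * Y \<omega>)"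
    proof (rule AE_I2)
      fix \<omega> assume "\<omega> \<in> space P"
      then have "\<bar>?Z \<omega>\<bar> \<le> \<bar>C * C'\<bar>" using Zb by (meson abs_ge_self order_trans)
      then show "norm (?Z \<omega> * Y \<omega>) \<le> norm (C * C' * Y \<omega>)" by (simp add: abs_mult mult_right_mono)
    qed
  qed (use ZP that in auto)
  define m where "m = max c (min b d)"
  define k where "k = min b c"
  have m: "c \<le> m" "m \<le> d" "0 \<le> m" "b \<le> m \<or> m = d \<or> False" using ab by (auto simp: m_def)
  have k: "a \<le> k" "k \<le> b" "k \<le> c" "0 \<le> k" using ab by (auto simp: k_def)
  \<comment> \<open>Covers a first interval that extends beyond \<open>d\<close>: its remainder runs
    from \<open>m\<close> to \<open>bm\<close>. In the other cases this remainder, or its factor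
    \<open>?B\<close>, is zero.\<close>
  define bm where "bm = max b m"
  let ?A = "\<lambda>\<omega>. ?Z \<omega> * (W k \<omega> - W a \<omega>)" and ?B = "\<lambda>\<omega>. ?Z \<omega> * (W m \<omega> - W c \<omega>)"
  have A: "?A \<in> borel_measurable (F c)"
    using Z F_measurable_mono[OF _ _ increment_measurable[of a k], of c] k ab by measurable
  have Ai: "integrable P ?A" using Zi increment_moments(1)[of a k 1] k ab by auto
  have B: "?B \<in> borel_measurable (F m)"
    using F_measurable_mono[OF _ _ Z, of m] increment_measurable[of c m] m c0 by measurable
  have Bi: "integrable P ?B" using Zi increment_moments(1)[of c m 1] m c0 by auto
  have Zi1: "integrable P ?Z" using Zi[of "\<lambda>_. 1"] by simp
  note 1 = increment_mean_zero[OF c0 ab(4) A Ai]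
  note 2 = increment_indep[OF c0 m(1) Z Zi1, of 2]
  note 3 = increment_mean_zero[OF m(3,2) B Bi]
  have 4: "integrable P (\<lambda>\<omega>. ?B \<omega> * (W bm \<omega> - W m \<omega>))" "(\<integral>\<omega>. ?B \<omega> * (W bm \<omega> - W m \<omega>) \<partial>P) = 0"
    using increment_mean_zero[OF m(3) _ B Bi, of bm] by (auto simp: bm_def)
  have split: "(\<xi> \<omega> * (W b \<omega> - W a \<omega>)) * (\<eta> \<omega> * (W d \<omega> - W c \<omega>)) =
      ?A \<omega> * (W d \<omega> - W c \<omega>) + ?Z \<omega> * (W m \<omega> - W c \<omega>) ^ 2 + ?B \<omega> * (W d \<omega> - W m \<omega>) + ?B \<omega> * (W bm \<omega> - W m \<omega>)" for \<omega>
  proof (cases "b \<le> c")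
    case True
    then have "k = b" "m = c" using ab by (auto simp: k_def m_def)
    then show ?thesis by (simp add: algebra_simps)
  next
    case False
    then have kc: "k = c" by (simp add: k_def)
    have "m = min b d" using False ab by (simp add: m_def max_def)
    then have "bm = b" "m = b \<or> m = d" by (auto simp: bm_def max_def min_def)
    then consider "m = b" "bm = b" | "m = d" "bm = b" by blast
    then show ?thesis
      by cases (simp_all add: kc power2_eq_square algebra_simps)
  qed
  show "integrable P (\<lambda>\<omega>. (\<xi> \<omega> * (W b \<omega> - W a \<omega>)) * (\<eta> \<omega> * (W d \<omega> - W c \<omega>)))"
    unfolding split using 1 2 3 4 by (intro Bochner_Integration.integrable_add) auto
  have "(\<integral>\<omega>. (\<xi> \<omega> * (W b \<omega> - W a \<omega>)) * (\<eta> \<omega> * (W d \<omega> - W c \<omega>)) \<partial>P) 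
     = (\<integral>\<omega>. ?Z \<omega> \<partial>P) * (m - c)"
    unfolding split using 1 2 3 4 increment_moments(3)[OF c0 m(1)] by simp
  also have "m - c = max 0 (min b d - max a c)" using ab by (auto simp: m_def max_def)
  finally show "(\<integral>\<omega>. (\<xi> \<omega> * (W b \<omega> - W a \<omega>)) * (\<eta> \<omega> * (W d \<omega> - W c \<omega>)) \<partial>P) 
      = (\<integral>\<omega>. ?Z \<omega> \<partial>P) * max 0 (min b d - max a c)" .
qed

lemma increment_inner:
  assumes ab: "0 \<le> a" "a \<le> b" "0 \<le> c" "c \<le> d"
    and \<xi>: "\<xi> \<in> borel_measurable (F a)" "\<And>\<omega>. \<omega> \<in> space P \<Longrightarrow> \<bar>\<xi> \<omega>\<bar> \<le> C"
    and \<eta>: "\<eta> \<in> borel_measurable (F c)" "\<And>\<omega>. \<omega> \<in> space P \<Longrightarrow> \<bar>\<eta> \<omega>\<bar> \<le> C'"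
  shows "integrable P (\<lambda>\<omega>. (\<xi> \<omega> * (W b \<omega> - W a \<omega>)) * (\<eta> \<omega> * (W d \<omega> - W c \<omega>)))"
    and "(\<integral>\<omega>. (\<xi> \<omega> * (W b \<omega> - W a \<omega>)) * (\<eta> \<omega> * (W d \<omega> - W c \<omega>)) \<partial>P) 
      = (\<integral>\<omega>. \<xi> \<omega> * \<eta> \<omega> \<partial>P) * max 0 (min b d - max a c)"
  using increment_inner_aux[OF ab(1,2) _ ab(4) \<xi> \<eta>] increment_inner_aux[OF ab(3,4) _ ab(2) \<eta> \<xi>]
  by (cases "a \<le> c"; simp add: mult.commute mult.left_commute min.commute max.commute)+

text \<open>Unlike in \<open>simple_integral\<close>, the end points form two unrelated families, so
  the intervals may be empty, overlap or leave gaps.\<close>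

definition elem_int :: "nat \<Rightarrow> (nat \<Rightarrow> real) \<Rightarrow> (nat \<Rightarrow> real) \<Rightarrow> (nat \<Rightarrow> 'a \<Rightarrow> real) \<Rightarrow> 'a \<Rightarrow> real" where
  "elem_int n \<alpha> \<beta> \<xi> \<omega> = (\<Sum>i<n. \<xi> i \<omega> * (W (\<beta> i) \<omega> - W (\<alpha> i) \<omega>))"

definition elem_proc :: "nat \<Rightarrow> (nat \<Rightarrow> real) \<Rightarrow> (nat \<Rightarrow> real) \<Rightarrow> (nat \<Rightarrow> 'a \<Rightarrow> real) \<Rightarrow> real \<times> 'a \<Rightarrow> real" where
  "elem_proc n \<alpha> \<beta> \<xi> w = (\<Sum>i<n. \<xi> i (snd w) * indicator {\<alpha> i<..\<beta> i} (fst w))"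

definition elem :: "nat \<Rightarrow> (nat \<Rightarrow> real) \<Rightarrow> (nat \<Rightarrow> real) \<Rightarrow> (nat \<Rightarrow> 'a \<Rightarrow> real) \<Rightarrow> bool" where
  "elem n \<alpha> \<beta> \<xi> \<longleftrightarrow> (\<forall>i<n. 0 \<le> \<alpha> i \<and> \<alpha> i \<le> \<beta> i \<and> \<beta> i \<le> T \<and> \<xi> i \<in> borel_measurable (F (\<alpha> i)) \<and>
     (\<exists>C. \<forall>\<omega>\<in>space P. \<bar>\<xi> i \<omega>\<bar> \<le> C))"

text \<open>On both sides a pair of summands contributes E[\<xi>_i \<xi>'_j] times the length of the
  overlap of the two intervals. The two partitions are thus compared directly, without a common
  refinement.\<close>

lemma elem_isometry:
  assumes e: "elem n \<alpha> \<beta> \<xi>" and e': "elem n' \<alpha>' \<beta>' \<xi>'"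
  shows "integrable P (\<lambda>\<omega>. elem_int n \<alpha> \<beta> \<xi> \<omega> * elem_int n' \<alpha>' \<beta>' \<xi>' \<omega>)"
    and "integrable R (\<lambda>w. elem_proc n \<alpha> \<beta> \<xi> w * elem_proc n' \<alpha>' \<beta>' \<xi>' w)"
    and "(\<integral>\<omega>. elem_int n \<alpha> \<beta> \<xi> \<omega> * elem_int n' \<alpha>' \<beta>' \<xi>' \<omega> \<partial>P) = (\<integral>w. elem_proc n \<alpha> \<beta> \<xi> w * elem_proc n' \<alpha>' \<beta>' \<xi>' w \<partial>R)"
proof -
  let ?f = "\<lambda>i j \<omega>. (\<xi> i \<omega> * (W (\<beta> i) \<omega> - W (\<alpha> i) \<omega>)) * (\<xi>' j \<omega> * (W (\<beta>' j) \<omega> - W (\<alpha>' j) \<omega>))"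
  let ?g = "\<lambda>i j w. (\<xi> i (snd w) * indicator {\<alpha> i<..\<beta> i} (fst w)) * (\<xi>' j (snd w) * indicator {\<alpha>' j<..\<beta>' j} (fst w)) :: real"
  have fg: "integrable P (?f i j) \<and> integrable R (?g i j) \<and> (\<integral>\<omega>. ?f i j \<omega> \<partial>P) = (\<integral>w. ?g i j w \<partial>R)"
    if ij: "i < n" "j < n'" for i j
  proof -
    obtain C where i: "0 \<le> \<alpha> i" "\<alpha> i \<le> \<beta> i" "\<beta> i \<le> T" "\<xi> i \<in> borel_measurable (F (\<alpha> i))" "\<And>\<omega>. \<omega> \<in> space P \<Longrightarrow> \<bar>\<xi> i \<omega>\<bar> \<le> C"
      using e ij unfolding elem_def by blast
    obtain C' where j: "0 \<le> \<alpha>' j" "\<alpha>' j \<le> \<beta>' j" "\<beta>' j \<le> T" "\<xi>' j \<in> borel_measurable (F (\<alpha>' j))" "\<And>\<omega>. \<omega> \<in> space P \<Longrightarrow> \<bar>\<xi>' j \<omega>\<bar> \<le> C'"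
      using e' ij unfolding elem_def by blast
    have [measurable]: "\<xi> i \<in> borel_measurable P" "\<xi>' j \<in> borel_measurable P"
      using F_measurable i j by blast+
    note inc = increment_inner[OF i(1,2) j(1,2) i(4,5) j(4,5)]
    have b: "\<bar>\<xi> i \<omega> * \<xi>' j \<omega>\<bar> \<le> \<bar>C\<bar> * \<bar>C'\<bar>" if "\<omega> \<in> space P" for \<omega>
      unfolding abs_mult using i(5)[OF that] j(5)[OF that] by (intro mult_mono) auto
    have "finite_measure R"
      using finite_measure_pair_measure[OF finite_measure_axioms finite_measure_lbT] .
    then have gi: "integrable R (?g i j)"
    proof (rule finite_measure.integrable_const_bound[where B="\<bar>C\<bar> * \<bar>C'\<bar>"])
      show "AE w in R. norm (?g i j w) \<le> \<bar>C\<bar> * \<bar>C'\<bar>"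
        using b by (intro AE_I2) (auto split: split_indicator)
    qed measurable
    let ?A = "{max (\<alpha> i) (\<alpha>' j)<..min (\<beta> i) (\<beta>' j)}"
    have "(\<integral>w. ?g i j w \<partial>R) = (\<integral>\<omega>. \<integral>t. (\<xi> i \<omega> * \<xi>' j \<omega>) * indicator ?A t \<partial>lbT \<partial>P)"
      unfolding integral_R(1)[OF gi]
      by (intro Bochner_Integration.integral_cong refl) (auto split: split_indicator)
    also have "(\<integral>t. indicator ?A t \<partial>lbT) = max 0 (min (\<beta> i) (\<beta>' j) - max (\<alpha> i) (\<alpha>' j))"
    proof -
      have "(\<integral>t. indicat_real ?A t \<partial>lbT) = (\<integral>t. indicat_real ?A t \<partial>lborel)"
        unfolding integral_restrict_space[of "{0..T}" lborel, simplified]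
        using i j by (intro Bochner_Integration.integral_cong) (auto split: split_indicator)
      also have "\<dots> = max 0 (min (\<beta> i) (\<beta>' j) - max (\<alpha> i) (\<alpha>' j))"
        by (cases "max (\<alpha> i) (\<alpha>' j) \<le> min (\<beta> i) (\<beta>' j)") auto
      finally show ?thesis .
    qed
    then have "(\<integral>\<omega>. \<integral>t. (\<xi> i \<omega> * \<xi>' j \<omega>) * indicator ?A t \<partial>lbT \<partial>P) = (\<integral>\<omega>. ?f i j \<omega> \<partial>P)"
      using inc(2) by simp
    finally show ?thesis using inc(1) gi by auto
  qed
  have s1: "(\<lambda>\<omega>. elem_int n \<alpha> \<beta> \<xi> \<omega> * elem_int n' \<alpha>' \<beta>' \<xi>' \<omega>) = (\<lambda>\<omega>. \<Sum>i<n. \<Sum>j<n'. ?f i j \<omega>)"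
    unfolding elem_int_def sum_product ..
  have s2: "(\<lambda>w. elem_proc n \<alpha> \<beta> \<xi> w * elem_proc n' \<alpha>' \<beta>' \<xi>' w) = (\<lambda>w. \<Sum>i<n. \<Sum>j<n'. ?g i j w)"
    unfolding elem_proc_def sum_product ..
  show "integrable P (\<lambda>\<omega>. elem_int n \<alpha> \<beta> \<xi> \<omega> * elem_int n' \<alpha>' \<beta>' \<xi>' \<omega>)"
    unfolding s1 using fg by (intro Bochner_Integration.integrable_sum) auto
  show "integrable R (\<lambda>w. elem_proc n \<alpha> \<beta> \<xi> w * elem_proc n' \<alpha>' \<beta>' \<xi>' w)"
    unfolding s2 using fg by (intro Bochner_Integration.integrable_sum) auto
  show "(\<integral>\<omega>. elem_int n \<alpha> \<beta> \<xi> \<omega> * elem_int n' \<alpha>' \<beta>' \<xi>' \<omega> \<partial>P) = (\<integral>w. elem_proc n \<alpha> \<beta> \<xi> w * elem_proc n' \<alpha>' \<beta>' \<xi>' w \<partial>R)"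
    unfolding s1 s2 using fg
    by (subst Bochner_Integration.integral_sum; (intro Bochner_Integration.integrable_sum)?; simp)+
qed

lemma elem_measurable:
  assumes e: "elem n \<alpha> \<beta> \<xi>"
  shows "elem_int n \<alpha> \<beta> \<xi> \<in> borel_measurable P" "elem_proc n \<alpha> \<beta> \<xi> \<in> borel_measurable R"
proof -
  have i: "\<xi> i \<in> borel_measurable P" "W (\<alpha> i) \<in> borel_measurable P" "W (\<beta> i) \<in> borel_measurable P" if "i < n" for i
    using e that F_measurable W_measurable unfolding elem_def by (meson order_trans)+
  show "elem_int n \<alpha> \<beta> \<xi> \<in> borel_measurable P"
    unfolding elem_int_def[abs_def] using i by (intro borel_measurable_sum) auto
  show "elem_proc n \<alpha> \<beta> \<xi> \<in> borel_measurable R"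
    unfolding elem_proc_def[abs_def]
  proof (intro borel_measurable_sum borel_measurable_times)
    fix j assume "j \<in> {..<n}"
    then show "(\<lambda>w. \<xi> j (snd w)) \<in> borel_measurable R" using i by simp
  qed measurable
qed

lemma simple_integrand_bounds:
  assumes "simple_integrand P F T n ts \<xi>" "i \<le> n" shows "0 \<le> ts i" "ts i \<le> T"
proof -
  have step: "\<And>i. i < n \<Longrightarrow> ts i \<le> ts (Suc i)" and b: "0 \<le> ts 0" "ts n \<le> T"
    using assms by (auto simp: simple_integrand_def)
  have mono: "j \<le> n \<Longrightarrow> k \<le> j \<Longrightarrow> ts k \<le> ts j" for k j
  proof (induction j)
    case (Suc j)
    then show ?case using step[of j] by (cases "k = Suc j") auto
  qed simp
  show "0 \<le> ts i" using mono[of i 0] assms(2) b by simp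
  show "ts i \<le> T" using mono[of n i] assms(2) b by simp
qed

text \<open>Restricting a simple integrand to (r, T] and multiplying it by a bounded variable known
  at time r stays within the elementary class: each new left end is at least r, and intervals ending
  before r become empty.\<close>

lemma simple_elem:
  assumes s: "simple_integrand P F T n ts \<xi>" and r: "r \<in> {0..T}"
    and m: "m \<in> borel_measurable (F r)" "\<And>\<omega>. \<omega> \<in> space P \<Longrightarrow> \<bar>m \<omega>\<bar> \<le> c"
  shows "elem n (\<lambda>i. max r (ts i)) (\<lambda>i. max r (ts (Suc i))) (\<lambda>i \<omega>. m \<omega> * \<xi> i \<omega>)"
  unfolding elem_def
proof (intro allI impI conjI)
  fix i assume i: "i < n"
  note b = simple_integrand_bounds[OF s, of i] simple_integrand_bounds[OF s, of "Suc i"]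
  have \<xi>: "\<xi> i \<in> borel_measurable (F (ts i))" "\<exists>C. \<forall>\<omega>\<in>space P. \<bar>\<xi> i \<omega>\<bar> \<le> C" and le: "ts i \<le> ts (Suc i)"
    using s i by (auto simp: simple_integrand_def)
  show "0 \<le> max r (ts i)" "max r (ts (Suc i)) \<le> T" "max r (ts i) \<le> max r (ts (Suc i))"
    using b i r le by auto
  show "(\<lambda>\<omega>. m \<omega> * \<xi> i \<omega>) \<in> borel_measurable (F (max r (ts i)))"
    using F_measurable_mono[OF _ _ \<xi>(1), of "max r (ts i)"] F_measurable_mono[OF _ _ m(1), of "max r (ts i)"] b i r by auto
  obtain C where C: "\<forall>\<omega>\<in>space P. \<bar>\<xi> i \<omega>\<bar> \<le> C" using \<xi>(2) by blast
  show "\<exists>C. \<forall>\<omega>\<in>space P. \<bar>m \<omega> * \<xi> i \<omega>\<bar> \<le> C"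
  proof (intro exI ballI)
    fix \<omega> assume \<omega>: "\<omega> \<in> space P"
    show "\<bar>m \<omega> * \<xi> i \<omega>\<bar> \<le> \<bar>c\<bar> * \<bar>C\<bar>"
      unfolding abs_mult using m(2)[OF \<omega>] C \<omega> by (intro mult_mono) (auto intro: order_trans[OF _ abs_ge_self])
  qed
qed

lemma simple_elem_int:
  assumes s: "simple_integrand P F T n ts \<xi>" and r: "r \<in> {0..T}"
  shows "m \<omega> * (simple_integral W n ts \<xi> T \<omega> - simple_integral W n ts \<xi> r \<omega>) = 
    elem_int n (\<lambda>i. max r (ts i)) (\<lambda>i. max r (ts (Suc i))) (\<lambda>i \<omega>. m \<omega> * \<xi> i \<omega>) \<omega>"
proof -
  have *: "W (max r x) \<omega> = W (min T x) \<omega> - W (min r x) \<omega> + W r \<omega>" if "x \<le> T" for x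
    using that r by (auto simp: max_def min_def)
  show ?thesis
    unfolding elem_int_def simple_integral_def sum_subtractf[symmetric] sum_distrib_left
  proof (rule sum.cong[OF refl])
    fix i assume "i \<in> {..<n}"
    then have "ts i \<le> T" "ts (Suc i) \<le> T" using simple_integrand_bounds[OF s] by auto
    then show "m \<omega> * (\<xi> i \<omega> * (W (min T (ts (Suc i))) \<omega> - W (min T (ts i)) \<omega>) - \<xi> i \<omega> * (W (min r (ts (Suc i))) \<omega> - W (min r (ts i)) \<omega>)) =
         m \<omega> * \<xi> i \<omega> * (W (max r (ts (Suc i))) \<omega> - W (max r (ts i)) \<omega>)"
      by (simp add: * algebra_simps)
  qed
qed

lemma simple_elem_proc:
  assumes s: "simple_integrand P F T n ts \<xi>" and r: "r \<in> {0..T}" and w: "w \<in> space R"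
  shows "m (snd w) * indicator {r<..T} (fst w) * simple_process n ts \<xi> (fst w) (snd w) = 
    elem_proc n (\<lambda>i. max r (ts i)) (\<lambda>i. max r (ts (Suc i))) (\<lambda>i \<omega>. m \<omega> * \<xi> i \<omega>) w"
  unfolding elem_proc_def simple_process_def sum_distrib_left
proof (rule sum.cong[OF refl])
  fix i assume "i \<in> {..<n}"
  then have "ts i \<le> T" "ts (Suc i) \<le> T" using simple_integrand_bounds[OF s] by auto
  then show "m (snd w) * indicator {r<..T} (fst w) * (\<xi> i (snd w) * indicator {ts i<..ts (Suc i)} (fst w)) =
      m (snd w) * \<xi> i (snd w) * indicator {max r (ts i)<..max r (ts (Suc i))} (fst w)"
    using r w by (auto split: split_indicator)
qed

end

lemma L2_tendsto_cong:
  assumes L: "L2_tendsto M fs f" and eq: "\<And>k x. x \<in> space M \<Longrightarrow> fs k x = gs k x"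
  shows "L2_tendsto M gs f"
proof -
  have f: "f \<in> borel_measurable M" "\<And>k. fs k \<in> borel_measurable M" "\<And>k. integrable M (\<lambda>x. (fs k x)\<^sup>2)"
    and l: "(\<lambda>k. \<integral>\<^sup>+x. ennreal ((fs k x - f x)\<^sup>2) \<partial>M) \<longlonglongrightarrow> 0"
    using L by (auto simp: L2_tendsto_def)
  have "gs k \<in> borel_measurable M" for k
    using f(2)[of k] by (rule measurable_cong[THEN iffD1, rotated]) (rule eq)
  moreover have "integrable M (\<lambda>x. (gs k x)\<^sup>2)" for k
    using f(3)[of k] by (rule Bochner_Integration.integrable_cong[THEN iffD1, OF refl, rotated]) (simp add: eq)
  moreover have "(\<integral>\<^sup>+x. ennreal ((fs k x - f x)\<^sup>2) \<partial>M) = (\<integral>\<^sup>+x. ennreal ((gs k x - f x)\<^sup>2) \<partial>M)" for k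
    by (rule nn_integral_cong) (simp add: eq)
  ultimately show ?thesis using f l by (simp add: L2_tendsto_def)
qed

section \<open>Ito integrals as limits of elementary integrals\<close>

context brownian_horizon begin

lemma elemD:
  assumes "elem n \<alpha> \<beta> \<xi>" "i < n"
  shows "0 \<le> \<alpha> i" "\<alpha> i \<le> \<beta> i" "\<beta> i \<le> T" "\<xi> i \<in> borel_measurable (F (\<alpha> i))" "\<exists>C. \<forall>\<omega>\<in>space P. \<bar>\<xi> i \<omega>\<bar> \<le> C"
  using assms by (auto simp: elem_def)

lemma elem_mean_zero:
  assumes e: "elem n \<alpha> \<beta> \<xi>" shows "(\<integral>\<omega>. elem_int n \<alpha> \<beta> \<xi> \<omega> \<partial>P) = 0"
proof -
  have z: "integrable P (\<lambda>\<omega>. \<xi> i \<omega> * (W (\<beta> i) \<omega> - W (\<alpha> i) \<omega>)) \<and> (\<integral>\<omega>. \<xi> i \<omega> * (W (\<beta> i) \<omega> - W (\<alpha> i) \<omega>) \<partial>P) = 0"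
    if "i < n" for i
  proof -
    note i = elemD[OF e that]
    obtain C where C: "\<forall>\<omega>\<in>space P. \<bar>\<xi> i \<omega>\<bar> \<le> C" using i(5) by blast
    then have "integrable P (\<xi> i)"
      using F_measurable[OF i(1,4)] by (intro integrable_const_bound[where B=C]) auto
    then show ?thesis using increment_mean_zero[OF i(1,2,4)] by auto
  qed
  then show ?thesis unfolding elem_int_def by (subst Bochner_Integration.integral_sum) auto
qed

text \<open>One and the same sequence approximates the integrand in L2 of \<open>R\<close> and the
  integral at every time in L2 of \<open>P\<close>, so identities between the two inner products
  pass to the limit.\<close>

definition ito_approx :: "(real \<Rightarrow> 'a \<Rightarrow> real) \<Rightarrow> (real \<Rightarrow> 'a \<Rightarrow> real) \<Rightarrow> (nat \<Rightarrow> nat) \<Rightarrow> (nat \<Rightarrow> nat \<Rightarrow> real) \<Rightarrow> (nat \<Rightarrow> nat \<Rightarrow> 'a \<Rightarrow> real) \<Rightarrow> bool" where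
  "ito_approx Z I n ts \<xi> \<longleftrightarrow> (\<forall>k. simple_integrand P F T (n k) (ts k) (\<xi> k)) \<and>
     L2_tendsto R (\<lambda>k w. simple_process (n k) (ts k) (\<xi> k) (fst w) (snd w)) (\<lambda>w. Z (fst w) (snd w)) \<and>
     (\<forall>t\<in>{0..T}. L2_tendsto P (\<lambda>k. simple_integral W (n k) (ts k) (\<xi> k) t) (I t))"

lemma elem_L2:
  assumes "elem n \<alpha> \<beta> \<xi>"
  shows "integrable P (\<lambda>\<omega>. (elem_int n \<alpha> \<beta> \<xi> \<omega>)\<^sup>2)" "integrable R (\<lambda>w. (elem_proc n \<alpha> \<beta> \<xi> w)\<^sup>2)"
  using elem_isometry(1,2)[OF assms assms] by (simp_all add: power2_eq_square)

lemma ito_approx_exists: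
  assumes h: "has_ito_integral P F W T Z I" and Z: "(\<lambda>w. Z (fst w) (snd w)) \<in> borel_measurable R"
  obtains n ts \<xi> where "ito_approx Z I n ts \<xi>"
proof -
  obtain n ts \<xi> where s: "\<And>k. simple_integrand P F T (n k) (ts k) (\<xi> k)"
    and lz: "(\<lambda>k. \<integral>\<^sup>+\<omega>. (\<integral>\<^sup>+t\<in>{0..T}.
            ennreal ((simple_process (n k) (ts k) (\<xi> k) t \<omega> - Z t \<omega>)\<^sup>2) \<partial>lborel) \<partial>P) \<longlonglongrightarrow> 0"
    and li: "\<And>t. t \<in> {0..T} \<Longrightarrow> (\<lambda>k. \<integral>\<^sup>+\<omega>.
            ennreal ((simple_integral W (n k) (ts k) (\<xi> k) t \<omega> - I t \<omega>)\<^sup>2) \<partial>P) \<longlonglongrightarrow> 0"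
    using h unfolding has_ito_integral_def by blast
  have IP: "I t \<in> borel_measurable P" if "t \<in> {0..T}" for t
  proof (rule F_measurable)
    show "I t \<in> borel_measurable (F t)" using h that unfolding has_ito_integral_def by blast
  qed (use that in auto)
  have T0: "0 \<in> {0..T}" using T_pos by auto
  have e: "elem (n k) (\<lambda>i. max r (ts k i)) (\<lambda>i. max r (ts k (Suc i))) (\<lambda>i \<omega>. 1 * \<xi> k i \<omega>)" if "r \<in> {0..T}" for k r
    by (rule simple_elem[OF s that, where c=1]) auto
  have sp: "simple_process (n k) (ts k) (\<xi> k) (fst w) (snd w) = 
      elem_proc (n k) (\<lambda>i. max 0 (ts k i)) (\<lambda>i. max 0 (ts k (Suc i))) (\<lambda>i \<omega>. 1 * \<xi> k i \<omega>) w" if w: "w \<in> space R" for k w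
  proof -
    have "simple_process (n k) (ts k) (\<xi> k) (fst w) (snd w) = 1 * indicator {0<..T} (fst w) * simple_process (n k) (ts k) (\<xi> k) (fst w) (snd w)"
    proof (cases "fst w = 0")
      case True
      have "simple_process (n k) (ts k) (\<xi> k) 0 (snd w) = 0"
        unfolding simple_process_def
      proof (rule sum.neutral, rule ballI)
        fix i assume "i \<in> {..<n k}"
        then have "0 \<le> ts k i" using simple_integrand_bounds[OF s] by auto
        then show "\<xi> k i (snd w) * indicator {ts k i<..ts k (Suc i)} 0 = 0" by auto
      qed
      then show ?thesis using True by simp
    next
      case False
      then show ?thesis using w by auto
    qed
    from this simple_elem_proc[OF s T0 w, of "\<lambda>_. 1"] show ?thesis by (rule trans)
  qed
  have pm: "(\<lambda>w. simple_process (n k) (ts k) (\<xi> k) (fst w) (snd w)) \<in> borel_measurable R" for k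
    using elem_measurable(2)[OF e[OF T0, of k]] by (rule measurable_cong[THEN iffD1, rotated]) (rule sp[symmetric])
  have L1: "L2_tendsto R (\<lambda>k w. simple_process (n k) (ts k) (\<xi> k) (fst w) (snd w)) (\<lambda>w. Z (fst w) (snd w))"
    unfolding L2_tendsto_def
  proof (intro conjI allI Z pm)
    fix k
    show "integrable R (\<lambda>w. (simple_process (n k) (ts k) (\<xi> k) (fst w) (snd w))\<^sup>2)"
      using elem_L2(2)[OF e[OF T0, of k]] by (rule Bochner_Integration.integrable_cong[THEN iffD1, OF refl, rotated]) (simp add: sp)
  next
    have "(\<integral>\<^sup>+w. ennreal ((simple_process (n k) (ts k) (\<xi> k) (fst w) (snd w) - Z (fst w) (snd w))\<^sup>2) \<partial>R)
      = (\<integral>\<^sup>+\<omega>. (\<integral>\<^sup>+t\<in>{0..T}. ennreal ((simple_process (n k) (ts k) (\<xi> k) t \<omega> - Z t \<omega>)\<^sup>2) \<partial>lborel) \<partial>P)" for k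
      unfolding nn_set_integral_lbT using pm Z by (subst nn_integral_R(1)) auto
    then show "(\<lambda>k. \<integral>\<^sup>+w. ennreal ((simple_process (n k) (ts k) (\<xi> k) (fst w) (snd w) - Z (fst w) (snd w))\<^sup>2) \<partial>R) \<longlonglongrightarrow> 0"
      using lz by simp
  qed
  have z0: "simple_integral W (n k) (ts k) (\<xi> k) 0 \<omega> = 0" for k \<omega>
    unfolding simple_integral_def
  proof (rule sum.neutral, rule ballI)
    fix i assume "i \<in> {..<n k}"
    then have "0 \<le> ts k i" "0 \<le> ts k (Suc i)" using simple_integrand_bounds[OF s] by auto
    then show "\<xi> k i \<omega> * (W (min 0 (ts k (Suc i))) \<omega> - W (min 0 (ts k i)) \<omega>) = 0" by simp
  qed
  have L2: "L2_tendsto P (\<lambda>k. simple_integral W (n k) (ts k) (\<xi> k) t) (I t)" if t: "t \<in> {0..T}" for t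
  proof -
    \<comment> \<open>The integral up to t is the integral over (0, T] minus that over (t, T], both
      elementary; this gives its measurability and square integrability.\<close>
    have eq: "simple_integral W (n k) (ts k) (\<xi> k) t = (\<lambda>\<omega>. elem_int (n k) (\<lambda>i. max 0 (ts k i)) (\<lambda>i. max 0 (ts k (Suc i))) (\<lambda>i \<omega>. 1 * \<xi> k i \<omega>) \<omega> - 
       elem_int (n k) (\<lambda>i. max t (ts k i)) (\<lambda>i. max t (ts k (Suc i))) (\<lambda>i \<omega>. 1 * \<xi> k i \<omega>) \<omega>)" for k
    proof
      fix \<omega>
      show "simple_integral W (n k) (ts k) (\<xi> k) t \<omega> = elem_int (n k) (\<lambda>i. max 0 (ts k i)) (\<lambda>i. max 0 (ts k (Suc i))) (\<lambda>i \<omega>. 1 * \<xi> k i \<omega>) \<omega> - 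
        elem_int (n k) (\<lambda>i. max t (ts k i)) (\<lambda>i. max t (ts k (Suc i))) (\<lambda>i \<omega>. 1 * \<xi> k i \<omega>) \<omega>"
        using simple_elem_int[OF s[of k] T0, of "\<lambda>_. 1" \<omega>] simple_elem_int[OF s[of k] t, of "\<lambda>_. 1" \<omega>] z0[of k \<omega>]
        by (simp only: mult_1)
    qed
    show ?thesis
      unfolding L2_tendsto_def
      using IP[OF t] elem_measurable(1)[OF e[OF T0]] elem_measurable(1)[OF e[OF t]] elem_L2(1)[OF e[OF T0]] elem_L2(1)[OF e[OF t]] li[OF t]
      by (simp add: eq L2_add_integrable)
  qed
  show ?thesis by (rule that[of n ts \<xi>]) (use s L1 L2 in \<open>simp add: ito_approx_def\<close>)
qed

lemma ito_L2:
  assumes h: "has_ito_integral P F W T Z I" and Z: "(\<lambda>w. Z (fst w) (snd w)) \<in> borel_measurable R" and t: "t \<in> {0..T}"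
  shows "I t \<in> borel_measurable P" "integrable P (\<lambda>\<omega>. (I t \<omega>)\<^sup>2)" "integrable P (I t)"
    "integrable R (\<lambda>w. (Z (fst w) (snd w))\<^sup>2)"
proof -
  obtain n ts \<xi> where a: "ito_approx Z I n ts \<xi>" using ito_approx_exists[OF h Z] .
  have L: "L2_tendsto P (\<lambda>k. simple_integral W (n k) (ts k) (\<xi> k) t) (I t)" using a t by (simp add: ito_approx_def)
  show m: "I t \<in> borel_measurable P" using L by (simp add: L2_tendsto_def)
  show sq: "integrable P (\<lambda>\<omega>. (I t \<omega>)\<^sup>2)" by (rule L2_tendsto_integrable[OF L])
  show "integrable P (I t)" by (rule square_integrable_imp_integrable[OF m sq])
  have "L2_tendsto R (\<lambda>k w. simple_process (n k) (ts k) (\<xi> k) (fst w) (snd w)) (\<lambda>w. Z (fst w) (snd w))"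
    using a by (simp add: ito_approx_def)
  then show "integrable R (\<lambda>w. (Z (fst w) (snd w))\<^sup>2)" by (rule L2_tendsto_integrable)
qed

text \<open>Localisation by a factor m known at time r. It yields the martingale property, the
  conditional second moment bound and, with r = 0 and m = 1, the isometry.\<close>

lemma ito_increment:
  assumes a: "ito_approx Z I n ts \<xi>" and r: "r \<in> {0..T}"
    and m: "m \<in> borel_measurable (F r)" "\<forall>\<omega>\<in>space P. \<bar>m \<omega>\<bar> \<le> c"
  defines "S \<equiv> \<lambda>k. elem_int (n k) (\<lambda>i. max r (ts k i)) (\<lambda>i. max r (ts k (Suc i))) (\<lambda>i \<omega>. m \<omega> * \<xi> k i \<omega>)"
    and "E \<equiv> \<lambda>k. elem_proc (n k) (\<lambda>i. max r (ts k i)) (\<lambda>i. max r (ts k (Suc i))) (\<lambda>i \<omega>. m \<omega> * \<xi> k i \<omega>)"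
  shows "elem (n k) (\<lambda>i. max r (ts k i)) (\<lambda>i. max r (ts k (Suc i))) (\<lambda>i \<omega>. m \<omega> * \<xi> k i \<omega>)"
    and "L2_tendsto P S (\<lambda>\<omega>. m \<omega> * (I T \<omega> - I r \<omega>))"
    and "L2_tendsto R E (\<lambda>w. m (snd w) * indicator {r<..T} (fst w) * Z (fst w) (snd w))"
proof -
  have s: "simple_integrand P F T (n k) (ts k) (\<xi> k)" for k using a by (simp add: ito_approx_def)
  show "elem (n k) (\<lambda>i. max r (ts k i)) (\<lambda>i. max r (ts k (Suc i))) (\<lambda>i \<omega>. m \<omega> * \<xi> k i \<omega>)"
    using m(2) by (intro simple_elem[OF s r m(1), of c]) auto
  have Tin: "T \<in> {0..T}" using T_pos by auto
  have mP: "m \<in> borel_measurable P" using F_measurable[OF _ m(1)] r by auto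
  have "L2_tendsto P (\<lambda>k \<omega>. m \<omega> * (simple_integral W (n k) (ts k) (\<xi> k) T \<omega> - simple_integral W (n k) (ts k) (\<xi> k) r \<omega>)) (\<lambda>\<omega>. m \<omega> * (I T \<omega> - I r \<omega>))"
    using a r Tin m(2) by (intro L2_tendsto_mult_bounded[where c=c] L2_tendsto_diff mP) (auto simp: ito_approx_def)
  then show "L2_tendsto P S (\<lambda>\<omega>. m \<omega> * (I T \<omega> - I r \<omega>))"
    unfolding S_def 
  proof (rule L2_tendsto_cong)
    fix k \<omega>
    show "m \<omega> * (simple_integral W (n k) (ts k) (\<xi> k) T \<omega> - simple_integral W (n k) (ts k) (\<xi> k) r \<omega>) =
      elem_int (n k) (\<lambda>i. max r (ts k i)) (\<lambda>i. max r (ts k (Suc i))) (\<lambda>i \<omega>. m \<omega> * \<xi> k i \<omega>) \<omega>"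
      by (rule simple_elem_int[OF s[of k] r])
  qed
  have c0: "0 \<le> c"
  proof -
    obtain \<omega> where "\<omega> \<in> space P" using not_empty by auto
    then have "\<bar>m \<omega>\<bar> \<le> c" using m(2) by simp
    then show ?thesis by simp
  qed
  have "L2_tendsto R (\<lambda>k w. (m (snd w) * indicator {r<..T} (fst w)) * simple_process (n k) (ts k) (\<xi> k) (fst w) (snd w))
    (\<lambda>w. (m (snd w) * indicator {r<..T} (fst w)) * Z (fst w) (snd w))"
  proof (rule L2_tendsto_mult_bounded)
    show "L2_tendsto R (\<lambda>k w. simple_process (n k) (ts k) (\<xi> k) (fst w) (snd w)) (\<lambda>w. Z (fst w) (snd w))"
      using a by (simp add: ito_approx_def)
    show "(\<lambda>w. m (snd w) * indicator {r<..T} (fst w)) \<in> borel_measurable R" using mP by measurable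
    show "\<bar>m (snd w) * indicator {r<..T} (fst w)\<bar> \<le> c" if "w \<in> space R" for w
      using m(2) that c0 by (auto split: split_indicator)
  qed
  then show "L2_tendsto R E (\<lambda>w. m (snd w) * indicator {r<..T} (fst w) * Z (fst w) (snd w))"
    unfolding E_def 
  proof (rule L2_tendsto_cong)
    fix k w assume w: "w \<in> space R"
    show "m (snd w) * indicator {r<..T} (fst w) * simple_process (n k) (ts k) (\<xi> k) (fst w) (snd w) =
      elem_proc (n k) (\<lambda>i. max r (ts k i)) (\<lambda>i. max r (ts k (Suc i))) (\<lambda>i \<omega>. m \<omega> * \<xi> k i \<omega>) w"
      by (rule simple_elem_proc[OF s[of k] r w])
  qed
qed

lemma ito_orthogonal:
  assumes h: "has_ito_integral P F W T Z I" and Z: "(\<lambda>w. Z (fst w) (snd w)) \<in> borel_measurable R" and r: "r \<in> {0..T}"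
    and m: "m \<in> borel_measurable (F r)" "\<And>\<omega>. \<omega> \<in> space P \<Longrightarrow> \<bar>m \<omega>\<bar> \<le> c"
  shows "(\<integral>\<omega>. m \<omega> * (I T \<omega> - I r \<omega>) \<partial>P) = 0"
proof -
  obtain n ts \<xi> where a: "ito_approx Z I n ts \<xi>" using ito_approx_exists[OF h Z] .
  have "\<forall>\<omega>\<in>space P. \<bar>m \<omega>\<bar> \<le> c" using m(2) by blast
  note inc = ito_increment[OF a r m(1) this]
  from L2_tendsto_inner[OF inc(2) L2_tendsto_const[of "\<lambda>_. 1"]]
  have "(\<lambda>k. \<integral>\<omega>. elem_int (n k) (\<lambda>i. max r (ts k i)) (\<lambda>i. max r (ts k (Suc i))) (\<lambda>i \<omega>. m \<omega> * \<xi> k i \<omega>) \<omega> \<partial>P) \<longlonglongrightarrow> (\<integral>\<omega>. m \<omega> * (I T \<omega> - I r \<omega>) \<partial>P)"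
    by simp
  then show ?thesis unfolding elem_mean_zero[OF inc(1)] using LIMSEQ_unique tendsto_const by blast
qed

text \<open>The estimate E[(I_T - I_r)^2 | F_r] \<le> C^2 T in tested form. The isometry is applied
  to m (I_T - I_r) against I_T - I_r, so the weight m enters one factor only and its square never
  appears.\<close>

lemma ito_conditional_second_moment:
  assumes h: "has_ito_integral P F W T Z I" and Z: "(\<lambda>w. Z (fst w) (snd w)) \<in> borel_measurable R" and r: "r \<in> {0..T}"
    and m: "m \<in> borel_measurable (F r)" "\<And>\<omega>. \<omega> \<in> space P \<Longrightarrow> 0 \<le> m \<omega> \<and> m \<omega> \<le> c"
    and C: "\<And>w. w \<in> space R \<Longrightarrow> \<bar>Z (fst w) (snd w)\<bar> \<le> C"
  shows "integrable P (\<lambda>\<omega>. m \<omega> * (I T \<omega> - I r \<omega>)\<^sup>2)"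
    and "(\<integral>\<omega>. m \<omega> * (I T \<omega> - I r \<omega>)\<^sup>2 \<partial>P) \<le> C\<^sup>2 * T * (\<integral>\<omega>. m \<omega> \<partial>P)"
proof -
  obtain n ts \<xi> where a: "ito_approx Z I n ts \<xi>" using ito_approx_exists[OF h Z] .
  have mc: "\<forall>\<omega>\<in>space P. \<bar>m \<omega>\<bar> \<le> c" using m(2) by auto
  have mP[measurable]: "m \<in> borel_measurable P" using F_measurable[OF _ m(1)] r by auto
  note inc = ito_increment[OF a r m(1) mc]
  have one: "(\<lambda>_. 1) \<in> borel_measurable (F r)" "\<forall>\<omega>\<in>space P. \<bar>1::real\<bar> \<le> 1" by auto
  note i1 = ito_increment[OF a r one]
  have l1: "(\<lambda>k. \<integral>\<omega>. elem_int (n k) (\<lambda>i. max r (ts k i)) (\<lambda>i. max r (ts k (Suc i))) (\<lambda>i \<omega>. m \<omega> * \<xi> k i \<omega>) \<omega> *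
      elem_int (n k) (\<lambda>i. max r (ts k i)) (\<lambda>i. max r (ts k (Suc i))) (\<lambda>i \<omega>. 1 * \<xi> k i \<omega>) \<omega> \<partial>P)
    \<longlonglongrightarrow> (\<integral>\<omega>. m \<omega> * (I T \<omega> - I r \<omega>) * (1 * (I T \<omega> - I r \<omega>)) \<partial>P)"
    by (rule L2_tendsto_inner[OF inc(2) i1(2)])
  have l2: "(\<lambda>k. \<integral>w. elem_proc (n k) (\<lambda>i. max r (ts k i)) (\<lambda>i. max r (ts k (Suc i))) (\<lambda>i \<omega>. m \<omega> * \<xi> k i \<omega>) w *
      elem_proc (n k) (\<lambda>i. max r (ts k i)) (\<lambda>i. max r (ts k (Suc i))) (\<lambda>i \<omega>. 1 * \<xi> k i \<omega>) w \<partial>R)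
    \<longlonglongrightarrow> (\<integral>w. m (snd w) * indicator {r<..T} (fst w) * Z (fst w) (snd w) * (1 * indicator {r<..T} (fst w) * Z (fst w) (snd w)) \<partial>R)"
    by (rule L2_tendsto_inner[OF inc(3) i1(3)])
  have eq: "(\<integral>\<omega>. m \<omega> * (I T \<omega> - I r \<omega>)\<^sup>2 \<partial>P) = (\<integral>w. m (snd w) * indicator {r<..T} (fst w) * (Z (fst w) (snd w))\<^sup>2 \<partial>R)"
    using LIMSEQ_unique[OF l1 l2[folded elem_isometry(3)[OF inc(1) i1(1)]]]
    by (simp add: power2_eq_square mult_ac indicator_inter_arith[symmetric])
  have "integrable P (\<lambda>\<omega>. m \<omega> * (I T \<omega> - I r \<omega>) * (1 * (I T \<omega> - I r \<omega>)))"
    using L2_tendsto_integrable[OF inc(2)] L2_tendsto_integrable[OF i1(2)] inc(2) i1(2)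
    by (intro integrable_mult_L2) (auto simp: L2_tendsto_def)
  then show "integrable P (\<lambda>\<omega>. m \<omega> * (I T \<omega> - I r \<omega>)\<^sup>2)" by (simp add: power2_eq_square mult_ac)
  have fm: "finite_measure R" using finite_measure_pair_measure[OF finite_measure_axioms finite_measure_lbT] .
  have mi: "integrable R (\<lambda>w. C\<^sup>2 * m (snd w))"
    using mc by (intro integrable_mult_right finite_measure.integrable_const_bound[OF fm, where B=c]) (auto intro!: AE_I2)
  have "(\<integral>w. m (snd w) * indicator {r<..T} (fst w) * (Z (fst w) (snd w))\<^sup>2 \<partial>R) \<le> (\<integral>w. C\<^sup>2 * m (snd w) \<partial>R)"
  proof (rule integral_mono')
    show "integrable R (\<lambda>w. C\<^sup>2 * m (snd w))" by (rule mi)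
    fix w assume w: "w \<in> space R"
    have "(Z (fst w) (snd w))\<^sup>2 \<le> C\<^sup>2" using C[OF w] by (simp add: abs_le_square_iff[symmetric] order_trans[OF _ abs_ge_self])
    then have "m (snd w) * (Z (fst w) (snd w))\<^sup>2 \<le> m (snd w) * C\<^sup>2" using m(2) w by (intro mult_left_mono) auto
    then show "m (snd w) * indicator {r<..T} (fst w) * (Z (fst w) (snd w))\<^sup>2 \<le> C\<^sup>2 * m (snd w)"
      using m(2) w by (auto simp: mult.commute split: split_indicator)
    show "0 \<le> C\<^sup>2 * m (snd w)" using m(2) w by auto
  qed
  also have "\<dots> = C\<^sup>2 * T * (\<integral>\<omega>. m \<omega> \<partial>P)"
  proof -
    have "measure lbT (space lbT) = T"
      using T_pos by (simp add: measure_restrict_space space_restrict_space)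
    then show ?thesis unfolding integral_R(1)[OF mi] by simp
  qed
  finally show "(\<integral>\<omega>. m \<omega> * (I T \<omega> - I r \<omega>)\<^sup>2 \<partial>P) \<le> C\<^sup>2 * T * (\<integral>\<omega>. m \<omega> \<partial>P)" unfolding eq .
qed

text \<open>An unbounded weight is reached by truncation and Fatou's lemma; the weight of interest
  is \<lambda>_t.\<close>

lemma ito_conditional_second_moment_nn:
  assumes h: "has_ito_integral P F W T Z I" and Z: "(\<lambda>w. Z (fst w) (snd w)) \<in> borel_measurable R" and r: "r \<in> {0..T}"
    and m: "m \<in> borel_measurable (F r)" "\<And>\<omega>. \<omega> \<in> space P \<Longrightarrow> 0 \<le> m \<omega>"
    and C: "\<And>w. w \<in> space R \<Longrightarrow> \<bar>Z (fst w) (snd w)\<bar> \<le> C"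
  shows "(\<integral>\<^sup>+\<omega>. ennreal (m \<omega> * (I T \<omega> - I r \<omega>)\<^sup>2) \<partial>P) \<le> ennreal (C\<^sup>2 * T) * (\<integral>\<^sup>+\<omega>. ennreal (m \<omega>) \<partial>P)"
proof -
  let ?c = "ennreal (C\<^sup>2 * T) * (\<integral>\<^sup>+\<omega>. ennreal (m \<omega>) \<partial>P)"
  let ?m = "\<lambda>k \<omega>. min (m \<omega>) (real k)"
  have Tin: "T \<in> {0..T}" using T_pos by auto
  have mP[measurable]: "m \<in> borel_measurable P" using F_measurable[OF _ m(1)] r by auto
  note [measurable] = ito_L2(1)[OF h Z r] ito_L2(1)[OF h Z Tin]
  have le: "(\<integral>\<^sup>+\<omega>. ennreal (?m k \<omega> * (I T \<omega> - I r \<omega>)\<^sup>2) \<partial>P) \<le> ?c" for k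
  proof -
    have mk: "?m k \<in> borel_measurable (F r)" "\<And>\<omega>. \<omega> \<in> space P \<Longrightarrow> 0 \<le> ?m k \<omega> \<and> ?m k \<omega> \<le> real k"
      using m by auto
    note b = ito_conditional_second_moment[OF h Z r mk C]
    have mi: "integrable P (?m k)" using mk(2) by (intro integrable_const_bound[where B="real k"]) (auto intro!: AE_I2)
    have "(\<integral>\<^sup>+\<omega>. ennreal (?m k \<omega> * (I T \<omega> - I r \<omega>)\<^sup>2) \<partial>P) = ennreal (\<integral>\<omega>. ?m k \<omega> * (I T \<omega> - I r \<omega>)\<^sup>2 \<partial>P)"
      using b(1) mk(2) by (intro nn_integral_eq_integral AE_I2) auto
    also have "\<dots> \<le> ennreal (C\<^sup>2 * T * (\<integral>\<omega>. ?m k \<omega> \<partial>P))" using b(2) by (rule ennreal_leI)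
    also have "\<dots> = ennreal (C\<^sup>2 * T) * (\<integral>\<^sup>+\<omega>. ennreal (?m k \<omega>) \<partial>P)"
      using mi mk(2) T_pos by (subst nn_integral_eq_integral) (auto simp: ennreal_mult' intro!: AE_I2)
    also have "\<dots> \<le> ?c" by (intro mult_left_mono nn_integral_mono ennreal_leI) auto
    finally show ?thesis .
  qed
  have "(\<integral>\<^sup>+\<omega>. ennreal (m \<omega> * (I T \<omega> - I r \<omega>)\<^sup>2) \<partial>P) = (\<integral>\<^sup>+\<omega>. liminf (\<lambda>k. ennreal (?m k \<omega> * (I T \<omega> - I r \<omega>)\<^sup>2)) \<partial>P)"
  proof (rule nn_integral_cong)
    fix \<omega>
    have "eventually (\<lambda>k. ?m k \<omega> = m \<omega>) sequentially"
      using eventually_ge_at_top[of "nat \<lceil>m \<omega>\<rceil>"] by eventually_elim (auto simp: min_def nat_le_iff ceiling_le_iff)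
    then have "(\<lambda>k. ennreal (?m k \<omega> * (I T \<omega> - I r \<omega>)\<^sup>2)) \<longlonglongrightarrow> ennreal (m \<omega> * (I T \<omega> - I r \<omega>)\<^sup>2)"
      by (intro tendsto_ennrealI tendsto_mult tendsto_const tendsto_eventually)
    then show "ennreal (m \<omega> * (I T \<omega> - I r \<omega>)\<^sup>2) = liminf (\<lambda>k. ennreal (?m k \<omega> * (I T \<omega> - I r \<omega>)\<^sup>2))"
      using lim_imp_Liminf[OF sequentially_bot] by metis
  qed
  also have "\<dots> \<le> liminf (\<lambda>k. \<integral>\<^sup>+\<omega>. ennreal (?m k \<omega> * (I T \<omega> - I r \<omega>)\<^sup>2) \<partial>P)"
    by (intro nn_integral_liminf) measurable
  also have "\<dots> \<le> liminf (\<lambda>k. ?c)" using le by (intro Liminf_mono always_eventually) auto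
  also have "\<dots> = ?c" by (intro Liminf_const) auto
  finally show ?thesis .
qed

theorem ito_isometry:
  assumes h: "has_ito_integral P F W T Z I" "(\<lambda>w. Z (fst w) (snd w)) \<in> borel_measurable R"
    and h': "has_ito_integral P F W T Z' I'" "(\<lambda>w. Z' (fst w) (snd w)) \<in> borel_measurable R"
  shows "(\<integral>\<omega>. (I T \<omega> - I 0 \<omega>) * (I' T \<omega> - I' 0 \<omega>) \<partial>P) = (\<integral>w. Z (fst w) (snd w) * Z' (fst w) (snd w) \<partial>R)"
proof -
  have T0: "0 \<in> {0..T}" using T_pos by auto
  obtain n ts \<xi> where a: "ito_approx Z I n ts \<xi>" using ito_approx_exists[OF h] .
  obtain n' ts' \<xi>' where a': "ito_approx Z' I' n' ts' \<xi>'" using ito_approx_exists[OF h'] .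
  have one: "(\<lambda>_. 1) \<in> borel_measurable (F 0)" "\<forall>\<omega>\<in>space P. \<bar>1::real\<bar> \<le> 1" by auto
  note i = ito_increment[OF a T0 one] and i' = ito_increment[OF a' T0 one]
  have "(\<integral>\<omega>. 1 * (I T \<omega> - I 0 \<omega>) * (1 * (I' T \<omega> - I' 0 \<omega>)) \<partial>P) = 
    (\<integral>w. 1 * indicator {0<..T} (fst w) * Z (fst w) (snd w) * (1 * indicator {0<..T} (fst w) * Z' (fst w) (snd w)) \<partial>R)"
    by (rule LIMSEQ_unique[OF L2_tendsto_inner[OF i(2) i'(2)]
      L2_tendsto_inner[OF i(3) i'(3), folded elem_isometry(3)[OF i(1) i'(1)]]])
  \<comment> \<open>The localisation to (0, T] removes only the slice at time 0, which is
    null.\<close>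
  also have "\<dots> = (\<integral>w. Z (fst w) (snd w) * Z' (fst w) (snd w) \<partial>R)"
  proof (rule integral_cong_AE)
    have "AE t in lbT. AE \<omega> in P. fst (t, \<omega>) \<noteq> 0"
    proof -
      have "AE t in lbT. t \<noteq> 0"
        by (subst AE_restrict_space_iff) (use AE_lborel_singleton[of 0] in \<open>auto elim: eventually_mono\<close>)
      then show ?thesis by eventually_elim simp
    qed
    moreover have "{w \<in> space R. fst w \<noteq> 0} \<in> sets R" by measurable
    ultimately have "AE w in R. fst w \<noteq> 0" by (rule TP.AE_pair_measure[rotated])
    then show "AE w in R. 1 * indicator {0<..T} (fst w) * Z (fst w) (snd w) * (1 * indicator {0<..T} (fst w) * Z' (fst w) (snd w)) = Z (fst w) (snd w) * Z' (fst w) (snd w)"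
      using AE_space by eventually_elim (auto split: split_indicator)
  qed (use h(2) h'(2) in measurable)
  finally show ?thesis by simp
qed

end

section \<open>Orthogonality of the Brownian motion and the jump martingale\<close>

sublocale default_horizon \<subseteq> brownian_horizon P "default_filtration P W \<tau>" T W
  by unfold_locales (rule brownian)

context default_horizon begin

lemma tau_stopping:
  assumes "0 \<le> x" shows "{\<omega> \<in> space P. \<tau> \<omega> \<le> x} \<in> sets (F x)"
proof -
  have "{\<omega> \<in> space P. \<tau> \<omega> \<le> x} = default_indicator \<tau> x -` {1} \<inter> space P"
    by (auto simp: default_indicator_def split: if_splits)
  also have "\<dots> \<in> sets (F x)"
    unfolding sets_default_filtration using assms
    by (intro sigma_sets.Basic UnI1 UnI2 CollectI exI[of _ x] exI[of _ "{1}"]) auto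
  finally show ?thesis .
qed

lemma tau_stopping_mono: "0 \<le> x \<Longrightarrow> x \<le> t \<Longrightarrow> {\<omega> \<in> space P. \<tau> \<omega> \<le> x} \<in> sets (F t)"
  using tau_stopping[of x] F_mono[of x t] by auto

text \<open>On the event \<tau> \<le> t the map \<omega> to (\<tau>, \<omega>) is
  \<open>F t\<close>-measurable into the predictable sets. The preimage of (r, r'] \<times> A with A
  in \<open>F r\<close> is A intersected with r < \<tau> \<le> min r' t, which is known at time t if
  r < t and is empty otherwise.\<close>

lemma jump_adapted:
  assumes \<kappa>: "pred \<kappa>" and t: "t \<in> {0..T}" and s: "0 \<le> s" "s \<le> t"
  shows "(\<lambda>\<omega>. if s < \<tau> \<omega> \<and> \<tau> \<omega> \<le> t then \<kappa> (\<tau> \<omega>) \<omega> else 0) \<in> borel_measurable (F t)"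
proof -
  have t0: "0 \<le> t" using t by simp
  let ?M = "restrict_space (F t) {\<omega>. \<tau> \<omega> \<le> t}"
  have spM: "space ?M = {\<omega> \<in> space P. \<tau> \<omega> \<le> t}" using space_F[OF t0] by (auto simp: space_restrict_space)
  have inM: "A \<in> sets (F t) \<Longrightarrow> A \<subseteq> {\<omega>. \<tau> \<omega> \<le> t} \<Longrightarrow> A \<in> sets ?M" for A
    using tau_stopping[OF t0] space_F[OF t0] by (subst sets_restrict_space_iff) (auto simp: Int_def conj_commute)
  have map: "(\<lambda>\<omega>. (\<tau> \<omega>, \<omega>)) \<in> measurable ?M PR"
  proof (rule measurable_restrict_space2)
    show "(\<lambda>\<omega>. (\<tau> \<omega>, \<omega>)) \<in> space ?M \<rightarrow> {0..T} \<times> space P"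
      using t tau_positive by (auto simp: spM less_imp_le intro: order_trans)
    show "(\<lambda>\<omega>. (\<tau> \<omega>, \<omega>)) \<in> measurable ?M (predictable_sigma P F)"
    proof (rule measurable_predictableI)
      fix A assume "A \<in> sets (F 0)"
      have "(\<lambda>\<omega>. (\<tau> \<omega>, \<omega>)) -` ({0} \<times> A) \<inter> space ?M = {}" using tau_positive by (fastforce simp: spM)
      then show "(\<lambda>\<omega>. (\<tau> \<omega>, \<omega>)) -` ({0} \<times> A) \<inter> space ?M \<in> sets ?M" by (simp only: sets.empty_sets)
    next
      fix r r' A assume r: "0 \<le> r" "r < (r'::real)" and A: "A \<in> sets (F r)"
      show "(\<lambda>\<omega>. (\<tau> \<omega>, \<omega>)) -` ({r<..r'} \<times> A) \<inter> space ?M \<in> sets ?M"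
      proof (cases "r < t")
        case False
        then have "(\<lambda>\<omega>. (\<tau> \<omega>, \<omega>)) -` ({r<..r'} \<times> A) \<inter> space ?M = {}" by (auto simp: spM)
        then show ?thesis by (simp only: sets.empty_sets)
      next
        case True
        have A': "A \<in> sets (F t)" using F_mono[of r t] A r True by auto
        have eq: "(\<lambda>\<omega>. (\<tau> \<omega>, \<omega>)) -` ({r<..r'} \<times> A) \<inter> space ?M =
          A \<inter> ({\<omega> \<in> space P. \<tau> \<omega> \<le> min r' t} - {\<omega> \<in> space P. \<tau> \<omega> \<le> r})"
          using sets.sets_into_space[OF sets_F[OF t0 A']] by (auto simp: spM)
        show ?thesis
        proof (rule inM)
          show "(\<lambda>\<omega>. (\<tau> \<omega>, \<omega>)) -` ({r<..r'} \<times> A) \<inter> space ?M \<in> sets (F t)"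
            unfolding eq using A' r True by (intro sets.Int sets.Diff tau_stopping_mono) auto
        qed (auto simp: spM)
      qed
    qed (use tau_positive in \<open>auto simp: spM less_imp_le\<close>)
  qed
  have "(\<lambda>\<omega>. if \<tau> \<omega> \<le> t then \<kappa> (\<tau> \<omega>) \<omega> else 0) \<in> borel_measurable (F t)"
  proof (rule measurable_If_restrict_space_iff[THEN iffD2])
    show "{x \<in> space (F t). \<tau> x \<le> t} \<in> sets (F t)" using tau_stopping[OF t0] by (simp add: space_F[OF t0])
    from measurable_compose[OF map pred_PR[OF \<kappa>]]
    show "(\<lambda>\<omega>. \<kappa> (\<tau> \<omega>) \<omega>) \<in> borel_measurable ?M \<and> (\<lambda>x. 0) \<in> borel_measurable (restrict_space (F t) {x. \<not> \<tau> x \<le> t})"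
      by simp
  qed
  then have "(\<lambda>\<omega>. if \<tau> \<omega> \<le> s then 0 else (if \<tau> \<omega> \<le> t then \<kappa> (\<tau> \<omega>) \<omega> else 0)) \<in> borel_measurable (F t)"
    by (rule measurable_If[OF borel_measurable_const]) (use tau_stopping_mono[OF s] space_F[OF t0] in simp)
  moreover have "(\<lambda>\<omega>. if \<tau> \<omega> \<le> s then 0 else (if \<tau> \<omega> \<le> t then \<kappa> (\<tau> \<omega>) \<omega> else 0)) = 
    (\<lambda>\<omega>. if s < \<tau> \<omega> \<and> \<tau> \<omega> \<le> t then \<kappa> (\<tau> \<omega>) \<omega> else 0)" by auto
  ultimately show ?thesis by simp
qed

text \<open>The increments of the compensated jump integral need not be shown to be adapted: the
  absolutely continuous part is handled by Fubini, since \<open>\<lambda>\<^sub>r\<close> is \<open>F\<^sub>r\<close>-measurable for every \<open>r\<close>.\<close>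

lemma jmp_past_orthogonal:
  assumes b: "pbounded C \<kappa>" and st: "0 \<le> s" "s \<le> t" "t \<le> T"
    and Y: "integrable P Y" and LY: "integrable P (\<lambda>\<omega>. compensator lam T \<omega> * Y \<omega>)"
    and orth: "\<And>\<xi>. \<xi> \<in> borel_measurable (F t) \<Longrightarrow> (\<And>\<omega>. \<omega> \<in> space P \<Longrightarrow> \<bar>\<xi> \<omega>\<bar> \<le> 1) \<Longrightarrow> (\<integral>\<omega>. \<xi> \<omega> * Y \<omega> \<partial>P) = 0"
  shows "(\<integral>\<omega>. (jmp \<kappa> t \<omega> - jmp \<kappa> s \<omega>) * Y \<omega> \<partial>P) = 0"
proof -
  have \<kappa>: "pred \<kappa>" and C: "0 \<le> C" using b by (auto simp: pbounded_def)
  have tT: "t \<in> {0..T}" using st by auto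
  have YP[measurable]: "Y \<in> borel_measurable P" using Y by auto
  have sub: "subalgebra P (F t)" using F_subalgebra st by auto
  let ?h = "\<lambda>\<omega>. if s < \<tau> \<omega> \<and> \<tau> \<omega> \<le> t then \<kappa> (\<tau> \<omega>) \<omega> else 0"
  have h: "?h \<in> borel_measurable (F t)" by (rule jump_adapted[OF \<kappa> tT st(1,2)])
  have hP: "?h \<in> borel_measurable P" using F_measurable[OF _ h] st by auto
  have hY: "integrable P (\<lambda>\<omega>. ?h \<omega> * Y \<omega>)"
  proof (rule Bochner_Integration.integrable_bound)
    show "integrable P (\<lambda>\<omega>. C * Y \<omega>)" using Y by simp
    show "(\<lambda>\<omega>. ?h \<omega> * Y \<omega>) \<in> borel_measurable P" using hP YP by measurable
    show "AE \<omega> in P. norm (?h \<omega> * Y \<omega>) \<le> norm (C * Y \<omega>)"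
      using b st by (intro AE_I2) (auto simp: pbounded_def abs_mult intro!: mult_right_mono)
  qed
  have 1: "(\<integral>\<omega>. ?h \<omega> * Y \<omega> \<partial>P) = 0"
    by (rule integral_mult_eq_0_of_bounded[OF sub Y orth h hY])
  let ?f = "\<lambda>w. indicator {s<..t} (fst w) * (\<kappa> (fst w) (snd w) * lamw w) * Y (snd w)"
  have LYR: "integrable R (\<lambda>w. lamw w * Y (snd w))" by (rule integrable_lam_mult[OF YP LY])
  have fi: "integrable R ?f"
  proof (rule Bochner_Integration.integrable_bound)
    show "integrable R (\<lambda>w. C * (lamw w * Y (snd w)))" using LYR by simp
    show "?f \<in> borel_measurable R" using pred_R[OF \<kappa>] by measurable
    show "AE w in R. norm (?f w) \<le> norm (C * (lamw w * Y (snd w)))"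
      using b C by (intro AE_I2) (auto simp: pbounded_def abs_mult mult.assoc split: split_indicator intro!: mult_right_mono)
  qed
  have "(\<integral>w. ?f w \<partial>R) = (\<integral>r. \<integral>\<omega>. ?f (r, \<omega>) \<partial>P \<partial>lbT)" by (rule integral_R(2)[OF fi])
  also have "\<dots> = (\<integral>r. 0 \<partial>lbT)"
  proof (rule integral_cong_AE)
    show "AE r in lbT. (\<integral>\<omega>. ?f (r, \<omega>) \<partial>P) = 0"
      using integral_R(3)[OF fi] AE_space
    proof eventually_elim
      case (elim r)
      have r: "r \<in> {0..T}" using elim by (simp add: space_restrict_space)
      show ?case
      proof (cases "r \<in> {s<..t}")
        case True
        have m: "(\<lambda>\<omega>. \<kappa> r \<omega> * lam r \<omega>) \<in> borel_measurable (F r)"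
          using pred_section[OF \<kappa> r] lam_section[OF r] by measurable
        have m': "(\<lambda>\<omega>. \<kappa> r \<omega> * lam r \<omega>) \<in> borel_measurable (F t)"
          using F_measurable_mono[OF _ _ m] True r by auto
        have "(\<integral>\<omega>. \<kappa> r \<omega> * lam r \<omega> * Y \<omega> \<partial>P) = 0"
          using elim True by (intro integral_mult_eq_0_of_bounded[OF sub Y orth m']) auto
        then show ?thesis using True by simp
      qed simp
    qed
  qed (use integral_R(6)[OF fi] in auto)
  finally have 2: "(\<integral>w. ?f w \<partial>R) = 0" by simp
  have eq: "AE \<omega> in P. (jmp \<kappa> t \<omega> - jmp \<kappa> s \<omega>) * Y \<omega> = ?h \<omega> * Y \<omega> - (\<integral>r. ?f (r, \<omega>) \<partial>lbT)"
    using AE_kint_diff[OF pbounded_integrable[OF b]]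
  proof eventually_elim
    case (elim \<omega>)
    have "(\<integral>r. ?f (r, \<omega>) \<partial>lbT) = (kint \<kappa> t \<omega> - kint \<kappa> s \<omega>) * Y \<omega>" using elim st by simp
    moreover have "jmp \<kappa> t \<omega> - jmp \<kappa> s \<omega> = ?h \<omega> - (kint \<kappa> t \<omega> - kint \<kappa> s \<omega>)"
      using st by (auto simp: jmp_def)
    ultimately show ?case by (simp only: left_diff_distrib)
  qed
  have "(\<integral>\<omega>. (jmp \<kappa> t \<omega> - jmp \<kappa> s \<omega>) * Y \<omega> \<partial>P) = (\<integral>\<omega>. ?h \<omega> * Y \<omega> - (\<integral>r. ?f (r, \<omega>) \<partial>lbT) \<partial>P)"
    using eq jmp_measurable[OF \<kappa>, of t] jmp_measurable[OF \<kappa>, of s] st hY integral_R(5)[OF fi]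
    by (intro integral_cong_AE) auto
  also have "\<dots> = 0" using hY integral_R(5)[OF fi] 1 2 integral_R(1)[OF fi] by simp
  finally show ?thesis .
qed

text \<open>105 = 1 * 3 * 5 * 7. The eighth moment arises from Cauchy-Schwarz applied to the fourth
  power of an increment times a function in L2.\<close>

lemma increment_moment_8:
  assumes "0 \<le> a" "a \<le> b" shows "(\<integral>\<omega>. (W b \<omega> - W a \<omega>) ^ 8 \<partial>P) = 105 * (b - a) ^ 4"
proof (cases "a = b")
  case False
  have "(fact 8 :: real) = 40320" "(fact 4 :: real) = 24" by (simp_all add: eval_nat_numeral)
  then show ?thesis
    using False assms increment_moment(2)[of a b 8] integral_normal_moment_even[of "sqrt (b - a)" 0 4]
    by (simp add: power_divide field_simps)
qed simp

lemma mult_bounded_integrable: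
  fixes Y :: "'a \<Rightarrow> real"
  assumes "m \<in> borel_measurable P" "\<And>\<omega>. \<omega> \<in> space P \<Longrightarrow> \<bar>m \<omega>\<bar> \<le> c" and Y: "integrable P Y"
  shows "integrable P (\<lambda>\<omega>. m \<omega> * Y \<omega>)"
proof (rule Bochner_Integration.integrable_bound)
  show "integrable P (\<lambda>\<omega>. c * Y \<omega>)" using Y by simp
  show "AE \<omega> in P. norm (m \<omega> * Y \<omega>) \<le> norm (c * Y \<omega>)"
  proof (rule AE_I2)
    fix \<omega> assume "\<omega> \<in> space P"
    then have "\<bar>m \<omega>\<bar> \<le> \<bar>c\<bar>" using assms(2) abs_ge_self order_trans by blast
    then show "norm (m \<omega> * Y \<omega>) \<le> norm (c * Y \<omega>)" by (simp add: abs_mult mult_right_mono)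
  qed
qed (use assms in auto)

text \<open>On a grid of
  mesh \<open>h\<close> only the diagonal terms \<open>E[\<xi> \<Delta>\<^sub>iW \<Delta>\<^sub>iJ]\<close> survive, and they are controlled by
  \<open>\<bar>\<Delta>\<^sub>iW\<bar> \<le> \<epsilon> + \<Delta>\<^sub>iW\<^sup>4 / \<epsilon>\<^sup>3\<close>, whose second term contributes \<open>O(h)\<close> after summation.\<close>

lemma cross_increment:
  assumes b: "pbounded C \<kappa>" and st: "0 \<le> s" "s \<le> t" "t \<le> T"
    and \<xi>: "\<xi> \<in> borel_measurable (F s)" "\<And>\<omega>. \<omega> \<in> space P \<Longrightarrow> \<bar>\<xi> \<omega>\<bar> \<le> c"
  shows "(\<integral>\<omega>. \<xi> \<omega> * (W t \<omega> - W s \<omega>) * (jmp \<kappa> t \<omega> - jmp \<kappa> s \<omega>) \<partial>P) = 0" (is "?x = 0")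
proof -
  have \<kappa>: "pred \<kappa>" and C: "0 \<le> C" using b by (auto simp: pbounded_def)
  have \<xi>P[measurable]: "\<xi> \<in> borel_measurable P" using F_measurable[OF st(1) \<xi>(1)] .
  have c0: "0 \<le> c"
  proof -
    obtain \<omega> where "\<omega> \<in> space P" using not_empty by auto
    then have "\<bar>\<xi> \<omega>\<bar> \<le> c" by (rule \<xi>(2))
    then show ?thesis by simp
  qed
  \<comment> \<open>\<open>V\<close> dominates the sum of |\<Delta>J| over any partition of [s, t]:
    there is at most one jump, of size at most C, and the rest is at most C times the increase of
    the compensator.\<close>
  define V where "V = (\<lambda>\<omega>. C * (1 + compensator lam T \<omega>))"
  have V0: "\<omega> \<in> space P \<Longrightarrow> 0 \<le> V \<omega>" for \<omega> using C compensator_nonneg by (auto simp: V_def)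
  have VP[measurable]: "V \<in> borel_measurable P" unfolding V_def by measurable
  have Vi: "integrable P V" using power_compensator_integrable[of 1] unfolding V_def by simp
  have V2: "integrable P (\<lambda>\<omega>. (V \<omega>)\<^sup>2)"
    using power_compensator_integrable[of 2] unfolding V_def by (simp add: power_mult_distrib)
  define K where "K = sqrt 105 * sqrt (\<integral>\<omega>. (V \<omega>)\<^sup>2 \<partial>P)"
  have est: "\<bar>?x\<bar> \<le> c * (\<epsilon> * (\<integral>\<omega>. V \<omega> \<partial>P) + K * (t - s)\<^sup>2 / \<epsilon> ^ 3 * (1 / real (Suc N)))" if \<epsilon>: "0 < \<epsilon>" for \<epsilon> N
  proof -
    define h where "h = (t - s) / real (Suc N)"
    have h0: "0 \<le> h" using st by (simp add: h_def)
    define g where "g = (\<lambda>i. s + h * real i)"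
    have gs: "g 0 = s" "g (Suc N) = t" by (simp_all add: g_def h_def)
    have gle: "i \<le> j \<Longrightarrow> g i \<le> g j" for i j using h0 by (simp add: g_def mult_left_mono)
    have gb: "0 \<le> g i" "s \<le> g i" "i \<le> Suc N \<Longrightarrow> g i \<le> T" for i
      using gle[of 0 i] gle[of i "Suc N"] gs st by auto
    have gd: "g (Suc i) - g i = h" for i by (simp add: g_def algebra_simps)
    define D where "D = (\<lambda>i \<omega>. W (g (Suc i)) \<omega> - W (g i) \<omega>)"
    define G where "G = (\<lambda>i \<omega>. jmp \<kappa> (g (Suc i)) \<omega> - jmp \<kappa> (g i) \<omega>)"
    have DP[measurable]: "D i \<in> borel_measurable P" for i
      unfolding D_def using W_measurable[OF gb(1)[of i]] W_measurable[OF gb(1)[of "Suc i"]] by measurable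
    have Dk: "integrable P (\<lambda>\<omega>. D i \<omega> ^ k)" for i k
      unfolding D_def using increment_moments(1)[OF gb(1) gle] by simp
    have GP[measurable]: "G i \<in> borel_measurable P" if "i < Suc N" for i
      unfolding G_def using jmp_measurable[OF \<kappa>, of "g i"] jmp_measurable[OF \<kappa>, of "g (Suc i)"] gb[of i] gb[of "Suc i"] that by auto
    have G2: "integrable P (\<lambda>\<omega>. (G i \<omega>)\<^sup>2)" if "i < Suc N" for i
      unfolding G_def using jmp_square_integrable[OF b, of "g i"] jmp_square_integrable[OF b, of "g (Suc i)"] 
        jmp_measurable[OF \<kappa>, of "g i"] jmp_measurable[OF \<kappa>, of "g (Suc i)"] gb[of i] gb[of "Suc i"] that 
      by (intro L2_add_integrable) auto
    have DG: "integrable P (\<lambda>\<omega>. D i \<omega> * G j \<omega>)" if "j < Suc N" for i j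
      using Dk[of i 2] G2[OF that] GP[OF that] by (intro integrable_mult_L2) auto
    have xDG: "integrable P (\<lambda>\<omega>. \<xi> \<omega> * (D i \<omega> * G j \<omega>))" if "j < Suc N" for i j
      by (rule mult_bounded_integrable[OF \<xi>P \<xi>(2) DG[OF that]])
    \<comment> \<open>If the W-increment comes first, the later jump increment has mean zero given
      what is known at its start. If the jump increment comes first, the later W-increment is
      orthogonal to it by \<open>jmp_past_orthogonal\<close>.\<close>
    have off: "(\<integral>\<omega>. \<xi> \<omega> * (D i \<omega> * G j \<omega>) \<partial>P) = 0" if ij: "i < Suc N" "j < Suc N" "i \<noteq> j" for i j
    proof (cases "i < j")
      case True
      have le: "g (Suc i) \<le> g j" using True by (intro gle) auto
      have aF: "(\<lambda>\<omega>. \<xi> \<omega> * D i \<omega>) \<in> borel_measurable (F (g j))"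
      proof (intro borel_measurable_times)
        show "\<xi> \<in> borel_measurable (F (g j))" using F_measurable_mono[OF st(1) gb(2) \<xi>(1)] .
        have "D i \<in> borel_measurable (F (g (Suc i)))"
          unfolding D_def by (rule increment_measurable[OF gb(1) gle]) simp
        then show "D i \<in> borel_measurable (F (g j))" by (rule F_measurable_mono[OF gb(1) le])
      qed
      have "(\<integral>\<omega>. (\<xi> \<omega> * D i \<omega>) * G j \<omega> \<partial>P) = 0"
      proof (rule integral_mult_eq_0_of_bounded[OF F_subalgebra[OF gb(1)] _ _ aF])
        show "integrable P (G j)"
          using square_integrable_imp_integrable[OF GP G2] ij by auto
        show "(\<integral>\<omega>. \<eta> \<omega> * G j \<omega> \<partial>P) = 0" if "\<eta> \<in> borel_measurable (F (g j))" "\<And>\<omega>. \<omega> \<in> space P \<Longrightarrow> \<bar>\<eta> \<omega>\<bar> \<le> 1" for \<eta>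
          unfolding G_def using ij gb
          by (intro jmp_orthogonal(2)[OF \<kappa> pbounded_integrable[OF b] _ _ _ that(1), where C=1] gle that(2)) auto
        show "integrable P (\<lambda>\<omega>. (\<xi> \<omega> * D i \<omega>) * G j \<omega>)" using xDG[OF ij(2), of i] by (simp add: mult.assoc)
      qed
      then show ?thesis by (simp add: mult.assoc)
    next
      case False
      then have le: "g (Suc j) \<le> g i" using ij by (intro gle) auto
      have "(\<integral>\<omega>. (jmp \<kappa> (g (Suc j)) \<omega> - jmp \<kappa> (g j) \<omega>) * (\<xi> \<omega> * D i \<omega>) \<partial>P) = 0"
      proof (rule jmp_past_orthogonal[OF b])
        show "0 \<le> g j" "g j \<le> g (Suc j)" "g (Suc j) \<le> T" using gb ij gle by auto
        show "integrable P (\<lambda>\<omega>. \<xi> \<omega> * D i \<omega>)"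
          using mult_bounded_integrable[OF \<xi>P \<xi>(2)] Dk[of i 1] by simp
        have "integrable P (\<lambda>\<omega>. compensator lam T \<omega> * D i \<omega>)"
          using Dk[of i 2] compensator_moment_integrable[of 2] by (intro integrable_mult_L2) auto
        then show "integrable P (\<lambda>\<omega>. compensator lam T \<omega> * (\<xi> \<omega> * D i \<omega>))"
          using mult_bounded_integrable[OF \<xi>P \<xi>(2)] by (simp add: mult.left_commute)
        fix \<eta> :: "'a \<Rightarrow> real" assume \<eta>: "\<eta> \<in> borel_measurable (F (g (Suc j)))" "\<And>\<omega>. \<omega> \<in> space P \<Longrightarrow> \<bar>\<eta> \<omega>\<bar> \<le> 1"
        have m: "(\<lambda>\<omega>. \<eta> \<omega> * \<xi> \<omega>) \<in> borel_measurable (F (g i))"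
          using F_measurable_mono[OF st(1) gb(2) \<xi>(1)] F_measurable_mono[OF gb(1) le \<eta>(1)] by measurable
        have "integrable P (\<lambda>\<omega>. \<eta> \<omega> * \<xi> \<omega>)"
          using F_measurable[OF gb(1) \<eta>(1)] \<xi>(2)
          by (intro mult_bounded_integrable[OF _ \<eta>(2)] integrable_const_bound[where B=c]) auto
        from increment_mean_zero(2)[OF gb(1) gle m this, of "Suc i"]
        show "(\<integral>\<omega>. \<eta> \<omega> * (\<xi> \<omega> * D i \<omega>) \<partial>P) = 0" by (simp add: D_def mult.assoc)
      qed
      then show ?thesis by (simp add: G_def mult_ac)
    qed
    have "?x = (\<integral>\<omega>. (\<Sum>i<Suc N. \<Sum>j<Suc N. \<xi> \<omega> * (D i \<omega> * G j \<omega>)) \<partial>P)"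
    proof (rule Bochner_Integration.integral_cong[OF refl])
      fix \<omega>
      have "(\<Sum>i<Suc N. D i \<omega>) = W t \<omega> - W s \<omega>" "(\<Sum>j<Suc N. G j \<omega>) = jmp \<kappa> t \<omega> - jmp \<kappa> s \<omega>"
        unfolding D_def G_def using sum_lessThan_telescope[of "\<lambda>i. W (g i) \<omega>" "Suc N"]
          sum_lessThan_telescope[of "\<lambda>i. jmp \<kappa> (g i) \<omega>" "Suc N"] gs by simp_all
      then have "\<xi> \<omega> * (W t \<omega> - W s \<omega>) * (jmp \<kappa> t \<omega> - jmp \<kappa> s \<omega>) = \<xi> \<omega> * ((\<Sum>i<Suc N. D i \<omega>) * (\<Sum>j<Suc N. G j \<omega>))"
        by (simp only: mult.assoc)
      also have "\<dots> = (\<Sum>i<Suc N. \<Sum>j<Suc N. \<xi> \<omega> * (D i \<omega> * G j \<omega>))"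
        unfolding sum_product by (simp only: sum_distrib_left)
      finally show "\<xi> \<omega> * (W t \<omega> - W s \<omega>) * (jmp \<kappa> t \<omega> - jmp \<kappa> s \<omega>) = (\<Sum>i<Suc N. \<Sum>j<Suc N. \<xi> \<omega> * (D i \<omega> * G j \<omega>))" .
    qed
    also have "\<dots> = (\<Sum>i<Suc N. \<Sum>j<Suc N. \<integral>\<omega>. \<xi> \<omega> * (D i \<omega> * G j \<omega>) \<partial>P)"
      using xDG by (subst Bochner_Integration.integral_sum, fastforce intro: Bochner_Integration.integrable_sum)
        (intro sum.cong refl Bochner_Integration.integral_sum, auto)
    also have "\<dots> = (\<Sum>i<Suc N. \<integral>\<omega>. \<xi> \<omega> * (D i \<omega> * G i \<omega>) \<partial>P)"
    proof (rule sum.cong[OF refl])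
      fix i assume i: "i \<in> {..<Suc N}"
      have "(\<Sum>j<Suc N. \<integral>\<omega>. \<xi> \<omega> * (D i \<omega> * G j \<omega>) \<partial>P) = (\<Sum>j\<in>{i}. \<integral>\<omega>. \<xi> \<omega> * (D i \<omega> * G j \<omega>) \<partial>P)"
        using i off by (intro sum.mono_neutral_right) auto
      then show "(\<Sum>j<Suc N. \<integral>\<omega>. \<xi> \<omega> * (D i \<omega> * G j \<omega>) \<partial>P) = (\<integral>\<omega>. \<xi> \<omega> * (D i \<omega> * G i \<omega>) \<partial>P)" by simp
    qed
    also have "\<dots> = (\<integral>\<omega>. (\<Sum>i<Suc N. \<xi> \<omega> * (D i \<omega> * G i \<omega>)) \<partial>P)"
      using xDG by (intro Bochner_Integration.integral_sum[symmetric]) auto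
    finally have x: "?x = (\<integral>\<omega>. (\<Sum>i<Suc N. \<xi> \<omega> * (D i \<omega> * G i \<omega>)) \<partial>P)" .
    \<comment> \<open>Cauchy-Schwarz with the eighth moment 105 h^4 makes each summand of order h^2;
      the N + 1 summands together are of order h.\<close>
    have D4V: "integrable P (\<lambda>\<omega>. D i \<omega> ^ 4 * V \<omega>)" "(\<integral>\<omega>. D i \<omega> ^ 4 * V \<omega> \<partial>P) \<le> K * h\<^sup>2" for i
    proof -
      have d8: "(\<lambda>\<omega>. (D i \<omega> ^ 4)\<^sup>2) = (\<lambda>\<omega>. D i \<omega> ^ 8)" by (simp flip: power_mult)
      have i8: "integrable P (\<lambda>\<omega>. (D i \<omega> ^ 4)\<^sup>2)" unfolding d8 by (rule Dk)
      show "integrable P (\<lambda>\<omega>. D i \<omega> ^ 4 * V \<omega>)"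
        by (rule integrable_mult_L2[OF _ VP i8 V2]) measurable
      have "\<bar>\<integral>\<omega>. D i \<omega> ^ 4 * V \<omega> \<partial>P\<bar> \<le> sqrt (\<integral>\<omega>. (D i \<omega> ^ 4)\<^sup>2 \<partial>P) * sqrt (\<integral>\<omega>. (V \<omega>)\<^sup>2 \<partial>P)"
        by (rule L2_Cauchy_Schwarz[OF _ VP i8 V2]) measurable
      also have "(\<integral>\<omega>. (D i \<omega> ^ 4)\<^sup>2 \<partial>P) = 105 * (h\<^sup>2)\<^sup>2"
        unfolding d8 unfolding D_def using increment_moment_8[OF gb(1) gle, of i "Suc i"] gd by simp
      also have "sqrt (105 * (h\<^sup>2)\<^sup>2) = sqrt 105 * h\<^sup>2" unfolding real_sqrt_mult real_sqrt_abs by simp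
      finally show "(\<integral>\<omega>. D i \<omega> ^ 4 * V \<omega> \<partial>P) \<le> K * h\<^sup>2" by (simp add: K_def mult_ac)
    qed
    let ?B = "\<lambda>\<omega>. c * (\<epsilon> * V \<omega> + (\<Sum>i<Suc N. D i \<omega> ^ 4 * V \<omega>) / \<epsilon> ^ 3)"
    have Bi: "integrable P ?B"
      using Vi D4V(1) by (intro integrable_mult_right Bochner_Integration.integrable_add integrable_divide Bochner_Integration.integrable_sum) auto
    have "AE \<omega> in P. \<bar>\<Sum>i<Suc N. \<xi> \<omega> * (D i \<omega> * G i \<omega>)\<bar> \<le> ?B \<omega>"
      using AE_jmp_increment_bound[OF b] AE_compensator_diff AE_space
    proof eventually_elim
      case (elim \<omega>)
      let ?H = "\<lambda>r. default_indicator \<tau> r \<omega> + compensator lam r \<omega>"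
      have Gi: "\<bar>G i \<omega>\<bar> \<le> C * (?H (g (Suc i)) - ?H (g i))" if "i < Suc N" for i
      proof -
        have "\<bar>G i \<omega>\<bar> \<le> C * ((if g i < \<tau> \<omega> \<and> \<tau> \<omega> \<le> g (Suc i) then 1 else 0) + (compensator lam (g (Suc i)) \<omega> - compensator lam (g i) \<omega>))"
          unfolding G_def using elim(1)[rule_format, OF gb(1)[of i] gle[of i "Suc i"]] gb(3)[of "Suc i"] that by simp
        also have "\<dots> = C * (?H (g (Suc i)) - ?H (g i))"
          using gle[of i "Suc i"] by (auto simp: default_indicator_def algebra_simps)
        finally show ?thesis .
      qed
      have HT: "?H t - ?H s \<le> 1 + compensator lam T \<omega>"
        using elim(2)[rule_format, OF _ st(3)] compensator_nonneg[OF elim(3), of s] st by (auto simp: default_indicator_def)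
      have sumG: "(\<Sum>i<Suc N. \<bar>G i \<omega>\<bar>) \<le> V \<omega>"
      proof -
        have "(\<Sum>i<Suc N. \<bar>G i \<omega>\<bar>) \<le> (\<Sum>i<Suc N. C * (?H (g (Suc i)) - ?H (g i)))"
          by (intro sum_mono Gi) auto
        also have "\<dots> = C * (?H t - ?H s)"
          unfolding sum_distrib_left[symmetric] sum_lessThan_telescope[of "\<lambda>i. ?H (g i)"] gs ..
        also have "\<dots> \<le> V \<omega>" unfolding V_def using HT C by (intro mult_left_mono) auto
        finally show ?thesis .
      qed
      have GV: "\<bar>G i \<omega>\<bar> \<le> V \<omega>" if "i < Suc N" for i
        using member_le_sum[of i "{..<Suc N}" "\<lambda>i. \<bar>G i \<omega>\<bar>"] that sumG by auto
      have y: "\<bar>y\<bar> \<le> \<epsilon> + y ^ 4 / \<epsilon> ^ 3" for y :: real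
      proof (cases "\<bar>y\<bar> \<le> \<epsilon>")
        case True
        have "0 \<le> y ^ 4 / \<epsilon> ^ 3" using \<epsilon> by simp
        then show ?thesis using True by linarith
      next
        case False
        have "\<bar>y\<bar> * \<epsilon> ^ 3 \<le> \<bar>y\<bar> * \<bar>y\<bar> ^ 3" using False \<epsilon> by (intro mult_left_mono power_mono) auto
        also have "\<dots> = y ^ 4" by (simp add: power4_eq_xxxx power3_eq_cube abs_mult_self_eq mult.assoc) 
        finally have "\<bar>y\<bar> \<le> y ^ 4 / \<epsilon> ^ 3" using \<epsilon> by (simp add: field_simps)
        then show ?thesis using \<epsilon> by linarith
      qed
      have "\<bar>\<Sum>i<Suc N. \<xi> \<omega> * (D i \<omega> * G i \<omega>)\<bar> \<le> (\<Sum>i<Suc N. \<bar>\<xi> \<omega> * (D i \<omega> * G i \<omega>)\<bar>)" by (rule sum_abs)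
      also have "\<dots> \<le> (\<Sum>i<Suc N. c * (\<epsilon> * \<bar>G i \<omega>\<bar> + D i \<omega> ^ 4 * V \<omega> / \<epsilon> ^ 3))"
      proof (rule sum_mono)
        fix i assume i: "i \<in> {..<Suc N}"
        have "\<bar>D i \<omega>\<bar> * \<bar>G i \<omega>\<bar> \<le> (\<epsilon> + D i \<omega> ^ 4 / \<epsilon> ^ 3) * \<bar>G i \<omega>\<bar>" by (intro mult_right_mono y) auto
        also have "\<dots> = \<epsilon> * \<bar>G i \<omega>\<bar> + D i \<omega> ^ 4 / \<epsilon> ^ 3 * \<bar>G i \<omega>\<bar>" by (simp add: distrib_right)
        also have "\<dots> \<le> \<epsilon> * \<bar>G i \<omega>\<bar> + D i \<omega> ^ 4 / \<epsilon> ^ 3 * V \<omega>"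
          using GV i \<epsilon> by (intro add_left_mono mult_left_mono) auto
        finally have "\<bar>D i \<omega>\<bar> * \<bar>G i \<omega>\<bar> \<le> \<epsilon> * \<bar>G i \<omega>\<bar> + D i \<omega> ^ 4 * V \<omega> / \<epsilon> ^ 3" by simp
        then have "\<bar>\<xi> \<omega>\<bar> * (\<bar>D i \<omega>\<bar> * \<bar>G i \<omega>\<bar>) \<le> c * (\<epsilon> * \<bar>G i \<omega>\<bar> + D i \<omega> ^ 4 * V \<omega> / \<epsilon> ^ 3)"
          using \<xi>(2)[OF elim(3)] by (intro mult_mono) auto
        then show "\<bar>\<xi> \<omega> * (D i \<omega> * G i \<omega>)\<bar> \<le> c * (\<epsilon> * \<bar>G i \<omega>\<bar> + D i \<omega> ^ 4 * V \<omega> / \<epsilon> ^ 3)" by (simp only: abs_mult)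
      qed
      also have "\<dots> = c * (\<epsilon> * (\<Sum>i<Suc N. \<bar>G i \<omega>\<bar>) + (\<Sum>i<Suc N. D i \<omega> ^ 4 * V \<omega>) / \<epsilon> ^ 3)"
        by (simp only: sum_distrib_left[symmetric] sum.distrib sum_divide_distrib)
      also have "\<dots> \<le> ?B \<omega>"
        using sumG \<epsilon> c0 by (intro mult_left_mono add_right_mono) auto
      finally show ?case .
    qed
    then have le: "(\<integral>\<omega>. norm (\<Sum>i<Suc N. \<xi> \<omega> * (D i \<omega> * G i \<omega>)) \<partial>P) \<le> (\<integral>\<omega>. ?B \<omega> \<partial>P)"
      using xDG by (intro integral_mono_AE Bi integrable_norm Bochner_Integration.integrable_sum) auto
    have "norm ?x \<le> (\<integral>\<omega>. norm (\<Sum>i<Suc N. \<xi> \<omega> * (D i \<omega> * G i \<omega>)) \<partial>P)"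
      unfolding x by (rule integral_norm_bound)
    from this le have "norm ?x \<le> (\<integral>\<omega>. ?B \<omega> \<partial>P)" by (rule order_trans)
    also have "\<dots> = c * (\<epsilon> * (\<integral>\<omega>. V \<omega> \<partial>P) + (\<Sum>i<Suc N. \<integral>\<omega>. D i \<omega> ^ 4 * V \<omega> \<partial>P) / \<epsilon> ^ 3)"
      using Vi D4V(1) by (simp add: Bochner_Integration.integral_sum del: sum.lessThan_Suc)
    also have "\<dots> \<le> c * (\<epsilon> * (\<integral>\<omega>. V \<omega> \<partial>P) + (\<Sum>i<Suc N. K * h\<^sup>2) / \<epsilon> ^ 3)"
      using c0 \<epsilon> by (intro mult_left_mono add_left_mono divide_right_mono sum_mono D4V(2)) auto
    also have "(\<Sum>i<Suc N. K * h\<^sup>2) / \<epsilon> ^ 3 = K * (t - s)\<^sup>2 / \<epsilon> ^ 3 * (1 / real (Suc N))"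
    proof -
      have "real (Suc N) * h\<^sup>2 = (t - s)\<^sup>2 * (1 / real (Suc N))"
        by (simp add: h_def power_divide power2_eq_square[of "real (Suc N)"] del: of_nat_Suc)
      moreover have "(\<Sum>i<Suc N. K * h\<^sup>2) = K * (real (Suc N) * h\<^sup>2)"
        by (simp del: of_nat_Suc sum.lessThan_Suc)
      ultimately show ?thesis by (simp del: of_nat_Suc)
    qed
    finally show ?thesis by simp
  qed
  have v0: "0 \<le> (\<integral>\<omega>. V \<omega> \<partial>P)" using V0 by (intro Bochner_Integration.integral_nonneg) auto
  \<comment> \<open>The mesh tends to 0 first with \<epsilon> fixed; \<epsilon> is chosen small only
    afterwards.\<close>
  have lim: "\<bar>?x\<bar> \<le> c * (\<epsilon> * (\<integral>\<omega>. V \<omega> \<partial>P))" if \<epsilon>: "0 < \<epsilon>" for \<epsilon>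
  proof (rule LIMSEQ_le_const)
    have "(\<lambda>n. 1 / real (Suc n)) \<longlonglongrightarrow> 0" by (rule LIMSEQ_Suc) (rule lim_1_over_n)
    then have "(\<lambda>n. c * (\<epsilon> * (\<integral>\<omega>. V \<omega> \<partial>P) + K * (t - s)\<^sup>2 / \<epsilon> ^ 3 * (1 / real (Suc n)))) \<longlonglongrightarrow> c * (\<epsilon> * (\<integral>\<omega>. V \<omega> \<partial>P) + K * (t - s)\<^sup>2 / \<epsilon> ^ 3 * 0)"
      by (intro tendsto_mult tendsto_add tendsto_const)
    then show "(\<lambda>n. c * (\<epsilon> * (\<integral>\<omega>. V \<omega> \<partial>P) + K * (t - s)\<^sup>2 / \<epsilon> ^ 3 * (1 / real (Suc n)))) \<longlonglongrightarrow> c * (\<epsilon> * (\<integral>\<omega>. V \<omega> \<partial>P))"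
      by simp
  qed (use est[OF \<epsilon>] in blast)
  have "\<bar>?x\<bar> \<le> 0 + e" if "0 < e" for e
  proof -
    \<comment> \<open>The added 1 keeps the divisor positive even when the product before it is
      0.\<close>
    let ?q = "c * (\<integral>\<omega>. V \<omega> \<partial>P) + 1"
    have q: "0 < ?q" using c0 v0 by (simp add: add_nonneg_pos)
    have "\<bar>?x\<bar> \<le> c * (e / ?q * (\<integral>\<omega>. V \<omega> \<partial>P))" using that q by (intro lim) simp
    also have "\<dots> = e * ((?q - 1) / ?q)" by simp
    also have "\<dots> \<le> e * 1" using that q by (intro mult_left_mono) auto
    finally show ?thesis by simp
  qed
  then have "\<bar>?x\<bar> \<le> 0" by (rule field_le_epsilon)
  then show ?thesis by simp
qed

text \<open>For each summand the jump martingale is split at the end points of the W-interval. The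
  part after it is killed by the martingale property of J, the part before it by that of W, and the
  part on the interval by \<open>cross_increment\<close>.\<close>

lemma elem_jmp_orthogonal:
  assumes e: "elem n \<alpha> \<beta> \<xi>" and b: "pbounded C \<kappa>"
  shows "(\<integral>\<omega>. elem_int n \<alpha> \<beta> \<xi> \<omega> * jmp \<kappa> T \<omega> \<partial>P) = 0"
proof -
  have \<kappa>: "pred \<kappa>" using b by (simp add: pbounded_def)
  have Tin: "T \<in> {0..T}" using T_pos by auto
  have "integrable P (\<lambda>\<omega>. \<xi> i \<omega> * (W (\<beta> i) \<omega> - W (\<alpha> i) \<omega>) * jmp \<kappa> T \<omega>) \<and>
    (\<integral>\<omega>. \<xi> i \<omega> * (W (\<beta> i) \<omega> - W (\<alpha> i) \<omega>) * jmp \<kappa> T \<omega> \<partial>P) = 0" if i: "i < n" for i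
  proof -
    note ei = elemD[OF e i]
    obtain c where c: "\<And>\<omega>. \<omega> \<in> space P \<Longrightarrow> \<bar>\<xi> i \<omega>\<bar> \<le> c" using ei(5) by blast
    have \<beta>0: "0 \<le> \<beta> i" using ei by simp
    have \<xi>P: "\<xi> i \<in> borel_measurable P" using F_measurable[OF ei(1,4)] .
    let ?D = "\<lambda>\<omega>. W (\<beta> i) \<omega> - W (\<alpha> i) \<omega>" and ?J = "jmp \<kappa>"
    have Dk: "integrable P (\<lambda>\<omega>. ?D \<omega> ^ k)" for k by (rule increment_moments(1)[OF ei(1,2)])
    have DP: "?D \<in> borel_measurable P" using W_measurable[OF ei(1)] W_measurable[OF \<beta>0] by measurable
    have Dint: "integrable P (\<lambda>\<omega>. \<xi> i \<omega> * ?D \<omega> * Z \<omega>)" if "Z \<in> borel_measurable P" "integrable P (\<lambda>\<omega>. (Z \<omega>)\<^sup>2)" for Z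
      using mult_bounded_integrable[OF \<xi>P c integrable_mult_L2[OF DP that(1) Dk[of 2] that(2)]] by (simp add: mult.assoc)
    have J: "?J r \<in> borel_measurable P" "integrable P (\<lambda>\<omega>. (?J r \<omega>)\<^sup>2)" if "r \<in> {0..T}" for r
      using jmp_measurable[OF \<kappa> that] jmp_square_integrable[OF b that] by auto
    have \<beta>: "\<beta> i \<in> {0..T}" and \<alpha>: "\<alpha> i \<in> {0..T}" using ei by auto
    have Dadp: "(\<lambda>\<omega>. \<xi> i \<omega> * ?D \<omega>) \<in> borel_measurable (F (\<beta> i))"
      using F_measurable_mono[OF ei(1,2,4)] increment_measurable[OF ei(1,2)] by measurable
    have iD: "integrable P (\<lambda>\<omega>. \<xi> i \<omega> * ?D \<omega>)" using Dint[of "\<lambda>_. 1"] by simp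
    have i1: "integrable P (\<lambda>\<omega>. \<xi> i \<omega> * ?D \<omega> * (?J T \<omega> - ?J (\<beta> i) \<omega>))"
      and i2: "integrable P (\<lambda>\<omega>. \<xi> i \<omega> * ?D \<omega> * (?J (\<beta> i) \<omega> - ?J (\<alpha> i) \<omega>))"
      and i3: "integrable P (\<lambda>\<omega>. \<xi> i \<omega> * ?D \<omega> * (?J (\<alpha> i) \<omega> - ?J 0 \<omega>))"
      using J[OF Tin] J[OF \<beta>] J[OF \<alpha>] J[of 0] T_pos by (intro Dint L2_add_integrable; simp)+
    have z1: "(\<integral>\<omega>. \<xi> i \<omega> * ?D \<omega> * (?J T \<omega> - ?J (\<beta> i) \<omega>) \<partial>P) = 0"
    proof (rule integral_mult_eq_0_of_bounded[OF F_subalgebra[OF \<beta>0] _ _ Dadp i1])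
      show "integrable P (\<lambda>\<omega>. ?J T \<omega> - ?J (\<beta> i) \<omega>)"
        using jmp_integrable[OF \<kappa> pbounded_integrable[OF b]] Tin \<beta> by auto
    qed (rule jmp_orthogonal(2)[OF \<kappa> pbounded_integrable[OF b], where C=1], use \<beta> in auto)
    have z2: "(\<integral>\<omega>. \<xi> i \<omega> * ?D \<omega> * (?J (\<beta> i) \<omega> - ?J (\<alpha> i) \<omega>) \<partial>P) = 0"
      by (rule cross_increment[OF b ei(1,2,3,4) c])
    have "(\<integral>\<omega>. (?J (\<alpha> i) \<omega> - ?J 0 \<omega>) * (\<xi> i \<omega> * ?D \<omega>) \<partial>P) = 0"
    proof (rule jmp_past_orthogonal[OF b _ _ _ iD])
      show "integrable P (\<lambda>\<omega>. compensator lam T \<omega> * (\<xi> i \<omega> * ?D \<omega>))"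
        using Dint[OF compensator_measurable compensator_moment_integrable[of 2]] by (simp add: mult_ac)
      fix \<eta> :: "'a \<Rightarrow> real" assume \<eta>: "\<eta> \<in> borel_measurable (F (\<alpha> i))" "\<And>\<omega>. \<omega> \<in> space P \<Longrightarrow> \<bar>\<eta> \<omega>\<bar> \<le> 1"
      have m: "(\<lambda>\<omega>. \<eta> \<omega> * \<xi> i \<omega>) \<in> borel_measurable (F (\<alpha> i))" using \<eta>(1) ei(4) by measurable
      have "integrable P (\<lambda>\<omega>. \<eta> \<omega> * \<xi> i \<omega>)"
        using F_measurable[OF ei(1) \<eta>(1)] c \<xi>P
        by (intro mult_bounded_integrable[OF _ \<eta>(2)] integrable_const_bound[where B=c]) auto
      from increment_mean_zero(2)[OF ei(1,2) m this]
      show "(\<integral>\<omega>. \<eta> \<omega> * (\<xi> i \<omega> * ?D \<omega>) \<partial>P) = 0" by (simp add: mult.assoc)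
    qed (use ei in auto)
    then have z3: "(\<integral>\<omega>. \<xi> i \<omega> * ?D \<omega> * (?J (\<alpha> i) \<omega> - ?J 0 \<omega>) \<partial>P) = 0" by (simp add: mult_ac)
    have "(\<integral>\<omega>. \<xi> i \<omega> * ?D \<omega> * ?J T \<omega> \<partial>P) = (\<integral>\<omega>. \<xi> i \<omega> * ?D \<omega> * (?J T \<omega> - ?J (\<beta> i) \<omega>) + \<xi> i \<omega> * ?D \<omega> * (?J (\<beta> i) \<omega> - ?J (\<alpha> i) \<omega>)
        + \<xi> i \<omega> * ?D \<omega> * (?J (\<alpha> i) \<omega> - ?J 0 \<omega>) \<partial>P)"
      by (rule Bochner_Integration.integral_cong) (auto simp: jmp_zero algebra_simps)
    also have "\<dots> = 0" using i1 i2 i3 z1 z2 z3 by simp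
    finally show ?thesis using Dint[OF J[OF Tin]] by simp
  qed
  then show ?thesis
    unfolding elem_int_def sum_distrib_right by (subst Bochner_Integration.integral_sum) auto
qed

lemma ito_jmp_orthogonal_bounded:
  assumes h: "has_ito_integral P F W T Z I" and Z: "(\<lambda>w. Z (fst w) (snd w)) \<in> borel_measurable R" and b: "pbounded C \<kappa>"
  shows "(\<integral>\<omega>. (I T \<omega> - I 0 \<omega>) * jmp \<kappa> T \<omega> \<partial>P) = 0"
proof -
  have Tin: "T \<in> {0..T}" and T0: "0 \<in> {0..T}" using T_pos by auto
  have \<kappa>: "pred \<kappa>" using b by (simp add: pbounded_def)
  obtain n ts \<xi> where a: "ito_approx Z I n ts \<xi>" using ito_approx_exists[OF h Z] .
  have one: "(\<lambda>_. 1) \<in> borel_measurable (F 0)" "\<forall>\<omega>\<in>space P. \<bar>1::real\<bar> \<le> 1" by auto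
  note i = ito_increment[OF a T0 one]
  have "(\<lambda>k. \<integral>\<omega>. elem_int (n k) (\<lambda>i. max 0 (ts k i)) (\<lambda>i. max 0 (ts k (Suc i))) (\<lambda>i \<omega>. 1 * \<xi> k i \<omega>) \<omega> * jmp \<kappa> T \<omega> \<partial>P)
    \<longlonglongrightarrow> (\<integral>\<omega>. 1 * (I T \<omega> - I 0 \<omega>) * jmp \<kappa> T \<omega> \<partial>P)"
    by (rule L2_tendsto_inner[OF i(2) L2_tendsto_const[OF jmp_measurable[OF \<kappa> Tin] jmp_square_integrable[OF b Tin]]])
  then have "(\<lambda>k. 0) \<longlonglongrightarrow> (\<integral>\<omega>. (I T \<omega> - I 0 \<omega>) * jmp \<kappa> T \<omega> \<partial>P)"
    unfolding elem_jmp_orthogonal[OF i(1) b] by simp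
  then show ?thesis using LIMSEQ_unique tendsto_const by blast
qed

text \<open>Truncation again: the orthogonality for bounded jump integrands passes to the L2
  limit.\<close>

lemma ito_jmp_orthogonal:
  assumes h: "has_ito_integral P F W T Z I" and Z: "(\<lambda>w. Z (fst w) (snd w)) \<in> borel_measurable R"
    and w: "pred w" and i: "integrable R (\<lambda>x. (w (fst x) (snd x))\<^sup>2 * lamw x)"
  shows "(\<integral>\<omega>. (I T \<omega> - I 0 \<omega>) * jmp w T \<omega> \<partial>P) = 0"
proof -
  have Tin: "T \<in> {0..T}" and T0: "0 \<in> {0..T}" using T_pos by auto
  note IT = ito_L2[OF h Z Tin] and I0 = ito_L2[OF h Z T0]
  have "L2_tendsto P (\<lambda>k \<omega>. I T \<omega> - I 0 \<omega>) (\<lambda>\<omega>. I T \<omega> - I 0 \<omega>)"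
    using IT I0 by (intro L2_tendsto_const L2_add_integrable) auto
  from L2_tendsto_inner[OF this jmp_L2_tendsto[OF w i]]
  have "(\<lambda>k. 0) \<longlonglongrightarrow> (\<integral>\<omega>. (I T \<omega> - I 0 \<omega>) * jmp w T \<omega> \<partial>P)"
    unfolding ito_jmp_orthogonal_bounded[OF h Z trunc_pbounded[OF w]] .
  then show ?thesis using LIMSEQ_unique tendsto_const by blast
qed

end

section \<open>The product formula\<close>

lemma lam_square_bound:
  fixes l a b :: real
  assumes "0 \<le> l" shows "l * \<bar>a\<bar> * \<bar>b\<bar> \<le> a\<^sup>2 * l + l * b\<^sup>2"
proof -
  have "2 * (\<bar>a\<bar> * \<bar>b\<bar>) \<le> a\<^sup>2 + b\<^sup>2" using sum_squares_bound[of "\<bar>a\<bar>" "\<bar>b\<bar>"] by simp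
  moreover have "0 \<le> \<bar>a\<bar> * \<bar>b\<bar>" by simp
  ultimately have "\<bar>a\<bar> * \<bar>b\<bar> \<le> a\<^sup>2 + b\<^sup>2" by linarith
  from mult_left_mono[OF this assms] show ?thesis by (simp add: algebra_simps)
qed

context finite_horizon begin

lemma finite_measure_R: "finite_measure R"
  using finite_measure_pair_measure[OF finite_measure_axioms finite_measure_lbT] .

lemma integrable_snd_R:
  fixes Z :: "'a \<Rightarrow> real"
  assumes Z: "integrable P Z" shows "integrable R (\<lambda>w. Z (snd w))"
proof (rule integrableI_bounded)
  have [measurable]: "Z \<in> borel_measurable P" using Z by auto
  show "(\<lambda>w. Z (snd w)) \<in> borel_measurable R" by measurable
  have "(\<integral>\<^sup>+w. ennreal (norm (Z (snd w))) \<partial>R) = (\<integral>\<^sup>+t. \<integral>\<^sup>+\<omega>. ennreal (norm (Z \<omega>)) \<partial>P \<partial>lbT)"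
    by (subst nn_integral_R(2)) auto
  also have "\<dots> = (\<integral>\<^sup>+\<omega>. ennreal (norm (Z \<omega>)) \<partial>P) * emeasure lbT (space lbT)" by simp
  also have "\<dots> < \<infinity>"
    using Z finite_measure.emeasure_finite[OF finite_measure_lbT]
    by (simp add: integrable_iff_bounded ennreal_mult_less_top less_top)
  finally show "(\<integral>\<^sup>+w. ennreal (norm (Z (snd w))) \<partial>R) < \<infinity>" .
qed

lemma integrable_R_mult_bounded:
  fixes f g :: "real \<times> 'a \<Rightarrow> real"
  assumes g: "integrable R g" and f: "f \<in> borel_measurable R" "\<And>w. w \<in> space R \<Longrightarrow> \<bar>f w\<bar> \<le> C"
  shows "integrable R (\<lambda>w. f w * g w)"
proof (rule Bochner_Integration.integrable_bound)
  show "integrable R (\<lambda>w. C * g w)" using g by simp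
  show "AE w in R. norm (f w * g w) \<le> norm (C * g w)"
  proof (rule AE_I2)
    fix w assume "w \<in> space R"
    then have "\<bar>f w\<bar> \<le> \<bar>C\<bar>" using f(2) abs_ge_self order_trans by blast
    then show "norm (f w * g w) \<le> norm (C * g w)" by (simp add: abs_mult mult_right_mono)
  qed
qed (use f g in auto)

text \<open>For almost every t the product g_t (Y_T - Y_t) has mean zero, since g_t is known at time
  t. Fubini moves this in and out of the time integral.\<close>

lemma integral_martingale_swap:
  fixes g Y :: "real \<Rightarrow> 'a \<Rightarrow> real"
  assumes adapted: "\<And>t. t \<in> {0..T} \<Longrightarrow> g t \<in> borel_measurable (F t)"
    and Y: "\<And>t. t \<in> {0..T} \<Longrightarrow> integrable P (Y t)"
    and orth: "\<And>t \<xi>. t \<in> {0..T} \<Longrightarrow> \<xi> \<in> borel_measurable (F t) \<Longrightarrow> (\<And>\<omega>. \<omega> \<in> space P \<Longrightarrow> \<bar>\<xi> \<omega>\<bar> \<le> 1)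
        \<Longrightarrow> (\<integral>\<omega>. \<xi> \<omega> * (Y T \<omega> - Y t \<omega>) \<partial>P) = 0"
    and i1: "integrable R (\<lambda>w. g (fst w) (snd w) * Y T (snd w))"
    and i2: "integrable R (\<lambda>w. g (fst w) (snd w) * Y (fst w) (snd w))"
  shows "(\<integral>w. g (fst w) (snd w) * Y T (snd w) \<partial>R) = (\<integral>w. g (fst w) (snd w) * Y (fst w) (snd w) \<partial>R)"
proof -
  have Tin: "T \<in> {0..T}" using T_pos by auto
  have "(\<integral>w. g (fst w) (snd w) * Y T (snd w) \<partial>R) = (\<integral>t. \<integral>\<omega>. g t \<omega> * Y T \<omega> \<partial>P \<partial>lbT)"
    using integral_R(2)[OF i1] by simp
  also have "\<dots> = (\<integral>t. \<integral>\<omega>. g t \<omega> * Y t \<omega> \<partial>P \<partial>lbT)"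
  proof (rule integral_cong_AE)
    show "AE t in lbT. (\<integral>\<omega>. g t \<omega> * Y T \<omega> \<partial>P) = (\<integral>\<omega>. g t \<omega> * Y t \<omega> \<partial>P)"
      using integral_R(3)[OF i1] integral_R(3)[OF i2] AE_space
    proof eventually_elim
      case (elim t)
      have t: "t \<in> {0..T}" using elim by (simp add: space_restrict_space)
      have "(\<integral>\<omega>. g t \<omega> * (Y T \<omega> - Y t \<omega>) \<partial>P) = 0"
      proof (rule integral_mult_eq_0_of_bounded[OF _ _ orth[OF t] adapted[OF t]])
        show "subalgebra P (F t)" using F_subalgebra t by auto
        show "integrable P (\<lambda>\<omega>. Y T \<omega> - Y t \<omega>)" using Y t Tin by auto
        show "integrable P (\<lambda>\<omega>. g t \<omega> * (Y T \<omega> - Y t \<omega>))"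
          using elim by (simp add: right_diff_distrib)
      qed
      then show ?case using elim by (simp add: right_diff_distrib)
    qed
  qed (use integral_R(6)[OF i1] integral_R(6)[OF i2] in auto)
  also have "\<dots> = (\<integral>w. g (fst w) (snd w) * Y (fst w) (snd w) \<partial>R)"
    using integral_R(2)[OF i2] by simp
  finally show ?thesis .
qed

text \<open>Write \<open>p = p\<^sub>0 + A + N\<close> and \<open>X = x\<^sub>0 + B + L\<close> with absolutely
  continuous \<open>A\<close>, \<open>B\<close>, expand \<open>p\<^sub>T X\<^sub>T\<close>, and use the martingale property to replace \<open>N\<^sub>T\<close>, \<open>L\<^sub>T\<close> by
  \<open>N\<^sub>s\<close>, \<open>L\<^sub>s\<close> under the \<open>ds\<close>-integrals.  Only the product \<open>N\<^sub>T L\<^sub>T\<close> remains.\<close>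

lemma expectation_product:
  fixes p X \<alpha> \<beta> N L :: "real \<Rightarrow> 'a \<Rightarrow> real" and x0 C :: real
  assumes N_def: "\<And>s \<omega>. N s \<omega> = p s \<omega> - p 0 \<omega> - (LBINT r:{0..s}. \<alpha> r \<omega>)"
    and L_def: "\<And>s \<omega>. L s \<omega> = X s \<omega> - x0 - (LBINT r:{0..s}. \<beta> r \<omega>)"
    and \<alpha>m: "\<And>t. t \<in> {0..T} \<Longrightarrow> \<alpha> t \<in> borel_measurable (F t)" and \<alpha>i: "integrable R (\<lambda>w. \<alpha> (fst w) (snd w))"
    and \<beta>m: "\<And>t. t \<in> {0..T} \<Longrightarrow> \<beta> t \<in> borel_measurable (F t)" "(\<lambda>w. \<beta> (fst w) (snd w)) \<in> borel_measurable R"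
    and \<beta>b: "\<And>w. w \<in> space R \<Longrightarrow> \<bar>\<beta> (fst w) (snd w)\<bar> \<le> C"
    and p0: "p 0 \<in> borel_measurable (F 0)" "integrable P (p 0)" and X0: "AE \<omega> in P. X 0 \<omega> = x0"
    and pR: "integrable R (\<lambda>w. p (fst w) (snd w))"
    and \<alpha>X: "integrable R (\<lambda>w. \<alpha> (fst w) (snd w) * X (fst w) (snd w))"
    and \<alpha>L: "integrable R (\<lambda>w. \<alpha> (fst w) (snd w) * L T (snd w))"
    and Ni: "\<And>t. t \<in> {0..T} \<Longrightarrow> integrable P (N t)" and Li: "\<And>t. t \<in> {0..T} \<Longrightarrow> integrable P (L t)"
    and pL: "integrable P (\<lambda>\<omega>. p 0 \<omega> * L T \<omega>)" and NL: "integrable P (\<lambda>\<omega>. N T \<omega> * L T \<omega>)"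
    and orthN: "\<And>t \<xi>. t \<in> {0..T} \<Longrightarrow> \<xi> \<in> borel_measurable (F t) \<Longrightarrow> (\<And>\<omega>. \<omega> \<in> space P \<Longrightarrow> \<bar>\<xi> \<omega>\<bar> \<le> 1)
        \<Longrightarrow> (\<integral>\<omega>. \<xi> \<omega> * (N T \<omega> - N t \<omega>) \<partial>P) = 0"
    and orthL: "\<And>t \<xi>. t \<in> {0..T} \<Longrightarrow> \<xi> \<in> borel_measurable (F t) \<Longrightarrow> (\<And>\<omega>. \<omega> \<in> space P \<Longrightarrow> \<bar>\<xi> \<omega>\<bar> \<le> 1)
        \<Longrightarrow> (\<integral>\<omega>. \<xi> \<omega> * (L T \<omega> - L t \<omega>) \<partial>P) = 0"
  shows "integrable P (\<lambda>\<omega>. p T \<omega> * X T \<omega>)"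
    and "integrable R (\<lambda>w. \<beta> (fst w) (snd w) * p (fst w) (snd w))"
    and "(\<integral>\<omega>. p T \<omega> * X T \<omega> \<partial>P) = x0 * (\<integral>\<omega>. p 0 \<omega> \<partial>P) + (\<integral>w. \<alpha> (fst w) (snd w) * X (fst w) (snd w) \<partial>R)
       + (\<integral>w. \<beta> (fst w) (snd w) * p (fst w) (snd w) \<partial>R) + (\<integral>\<omega>. N T \<omega> * L T \<omega> \<partial>P)"
proof -
  have Tin: "T \<in> {0..T}" and T0: "0 \<in> {0..T}" using T_pos by auto
  define A where "A = (\<lambda>s \<omega>. LBINT r:{0..s}. \<alpha> r \<omega>)"
  define B where "B = (\<lambda>s \<omega>. LBINT r:{0..s}. \<beta> r \<omega>)"
  let ?\<alpha> = "\<lambda>w. \<alpha> (fst w) (snd w)" and ?\<beta> = "\<lambda>w. \<beta> (fst w) (snd w)"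
  have \<alpha>R[measurable]: "?\<alpha> \<in> borel_measurable R" using \<alpha>i by auto
  note [measurable] = \<beta>m(2)
  have AR[measurable]: "(\<lambda>w. A (fst w) (snd w)) \<in> borel_measurable R"
    using running_integral_measurable[OF \<alpha>R] by (simp add: split_def A_def)
  have BR[measurable]: "(\<lambda>w. B (fst w) (snd w)) \<in> borel_measurable R"
    using running_integral_measurable[OF \<beta>m(2)] by (simp add: split_def B_def)
  have \<beta>i: "integrable R ?\<beta>"
    by (rule finite_measure.integrable_const_bound[OF finite_measure_R, where B=C]) (use \<beta>b in \<open>auto intro: AE_I2\<close>)
  have z: "(LBINT r:{0::real}. f r) = 0" for f :: "real \<Rightarrow> real"
    unfolding set_lebesgue_integral_def
    by (rule integral_eq_zero_AE) (use AE_lborel_singleton[of 0] in \<open>eventually_elim, auto split: split_indicator\<close>)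
  have C0: "0 \<le> C"
  proof -
    obtain \<omega> where "\<omega> \<in> space P" using not_empty by auto
    then have "\<bar>\<beta> 0 \<omega>\<bar> \<le> C" using \<beta>b[of "(0, \<omega>)"] T0 by auto
    then show ?thesis by simp
  qed
  have mT: "measure lbT (space lbT) = T"
    using T_pos by (simp add: measure_restrict_space space_restrict_space)
  have run_bound: "\<bar>LBINT r:{0..s}. f r\<bar> \<le> (\<integral>r. \<bar>f r\<bar> \<partial>lbT)" if s: "s \<in> {0..T}" and f: "integrable lbT f" for s and f :: "real \<Rightarrow> real"
    unfolding set_integral_lbT(1)[OF s]
    by (rule integral_abs_bound_integral) (use f in \<open>auto simp: abs_mult intro!: lbT_integrable_indicator split: split_indicator\<close>)
  have Bb: "\<bar>B s \<omega>\<bar> \<le> C * T" if s: "s \<in> {0..T}" and \<omega>: "\<omega> \<in> space P" for s \<omega>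
  proof -
    have m: "(\<lambda>r. \<beta> r \<omega>) \<in> borel_measurable lbT"
      using measurable_compose[OF measurable_Pair2'[OF \<omega>] \<beta>m(2)] by simp
    have bd: "r \<in> space lbT \<Longrightarrow> \<bar>\<beta> r \<omega>\<bar> \<le> C" for r using \<beta>b[of "(r, \<omega>)"] \<omega> by (auto simp: space_restrict_space)
    have i: "integrable lbT (\<lambda>r. \<beta> r \<omega>)"
      by (rule finite_measure.integrable_const_bound[OF finite_measure_lbT, where B=C]) (use m bd in \<open>auto intro: AE_I2\<close>)
    have "\<bar>B s \<omega>\<bar> \<le> (\<integral>r. \<bar>\<beta> r \<omega>\<bar> \<partial>lbT)" unfolding B_def by (rule run_bound[OF s i])
    also have "\<dots> \<le> (\<integral>r. C \<partial>lbT)"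
      using i bd finite_measure_lbT by (intro integral_mono) (auto intro: finite_measure.integrable_const)
    also have "\<dots> = C * T" using mT by simp
    finally show ?thesis .
  qed
  \<comment> \<open>The path of A is dominated by the total integral of |\<alpha>|, which does not
    depend on time and has finite mean.\<close>
  have Ai: "integrable R (\<lambda>w. A (fst w) (snd w))"
  proof (rule Bochner_Integration.integrable_bound)
    show "integrable R (\<lambda>w. \<integral>r. \<bar>\<alpha> r (snd w)\<bar> \<partial>lbT)"
      using integral_R(5)[OF integrable_abs[OF \<alpha>i]] by (intro integrable_snd_R) simp
    have mm: "{w \<in> space R. norm (A (fst w) (snd w)) \<le> norm (\<integral>r. \<bar>\<alpha> r (snd w)\<bar> \<partial>lbT)} \<in> sets R"
      using borel_measurable_integrable[OF \<open>integrable R (\<lambda>w. \<integral>r. \<bar>\<alpha> r (snd w)\<bar> \<partial>lbT)\<close>] by measurable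
    have "AE t in lbT. AE \<omega> in P. norm (A (fst (t, \<omega>)) (snd (t, \<omega>))) \<le> norm (\<integral>r. \<bar>\<alpha> r (snd (t, \<omega>))\<bar> \<partial>lbT)"
    proof (rule AE_I2)
      fix t assume "t \<in> space lbT"
      then have t: "t \<in> {0..T}" by (simp add: space_restrict_space)
      show "AE \<omega> in P. norm (A (fst (t, \<omega>)) (snd (t, \<omega>))) \<le> norm (\<integral>r. \<bar>\<alpha> r (snd (t, \<omega>))\<bar> \<partial>lbT)"
        using integral_R(4)[OF \<alpha>i]
      proof eventually_elim
        case (elim \<omega>)
        then show ?case using run_bound[OF t, of "\<lambda>r. \<alpha> r \<omega>"] by (simp add: A_def)
      qed
    qed
    then show "AE w in R. norm (A (fst w) (snd w)) \<le> norm (\<integral>r. \<bar>\<alpha> r (snd w)\<bar> \<partial>lbT)"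
      by (rule TP.AE_pair_measure[OF mm])
  qed measurable
  have p0R: "integrable R (\<lambda>w. p 0 (snd w))" by (rule integrable_snd_R[OF p0(2)])
  have NR: "integrable R (\<lambda>w. N (fst w) (snd w))"
    using pR p0R Ai unfolding N_def A_def by simp
  have NTR: "integrable R (\<lambda>w. N T (snd w))" by (rule integrable_snd_R[OF Ni[OF Tin]])
  have \<alpha>B: "integrable R (\<lambda>w. ?\<alpha> w * B (fst w) (snd w))"
    using integrable_R_mult_bounded[OF \<alpha>i BR, of "C * T"] Bb by (auto simp: mult.commute)
  have \<beta>A: "integrable R (\<lambda>w. ?\<beta> w * A (fst w) (snd w))" by (rule integrable_R_mult_bounded[OF Ai \<beta>m(2) \<beta>b])
  have \<beta>N: "integrable R (\<lambda>w. ?\<beta> w * N (fst w) (snd w))" by (rule integrable_R_mult_bounded[OF NR \<beta>m(2) \<beta>b])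
  have \<beta>NT: "integrable R (\<lambda>w. ?\<beta> w * N T (snd w))" by (rule integrable_R_mult_bounded[OF NTR \<beta>m(2) \<beta>b])
  have \<beta>p0: "integrable R (\<lambda>w. ?\<beta> w * p 0 (snd w))" by (rule integrable_R_mult_bounded[OF p0R \<beta>m(2) \<beta>b])
  show \<beta>p: "integrable R (\<lambda>w. ?\<beta> w * p (fst w) (snd w))" by (rule integrable_R_mult_bounded[OF pR \<beta>m(2) \<beta>b])
  have \<alpha>Ls: "integrable R (\<lambda>w. ?\<alpha> w * L (fst w) (snd w))"
  proof -
    have "integrable R (\<lambda>w. ?\<alpha> w * X (fst w) (snd w) - ?\<alpha> w * x0 - ?\<alpha> w * B (fst w) (snd w))"
      using \<alpha>X \<alpha>i \<alpha>B by auto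
    then show ?thesis by (simp add: L_def B_def right_diff_distrib)
  qed
  have time: "integrable P (\<lambda>\<omega>. (LBINT r:{0..T}. g r \<omega>) * Z \<omega>)" "(\<integral>\<omega>. (LBINT r:{0..T}. g r \<omega>) * Z \<omega> \<partial>P) = (\<integral>w. g (fst w) (snd w) * Z (snd w) \<partial>R)"
    if "integrable R (\<lambda>w. g (fst w) (snd w) * Z (snd w))" for g :: "real \<Rightarrow> 'a \<Rightarrow> real" and Z
    using integral_R(1)[OF that] integral_R(5)[OF that] by (simp_all add: set_integral_lbT(2)[OF Tin])
  have t2: "integrable P (\<lambda>\<omega>. B T \<omega> * p 0 \<omega>)" "(\<integral>\<omega>. B T \<omega> * p 0 \<omega> \<partial>P) = (\<integral>w. ?\<beta> w * p 0 (snd w) \<partial>R)"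
    unfolding B_def by (rule time[OF \<beta>p0])+
  have t4: "integrable P (\<lambda>\<omega>. A T \<omega> * x0)" "(\<integral>\<omega>. A T \<omega> * x0 \<partial>P) = (\<integral>w. ?\<alpha> w * x0 \<partial>R)"
    unfolding A_def by (rule time[of \<alpha> "\<lambda>_. x0", OF integrable_mult_left[OF \<alpha>i]])+
  have t6: "integrable P (\<lambda>\<omega>. A T \<omega> * L T \<omega>)" "(\<integral>\<omega>. A T \<omega> * L T \<omega> \<partial>P) = (\<integral>w. ?\<alpha> w * L T (snd w) \<partial>R)"
    unfolding A_def by (rule time[OF \<alpha>L])+
  have t8: "integrable P (\<lambda>\<omega>. B T \<omega> * N T \<omega>)" "(\<integral>\<omega>. B T \<omega> * N T \<omega> \<partial>P) = (\<integral>w. ?\<beta> w * N T (snd w) \<partial>R)"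
    unfolding B_def by (rule time[OF \<beta>NT])+
  have t5: "AE \<omega> in P. A T \<omega> * B T \<omega> = (\<integral>t. \<alpha> t \<omega> * B t \<omega> \<partial>lbT) + (\<integral>t. \<beta> t \<omega> * A t \<omega> \<partial>lbT)"
    using integral_R(4)[OF \<alpha>i] integral_R(4)[OF \<beta>i]
  proof eventually_elim
    case (elim \<omega>)
    then show ?case
      using integral_mult_absolutely_continuous(1)[of T "\<lambda>r. \<alpha> r \<omega>" "\<lambda>r. \<beta> r \<omega>"]
      by (simp add: A_def B_def set_integral_lbT(2,3)[OF Tin])
  qed
  have iAB: "integrable P (\<lambda>\<omega>. (\<integral>t. \<alpha> t \<omega> * B t \<omega> \<partial>lbT) + (\<integral>t. \<beta> t \<omega> * A t \<omega> \<partial>lbT))"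
    using integral_R(5)[OF \<alpha>B] integral_R(5)[OF \<beta>A] by simp
  have ATP: "A T \<in> borel_measurable P" and BTP: "B T \<in> borel_measurable P"
    using time_integral_measurable[OF \<alpha>R] time_integral_measurable[OF \<beta>m(2)] by (simp_all add: A_def B_def set_integral_lbT(2)[OF Tin])
  have iAB': "integrable P (\<lambda>\<omega>. A T \<omega> * B T \<omega>)"
    using iAB by (rule integrable_cong_AE_imp) (use t5 ATP BTP in auto)
  have eAB: "(\<integral>\<omega>. A T \<omega> * B T \<omega> \<partial>P) = (\<integral>w. ?\<alpha> w * B (fst w) (snd w) \<partial>R) + (\<integral>w. ?\<beta> w * A (fst w) (snd w) \<partial>R)"
  proof -
    have "(\<integral>\<omega>. A T \<omega> * B T \<omega> \<partial>P) = (\<integral>\<omega>. (\<integral>t. \<alpha> t \<omega> * B t \<omega> \<partial>lbT) + (\<integral>t. \<beta> t \<omega> * A t \<omega> \<partial>lbT) \<partial>P)"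
      by (rule integral_cong_AE) (use iAB' iAB t5 in auto)
    then show ?thesis
      using integral_R(1)[OF \<alpha>B] integral_R(1)[OF \<beta>A] integral_R(5)[OF \<alpha>B] integral_R(5)[OF \<beta>A] by simp
  qed
  have N0: "N 0 \<omega> = 0" for \<omega> by (simp add: N_def z)
  have L0: "AE \<omega> in P. L 0 \<omega> = 0" using X0 by eventually_elim (simp add: L_def z)
  have eN: "(\<integral>\<omega>. N T \<omega> \<partial>P) = 0" using orthN[OF T0, of "\<lambda>_. 1"] by (simp add: N0)
  \<comment> \<open>\<open>p 0\<close> may be random, so the martingale property of L is used at
    time 0, where L vanishes almost surely.\<close>
  have epL: "(\<integral>\<omega>. p 0 \<omega> * L T \<omega> \<partial>P) = 0"
  proof -
    have AEeq: "AE \<omega> in P. p 0 \<omega> * (L T \<omega> - L 0 \<omega>) = p 0 \<omega> * L T \<omega>" using L0 by eventually_elim simp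
    have m: "(\<lambda>\<omega>. p 0 \<omega> * (L T \<omega> - L 0 \<omega>)) \<in> borel_measurable P"
      using p0(2) Li[OF Tin] Li[OF T0] by (auto dest!: borel_measurable_integrable)
    have i: "integrable P (\<lambda>\<omega>. p 0 \<omega> * (L T \<omega> - L 0 \<omega>))"
      using pL by (rule integrable_cong_AE_imp[OF _ m]) (use AEeq in \<open>eventually_elim, simp\<close>)
    have "(\<integral>\<omega>. p 0 \<omega> * (L T \<omega> - L 0 \<omega>) \<partial>P) = 0"
      by (rule integral_mult_eq_0_of_bounded[OF F_subalgebra _ orthL[OF T0] p0(1) i]) (use Li Tin T0 in auto)
    moreover have "(\<integral>\<omega>. p 0 \<omega> * (L T \<omega> - L 0 \<omega>) \<partial>P) = (\<integral>\<omega>. p 0 \<omega> * L T \<omega> \<partial>P)"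
      by (rule integral_cong_AE) (use AEeq m pL in auto)
    ultimately show ?thesis by simp
  qed
  have e6: "(\<integral>w. ?\<alpha> w * L T (snd w) \<partial>R) = (\<integral>w. ?\<alpha> w * L (fst w) (snd w) \<partial>R)"
    by (rule integral_martingale_swap[OF \<alpha>m Li orthL \<alpha>L \<alpha>Ls])
  have e8: "(\<integral>w. ?\<beta> w * N T (snd w) \<partial>R) = (\<integral>w. ?\<beta> w * N (fst w) (snd w) \<partial>R)"
    by (rule integral_martingale_swap[OF \<beta>m(1) Ni orthN \<beta>NT \<beta>N])
  \<comment> \<open>Nine terms from multiplying out. Those with \<open>p 0 * L T\<close> and
    \<open>N T * x0\<close> have mean zero, and A_T B_T is rewritten by integration by
    parts.\<close>
  have exp: "p T \<omega> * X T \<omega> = p 0 \<omega> * x0 + B T \<omega> * p 0 \<omega> + p 0 \<omega> * L T \<omega> + A T \<omega> * x0 + A T \<omega> * B T \<omega> + A T \<omega> * L T \<omega>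
      + N T \<omega> * x0 + B T \<omega> * N T \<omega> + N T \<omega> * L T \<omega>" for \<omega>
    by (simp add: N_def L_def A_def B_def algebra_simps)
  have ints: "integrable P (\<lambda>\<omega>. p 0 \<omega> * x0)" "integrable P (\<lambda>\<omega>. N T \<omega> * x0)" using p0(2) Ni[OF Tin] by auto
  show "integrable P (\<lambda>\<omega>. p T \<omega> * X T \<omega>)"
    unfolding exp by (intro Bochner_Integration.integrable_add ints t2(1) pL t4(1) iAB' t6(1) t8(1) NL)
  have "(\<integral>\<omega>. p T \<omega> * X T \<omega> \<partial>P) = (\<integral>\<omega>. p 0 \<omega> \<partial>P) * x0 + (\<integral>w. ?\<beta> w * p 0 (snd w) \<partial>R) + (\<integral>w. ?\<alpha> w * x0 \<partial>R)
      + ((\<integral>w. ?\<alpha> w * B (fst w) (snd w) \<partial>R) + (\<integral>w. ?\<beta> w * A (fst w) (snd w) \<partial>R)) + (\<integral>w. ?\<alpha> w * L (fst w) (snd w) \<partial>R)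
      + (\<integral>w. ?\<beta> w * N (fst w) (snd w) \<partial>R) + (\<integral>\<omega>. N T \<omega> * L T \<omega> \<partial>P)"
    unfolding exp
    by (subst Bochner_Integration.integral_add, (intro Bochner_Integration.integrable_add ints t2(1) pL t4(1) iAB' t6(1) t8(1) NL)+)+
      (simp only: t2(2) t4(2) t6(2) t8(2) eAB epL e6 e8, simp add: eN)
  \<comment> \<open>Under the time integral the three parts of X recombine against \<alpha>, and
    below the three parts of p against \<beta>, so that A, B and the initial values
    disappear.\<close>
  also have "(\<integral>w. ?\<alpha> w * L (fst w) (snd w) \<partial>R) = (\<integral>w. ?\<alpha> w * X (fst w) (snd w) \<partial>R) - (\<integral>w. ?\<alpha> w * x0 \<partial>R) - (\<integral>w. ?\<alpha> w * B (fst w) (snd w) \<partial>R)"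
    using \<alpha>X integrable_mult_left[OF \<alpha>i, of x0] \<alpha>B by (simp add: L_def B_def right_diff_distrib)
  also have "(\<integral>w. ?\<beta> w * N (fst w) (snd w) \<partial>R) = (\<integral>w. ?\<beta> w * p (fst w) (snd w) \<partial>R) - (\<integral>w. ?\<beta> w * p 0 (snd w) \<partial>R) - (\<integral>w. ?\<beta> w * A (fst w) (snd w) \<partial>R)"
    using \<beta>p \<beta>p0 \<beta>A by (simp add: N_def A_def right_diff_distrib)
  finally show "(\<integral>\<omega>. p T \<omega> * X T \<omega> \<partial>P) = x0 * (\<integral>\<omega>. p 0 \<omega> \<partial>P) + (\<integral>w. ?\<alpha> w * X (fst w) (snd w) \<partial>R)
       + (\<integral>w. ?\<beta> w * p (fst w) (snd w) \<partial>R) + (\<integral>\<omega>. N T \<omega> * L T \<omega> \<partial>P)" by simp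
qed

end

section \<open>Regular versions and the product formula for the state and adjoint equations\<close>

context finite_horizon begin

lemma AE_R_I:
  assumes "AE \<omega> in P. \<forall>t\<in>{0..T}. Q (t, \<omega>)" "{w \<in> space R. Q w} \<in> sets R"
  shows "AE w in R. Q w"
proof (rule TP.AE_pair_measure[OF assms(2)])
  show "AE t in lbT. AE \<omega> in P. Q (t, \<omega>)"
    by (rule AE_I2) (use assms(1) in \<open>auto simp: space_restrict_space elim: eventually_mono\<close>)
qed

text \<open>\<open>S2\<close> with the cadlag property on every path instead of almost every path,
  so that joint measurability and predictability of left limits hold outright.\<close>

definition regular :: "(real \<Rightarrow> 'a \<Rightarrow> real) \<Rightarrow> bool" where
  "regular Y \<longleftrightarrow> (\<forall>t\<in>{0..T}. Y t \<in> borel_measurable (F t)) \<and> (\<forall>\<omega>\<in>space P. cadlag_on T (\<lambda>t. Y t \<omega>)) \<and>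
     (\<integral>\<^sup>+\<omega>. (SUP t\<in>{0..T}. ennreal (\<bar>Y t \<omega>\<bar>\<^sup>2)) \<partial>P) < \<infinity>"

lemma regular_measurable_F: "regular Y \<Longrightarrow> t \<in> {0..T} \<Longrightarrow> Y t \<in> borel_measurable (F t)"
  by (simp add: regular_def)

lemma regular_measurable: "regular Y \<Longrightarrow> t \<in> {0..T} \<Longrightarrow> Y t \<in> borel_measurable P"
  using F_measurable[OF _ regular_measurable_F[of Y t]] by simp

lemma regular_R: assumes "regular Y" shows "(\<lambda>w. Y (fst w) (snd w)) \<in> borel_measurable R"
  using cadlag_measurable_R[of Y] regular_measurable[OF assms] assms by (simp add: regular_def split_def)

lemma regular_square:
  assumes Y: "regular Y" and t: "t \<in> {0..T}" shows "integrable P (\<lambda>\<omega>. (Y t \<omega>)\<^sup>2)"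
proof (rule nn_integral_power2_lessD[OF regular_measurable[OF Y t]])
  have "(\<integral>\<^sup>+\<omega>. ennreal ((Y t \<omega>)\<^sup>2) \<partial>P) \<le> (\<integral>\<^sup>+\<omega>. (SUP t\<in>{0..T}. ennreal (\<bar>Y t \<omega>\<bar>\<^sup>2)) \<partial>P)"
    by (intro nn_integral_mono SUP_upper2[OF t]) simp
  also have "\<dots> < \<infinity>" using Y by (simp add: regular_def)
  finally show "(\<integral>\<^sup>+\<omega>. ennreal ((Y t \<omega>)\<^sup>2) \<partial>P) < \<infinity>" .
qed

lemma regular_square_R:
  assumes Y: "regular Y" shows "integrable R (\<lambda>w. (Y (fst w) (snd w))\<^sup>2)"
proof (rule nn_integral_power2_lessD[OF regular_R[OF Y]])
  let ?c = "\<integral>\<^sup>+\<omega>. (SUP t\<in>{0..T}. ennreal (\<bar>Y t \<omega>\<bar>\<^sup>2)) \<partial>P"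
  have "(\<integral>\<^sup>+w. ennreal ((Y (fst w) (snd w))\<^sup>2) \<partial>R) = (\<integral>\<^sup>+t. \<integral>\<^sup>+\<omega>. ennreal ((Y t \<omega>)\<^sup>2) \<partial>P \<partial>lbT)"
    using regular_R[OF Y] by (subst nn_integral_R(2)) auto
  also have "\<dots> \<le> (\<integral>\<^sup>+t. ?c \<partial>lbT)"
  proof (rule nn_integral_mono)
    fix t assume "t \<in> space lbT"
    then have t: "t \<in> {0..T}" by (simp add: space_restrict_space)
    show "(\<integral>\<^sup>+\<omega>. ennreal ((Y t \<omega>)\<^sup>2) \<partial>P) \<le> ?c"
      by (intro nn_integral_mono SUP_upper2[OF t]) simp
  qed
  also have "\<dots> = ?c * emeasure lbT (space lbT)" by simp
  also have "\<dots> < \<infinity>"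
    using Y finite_measure.emeasure_finite[OF finite_measure_lbT]
    by (simp add: regular_def ennreal_mult_less_top less_top)
  finally show "(\<integral>\<^sup>+w. ennreal ((Y (fst w) (snd w))\<^sup>2) \<partial>R) < \<infinity>" .
qed

end

context default_horizon begin

text \<open>For unbounded \<lambda> this does not follow from square integrability over
  \<open>R\<close>. Under dt the process may be replaced by its left limits, which are predictable,
  and the compensation formula gives E[Y_(\<tau>-)^2; \<tau> \<le> T], at most the mean of the
  supremum of Y^2.\<close>

lemma regular_lam:
  assumes Y: "regular Y" shows "integrable R (\<lambda>w. lamw w * (Y (fst w) (snd w))\<^sup>2)"
proof (rule integrableI_nonneg)
  note [measurable] = regular_R[OF Y]
  show "(\<lambda>w. lamw w * (Y (fst w) (snd w))\<^sup>2) \<in> borel_measurable R" by measurable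
  show "AE w in R. 0 \<le> lamw w * (Y (fst w) (snd w))\<^sup>2" using lamw_nonneg by (intro AE_I2) auto
  have c: "\<And>\<omega>. \<omega> \<in> space P \<Longrightarrow> cadlag_on T (\<lambda>t. Y t \<omega>)" using Y by (simp add: regular_def)
  have ll: "(\<lambda>w. left_limit Y (fst w) (snd w)) \<in> borel_measurable PR"
    using left_limit_predictable[of Y] Y by (simp add: regular_def split_def)
  note [measurable] = predictable_measurable_R[OF ll]
  let ?\<phi> = "\<lambda>w. ennreal ((left_limit Y (fst w) (snd w))\<^sup>2)"
  have "(\<integral>\<^sup>+w. ennreal (lamw w * (Y (fst w) (snd w))\<^sup>2) \<partial>R) = (\<integral>\<^sup>+\<omega>. \<integral>\<^sup>+t. ennreal (lam t \<omega> * (Y t \<omega>)\<^sup>2) \<partial>lbT \<partial>P)"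
    by (subst nn_integral_R(1)) auto
  also have "\<dots> = (\<integral>\<^sup>+\<omega>. \<integral>\<^sup>+t. ?\<phi> (t, \<omega>) * ennreal (lamw (t, \<omega>)) \<partial>lbT \<partial>P)"
  proof (rule nn_integral_cong)
    fix \<omega> assume \<omega>: "\<omega> \<in> space P"
    show "(\<integral>\<^sup>+t. ennreal (lam t \<omega> * (Y t \<omega>)\<^sup>2) \<partial>lbT) = (\<integral>\<^sup>+t. ?\<phi> (t, \<omega>) * ennreal (lamw (t, \<omega>)) \<partial>lbT)"
    proof (rule nn_integral_cong_AE)
      show "AE t in lbT. ennreal (lam t \<omega> * (Y t \<omega>)\<^sup>2) = ?\<phi> (t, \<omega>) * ennreal (lamw (t, \<omega>))"
        using AE_left_limit_eq[where Y=Y and \<omega>=\<omega>, OF c[OF \<omega>]] AE_space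
      proof eventually_elim
        case (elim t)
        then have "0 \<le> lam t \<omega>" using lam_nonneg[OF _ \<omega>] by (simp add: space_restrict_space)
        then show ?case using elim by (simp add: ennreal_mult mult.commute)
      qed
    qed
  qed
  also have "\<dots> = (\<integral>\<^sup>+w. ?\<phi> w * ennreal (lamw w) \<partial>R)" by (subst nn_integral_R(1)) auto
  also have "\<dots> = (\<integral>\<^sup>+\<omega>. (if \<tau> \<omega> \<le> T then ?\<phi> (\<tau> \<omega>, \<omega>) else 0) \<partial>P)"
    using measurable_compose[OF ll, of "\<lambda>x. ennreal (x\<^sup>2)" borel]
    by (intro compensation_formula_nn[symmetric]) simp
  also have "\<dots> \<le> (\<integral>\<^sup>+\<omega>. (SUP t\<in>{0..T}. ennreal (\<bar>Y t \<omega>\<bar>\<^sup>2)) \<partial>P)"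
  proof (rule nn_integral_mono)
    fix \<omega> assume \<omega>: "\<omega> \<in> space P"
    show "(if \<tau> \<omega> \<le> T then ?\<phi> (\<tau> \<omega>, \<omega>) else 0) \<le> (SUP t\<in>{0..T}. ennreal (\<bar>Y t \<omega>\<bar>\<^sup>2))"
    proof (cases "\<tau> \<omega> \<le> T")
      case True
      have t0: "\<tau> \<omega> \<in> {0<..T}" using True tau_positive[OF \<omega>] by simp
      have "((\<lambda>s. ennreal ((Y s \<omega>)\<^sup>2)) \<longlongrightarrow> ennreal ((left_limit Y (\<tau> \<omega>) \<omega>)\<^sup>2)) (at_left (\<tau> \<omega>))"
        by (intro tendsto_ennrealI tendsto_power cadlag_left_limit[where Y=Y and \<omega>=\<omega>, OF c[OF \<omega>] t0])
      moreover have "eventually (\<lambda>s. ennreal ((Y s \<omega>)\<^sup>2) \<le> (SUP t\<in>{0..T}. ennreal (\<bar>Y t \<omega>\<bar>\<^sup>2))) (at_left (\<tau> \<omega>))"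
      proof -
        have "eventually (\<lambda>s. s \<in> {0<..<\<tau> \<omega>}) (at_left (\<tau> \<omega>))" using t0 by (intro eventually_at_left_real) auto
        then show ?thesis
        proof eventually_elim
          case (elim s)
          then have "s \<in> {0..T}" using True by auto
          then show ?case by (rule SUP_upper2) simp
        qed
      qed
      ultimately have "ennreal ((left_limit Y (\<tau> \<omega>) \<omega>)\<^sup>2) \<le> (SUP t\<in>{0..T}. ennreal (\<bar>Y t \<omega>\<bar>\<^sup>2))"
        by (rule tendsto_upperbound) simp
      then show ?thesis using True by simp
    qed simp
  qed
  also have "\<dots> < \<infinity>" using Y by (simp add: regular_def)
  finally show "(\<integral>\<^sup>+w. ennreal (lamw w * (Y (fst w) (snd w))\<^sup>2) \<partial>R) < \<infinity>" .
qed

lemma pbounded_square: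
  assumes b: "pbounded C \<kappa>" shows "integrable R (\<lambda>x. (\<kappa> (fst x) (snd x))\<^sup>2 * lamw x)"
  using jmp_isometry_bounded(2)[OF b b] by (simp add: power2_eq_square)

lemma integral_singleton_Icc: "(LBINT r:{0..0::real}. f r) = (0::real)"
  unfolding set_lebesgue_integral_def
  by (rule integral_eq_zero_AE) (use AE_lborel_singleton[of 0] in \<open>eventually_elim, auto split: split_indicator\<close>)

text \<open>\<open>y0\<close> is \<open>p 0\<close> for the adjoint process and the constant
  \<open>x0\<close> for the state, whose value at time 0 agrees with it only almost surely. All that
  later arguments use of a martingale is collected here: the decomposition, integrability and the
  tested martingale property.\<close>

lemma martingale_part:
  assumes d: "has_stoch_differential P W \<tau> lam T Y \<beta> \<zeta> \<kappa>"
    and Y: "\<And>t. t \<in> {0..T} \<Longrightarrow> Y t \<in> borel_measurable P"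
    and y0: "y0 \<in> borel_measurable P" "AE \<omega> in P. Y 0 \<omega> = y0 \<omega>"
    and \<beta>: "(\<lambda>w. \<beta> (fst w) (snd w)) \<in> borel_measurable R" and \<zeta>: "(\<lambda>w. \<zeta> (fst w) (snd w)) \<in> borel_measurable R"
    and \<kappa>: "pred \<kappa>" "integrable R (\<lambda>x. (\<kappa> (fst x) (snd x))\<^sup>2 * lamw x)"
    and M: "\<And>t \<omega>. M t \<omega> = Y t \<omega> - y0 \<omega> - (LBINT r:{0..t}. \<beta> r \<omega>)"
  obtains I where "has_ito_integral P F W T \<zeta> I"
    "AE \<omega> in P. \<forall>t\<in>{0..T}. M t \<omega> = I t \<omega> + jmp \<kappa> t \<omega>" "AE \<omega> in P. I 0 \<omega> = 0"
    "\<forall>t\<in>{0..T}. integrable P (M t)" "integrable P (\<lambda>\<omega>. (M T \<omega>)\<^sup>2)"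
    "\<forall>t\<in>{0..T}. \<forall>\<xi>\<in>borel_measurable (F t). (\<forall>\<omega>\<in>space P. \<bar>\<xi> \<omega>\<bar> \<le> 1)
        \<longrightarrow> (\<integral>\<omega>. \<xi> \<omega> * (M T \<omega> - M t \<omega>) \<partial>P) = 0"
proof -
  have Tin: "T \<in> {0..T}" and T0: "0 \<in> {0..T}" using T_pos by auto
  have \<kappa>i: "integrable R (\<lambda>w. \<kappa> (fst w) (snd w) * lamw w)" by (rule integrable_lam_of_square[OF \<kappa>])
  obtain I where I: "has_ito_integral P F W T \<zeta> I"
    and eq: "AE \<omega> in P. \<forall>t\<in>{0..T}. Y t \<omega> = Y 0 \<omega> + (LBINT s:{0..t}. \<beta> s \<omega>) + I t \<omega> + jump_integral \<tau> lam \<kappa> t \<omega>"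
    and st: "AE \<omega> in P. stieltjes_integrable (default_indicator \<tau>) \<kappa> T \<omega> \<and> stieltjes_integrable (compensator lam) \<kappa> T \<omega>"
    using d unfolding has_stoch_differential_def by blast
  have e: "AE \<omega> in P. \<forall>t\<in>{0..T}. M t \<omega> = I t \<omega> + jmp \<kappa> t \<omega>"
    using eq AE_jump_integral_eq[OF st] y0(2)
  proof eventually_elim
    case (elim \<omega>)
    show ?case
    proof
      fix t assume t: "t \<in> {0..T}"
      from elim(1)[rule_format, OF t] elim(2)[rule_format, OF t] elim(3)
      show "M t \<omega> = I t \<omega> + jmp \<kappa> t \<omega>" unfolding M by linarith
    qed
  qed
  have i0: "AE \<omega> in P. I 0 \<omega> = 0"
    using e y0(2) AE_space
  proof eventually_elim
    case (elim \<omega>)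
    from elim(1) T0 have "M 0 \<omega> = I 0 \<omega> + jmp \<kappa> 0 \<omega>" by blast
    then show ?case using elim(2) jmp_zero[OF elim(3)] unfolding M integral_singleton_Icc by simp
  qed
  note iI = ito_L2[OF I \<zeta>]
  have run: "(\<lambda>\<omega>. LBINT r:{0..t}. \<beta> r \<omega>) \<in> borel_measurable P" if t: "t \<in> {0..T}" for t
    using measurable_compose[OF measurable_Pair1' running_integral_measurable[OF \<beta>], of t] t by (simp add: space_restrict_space)
  have Mm: "M t \<in> borel_measurable P" if t: "t \<in> {0..T}" for t
    unfolding M[abs_def] using Y[OF t] y0(1) run[OF t] by measurable
  have et: "AE \<omega> in P. I t \<omega> + jmp \<kappa> t \<omega> = M t \<omega>" if t: "t \<in> {0..T}" for t
    using e by eventually_elim (use t in auto)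
  have Mi: "integrable P (M t)" if t: "t \<in> {0..T}" for t
  proof -
    have "integrable P (\<lambda>\<omega>. I t \<omega> + jmp \<kappa> t \<omega>)" using iI(3)[OF t] jmp_integrable[OF \<kappa>(1) \<kappa>i t] by simp
    then show ?thesis by (rule integrable_cong_AE_imp[OF _ Mm[OF t]]) (use et[OF t] in \<open>eventually_elim, simp\<close>)
  qed
  have M2: "integrable P (\<lambda>\<omega>. (M T \<omega>)\<^sup>2)"
  proof -
    have "integrable P (\<lambda>\<omega>. (I T \<omega> + jmp \<kappa> T \<omega>)\<^sup>2)"
      using iI(1,2)[OF Tin] jmp_measurable[OF \<kappa>(1) Tin] L2_tendsto_integrable[OF jmp_L2_tendsto[OF \<kappa>]] by (intro L2_add_integrable)
    moreover have "AE \<omega> in P. (I T \<omega> + jmp \<kappa> T \<omega>)\<^sup>2 = (M T \<omega>)\<^sup>2"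
      using et[OF Tin] by eventually_elim simp
    moreover have "(\<lambda>\<omega>. (M T \<omega>)\<^sup>2) \<in> borel_measurable P" using Mm[OF Tin] by measurable
    ultimately show ?thesis using integrable_cong_AE_imp by blast
  qed
  have orth: "(\<integral>\<omega>. \<xi> \<omega> * (M T \<omega> - M t \<omega>) \<partial>P) = 0"
    if t: "t \<in> {0..T}" and \<xi>: "\<xi> \<in> borel_measurable (F t)" "\<And>\<omega>. \<omega> \<in> space P \<Longrightarrow> \<bar>\<xi> \<omega>\<bar> \<le> 1" for t \<xi>
  proof -
    have \<xi>P: "\<xi> \<in> borel_measurable P" using F_measurable[OF _ \<xi>(1)] t by auto
    have j: "integrable P (\<lambda>\<omega>. \<xi> \<omega> * (jmp \<kappa> T \<omega> - jmp \<kappa> t \<omega>))" "(\<integral>\<omega>. \<xi> \<omega> * (jmp \<kappa> T \<omega> - jmp \<kappa> t \<omega>) \<partial>P) = 0"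
      by (rule jmp_orthogonal[OF \<kappa>(1) \<kappa>i _ _ _ \<xi>(1), where C=1]; use t \<xi>(2) in auto)+
    have i: "integrable P (\<lambda>\<omega>. \<xi> \<omega> * (I T \<omega> - I t \<omega>))"
      using iI(3)[OF t] iI(3)[OF Tin] by (intro mult_bounded_integrable[OF \<xi>P \<xi>(2)]) auto
    have "(\<integral>\<omega>. \<xi> \<omega> * (M T \<omega> - M t \<omega>) \<partial>P) = (\<integral>\<omega>. \<xi> \<omega> * (I T \<omega> - I t \<omega>) + \<xi> \<omega> * (jmp \<kappa> T \<omega> - jmp \<kappa> t \<omega>) \<partial>P)"
    proof (rule integral_cong_AE)
      show "AE \<omega> in P. \<xi> \<omega> * (M T \<omega> - M t \<omega>) = \<xi> \<omega> * (I T \<omega> - I t \<omega>) + \<xi> \<omega> * (jmp \<kappa> T \<omega> - jmp \<kappa> t \<omega>)"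
        using et[OF t] et[OF Tin] by eventually_elim (simp add: algebra_simps flip: distrib_left)
    qed (use \<xi>P Mm[OF t] Mm[OF Tin] i j in auto)
    also have "\<dots> = 0" using i j ito_orthogonal[OF I \<zeta> t \<xi>] by simp
    finally show ?thesis .
  qed
  show ?thesis by (rule that[OF I e i0 _ M2]) (use Mi orth in blast)+
qed

text \<open>Needed because the drift of p contains \<lambda> w, which is multiplied by L_T. Split
  L_T = I_T + J_T. The jump part is bounded by a multiple of 1 + \<Lambda>_T. In I_T = I_t + (I_T -
  I_t) the first term is controlled through X_t and \<open>regular_lam\<close>, the second by the
  conditional second moment with weight \<lambda>_t, for which boundedness of \<zeta> is
  essential.\<close>

lemma lam_terminal_square:
  assumes X: "regular X" and d: "has_stoch_differential P W \<tau> lam T X \<beta> \<zeta> \<kappa>" and X0: "AE \<omega> in P. X 0 \<omega> = x0"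
    and \<beta>: "(\<lambda>w. \<beta> (fst w) (snd w)) \<in> borel_measurable R" "\<And>w. w \<in> space R \<Longrightarrow> \<bar>\<beta> (fst w) (snd w)\<bar> \<le> C"
    and \<zeta>: "(\<lambda>w. \<zeta> (fst w) (snd w)) \<in> borel_measurable R" "\<And>w. w \<in> space R \<Longrightarrow> \<bar>\<zeta> (fst w) (snd w)\<bar> \<le> C"
    and b: "pbounded C \<kappa>"
    and L: "\<And>t \<omega>. L t \<omega> = X t \<omega> - x0 - (LBINT r:{0..t}. \<beta> r \<omega>)"
  shows "integrable R (\<lambda>w. lamw w * (L T (snd w))\<^sup>2)"
proof -
  have Tin: "T \<in> {0..T}" and T0: "0 \<in> {0..T}" using T_pos by auto
  have \<kappa>: "pred \<kappa>" and C: "0 \<le> C" using b by (auto simp: pbounded_def)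
  obtain I where I: "has_ito_integral P F W T \<zeta> I"
    and e: "AE \<omega> in P. \<forall>t\<in>{0..T}. L t \<omega> = I t \<omega> + jmp \<kappa> t \<omega>" "AE \<omega> in P. I 0 \<omega> = 0"
    and Li: "\<forall>t\<in>{0..T}. integrable P (L t)"
    by (rule martingale_part[OF d regular_measurable[OF X] borel_measurable_const X0 \<beta>(1) \<zeta>(1) \<kappa> pbounded_square[OF b] L], assumption)
      (rule that; assumption)
  have LP[measurable]: "L T \<in> borel_measurable P" using Li Tin by auto
  have JP[measurable]: "jmp \<kappa> T \<in> borel_measurable P" by (rule jmp_measurable[OF \<kappa> Tin])
  note [measurable] = jmp_measurable_R[OF \<kappa>] regular_R[OF X]
  let ?B = "\<lambda>w. LBINT r:{0..fst w}. \<beta> r (snd w)"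
  have Bm[measurable]: "?B \<in> borel_measurable R"
    using running_integral_measurable[OF \<beta>(1)] by (simp add: split_def)
  \<comment> \<open>Joint measurability is known for L and J but not for the Ito integral, which is
    given time by time; I_t is therefore represented by their difference.\<close>
  let ?I = "\<lambda>w. L (fst w) (snd w) - jmp \<kappa> (fst w) (snd w)"
  have Im[measurable]: "?I \<in> borel_measurable R" unfolding L by measurable
  have \<Lambda>0: "w \<in> space R \<Longrightarrow> 0 \<le> compensator lam T (snd w)" for w using compensator_nonneg by auto
  have lamL2: "integrable R (\<lambda>w. lamw w * (1 + compensator lam T (snd w))\<^sup>2)"
  proof (rule integrable_lam_mult)
    show "integrable P (\<lambda>\<omega>. compensator lam T \<omega> * (1 + compensator lam T \<omega>)\<^sup>2)"
    proof (rule integrable_compensator_bound[where c=1 and n=3])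
      show "AE \<omega> in P. \<bar>compensator lam T \<omega> * (1 + compensator lam T \<omega>)\<^sup>2\<bar> \<le> 1 * (1 + compensator lam T \<omega>) ^ 3"
      proof (rule AE_I2)
        fix \<omega> assume "\<omega> \<in> space P"
        then have "0 \<le> compensator lam T \<omega>" by (rule compensator_nonneg)
        then have "compensator lam T \<omega> * (1 + compensator lam T \<omega>)\<^sup>2 \<le> (1 + compensator lam T \<omega>) * (1 + compensator lam T \<omega>)\<^sup>2"
          by (intro mult_right_mono) auto
        then show "\<bar>compensator lam T \<omega> * (1 + compensator lam T \<omega>)\<^sup>2\<bar> \<le> 1 * (1 + compensator lam T \<omega>) ^ 3"
          using \<open>0 \<le> compensator lam T \<omega>\<close> by (simp add: power3_eq_cube power2_eq_square abs_mult)
      qed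
    qed measurable
  qed measurable
  have Jsq: "AE w in R. (jmp \<kappa> T (snd w))\<^sup>2 \<le> C\<^sup>2 * (1 + compensator lam T (snd w))\<^sup>2 \<and>
      (jmp \<kappa> (fst w) (snd w))\<^sup>2 \<le> C\<^sup>2 * (1 + compensator lam T (snd w))\<^sup>2"
  proof (rule AE_R_I)
    show "AE \<omega> in P. \<forall>t\<in>{0..T}. (jmp \<kappa> T (snd (t, \<omega>)))\<^sup>2 \<le> C\<^sup>2 * (1 + compensator lam T (snd (t, \<omega>)))\<^sup>2 \<and>
      (jmp \<kappa> (fst (t, \<omega>)) (snd (t, \<omega>)))\<^sup>2 \<le> C\<^sup>2 * (1 + compensator lam T (snd (t, \<omega>)))\<^sup>2"
      using AE_jmp_bound[OF b]
    proof eventually_elim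
      case (elim \<omega>)
      have "(jmp \<kappa> t \<omega>)\<^sup>2 \<le> C\<^sup>2 * (1 + compensator lam T \<omega>)\<^sup>2" if "t \<in> {0..T}" for t
        using power_mono[of "\<bar>jmp \<kappa> t \<omega>\<bar>" "C * (1 + compensator lam T \<omega>)" 2] elim that by (simp add: power_mult_distrib)
      then show ?case using Tin by simp
    qed
  qed measurable
  have Bsq: "(?B w)\<^sup>2 \<le> (C * T)\<^sup>2" if w: "w \<in> space R" for w
  proof -
    obtain s \<omega> where s: "w = (s, \<omega>)" "s \<in> {0..T}" "\<omega> \<in> space P" using w by auto
    have m: "(\<lambda>r. \<beta> r \<omega>) \<in> borel_measurable lbT"
      using measurable_compose[OF measurable_Pair2'[OF s(3)] \<beta>(1)] by simp
    have bd: "r \<in> space lbT \<Longrightarrow> \<bar>\<beta> r \<omega>\<bar> \<le> C" for r using \<beta>(2)[of "(r, \<omega>)"] s by (auto simp: space_restrict_space)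
    have i: "integrable lbT (\<lambda>r. \<beta> r \<omega>)"
      by (rule finite_measure.integrable_const_bound[OF finite_measure_lbT, where B=C]) (use m bd in \<open>auto intro: AE_I2\<close>)
    have "\<bar>\<integral>r. indicator {0..s} r * \<beta> r \<omega> \<partial>lbT\<bar> \<le> (\<integral>r. C \<partial>lbT)"
      using bd C finite_measure_lbT lbT_integrable_indicator[OF i]
      by (intro integral_abs_bound_integral) (auto intro: finite_measure.integrable_const simp: abs_mult split: split_indicator)
    also have "\<dots> = C * T" using T_pos by (simp add: measure_restrict_space space_restrict_space)
    finally have "\<bar>?B w\<bar> \<le> C * T" unfolding s(1) using set_integral_lbT(1)[OF s(2)] by simp
    then show ?thesis using power_mono[of "\<bar>?B w\<bar>" "C * T" 2] by simp
  qed
  let ?D = "\<lambda>w. lamw w * (X (fst w) (snd w))\<^sup>2 + (x0\<^sup>2 + (C * T)\<^sup>2) * lamw w + C\<^sup>2 * (lamw w * (1 + compensator lam T (snd w))\<^sup>2)"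
  \<comment> \<open>16 = 4 * 4: one factor from \<open>?G\<close>, the other from the square of a
    sum of four terms.\<close>
  let ?H = "\<lambda>w. 2 * (C\<^sup>2 * (lamw w * (1 + compensator lam T (snd w))\<^sup>2)) + 16 * ?D w"
  have Hi: "integrable R ?H" using regular_lam[OF X] integrable_lam lamL2 by auto
  have dom: "AE w in R. lamw w * (2 * (jmp \<kappa> T (snd w))\<^sup>2 + 4 * (?I w)\<^sup>2) \<le> ?H w"
    using Jsq AE_space
  proof eventually_elim
    case (elim w)
    let ?x = "X (fst w) (snd w)" and ?j = "jmp \<kappa> (fst w) (snd w)"
    have "(?I w)\<^sup>2 \<le> 4 * (?x\<^sup>2 + x0\<^sup>2 + (?B w)\<^sup>2 + ?j\<^sup>2)"
    proof -
      have "(a - b - c - d)\<^sup>2 \<le> 4 * (a\<^sup>2 + b\<^sup>2 + c\<^sup>2 + d\<^sup>2)" for a b c d :: real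
        using zero_le_power2[of "a + b"] zero_le_power2[of "a + c"] zero_le_power2[of "a + d"] zero_le_power2[of "b - c"] zero_le_power2[of "b - d"] zero_le_power2[of "c - d"]
        by (simp add: power2_eq_square algebra_simps)
      then show ?thesis unfolding L by blast
    qed
    also have "\<dots> \<le> 4 * (?x\<^sup>2 + x0\<^sup>2 + (C * T)\<^sup>2 + C\<^sup>2 * (1 + compensator lam T (snd w))\<^sup>2)"
      using elim(1) Bsq[OF elim(2)] by auto
    finally have "2 * (jmp \<kappa> T (snd w))\<^sup>2 + 4 * (?I w)\<^sup>2 \<le> 2 * (C\<^sup>2 * (1 + compensator lam T (snd w))\<^sup>2) + 16 * (?x\<^sup>2 + x0\<^sup>2 + (C * T)\<^sup>2 + C\<^sup>2 * (1 + compensator lam T (snd w))\<^sup>2)"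
      using elim(1) by auto
    from mult_left_mono[OF this lamw_nonneg[OF elim(2)]] show ?case by (simp add: algebra_simps)
  qed
  let ?G = "\<lambda>w. lamw w * (2 * (jmp \<kappa> T (snd w))\<^sup>2 + 4 * (?I w)\<^sup>2)"
  have Gi: "integrable R ?G"
  proof (rule Bochner_Integration.integrable_bound[OF Hi])
    show "AE w in R. norm (?G w) \<le> norm (?H w)"
      using dom AE_space by eventually_elim (use lamw_nonneg in auto)
  qed measurable
  show ?thesis
  proof (rule integrableI_nonneg)
    show "AE w in R. 0 \<le> lamw w * (L T (snd w))\<^sup>2" using lamw_nonneg by (intro AE_I2) auto
    have "(\<integral>\<^sup>+w. ennreal (lamw w * (L T (snd w))\<^sup>2) \<partial>R) = (\<integral>\<^sup>+t. \<integral>\<^sup>+\<omega>. ennreal (lam t \<omega> * (L T \<omega>)\<^sup>2) \<partial>P \<partial>lbT)"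
      by (subst nn_integral_R(2)) auto
    also have "\<dots> \<le> (\<integral>\<^sup>+t. (\<integral>\<^sup>+\<omega>. ennreal (?G (t, \<omega>)) \<partial>P) + (4 * ennreal (C\<^sup>2 * T)) * (\<integral>\<^sup>+\<omega>. ennreal (lam t \<omega>) \<partial>P) \<partial>lbT)"
    proof (rule nn_integral_mono)
      fix t assume "t \<in> space lbT"
      then have t: "t \<in> {0..T}" by (simp add: space_restrict_space)
      have lP: "lam t \<in> borel_measurable P" using F_measurable[OF _ lam_section[OF t]] t by auto
      have Gm: "(\<lambda>\<omega>. ?G (t, \<omega>)) \<in> borel_measurable P"
        using measurable_compose[OF measurable_Pair1' borel_measurable_integrable[OF Gi], of t] t by (simp add: space_restrict_space)
      note [measurable] = ito_L2(1)[OF I \<zeta>(1) t] ito_L2(1)[OF I \<zeta>(1) Tin] lP Gm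
      have "(\<integral>\<^sup>+\<omega>. ennreal (lam t \<omega> * (L T \<omega>)\<^sup>2) \<partial>P) \<le> (\<integral>\<^sup>+\<omega>. ennreal (?G (t, \<omega>)) + 4 * ennreal (lam t \<omega> * (I T \<omega> - I t \<omega>)\<^sup>2) \<partial>P)"
      proof (rule nn_integral_mono_AE)
        show "AE \<omega> in P. ennreal (lam t \<omega> * (L T \<omega>)\<^sup>2) \<le> ennreal (?G (t, \<omega>)) + 4 * ennreal (lam t \<omega> * (I T \<omega> - I t \<omega>)\<^sup>2)"
          using e(1) AE_space
        proof eventually_elim
          case (elim \<omega>)
          have l0: "0 \<le> lam t \<omega>" using lam_nonneg[OF _ elim(2)] t by auto
          have i: "?I (t, \<omega>) = I t \<omega>" and LT: "L T \<omega> = I T \<omega> + jmp \<kappa> T \<omega>" using elim(1) t Tin by auto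
          \<comment> \<open>The constants combine (a + c)^2 \<le> 2 a^2 + 2 c^2 with a^2 \<le> 2 b^2
            + 2 (a - b)^2, for a = I_T, b = I_t and c = J_T.\<close>
          have "(a + c)\<^sup>2 \<le> 2 * c\<^sup>2 + 4 * b\<^sup>2 + 4 * (a - b)\<^sup>2" for a b c :: real
            using zero_le_power2[of "a - c"] zero_le_power2[of "a - 2 * b"] by (simp add: power2_eq_square algebra_simps)
          then have "(L T \<omega>)\<^sup>2 \<le> (2 * (jmp \<kappa> T \<omega>)\<^sup>2 + 4 * (?I (t, \<omega>))\<^sup>2) + 4 * (I T \<omega> - I t \<omega>)\<^sup>2" unfolding i LT .
          from mult_left_mono[OF this l0] have "lam t \<omega> * (L T \<omega>)\<^sup>2 \<le> ?G (t, \<omega>) + 4 * (lam t \<omega> * (I T \<omega> - I t \<omega>)\<^sup>2)"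
            by (simp add: algebra_simps)
          then have "ennreal (lam t \<omega> * (L T \<omega>)\<^sup>2) \<le> ennreal (?G (t, \<omega>) + 4 * (lam t \<omega> * (I T \<omega> - I t \<omega>)\<^sup>2))" by (rule ennreal_leI)
          also have "\<dots> = ennreal (?G (t, \<omega>)) + 4 * ennreal (lam t \<omega> * (I T \<omega> - I t \<omega>)\<^sup>2)"
            using l0 by (simp add: ennreal_plus ennreal_mult')
          finally show ?case .
        qed
      qed
      also have "\<dots> = (\<integral>\<^sup>+\<omega>. ennreal (?G (t, \<omega>)) \<partial>P) + 4 * (\<integral>\<^sup>+\<omega>. ennreal (lam t \<omega> * (I T \<omega> - I t \<omega>)\<^sup>2) \<partial>P)"
        using Gm by (simp add: nn_integral_add nn_integral_cmult)
      also have "\<dots> \<le> (\<integral>\<^sup>+\<omega>. ennreal (?G (t, \<omega>)) \<partial>P) + 4 * (ennreal (C\<^sup>2 * T) * (\<integral>\<^sup>+\<omega>. ennreal (lam t \<omega>) \<partial>P))"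
        using t lam_nonneg by (intro add_left_mono mult_left_mono ito_conditional_second_moment_nn[OF I \<zeta>(1) t lam_section[OF t] _ \<zeta>(2)]) auto
      finally show "(\<integral>\<^sup>+\<omega>. ennreal (lam t \<omega> * (L T \<omega>)\<^sup>2) \<partial>P) \<le> (\<integral>\<^sup>+\<omega>. ennreal (?G (t, \<omega>)) \<partial>P) + (4 * ennreal (C\<^sup>2 * T)) * (\<integral>\<^sup>+\<omega>. ennreal (lam t \<omega>) \<partial>P)"
        by (simp add: mult.assoc)
    qed
    also have "\<dots> = (\<integral>\<^sup>+t. \<integral>\<^sup>+\<omega>. ennreal (?G (t, \<omega>)) \<partial>P \<partial>lbT) + (4 * ennreal (C\<^sup>2 * T)) * (\<integral>\<^sup>+t. \<integral>\<^sup>+\<omega>. ennreal (lam t \<omega>) \<partial>P \<partial>lbT)"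
    proof -
      have m1: "(\<lambda>t. \<integral>\<^sup>+\<omega>. ennreal (?G (t, \<omega>)) \<partial>P) \<in> borel_measurable lbT"
        using borel_measurable_nn_integral_fst[of "\<lambda>w. ennreal (?G w)" lbT] by measurable
      have m2: "(\<lambda>t. \<integral>\<^sup>+\<omega>. ennreal (lam t \<omega>) \<partial>P) \<in> borel_measurable lbT"
        using borel_measurable_nn_integral_fst[of "\<lambda>w. ennreal (lamw w)" lbT] by simp
      show ?thesis by (subst nn_integral_add) (use m1 m2 in \<open>auto simp: nn_integral_cmult\<close>)
    qed
    also have "\<dots> = (\<integral>\<^sup>+w. ennreal (?G w) \<partial>R) + (4 * ennreal (C\<^sup>2 * T)) * (\<integral>\<^sup>+w. ennreal (lamw w) \<partial>R)"
      by (subst (1 2) nn_integral_R(2)) auto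
    also have "\<dots> < \<infinity>"
    proof -
      have "(\<integral>\<^sup>+w. ennreal (?G w) \<partial>R) = ennreal (\<integral>w. ?G w \<partial>R)"
        using Gi lamw_nonneg by (intro nn_integral_eq_integral AE_I2) auto
      moreover have "(\<integral>\<^sup>+w. ennreal (lamw w) \<partial>R) = ennreal (\<integral>w. lamw w \<partial>R)"
        using integrable_lam lamw_nonneg by (intro nn_integral_eq_integral AE_I2) auto
      ultimately show ?thesis by (simp add: ennreal_mult_less_top)
    qed
    finally show "(\<integral>\<^sup>+w. ennreal (lamw w * (L T (snd w))\<^sup>2) \<partial>R) < \<infinity>" .
  qed measurable
qed

text \<open>The two equations play different roles: the state has bounded coefficients, while the
  drift of p grows affinely in p, q and \<lambda> w, as the x-derivative of the Hamiltonian does.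
  The bilinear martingale term becomes the sum of the q-\<zeta> and w-\<kappa> integrals.\<close>

theorem product_formula:
  assumes p: "regular p" and X: "regular X" and X0: "AE \<omega> in P. X 0 \<omega> = x0"
    and dp: "has_stoch_differential P W \<tau> lam T p \<alpha> q w"
    and dX: "has_stoch_differential P W \<tau> lam T X \<beta> \<zeta> \<kappa>"
    and q: "pred q" "integrable R (\<lambda>x. (q (fst x) (snd x))\<^sup>2)"
    and w: "pred w" "integrable R (\<lambda>x. (w (fst x) (snd x))\<^sup>2 * lamw x)"
    and \<alpha>: "\<And>t. t \<in> {0..T} \<Longrightarrow> \<alpha> t \<in> borel_measurable (F t)" "(\<lambda>x. \<alpha> (fst x) (snd x)) \<in> borel_measurable R"
      "\<And>x. x \<in> space R \<Longrightarrow> \<bar>\<alpha> (fst x) (snd x)\<bar> \<le> D * (1 + \<bar>p (fst x) (snd x)\<bar> + \<bar>q (fst x) (snd x)\<bar> + lamw x * \<bar>w (fst x) (snd x)\<bar>)"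
    and \<beta>: "\<And>t. t \<in> {0..T} \<Longrightarrow> \<beta> t \<in> borel_measurable (F t)" "(\<lambda>x. \<beta> (fst x) (snd x)) \<in> borel_measurable R"
      "\<And>x. x \<in> space R \<Longrightarrow> \<bar>\<beta> (fst x) (snd x)\<bar> \<le> C"
    and \<zeta>: "(\<lambda>x. \<zeta> (fst x) (snd x)) \<in> borel_measurable R" "\<And>x. x \<in> space R \<Longrightarrow> \<bar>\<zeta> (fst x) (snd x)\<bar> \<le> C"
    and b: "pbounded C \<kappa>"
  shows "integrable P (\<lambda>\<omega>. p T \<omega> * X T \<omega>)"
    and "integrable R (\<lambda>x. \<alpha> (fst x) (snd x) * X (fst x) (snd x))"
    and "integrable R (\<lambda>x. \<beta> (fst x) (snd x) * p (fst x) (snd x))"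
    and "integrable R (\<lambda>x. q (fst x) (snd x) * \<zeta> (fst x) (snd x))"
    and "integrable R (\<lambda>x. w (fst x) (snd x) * \<kappa> (fst x) (snd x) * lamw x)"
    and "(\<integral>\<omega>. p T \<omega> * X T \<omega> \<partial>P) = x0 * (\<integral>\<omega>. p 0 \<omega> \<partial>P) + (\<integral>x. \<alpha> (fst x) (snd x) * X (fst x) (snd x) \<partial>R)
      + (\<integral>x. \<beta> (fst x) (snd x) * p (fst x) (snd x) \<partial>R)
      + ((\<integral>x. q (fst x) (snd x) * \<zeta> (fst x) (snd x) \<partial>R) + (\<integral>x. w (fst x) (snd x) * \<kappa> (fst x) (snd x) * lamw x \<partial>R))"
proof -
  have Tin: "T \<in> {0..T}" and T0: "0 \<in> {0..T}" using T_pos by auto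
  have \<kappa>: "pred \<kappa>" and C: "0 \<le> C" using b by (auto simp: pbounded_def)
  note [measurable] = regular_R[OF p] regular_R[OF X] \<alpha>(2) \<beta>(2) \<zeta>(1) pred_R[OF q(1)] pred_R[OF w(1)]
  define N where "N = (\<lambda>t \<omega>. p t \<omega> - p 0 \<omega> - (LBINT r:{0..t}. \<alpha> r \<omega>))"
  define L where "L = (\<lambda>t \<omega>. X t \<omega> - x0 - (LBINT r:{0..t}. \<beta> r \<omega>))"
  have Nd: "N t \<omega> = p t \<omega> - p 0 \<omega> - (LBINT r:{0..t}. \<alpha> r \<omega>)" and Ld: "L t \<omega> = X t \<omega> - x0 - (LBINT r:{0..t}. \<beta> r \<omega>)" for t \<omega>
    by (simp_all add: N_def L_def)
  obtain I' where I': "has_ito_integral P F W T q I'" "AE \<omega> in P. \<forall>t\<in>{0..T}. N t \<omega> = I' t \<omega> + jmp w t \<omega>" "AE \<omega> in P. I' 0 \<omega> = 0"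
    and Ni': "\<forall>t\<in>{0..T}. integrable P (N t)" and N2: "integrable P (\<lambda>\<omega>. (N T \<omega>)\<^sup>2)"
    and orthN': "\<forall>t\<in>{0..T}. \<forall>\<xi>\<in>borel_measurable (F t). (\<forall>\<omega>\<in>space P. \<bar>\<xi> \<omega>\<bar> \<le> 1) \<longrightarrow> (\<integral>\<omega>. \<xi> \<omega> * (N T \<omega> - N t \<omega>) \<partial>P) = 0"
    by (rule martingale_part[OF dp regular_measurable[OF p] regular_measurable[OF p T0] AE_I2[OF refl] \<alpha>(2) pred_R[OF q(1)] w Nd], assumption) (rule that; assumption)
  obtain I where I: "has_ito_integral P F W T \<zeta> I" "AE \<omega> in P. \<forall>t\<in>{0..T}. L t \<omega> = I t \<omega> + jmp \<kappa> t \<omega>" "AE \<omega> in P. I 0 \<omega> = 0"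
    and Li': "\<forall>t\<in>{0..T}. integrable P (L t)" and L2: "integrable P (\<lambda>\<omega>. (L T \<omega>)\<^sup>2)"
    and orthL': "\<forall>t\<in>{0..T}. \<forall>\<xi>\<in>borel_measurable (F t). (\<forall>\<omega>\<in>space P. \<bar>\<xi> \<omega>\<bar> \<le> 1) \<longrightarrow> (\<integral>\<omega>. \<xi> \<omega> * (L T \<omega> - L t \<omega>) \<partial>P) = 0"
    by (rule martingale_part[OF dX regular_measurable[OF X] borel_measurable_const X0 \<beta>(2) \<zeta>(1) \<kappa> pbounded_square[OF b] Ld], assumption) (rule that; assumption)
  have Ni: "\<And>t. t \<in> {0..T} \<Longrightarrow> integrable P (N t)" and Li: "\<And>t. t \<in> {0..T} \<Longrightarrow> integrable P (L t)"
    using Ni' Li' by auto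
  have orthN: "\<And>t \<xi>. t \<in> {0..T} \<Longrightarrow> \<xi> \<in> borel_measurable (F t) \<Longrightarrow> (\<And>\<omega>. \<omega> \<in> space P \<Longrightarrow> \<bar>\<xi> \<omega>\<bar> \<le> 1) \<Longrightarrow> (\<integral>\<omega>. \<xi> \<omega> * (N T \<omega> - N t \<omega>) \<partial>P) = 0"
    and orthL: "\<And>t \<xi>. t \<in> {0..T} \<Longrightarrow> \<xi> \<in> borel_measurable (F t) \<Longrightarrow> (\<And>\<omega>. \<omega> \<in> space P \<Longrightarrow> \<bar>\<xi> \<omega>\<bar> \<le> 1) \<Longrightarrow> (\<integral>\<omega>. \<xi> \<omega> * (L T \<omega> - L t \<omega>) \<partial>P) = 0"
    using orthN' orthL' by blast+
  \<comment> \<open>Used for Z = 1, for the state X and for L_T. Young's inequality treats each part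
    of the affine bound, with weight \<lambda> for the part in w; hence the two integrability
    conditions on Z.\<close>
  have \<alpha>Z: "integrable R (\<lambda>x. \<alpha> (fst x) (snd x) * Z x)"
    if [measurable]: "Z \<in> borel_measurable R" and Z: "integrable R (\<lambda>x. (Z x)\<^sup>2)" "integrable R (\<lambda>x. lamw x * (Z x)\<^sup>2)" for Z
  proof (rule Bochner_Integration.integrable_bound)
    let ?p = "\<lambda>x. p (fst x) (snd x)" and ?q = "\<lambda>x. q (fst x) (snd x)" and ?w = "\<lambda>x. w (fst x) (snd x)"
    let ?U = "\<lambda>x. \<bar>D\<bar> * ((1 + (Z x)\<^sup>2) + ((?p x)\<^sup>2 + (Z x)\<^sup>2) + ((?q x)\<^sup>2 + (Z x)\<^sup>2) + ((?w x)\<^sup>2 * lamw x + lamw x * (Z x)\<^sup>2))"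
    show "integrable R ?U"
      using Z regular_square_R[OF p] q(2) w(2) finite_measure.integrable_const[OF finite_measure_R]
      by (intro integrable_mult_right Bochner_Integration.integrable_add) auto
    show "AE x in R. norm (\<alpha> (fst x) (snd x) * Z x) \<le> norm (?U x)"
    proof (rule AE_I2)
      fix x assume x: "x \<in> space R"
      have l: "0 \<le> lamw x" by (rule lamw_nonneg[OF x])
      have "\<bar>\<alpha> (fst x) (snd x)\<bar> \<le> \<bar>D\<bar> * (1 + \<bar>?p x\<bar> + \<bar>?q x\<bar> + lamw x * \<bar>?w x\<bar>)"
        using l by (intro order_trans[OF \<alpha>(3)[OF x]] mult_right_mono) auto
      then have "\<bar>\<alpha> (fst x) (snd x)\<bar> * \<bar>Z x\<bar> \<le> \<bar>D\<bar> * (1 + \<bar>?p x\<bar> + \<bar>?q x\<bar> + lamw x * \<bar>?w x\<bar>) * \<bar>Z x\<bar>"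
        by (rule mult_right_mono) simp
      also have "\<dots> = \<bar>D\<bar> * (1 * \<bar>1\<bar> * \<bar>Z x\<bar> + 1 * \<bar>?p x\<bar> * \<bar>Z x\<bar> + 1 * \<bar>?q x\<bar> * \<bar>Z x\<bar> + lamw x * \<bar>?w x\<bar> * \<bar>Z x\<bar>)"
        by (simp add: algebra_simps)
      also have "\<dots> \<le> \<bar>D\<bar> * ((1\<^sup>2 * 1 + 1 * (Z x)\<^sup>2) + ((?p x)\<^sup>2 * 1 + 1 * (Z x)\<^sup>2) + ((?q x)\<^sup>2 * 1 + 1 * (Z x)\<^sup>2) + ((?w x)\<^sup>2 * lamw x + lamw x * (Z x)\<^sup>2))"
        using l by (intro mult_left_mono add_mono lam_square_bound) auto
      finally have "norm (\<alpha> (fst x) (snd x) * Z x) \<le> ?U x" by (simp add: abs_mult)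
      then show "norm (\<alpha> (fst x) (snd x) * Z x) \<le> norm (?U x)"
        unfolding real_norm_def by (rule order_trans[OF _ abs_ge_self])
    qed
  qed measurable
  have \<alpha>i: "integrable R (\<lambda>x. \<alpha> (fst x) (snd x))"
  proof -
    have "integrable R (\<lambda>_. 1 :: real)" by (rule finite_measure.integrable_const[OF finite_measure_R])
    then show ?thesis using \<alpha>Z[of "\<lambda>_. 1"] integrable_lam by simp
  qed
  show \<alpha>X: "integrable R (\<lambda>x. \<alpha> (fst x) (snd x) * X (fst x) (snd x))"
    by (rule \<alpha>Z[OF regular_R[OF X] regular_square_R[OF X] regular_lam[OF X]])
  have LP[measurable]: "L T \<in> borel_measurable P" using Li[OF Tin] by auto
  have NP[measurable]: "N T \<in> borel_measurable P" using Ni[OF Tin] by auto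
  have \<alpha>L: "integrable R (\<lambda>x. \<alpha> (fst x) (snd x) * L T (snd x))"
    by (rule \<alpha>Z[OF _ integrable_snd_R[OF L2] lam_terminal_square[OF X dX X0 \<beta>(2,3) \<zeta> b Ld]]) auto
  have pR: "integrable R (\<lambda>x. p (fst x) (snd x))"
    by (rule finite_measure.square_integrable_imp_integrable[OF finite_measure_R regular_R[OF p] regular_square_R[OF p]])
  have p0: "integrable P (p 0)"
    by (rule square_integrable_imp_integrable[OF regular_measurable[OF p T0] regular_square[OF p T0]])
  have p0L: "integrable P (\<lambda>\<omega>. p 0 \<omega> * L T \<omega>)"
    by (rule integrable_mult_L2[OF regular_measurable[OF p T0] LP regular_square[OF p T0] L2])
  have NL: "integrable P (\<lambda>\<omega>. N T \<omega> * L T \<omega>)" by (rule integrable_mult_L2[OF NP LP N2 L2])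
  note prod = expectation_product[OF Nd Ld \<alpha>(1) \<alpha>i \<beta> regular_measurable_F[OF p T0] p0 X0 pR \<alpha>X \<alpha>L Ni Li p0L NL orthN orthL]
  show "integrable P (\<lambda>\<omega>. p T \<omega> * X T \<omega>)" "integrable R (\<lambda>x. \<beta> (fst x) (snd x) * p (fst x) (snd x))"
    by (rule prod(1,2); assumption?)+
  note iI' = ito_L2[OF I'(1) pred_R[OF q(1)]] and iI = ito_L2[OF I(1) \<zeta>(1)]
  show "integrable R (\<lambda>x. q (fst x) (snd x) * \<zeta> (fst x) (snd x))"
    by (rule integrable_mult_L2[OF pred_R[OF q(1)] \<zeta>(1) q(2) iI(4)[OF Tin]])
  show "integrable R (\<lambda>x. w (fst x) (snd x) * \<kappa> (fst x) (snd x) * lamw x)"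
    using integrable_R_mult_bounded[OF integrable_lam_of_square[OF w] pred_R[OF \<kappa>], of C] b
    by (auto simp: pbounded_def mult_ac)
  let ?i' = "\<lambda>\<omega>. I' T \<omega> - I' 0 \<omega>" and ?i = "\<lambda>\<omega>. I T \<omega> - I 0 \<omega>"
  have m: "?i' \<in> borel_measurable P" "?i \<in> borel_measurable P" "jmp w T \<in> borel_measurable P" "jmp \<kappa> T \<in> borel_measurable P"
    using iI'(1)[OF Tin] iI'(1)[OF T0] iI(1)[OF Tin] iI(1)[OF T0] jmp_measurable[OF w(1) Tin] jmp_measurable[OF \<kappa> Tin] by auto
  have s: "integrable P (\<lambda>\<omega>. (?i' \<omega>)\<^sup>2)" "integrable P (\<lambda>\<omega>. (?i \<omega>)\<^sup>2)" "integrable P (\<lambda>\<omega>. (jmp w T \<omega>)\<^sup>2)" "integrable P (\<lambda>\<omega>. (jmp \<kappa> T \<omega>)\<^sup>2)"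
    using iI'(1,2)[OF Tin] iI'(1,2)[OF T0] iI(1,2)[OF Tin] iI(1,2)[OF T0] L2_tendsto_integrable[OF jmp_L2_tendsto[OF w]] jmp_square_integrable[OF b Tin]
    by (auto intro: L2_add_integrable)
  note pr = integrable_mult_L2[OF m(1,2) s(1,2)] integrable_mult_L2[OF m(1,4) s(1,4)] integrable_mult_L2[OF m(2,3) s(2,3)] integrable_mult_L2[OF m(3,4) s(3,4)]
  \<comment> \<open>Four products: the two pure ones are given by the isometries, the two mixed ones
    vanish. Subtracting the values at time 0 changes nothing almost surely and fits the form of the
    isometry.\<close>
  have "(\<integral>\<omega>. N T \<omega> * L T \<omega> \<partial>P) = (\<integral>\<omega>. ?i' \<omega> * ?i \<omega> + ?i' \<omega> * jmp \<kappa> T \<omega> + ?i \<omega> * jmp w T \<omega> + jmp w T \<omega> * jmp \<kappa> T \<omega> \<partial>P)"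
  proof (rule integral_cong_AE)
    show "AE \<omega> in P. N T \<omega> * L T \<omega> = ?i' \<omega> * ?i \<omega> + ?i' \<omega> * jmp \<kappa> T \<omega> + ?i \<omega> * jmp w T \<omega> + jmp w T \<omega> * jmp \<kappa> T \<omega>"
      using I'(2,3) I(2,3)
    proof eventually_elim
      case (elim \<omega>)
      have "N T \<omega> = I' T \<omega> + jmp w T \<omega>" "L T \<omega> = I T \<omega> + jmp \<kappa> T \<omega>" using elim(1,3) Tin by auto
      then show ?case using elim(2,4) by (simp add: algebra_simps)
    qed
  qed (use m NP LP in measurable)
  also have "\<dots> = (\<integral>\<omega>. ?i' \<omega> * ?i \<omega> \<partial>P) + (\<integral>\<omega>. ?i' \<omega> * jmp \<kappa> T \<omega> \<partial>P) + (\<integral>\<omega>. ?i \<omega> * jmp w T \<omega> \<partial>P) + (\<integral>\<omega>. jmp w T \<omega> * jmp \<kappa> T \<omega> \<partial>P)"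
    using pr by simp
  also have "\<dots> = (\<integral>x. q (fst x) (snd x) * \<zeta> (fst x) (snd x) \<partial>R) + (\<integral>x. w (fst x) (snd x) * \<kappa> (fst x) (snd x) * lamw x \<partial>R)"
    using ito_isometry[OF I'(1) pred_R[OF q(1)] I(1) \<zeta>(1)] ito_jmp_orthogonal_bounded[OF I'(1) pred_R[OF q(1)] b]
      ito_jmp_orthogonal[OF I(1) \<zeta>(1) w] jmp_isometry[OF w b] by simp
  finally have NLe: "(\<integral>\<omega>. N T \<omega> * L T \<omega> \<partial>P) = (\<integral>x. q (fst x) (snd x) * \<zeta> (fst x) (snd x) \<partial>R) + (\<integral>x. w (fst x) (snd x) * \<kappa> (fst x) (snd x) * lamw x \<partial>R)" .
  show "(\<integral>\<omega>. p T \<omega> * X T \<omega> \<partial>P) = x0 * (\<integral>\<omega>. p 0 \<omega> \<partial>P) + (\<integral>x. \<alpha> (fst x) (snd x) * X (fst x) (snd x) \<partial>R)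
      + (\<integral>x. \<beta> (fst x) (snd x) * p (fst x) (snd x) \<partial>R)
      + ((\<integral>x. q (fst x) (snd x) * \<zeta> (fst x) (snd x) \<partial>R) + (\<integral>x. w (fst x) (snd x) * \<kappa> (fst x) (snd x) * lamw x \<partial>R))"
    unfolding NLe[symmetric] by (rule prod(3); assumption?)
qed

end

section \<open>The maximum principle\<close>

text \<open>Completeness makes every subset of a null set measurable, so nothing need be known about
  \<open>g\<close> there.\<close>

lemma (in complete_measure) borel_measurable_off_null_set:
  fixes f g :: "'a \<Rightarrow> real"
  assumes f: "f \<in> borel_measurable M" and N: "N \<in> null_sets M" and eq: "\<And>x. x \<in> space M \<Longrightarrow> x \<notin> N \<Longrightarrow> g x = f x"
  shows "g \<in> borel_measurable M"
proof (rule measurableI)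
  fix B :: "real set" assume B: "B \<in> sets borel"
  have e: "g -` B \<inter> space M = (f -` B \<inter> space M - N) \<union> (g -` B \<inter> space M \<inter> N)"
    using eq by auto
  have "f -` B \<inter> space M - N \<in> sets M" using measurable_sets[OF f B] N by auto
  moreover have "g -` B \<inter> space M \<inter> N \<in> sets M" by (rule complete[OF _ N]) auto
  ultimately show "g -` B \<inter> space M \<in> sets M" by (subst e) (rule sets.Un)
qed simp

text \<open>The limit is one-sided because v0 may lie on the boundary of V. Convexity keeps the
  segment towards v0 + c inside V, where the derivative is taken.\<close>

lemma has_derivative_along_line:
  fixes H :: "real \<Rightarrow> real \<Rightarrow> real"
  assumes der: "((\<lambda>(x, v). H x v) has_derivative (\<lambda>(dx, dv). D * dx + E * dv)) (at (x0, v0) within UNIV \<times> V)"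
    and V: "convex V" "v0 \<in> V" "v0 + c \<in> V"
  shows "((\<lambda>s. (H (x0 + s * a) (v0 + s * c) - H x0 v0) / s) \<longlongrightarrow> D * a + E * c) (at_right 0)"
proof -
  let ?l = "\<lambda>s. (x0 + s * a, v0 + s * c)"
  have l: "(?l has_derivative (\<lambda>s. (s * a, s * c))) (at 0 within {0..1})"
    by (auto intro!: derivative_eq_intros)
  have "?l ` {0..1} \<subseteq> UNIV \<times> V"
  proof
    fix y assume "y \<in> ?l ` {0..1}"
    then obtain s where s: "s \<in> {0..1}" "y = ?l s" by auto
    have "(1 - s) *\<^sub>R v0 + s *\<^sub>R (v0 + c) \<in> V" using V s by (intro convexD) auto
    then show "y \<in> UNIV \<times> V" using s by (simp add: algebra_simps)
  qed
  then have "((\<lambda>(x, v). H x v) has_derivative (\<lambda>(dx, dv). D * dx + E * dv)) (at (?l 0) within ?l ` {0..1})"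
    using has_derivative_subset[OF der] by simp
  from has_derivative_in_compose[OF l this]
  have "((\<lambda>s. H (x0 + s * a) (v0 + s * c)) has_derivative (\<lambda>s. D * (s * a) + E * (s * c))) (at 0 within {0..1})" by simp
  then have "((\<lambda>s. H (x0 + s * a) (v0 + s * c)) has_field_derivative (D * a + E * c)) (at 0 within {0..1})"
    by (rule has_derivative_imp_has_field_derivative) (simp add: algebra_simps)
  then show ?thesis
    unfolding has_field_derivative_iff by (simp add: at_within_Icc_at_right)
qed

text \<open>At a point \<open>(x\<^sub>0, v\<^sub>0)\<close> with \<open>v\<^sub>0\<close> maximising \<open>H(x\<^sub>0, \<cdot>)\<close>, the supergradient inequality of the jointly
  concave function \<open>H\<close> loses its control component, whose sign is known.\<close>

lemma concave_maximum_bound: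
  fixes H :: "real \<Rightarrow> real \<Rightarrow> real"
  assumes conc: "concave_on (UNIV \<times> V) (\<lambda>(x, v). H x v)" and V: "convex V" "v0 \<in> V" "v1 \<in> V"
    and der: "((\<lambda>(x, v). H x v) has_derivative (\<lambda>(dx, dv). D * dx + E * dv)) (at (x0, v0) within UNIV \<times> V)"
    and mx: "\<And>v. v \<in> V \<Longrightarrow> H x0 v \<le> H x0 v0"
  shows "H x1 v1 - H x0 v0 \<le> D * (x1 - x0)"
proof -
  have ev: "eventually (\<lambda>s::real. s \<in> {0<..<1}) (at_right 0)" by (intro eventually_at_right_real) auto
  have V': "v0 + (v1 - v0) \<in> V" using V by simp
  have "eventually (\<lambda>s. H x1 v1 - H x0 v0 \<le> (H (x0 + s * (x1 - x0)) (v0 + s * (v1 - v0)) - H x0 v0) / s) (at_right 0)"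
    using ev
  proof eventually_elim
    case (elim s)
    have "convex_on (UNIV \<times> V) (\<lambda>z. - (case z of (x, v) \<Rightarrow> H x v))" using conc by (simp add: concave_on_def)
    from convex_onD[OF this, of s "(x0, v0)" "(x1, v1)"] elim V
    have "(1 - s) * H x0 v0 + s * H x1 v1 \<le> H (x0 + s * (x1 - x0)) (v0 + s * (v1 - v0))"
      by (simp add: algebra_simps)
    then have "s * (H x1 v1 - H x0 v0) \<le> H (x0 + s * (x1 - x0)) (v0 + s * (v1 - v0)) - H x0 v0"
      by (simp add: algebra_simps)
    then show ?case using elim by (simp add: le_divide_eq mult.commute)
  qed
  then have 1: "H x1 v1 - H x0 v0 \<le> D * (x1 - x0) + E * (v1 - v0)"
    by (intro tendsto_lowerbound[OF has_derivative_along_line[OF der V(1,2) V', of "x1 - x0"]]) auto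
  \<comment> \<open>Moving in the control direction alone cannot increase H, which fixes the sign of
    \<open>E * (v1 - v0)\<close>.\<close>
  have "eventually (\<lambda>s. (H (x0 + s * 0) (v0 + s * (v1 - v0)) - H x0 v0) / s \<le> 0) (at_right 0)"
    using ev
  proof eventually_elim
    case (elim s)
    have "(1 - s) *\<^sub>R v0 + s *\<^sub>R v1 \<in> V" using V elim by (intro convexD) auto
    then have "H x0 (v0 + s * (v1 - v0)) \<le> H x0 v0" by (intro mx) (simp add: algebra_simps)
    then show ?case using elim by (simp add: divide_nonpos_pos)
  qed
  then have "D * 0 + E * (v1 - v0) \<le> 0"
    by (intro tendsto_upperbound[OF has_derivative_along_line[OF der V(1,2) V', of 0]]) auto
  then show ?thesis using 1 by simp
qed

text \<open>The lines of constant v lie entirely in the domain, so the x-derivative is an ordinary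
  one and equals \<open>deriv\<close>, the form used in the adjoint equation. The v-derivative stays
  existential: within V it need not be unique, for instance if V is a single point.\<close>

lemma C1_bounded_derivsD:
  assumes "C1_bounded_derivs P T V f"
  shows "\<exists>e C. 0 \<le> (C::real) \<and> (\<forall>t\<in>{0..T}. \<forall>\<omega>\<in>space P. continuous_on (UNIV \<times> V) (\<lambda>(x, v). f t \<omega> x v) \<and>
    (\<forall>x. \<forall>v\<in>V. ((\<lambda>(x, v). f t \<omega> x v) has_derivative (\<lambda>(dx, dv). deriv (\<lambda>x. f t \<omega> x v) x * dx + e t \<omega> x v * dv)) (at (x, v) within UNIV \<times> V) \<and>
      ((\<lambda>x. f t \<omega> x v) has_field_derivative deriv (\<lambda>x. f t \<omega> x v) x) (at x) \<and> \<bar>deriv (\<lambda>x. f t \<omega> x v) x\<bar> \<le> C))"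
proof -
  obtain fx fv C where f: "\<And>t \<omega> x v. t \<in> {0..T} \<Longrightarrow> \<omega> \<in> space P \<Longrightarrow> v \<in> V \<Longrightarrow>
      ((\<lambda>(x, v). f t \<omega> x v) has_derivative (\<lambda>(dx, dv). fx t \<omega> x v * dx + fv t \<omega> x v * dv)) (at (x, v) within UNIV \<times> V)
      \<and> \<bar>fx t \<omega> x v\<bar> \<le> C"
    using assms unfolding C1_bounded_derivs_def by blast
  have d: "((\<lambda>x. f t \<omega> x v) has_field_derivative fx t \<omega> x v) (at x)"
    if h: "t \<in> {0..T}" "\<omega> \<in> space P" "v \<in> V" for t \<omega> x v
  proof -
    have l: "((\<lambda>y. (y, v)) has_derivative (\<lambda>y. (y, 0))) (at x within UNIV)" by (auto intro!: derivative_eq_intros)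
    have "((\<lambda>(x, v). f t \<omega> x v) has_derivative (\<lambda>(dx, dv). fx t \<omega> x v * dx + fv t \<omega> x v * dv)) (at (x, v) within (\<lambda>y. (y, v)) ` UNIV)"
      by (rule has_derivative_subset[OF conjunct1[OF f[OF h]]]) (use h in auto)
    from has_derivative_in_compose[OF l this]
    have "((\<lambda>x. f t \<omega> x v) has_derivative (\<lambda>y. fx t \<omega> x v * y)) (at x)" by simp
    then show ?thesis by (simp add: has_field_derivative_def)
  qed
  have de: "deriv (\<lambda>x. f t \<omega> x v) x = fx t \<omega> x v" if "t \<in> {0..T}" "\<omega> \<in> space P" "v \<in> V" for t \<omega> x v
    using DERIV_imp_deriv[OF d[OF that]] .
  show ?thesis
  proof (intro exI[of _ fv] exI[of _ "\<bar>C\<bar>"] conjI ballI allI)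
    fix t \<omega> x v assume h: "t \<in> {0..T}" "\<omega> \<in> space P" "v \<in> V"
    show "((\<lambda>(x, v). f t \<omega> x v) has_derivative (\<lambda>(dx, dv). deriv (\<lambda>x. f t \<omega> x v) x * dx + fv t \<omega> x v * dv)) (at (x, v) within UNIV \<times> V)"
      unfolding de[OF h] using f[OF h] by blast
    show "((\<lambda>x. f t \<omega> x v) has_field_derivative deriv (\<lambda>x. f t \<omega> x v) x) (at x)"
      unfolding de[OF h] by (rule d[OF h])
    show "\<bar>deriv (\<lambda>x. f t \<omega> x v) x\<bar> \<le> \<bar>C\<bar>"
      unfolding de[OF h] using f[OF h] by (meson abs_ge_self order_trans)
  next
    fix t \<omega> assume h: "t \<in> {0..T}" "\<omega> \<in> space P"
    show "continuous_on (UNIV \<times> V) (\<lambda>(x, v). f t \<omega> x v)"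
    proof (rule has_derivative_continuous_on)
      fix z :: "real \<times> real" assume "z \<in> UNIV \<times> V"
      then show "((\<lambda>(x, v). f t \<omega> x v) has_derivative (\<lambda>(dx, dv). fx t \<omega> (fst z) (snd z) * dx + fv t \<omega> (fst z) (snd z) * dv)) (at z within UNIV \<times> V)"
        using f[OF h, of "snd z" "fst z"] by auto
    qed
  qed simp
qed

lemma has_ito_integral_cong:
  assumes "has_ito_integral P F W T Z I" "AE \<omega> in P. \<forall>t\<in>{0..T}. Z t \<omega> = Z' t \<omega>"
  shows "has_ito_integral P F W T Z' I"
proof -
  have eq: "(\<integral>\<^sup>+\<omega>. (\<integral>\<^sup>+t\<in>{0..T}. ennreal ((S t \<omega> - Z t \<omega>)\<^sup>2) \<partial>lborel) \<partial>P) = (\<integral>\<^sup>+\<omega>. (\<integral>\<^sup>+t\<in>{0..T}. ennreal ((S t \<omega> - Z' t \<omega>)\<^sup>2) \<partial>lborel) \<partial>P)" for S :: "real \<Rightarrow> 'a \<Rightarrow> real"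
  proof (rule nn_integral_cong_AE)
    show "AE \<omega> in P. (\<integral>\<^sup>+t\<in>{0..T}. ennreal ((S t \<omega> - Z t \<omega>)\<^sup>2) \<partial>lborel) = (\<integral>\<^sup>+t\<in>{0..T}. ennreal ((S t \<omega> - Z' t \<omega>)\<^sup>2) \<partial>lborel)"
      using assms(2) by eventually_elim (auto intro!: nn_integral_cong split: split_indicator)
  qed
  show ?thesis using assms(1) unfolding has_ito_integral_def eq .
qed

text \<open>Lets the regular versions replace the state and adjoint processes in their
  equations.\<close>

lemma has_stoch_differential_cong:
  assumes d: "has_stoch_differential P W \<tau> lam T Y \<beta> \<zeta> \<kappa>" and T: "0 \<le> T"
    and eq: "AE \<omega> in P. \<forall>t\<in>{0..T}. Y t \<omega> = Y' t \<omega> \<and> \<beta> t \<omega> = \<beta>' t \<omega> \<and> \<zeta> t \<omega> = \<zeta>' t \<omega> \<and> \<kappa> t \<omega> = \<kappa>' t \<omega>"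
  shows "has_stoch_differential P W \<tau> lam T Y' \<beta>' \<zeta>' \<kappa>'"
proof -
  obtain I where i: "AE \<omega> in P. set_integrable lborel {0..T} (\<lambda>s. \<beta> s \<omega>)"
    and s: "AE \<omega> in P. stieltjes_integrable (default_indicator \<tau>) \<kappa> T \<omega> \<and> stieltjes_integrable (compensator lam) \<kappa> T \<omega>"
    and I: "has_ito_integral P (default_filtration P W \<tau>) W T \<zeta> I"
    and e: "AE \<omega> in P. \<forall>t\<in>{0..T}. Y t \<omega> = Y 0 \<omega> + (LBINT s:{0..t}. \<beta> s \<omega>) + I t \<omega> + jump_integral \<tau> lam \<kappa> t \<omega>"
    using d unfolding has_stoch_differential_def by blast
  have i': "AE \<omega> in P. set_integrable lborel {0..T} (\<lambda>s. \<beta>' s \<omega>)"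
    using i eq
  proof eventually_elim
    case (elim \<omega>)
    then show ?case
      using set_integrable_cong[OF refl refl, of "{0..T}" "\<lambda>s. \<beta> s \<omega>" "\<lambda>s. \<beta>' s \<omega>" lborel] by simp
  qed
  have st: "stieltjes_integrable A \<kappa>' T \<omega> = stieltjes_integrable A \<kappa> T \<omega>" if "\<forall>t\<in>{0..T}. \<kappa> t \<omega> = \<kappa>' t \<omega>" for A :: "real \<Rightarrow> 'a \<Rightarrow> real" and \<omega>
    unfolding stieltjes_integrable_def by (rule set_integrable_cong) (use that in auto)
  have st': "stieltjes_integral A \<kappa>' t \<omega> = stieltjes_integral A \<kappa> t \<omega>" if "\<forall>t\<in>{0..T}. \<kappa> t \<omega> = \<kappa>' t \<omega>" "t \<in> {0..T}" for A :: "real \<Rightarrow> 'a \<Rightarrow> real" and \<omega> t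
    unfolding stieltjes_integral_def by (rule set_lebesgue_integral_cong) (use that in auto)
  have s': "AE \<omega> in P. stieltjes_integrable (default_indicator \<tau>) \<kappa>' T \<omega> \<and> stieltjes_integrable (compensator lam) \<kappa>' T \<omega>"
    using s eq by eventually_elim (simp add: st)
  have I': "has_ito_integral P (default_filtration P W \<tau>) W T \<zeta>' I"
    by (rule has_ito_integral_cong[OF I]) (use eq in \<open>eventually_elim, simp\<close>)
  have e': "AE \<omega> in P. \<forall>t\<in>{0..T}. Y' t \<omega> = Y' 0 \<omega> + (LBINT s:{0..t}. \<beta>' s \<omega>) + I t \<omega> + jump_integral \<tau> lam \<kappa>' t \<omega>"
    using e eq
  proof eventually_elim
    case (elim \<omega>)
    show ?case
    proof
      fix t assume t: "t \<in> {0..T}"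
      have "(LBINT s:{0..t}. \<beta>' s \<omega>) = (LBINT s:{0..t}. \<beta> s \<omega>)"
        by (rule set_lebesgue_integral_cong) (use elim(2) t in auto)
      moreover have "jump_integral \<tau> lam \<kappa>' t \<omega> = jump_integral \<tau> lam \<kappa> t \<omega>"
        unfolding jump_integral_def using st'[OF _ t] elim(2) by simp
      moreover have "Y 0 \<omega> = Y' 0 \<omega>" "Y t \<omega> = Y' t \<omega>" using elim(2) t T by auto
      ultimately show "Y' t \<omega> = Y' 0 \<omega> + (LBINT s:{0..t}. \<beta>' s \<omega>) + I t \<omega> + jump_integral \<tau> lam \<kappa>' t \<omega>"
        using elim(1) t by simp
    qed
  qed
  show ?thesis unfolding has_stoch_differential_def using i' s' I' e' by blast
qed

section \<open>Measurability along controlled paths\<close>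

context default_horizon begin

lemma R_PR: "(\<lambda>x. x) \<in> measurable R PR"
  by (rule predictable_measurable_R) simp

lemma section_PR: "t \<in> {0..T} \<Longrightarrow> (\<lambda>\<omega>. (t, \<omega>)) \<in> measurable (F t) PR"
  using predictable_section[of "\<lambda>x. x" PR t] by simp

lemma S2_regular:
  assumes "Y \<in> S2 P F T"
  obtains N where "N \<in> null_sets P" "regular (\<lambda>t \<omega>. if \<omega> \<in> N then 0 else Y t \<omega>)"
proof (rule S2_regular_version[OF assms])
  fix N assume N: "N \<in> null_sets P"
    "\<And>t. t \<in> {0..T} \<Longrightarrow> (\<lambda>\<omega>. if \<omega> \<in> N then 0 else Y t \<omega>) \<in> borel_measurable (F t)"
    "\<And>\<omega>. cadlag_on T (\<lambda>t. if \<omega> \<in> N then 0 else Y t \<omega>) \<or> \<omega> \<notin> space P"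
  have "(\<integral>\<^sup>+\<omega>. (SUP t\<in>{0..T}. ennreal (\<bar>if \<omega> \<in> N then 0 else Y t \<omega>\<bar>\<^sup>2)) \<partial>P) \<le> (\<integral>\<^sup>+\<omega>. (SUP t\<in>{0..T}. ennreal (\<bar>Y t \<omega>\<bar>\<^sup>2)) \<partial>P)"
    by (intro nn_integral_mono SUP_mono') auto
  also have "\<dots> < \<infinity>" using assms by (simp add: S2_def)
  finally have "regular (\<lambda>t \<omega>. if \<omega> \<in> N then 0 else Y t \<omega>)" using N by (auto simp: regular_def)
  then show ?thesis using N(1) that by blast
qed

lemma AE_R_left_limit:
  assumes Y: "regular Y" shows "AE x in R. left_limit Y (fst x) (snd x) = Y (fst x) (snd x)"
proof -
  have c: "\<And>\<omega>. \<omega> \<in> space P \<Longrightarrow> cadlag_on T (\<lambda>t. Y t \<omega>)" using Y by (simp add: regular_def)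
  have ll: "(\<lambda>w. left_limit Y (fst w) (snd w)) \<in> borel_measurable R"
    using left_limit_predictable[of Y] Y by (intro predictable_measurable_R) (simp add: regular_def split_def)
  note [measurable] = ll regular_R[OF Y]
  have m: "{x \<in> space R. left_limit Y (fst x) (snd x) = Y (fst x) (snd x)} \<in> sets R" by measurable
  have "AE \<omega> in P. AE t in lbT. left_limit Y t \<omega> = Y t \<omega>"
    by (rule AE_I2) (rule AE_left_limit_eq[where Y=Y, OF c])
  then have "AE t in lbT. AE \<omega> in P. left_limit Y t \<omega> = Y t \<omega>"
    using TP.AE_commute[of "\<lambda>t \<omega>. left_limit Y t \<omega> = Y t \<omega>"] m by (simp add: pred_def)
  then show ?thesis by (intro TP.AE_pair_measure[OF m]) simp
qed

text \<open>The abstract map \<Phi> covers three uses at once: joint measurability on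
  \<open>R\<close>, predictability on \<open>PR\<close>, and adaptedness through the section at a
  fixed time. The value is measurable by \<open>caratheodory_measurable\<close>.\<close>

lemma field_measurable:
  assumes C1: "C1_bounded_derivs P T V f" and pf: "\<And>x v. v \<in> V \<Longrightarrow> pred (\<lambda>t \<omega>. f t \<omega> x v)"
    and \<Phi>: "\<Phi> \<in> measurable M PR" and y: "y \<in> borel_measurable M" and v: "v \<in> borel_measurable M" "\<And>m. m \<in> space M \<Longrightarrow> v m \<in> V"
  shows "(\<lambda>m. f (fst (\<Phi> m)) (snd (\<Phi> m)) (y m) (v m)) \<in> borel_measurable M"
    and "(\<lambda>m. deriv (\<lambda>x. f (fst (\<Phi> m)) (snd (\<Phi> m)) x (v m)) (y m)) \<in> borel_measurable M"
proof -
  have D: "((\<lambda>x. f t \<omega> x v) has_field_derivative deriv (\<lambda>x. f t \<omega> x v) x) (at x)"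
    if "t \<in> {0..T}" "\<omega> \<in> space P" "v \<in> V" for t \<omega> x v
    using C1_bounded_derivsD[OF C1] that by blast
  have cont: "continuous_on (UNIV \<times> V) (\<lambda>(x, v). f t \<omega> x v)" if "t \<in> {0..T}" "\<omega> \<in> space P" for t \<omega>
    using C1_bounded_derivsD[OF C1] that by blast
  have sp: "fst (\<Phi> m) \<in> {0..T}" "snd (\<Phi> m) \<in> space P" if "m \<in> space M" for m
    using measurable_space[OF \<Phi> that] by auto
  have comp: "(\<lambda>m. f (fst (\<Phi> m)) (snd (\<Phi> m)) (z m) (v m)) \<in> borel_measurable M" if z: "z \<in> borel_measurable M" for z
  proof -
    have "(\<lambda>m. (\<lambda>(x, v). f (fst (\<Phi> m)) (snd (\<Phi> m)) x v) (z m, v m)) \<in> borel_measurable M"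
    proof (rule caratheodory_measurable[where S="UNIV \<times> V" and Y="\<lambda>m. (z m, v m)" and f="\<lambda>m (x, v). f (fst (\<Phi> m)) (snd (\<Phi> m)) x v"])
      fix a :: "real \<times> real" assume a: "a \<in> UNIV \<times> V"
      from measurable_compose[OF \<Phi> pred_PR[OF pf[of "snd a" "fst a"]]] a
      show "(\<lambda>m. case a of (x, v) \<Rightarrow> f (fst (\<Phi> m)) (snd (\<Phi> m)) x v) \<in> borel_measurable M" by (auto simp: split_def)
    next
      fix m assume "m \<in> space M"
      then show "continuous_on (UNIV \<times> V) (\<lambda>(x, v). f (fst (\<Phi> m)) (snd (\<Phi> m)) x v)" using cont sp by blast
    qed (use z v in \<open>auto intro: borel_measurable_Pair\<close>)
    then show ?thesis by simp
  qed
  show "(\<lambda>m. f (fst (\<Phi> m)) (snd (\<Phi> m)) (y m) (v m)) \<in> borel_measurable M" by (rule comp[OF y])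
  \<comment> \<open>The derivative is a limit of difference quotients along 1/n, each a composition
    already known to be measurable.\<close>
  let ?q = "\<lambda>n m. (f (fst (\<Phi> m)) (snd (\<Phi> m)) (y m + 1 / real (Suc n)) (v m) - f (fst (\<Phi> m)) (snd (\<Phi> m)) (y m) (v m)) / (1 / real (Suc n))"
  show "(\<lambda>m. deriv (\<lambda>x. f (fst (\<Phi> m)) (snd (\<Phi> m)) x (v m)) (y m)) \<in> borel_measurable M"
  proof (rule borel_measurable_LIMSEQ_real[where u="?q"])
    fix n
    show "?q n \<in> borel_measurable M" using comp[of "\<lambda>m. y m + 1 / real (Suc n)"] comp[OF y] y by measurable
  next
    fix m assume m: "m \<in> space M"
    have "((\<lambda>h. (f (fst (\<Phi> m)) (snd (\<Phi> m)) (y m + h) (v m) - f (fst (\<Phi> m)) (snd (\<Phi> m)) (y m) (v m)) / h)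
      \<longlongrightarrow> deriv (\<lambda>x. f (fst (\<Phi> m)) (snd (\<Phi> m)) x (v m)) (y m)) (at 0)"
      using D[OF sp[OF m] v(2)[OF m]] by (simp add: DERIV_def)
    moreover have "filterlim (\<lambda>n. 1 / real (Suc n)) (at 0) sequentially"
      unfolding filterlim_at using LIMSEQ_Suc[OF lim_1_over_n] by (auto simp del: of_nat_Suc)
    ultimately show "(\<lambda>n. ?q n m) \<longlonglongrightarrow> deriv (\<lambda>x. f (fst (\<Phi> m)) (snd (\<Phi> m)) x (v m)) (y m)"
      by (rule filterlim_compose)
  qed
qed

end

sublocale default_control_problem \<subseteq> default_horizon P W \<tau> lam T
  by unfold_locales (rule horizon_pos)

section \<open>Duality, and the comparison of a control with the candidate\<close>

context default_control_problem begin

abbreviation at_pair :: "(real \<Rightarrow> 'a \<Rightarrow> real) \<Rightarrow> real \<times> 'a \<Rightarrow> real" where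
  "at_pair Z \<equiv> \<lambda>x. Z (fst x) (snd x)"

abbreviation along :: "(real \<Rightarrow> 'a \<Rightarrow> real \<Rightarrow> real \<Rightarrow> real) \<Rightarrow> (real \<Rightarrow> 'a \<Rightarrow> real) \<Rightarrow> (real \<Rightarrow> 'a \<Rightarrow> real) \<Rightarrow> real \<Rightarrow> 'a \<Rightarrow> real" where
  "along f Y u \<equiv> \<lambda>t \<omega>. f t \<omega> (Y t \<omega>) (u t \<omega>)"

abbreviation x_deriv :: "(real \<Rightarrow> 'a \<Rightarrow> real \<Rightarrow> real \<Rightarrow> real) \<Rightarrow> real \<Rightarrow> 'a \<Rightarrow> real \<Rightarrow> real \<Rightarrow> real" where
  "x_deriv f \<equiv> \<lambda>t \<omega> x v. deriv (\<lambda>x. f t \<omega> x v) x"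

lemma control_pred: "u \<in> A \<Longrightarrow> pred u"
  by (rule admissible_predictable)

lemma coefficientD:
  assumes "state_coefficient P F T V f"
  shows "C1_bounded_derivs P T V f" "\<And>x v. v \<in> V \<Longrightarrow> pred (\<lambda>t \<omega>. f t \<omega> x v)"
    "\<exists>C. \<forall>t\<in>{0..T}. \<forall>\<omega>\<in>space P. \<forall>x. \<forall>v\<in>V. \<bar>f t \<omega> x v\<bar> \<le> C"
  using assms unfolding state_coefficient_def by blast+

lemma along_adapted:
  assumes f: "C1_bounded_derivs P T V f" "\<And>x v. v \<in> V \<Longrightarrow> pred (\<lambda>t \<omega>. f t \<omega> x v)"
    and u: "u \<in> A" and Y: "regular Y" and t: "t \<in> {0..T}"
  shows "along f Y u t \<in> borel_measurable (F t)" "along (x_deriv f) Y u t \<in> borel_measurable (F t)"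
proof -
  have "u t \<omega> \<in> V" if "\<omega> \<in> space (F t)" for \<omega>
    using admissible_values[OF u t, of \<omega>] space_F[of t] t that by auto
  note m = field_measurable[OF f section_PR[OF t] regular_measurable_F[OF Y t] pred_section[OF control_pred[OF u] t] this]
  show "along f Y u t \<in> borel_measurable (F t)" "along (x_deriv f) Y u t \<in> borel_measurable (F t)"
    using m by simp_all
qed

lemma along_R:
  assumes f: "C1_bounded_derivs P T V f" "\<And>x v. v \<in> V \<Longrightarrow> pred (\<lambda>t \<omega>. f t \<omega> x v)"
    and u: "u \<in> A" and Y: "regular Y"
  shows "at_pair (along f Y u) \<in> borel_measurable R" "at_pair (along (x_deriv f) Y u) \<in> borel_measurable R"
proof -
  have "at_pair u x \<in> V" if "x \<in> space R" for x
    using admissible_values[OF u] that by auto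
  note m = field_measurable[OF f R_PR regular_R[OF Y] pred_R[OF control_pred[OF u]] this]
  show "at_pair (along f Y u) \<in> borel_measurable R" "at_pair (along (x_deriv f) Y u) \<in> borel_measurable R"
    using m by simp_all
qed

lemma along_left_limit_pred:
  assumes f: "C1_bounded_derivs P T V f" "\<And>x v. v \<in> V \<Longrightarrow> pred (\<lambda>t \<omega>. f t \<omega> x v)"
    and u: "u \<in> A" and Y: "regular Y"
  shows "pred (along f (left_limit Y) u)"
proof -
  have v: "at_pair u x \<in> V" if "x \<in> space PR" for x
    using admissible_values[OF u] that by auto
  have ll: "at_pair (left_limit Y) \<in> borel_measurable PR"
    using left_limit_predictable[of Y] Y by (simp add: regular_def split_def)
  have "(\<lambda>x. x) \<in> measurable PR PR" by simp
  from field_measurable(1)[OF f this ll pred_PR[OF control_pred[OF u]] v]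
  show ?thesis by (simp add: predictable_on_def split_def)
qed

text \<open>The version agrees with the state for all times outside one null set, so its left
  limits, and hence all coefficients of the equation, agree there as well.\<close>

lemma state_regular:
  assumes u: "u \<in> A"
  shows "\<exists>Y. regular Y \<and> (AE \<omega> in P. \<forall>t. Y t \<omega> = X u t \<omega>) \<and> (AE \<omega> in P. Y 0 \<omega> = x0) \<and>
    has_stoch_differential P W \<tau> lam T Y (along b Y u) (along \<sigma> Y u) (along \<gamma> (left_limit Y) u)"
proof -
  have S: "X u \<in> S2 P F T" and X0: "AE \<omega> in P. X u 0 \<omega> = x0"
    and d: "has_stoch_differential P W \<tau> lam T (X u) (along b (X u) u) (along \<sigma> (X u) u) (along \<gamma> (left_limit (X u)) u)"
    using state[OF u] by (auto simp: state_solution_def)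
  show ?thesis
  proof (rule S2_regular[OF S])
    fix N assume N: "N \<in> null_sets P" "regular (\<lambda>t \<omega>. if \<omega> \<in> N then 0 else X u t \<omega>)"
    define Y where "Y = (\<lambda>t \<omega>. if \<omega> \<in> N then 0 else X u t \<omega>)"
    have Y: "regular Y" using N(2) by (simp add: Y_def)
    have "AE \<omega> in P. \<omega> \<notin> N" by (rule AE_not_in[OF N(1)])
    then have eq: "AE \<omega> in P. \<forall>t. Y t \<omega> = X u t \<omega>"
      by eventually_elim (simp add: Y_def)
    have "AE \<omega> in P. \<forall>t\<in>{0..T}. X u t \<omega> = Y t \<omega> \<and> along b (X u) u t \<omega> = along b Y u t \<omega> \<and>
      along \<sigma> (X u) u t \<omega> = along \<sigma> Y u t \<omega> \<and> along \<gamma> (left_limit (X u)) u t \<omega> = along \<gamma> (left_limit Y) u t \<omega>"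
      using eq by eventually_elim (simp add: left_limit_def)
    then have d': "has_stoch_differential P W \<tau> lam T Y (along b Y u) (along \<sigma> Y u) (along \<gamma> (left_limit Y) u)"
      by (rule has_stoch_differential_cong[OF d less_imp_le[OF horizon_pos]])
    have "AE \<omega> in P. Y 0 \<omega> = x0" using eq X0 by eventually_elim simp
    then show ?thesis using Y eq d' by blast
  qed
qed

lemma hamiltonian_derivative:
  fixes x v p q w :: real
  assumes t: "t \<in> {0..T}" "\<omega> \<in> space P" and v: "v \<in> V"
  defines "D \<equiv> x_deriv h t \<omega> x v + x_deriv b t \<omega> x v * p + x_deriv \<sigma> t \<omega> x v * q + lam t \<omega> * x_deriv \<gamma> t \<omega> x v * w"
  shows "x_deriv (\<lambda>t \<omega> x v. hamiltonian lam b \<sigma> \<gamma> h t \<omega> x v p q w) t \<omega> x v = D"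
    and "\<exists>E. ((\<lambda>(x, v). hamiltonian lam b \<sigma> \<gamma> h t \<omega> x v p q w) has_derivative (\<lambda>(dx, dv). D * dx + E * dv)) (at (x, v) within UNIV \<times> V)"
proof -
  have c: "\<exists>E. ((\<lambda>z. f t \<omega> (fst z) (snd z)) has_derivative (\<lambda>z. x_deriv f t \<omega> x v * fst z + E * snd z)) (at (x, v) within UNIV \<times> V) \<and>
      ((\<lambda>x. f t \<omega> x v) has_field_derivative x_deriv f t \<omega> x v) (at x)"
    if f: "C1_bounded_derivs P T V f" for f
  proof -
    obtain e C where "\<forall>t\<in>{0..T}. \<forall>\<omega>\<in>space P. continuous_on (UNIV \<times> V) (\<lambda>(x, v). f t \<omega> x v) \<and>
      (\<forall>x. \<forall>v\<in>V. ((\<lambda>(x, v). f t \<omega> x v) has_derivative (\<lambda>(dx, dv). x_deriv f t \<omega> x v * dx + e t \<omega> x v * dv)) (at (x, v) within UNIV \<times> V) \<and>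
      ((\<lambda>x. f t \<omega> x v) has_field_derivative x_deriv f t \<omega> x v) (at x) \<and> \<bar>x_deriv f t \<omega> x v\<bar> \<le> C)"
      using C1_bounded_derivsD[OF f] by (elim exE conjE)
    then have "((\<lambda>(x, v). f t \<omega> x v) has_derivative (\<lambda>(dx, dv). x_deriv f t \<omega> x v * dx + e t \<omega> x v * dv)) (at (x, v) within UNIV \<times> V) \<and>
      ((\<lambda>x. f t \<omega> x v) has_field_derivative x_deriv f t \<omega> x v) (at x)" using t v by blast
    then show ?thesis unfolding split_def by blast
  qed
  obtain eh where h: "((\<lambda>z. h t \<omega> (fst z) (snd z)) has_derivative (\<lambda>z. x_deriv h t \<omega> x v * fst z + eh * snd z)) (at (x, v) within UNIV \<times> V)"
      "((\<lambda>x. h t \<omega> x v) has_field_derivative x_deriv h t \<omega> x v) (at x)" using c[OF h_C1] by blast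
  obtain eb where b: "((\<lambda>z. b t \<omega> (fst z) (snd z)) has_derivative (\<lambda>z. x_deriv b t \<omega> x v * fst z + eb * snd z)) (at (x, v) within UNIV \<times> V)"
      "((\<lambda>x. b t \<omega> x v) has_field_derivative x_deriv b t \<omega> x v) (at x)" using c[OF coefficientD(1)[OF b_coefficient]] by blast
  obtain es where s: "((\<lambda>z. \<sigma> t \<omega> (fst z) (snd z)) has_derivative (\<lambda>z. x_deriv \<sigma> t \<omega> x v * fst z + es * snd z)) (at (x, v) within UNIV \<times> V)"
      "((\<lambda>x. \<sigma> t \<omega> x v) has_field_derivative x_deriv \<sigma> t \<omega> x v) (at x)" using c[OF coefficientD(1)[OF sigma_coefficient]] by blast
  obtain eg where g: "((\<lambda>z. \<gamma> t \<omega> (fst z) (snd z)) has_derivative (\<lambda>z. x_deriv \<gamma> t \<omega> x v * fst z + eg * snd z)) (at (x, v) within UNIV \<times> V)"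
      "((\<lambda>x. \<gamma> t \<omega> x v) has_field_derivative x_deriv \<gamma> t \<omega> x v) (at x)" using c[OF coefficientD(1)[OF gamma_coefficient]] by blast
  have "((\<lambda>x. hamiltonian lam b \<sigma> \<gamma> h t \<omega> x v p q w) has_field_derivative D) (at x)"
    unfolding hamiltonian_def D_def
    by (rule DERIV_cong[OF DERIV_add[OF DERIV_add[OF DERIV_add[OF h(2) DERIV_cmult_right[OF b(2)]] DERIV_cmult_right[OF s(2)]]
      DERIV_cmult_right[OF DERIV_cmult[OF g(2)]]]]) (simp add: algebra_simps)
  then show "x_deriv (\<lambda>t \<omega> x v. hamiltonian lam b \<sigma> \<gamma> h t \<omega> x v p q w) t \<omega> x v = D"
    by (rule DERIV_imp_deriv)
  show "\<exists>E. ((\<lambda>(x, v). hamiltonian lam b \<sigma> \<gamma> h t \<omega> x v p q w) has_derivative (\<lambda>(dx, dv). D * dx + E * dv)) (at (x, v) within UNIV \<times> V)"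
    unfolding hamiltonian_def split_def
    by (rule exI[of _ "eh + eb * p + es * q + lam t \<omega> * eg * w"], rule has_derivative_eq_rhs[OF
      has_derivative_add[OF has_derivative_add[OF has_derivative_add[OF h(1) has_derivative_mult_left[OF b(1)]] has_derivative_mult_left[OF s(1)]]
      has_derivative_mult_left[OF has_derivative_mult_right[OF g(1)]]]]) (simp add: D_def fun_eq_iff algebra_simps)
qed

lemma performance_regular:
  assumes u: "u \<in> A" and Y: "regular Y" and eq: "AE \<omega> in P. \<forall>t. Y t \<omega> = X u t \<omega>"
  shows "integrable R (at_pair (along h Y u))" "integrable P (\<lambda>\<omega>. g \<omega> (Y T \<omega>))"
    and "performance P T h g X u = (\<integral>x. at_pair (along h Y u) x \<partial>R) + (\<integral>\<omega>. g \<omega> (Y T \<omega>) \<partial>P)"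
proof -
  have Tin: "T \<in> {0..T}" using horizon_pos by auto
  note hm[measurable] = along_R(1)[OF h_C1 h_predictable u Y]
  have gm[measurable]: "(\<lambda>\<omega>. g \<omega> (Y T \<omega>)) \<in> borel_measurable P"
  proof (rule caratheodory_measurable[where S=UNIV and f=g and Y="Y T"])
    show "(\<lambda>m. g m y) \<in> borel_measurable P" for y
      using F_measurable[OF _ g_measurable] horizon_pos by simp
    show "continuous_on UNIV (g m)" if "m \<in> space P" for m
      using g_C1[OF that] by (auto intro!: continuous_at_imp_continuous_on field_differentiable_imp_continuous_at)
  qed (use regular_measurable[OF Y Tin] in auto)
  let ?r = "\<lambda>\<omega>. \<integral>\<^sup>+t\<in>{0..T}. ennreal ((h t \<omega> (X u t \<omega>) (u t \<omega>))\<^sup>2) \<partial>lborel"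
  have r: "(\<integral>\<^sup>+\<omega>. ?r \<omega> + ennreal ((g \<omega> (X u T \<omega>))\<^sup>2) \<partial>P) < \<infinity>" by (rule reward_L2[OF u])
  have "(\<integral>\<^sup>+x. ennreal ((at_pair (along h Y u) x)\<^sup>2) \<partial>R) = (\<integral>\<^sup>+\<omega>. \<integral>\<^sup>+t. ennreal ((along h Y u t \<omega>)\<^sup>2) \<partial>lbT \<partial>P)"
    by (subst nn_integral_R(1)) auto
  also have "\<dots> \<le> (\<integral>\<^sup>+\<omega>. ?r \<omega> + ennreal ((g \<omega> (X u T \<omega>))\<^sup>2) \<partial>P)"
    by (rule nn_integral_mono_AE) (use eq in \<open>eventually_elim, simp add: nn_set_integral_lbT\<close>)
  finally have h2: "(\<integral>\<^sup>+x. ennreal ((at_pair (along h Y u) x)\<^sup>2) \<partial>R) < \<infinity>" using r by (rule order_le_less_trans)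
  show hi: "integrable R (at_pair (along h Y u))"
    by (rule finite_measure.square_integrable_imp_integrable[OF finite_measure_R hm nn_integral_power2_lessD[OF hm h2]])
  have "(\<integral>\<^sup>+\<omega>. ennreal ((g \<omega> (Y T \<omega>))\<^sup>2) \<partial>P) \<le> (\<integral>\<^sup>+\<omega>. ?r \<omega> + ennreal ((g \<omega> (X u T \<omega>))\<^sup>2) \<partial>P)"
    by (rule nn_integral_mono_AE) (use eq in \<open>eventually_elim, simp\<close>)
  then have g2: "(\<integral>\<^sup>+\<omega>. ennreal ((g \<omega> (Y T \<omega>))\<^sup>2) \<partial>P) < \<infinity>" using r by (rule order_le_less_trans)
  show gi: "integrable P (\<lambda>\<omega>. g \<omega> (Y T \<omega>))"
    by (rule square_integrable_imp_integrable[OF gm nn_integral_power2_lessD[OF gm g2]])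
  let ?f = "\<lambda>\<omega>. (\<integral>t. along h Y u t \<omega> \<partial>lbT) + g \<omega> (Y T \<omega>)"
  let ?f' = "\<lambda>\<omega>. (LBINT t:{0..T}. h t \<omega> (X u t \<omega>) (u t \<omega>)) + g \<omega> (X u T \<omega>)"
  have hp: "integrable P (\<lambda>\<omega>. \<integral>t. along h Y u t \<omega> \<partial>lbT)" using integral_R(5)[OF hi] by simp
  have e: "AE \<omega> in P. ?f' \<omega> = ?f \<omega>"
    using eq
  proof eventually_elim
    case (elim \<omega>)
    show ?case using set_integral_lbT(2)[OF Tin, of "\<lambda>t. h t \<omega> (X u t \<omega>) (u t \<omega>)"] elim by simp
  qed
  have fm: "?f \<in> borel_measurable P" using hp gi by auto
  \<comment> \<open>The performance is defined with the original state, whose paths are uncontrolled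
    on a null set; completeness of \<open>P\<close> gives measurability of its integrand.\<close>
  have fm': "?f' \<in> borel_measurable P"
  proof (rule AE_E3[OF e])
    fix N assume N: "\<And>\<omega>. \<omega> \<in> space P - N \<Longrightarrow> ?f' \<omega> = ?f \<omega>" "N \<in> null_sets P"
    show ?thesis by (rule borel_measurable_off_null_set[OF fm N(2)], rule N(1), rule DiffI)
  qed
  have "performance P T h g X u = (\<integral>\<omega>. ?f \<omega> \<partial>P)"
    unfolding performance_def by (rule integral_cong_AE[OF fm' fm e])
  also have "\<dots> = (\<integral>x. at_pair (along h Y u) x \<partial>R) + (\<integral>\<omega>. g \<omega> (Y T \<omega>) \<partial>P)"
    using Bochner_Integration.integral_add[OF hp gi] integral_R(1)[OF hi] by simp
  finally show "performance P T h g X u = (\<integral>x. at_pair (along h Y u) x \<partial>R) + (\<integral>\<omega>. g \<omega> (Y T \<omega>) \<partial>P)" .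
qed

text \<open>The product formula produces \<gamma> at the left limits of the state. Since these agree
  with the state almost everywhere under dt \<otimes> P, \<open>K\<close> can be written with
  \<gamma> at the state itself, as in the Hamiltonian.\<close>

lemma state_duality:
  assumes p: "regular p" and dp: "has_stoch_differential P W \<tau> lam T p \<alpha> q w"
    and q: "pred q" "integrable R (\<lambda>x. (at_pair q x)\<^sup>2)"
    and w: "pred w" "integrable R (\<lambda>x. (at_pair w x)\<^sup>2 * lamw x)"
    and \<alpha>: "\<And>t. t \<in> {0..T} \<Longrightarrow> \<alpha> t \<in> borel_measurable (F t)" "at_pair \<alpha> \<in> borel_measurable R"
      "\<And>x. x \<in> space R \<Longrightarrow> \<bar>at_pair \<alpha> x\<bar> \<le> D * (1 + \<bar>at_pair p x\<bar> + \<bar>at_pair q x\<bar> + lamw x * \<bar>at_pair w x\<bar>)"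
    and u: "u \<in> A" and Y: "regular Y" "AE \<omega> in P. Y 0 \<omega> = x0"
    and dY: "has_stoch_differential P W \<tau> lam T Y (along b Y u) (along \<sigma> Y u) (along \<gamma> (left_limit Y) u)"
  defines "K \<equiv> \<lambda>x. at_pair \<alpha> x * at_pair Y x + at_pair (along b Y u) x * at_pair p x + at_pair q x * at_pair (along \<sigma> Y u) x
    + at_pair w x * at_pair (along \<gamma> Y u) x * lamw x"
  shows "integrable P (\<lambda>\<omega>. p T \<omega> * Y T \<omega>)" "integrable R K"
    "(\<integral>\<omega>. p T \<omega> * Y T \<omega> \<partial>P) = x0 * (\<integral>\<omega>. p 0 \<omega> \<partial>P) + (\<integral>x. K x \<partial>R)"
proof -
  note bc = coefficientD[OF b_coefficient] and sc = coefficientD[OF sigma_coefficient] and gc = coefficientD[OF gamma_coefficient]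
  obtain Cb Cs Cg where C: "\<forall>t\<in>{0..T}. \<forall>\<omega>\<in>space P. \<forall>x. \<forall>v\<in>V. \<bar>b t \<omega> x v\<bar> \<le> Cb"
    "\<forall>t\<in>{0..T}. \<forall>\<omega>\<in>space P. \<forall>x. \<forall>v\<in>V. \<bar>\<sigma> t \<omega> x v\<bar> \<le> Cs"
    "\<forall>t\<in>{0..T}. \<forall>\<omega>\<in>space P. \<forall>x. \<forall>v\<in>V. \<bar>\<gamma> t \<omega> x v\<bar> \<le> Cg"
    using bc(3) sc(3) gc(3) by (elim exE)
  let ?C = "\<bar>Cb\<bar> + \<bar>Cs\<bar> + \<bar>Cg\<bar>"
  have V: "u t \<omega> \<in> V" if "t \<in> {0..T}" "\<omega> \<in> space P" for t \<omega> using admissible_values[OF u that] .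
  have bb: "\<bar>b t \<omega> y (u t \<omega>)\<bar> \<le> ?C" "\<bar>\<sigma> t \<omega> y (u t \<omega>)\<bar> \<le> ?C" "\<bar>\<gamma> t \<omega> y (u t \<omega>)\<bar> \<le> ?C"
    if h: "t \<in> {0..T}" "\<omega> \<in> space P" for t \<omega> y
  proof -
    have "\<bar>b t \<omega> y (u t \<omega>)\<bar> \<le> Cb" "\<bar>\<sigma> t \<omega> y (u t \<omega>)\<bar> \<le> Cs" "\<bar>\<gamma> t \<omega> y (u t \<omega>)\<bar> \<le> Cg"
      using C V[OF h] h by blast+
    then show "\<bar>b t \<omega> y (u t \<omega>)\<bar> \<le> ?C" "\<bar>\<sigma> t \<omega> y (u t \<omega>)\<bar> \<le> ?C" "\<bar>\<gamma> t \<omega> y (u t \<omega>)\<bar> \<le> ?C" by linarith+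
  qed
  have \<kappa>: "pred (along \<gamma> (left_limit Y) u)" by (rule along_left_limit_pred[OF gc(1,2) u Y(1)])
  have pb: "pbounded ?C (along \<gamma> (left_limit Y) u)"
    using \<kappa> bb(3) by (simp add: pbounded_def)
  have bR: "\<bar>at_pair (along b Y u) x\<bar> \<le> ?C" if "x \<in> space R" for x using bb(1) that by auto
  have sR: "\<bar>at_pair (along \<sigma> Y u) x\<bar> \<le> ?C" if "x \<in> space R" for x using bb(2) that by auto
  note m[measurable] = along_R(1)[OF bc(1,2) u Y(1)] along_R(1)[OF sc(1,2) u Y(1)] along_R(1)[OF gc(1,2) u Y(1)]
    pred_R[OF w(1)] pred_R[OF \<kappa>]
  note pf = product_formula[OF p Y dp dY q w \<alpha> along_adapted(1)[OF bc(1,2) u Y(1)] m(1) bR m(2) sR pb]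
  have e: "AE x in R. at_pair w x * at_pair (along \<gamma> (left_limit Y) u) x * lamw x = at_pair w x * at_pair (along \<gamma> Y u) x * lamw x"
    using AE_R_left_limit[OF Y(1)] by eventually_elim simp
  have m1: "(\<lambda>x. at_pair w x * at_pair (along \<gamma> (left_limit Y) u) x * lamw x) \<in> borel_measurable R"
    and m2: "(\<lambda>x. at_pair w x * at_pair (along \<gamma> Y u) x * lamw x) \<in> borel_measurable R" by measurable
  have i5: "integrable R (\<lambda>x. at_pair w x * at_pair (along \<gamma> Y u) x * lamw x)"
    using integrable_cong_AE[OF m1 m2 e] pf(5) by simp
  note i3 = Bochner_Integration.integrable_add[OF pf(2,3)] and i4 = Bochner_Integration.integrable_add[OF Bochner_Integration.integrable_add[OF pf(2,3)] pf(4)]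
  show "integrable P (\<lambda>\<omega>. p T \<omega> * Y T \<omega>)" by (rule pf(1))
  show "integrable R K" unfolding K_def by (rule Bochner_Integration.integrable_add[OF i4 i5])
  show "(\<integral>\<omega>. p T \<omega> * Y T \<omega> \<partial>P) = x0 * (\<integral>\<omega>. p 0 \<omega> \<partial>P) + (\<integral>x. K x \<partial>R)"
    using pf(6) Bochner_Integration.integral_add[OF i4 i5] Bochner_Integration.integral_add[OF i3 pf(4)]
      Bochner_Integration.integral_add[OF pf(2,3)] integral_cong_AE[OF m1 m2 e] unfolding K_def by linarith
qed

lemma concave_tangent:
  assumes g: "concave_on UNIV (g \<omega>)" and \<omega>: "\<omega> \<in> space P"
  shows "g \<omega> y - g \<omega> x \<le> deriv (g \<omega>) x * (y - x)"
proof -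
  have "(g \<omega> has_field_derivative deriv (g \<omega>) x) (at x)"
    using g_C1[OF \<omega>] by (simp add: DERIV_deriv_iff_field_differentiable)
  then have "((\<lambda>x. - g \<omega> x) has_field_derivative - deriv (g \<omega>) x) (at x within UNIV)" by (auto intro: DERIV_minus)
  from convex_on_imp_above_tangent[of UNIV "\<lambda>x. - g \<omega> x" x y, OF _ _ _ _ this] g
  show ?thesis by (simp add: concave_on_def)
qed

text \<open>The terminal value of the adjoint process is a supergradient of the concave g at
  \<open>Z T\<close>.\<close>

lemma terminal_bound:
  assumes u: "u \<in> A" and uh: "uh \<in> A" and Y: "regular Y" "AE \<omega> in P. \<forall>t. Y t \<omega> = X u t \<omega>"
    and Z: "regular Z" "AE \<omega> in P. \<forall>t. Z t \<omega> = X uh t \<omega>" and conc: "AE \<omega> in P. concave_on UNIV (g \<omega>)"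
    and p: "AE \<omega> in P. p T \<omega> = deriv (g \<omega>) (Z T \<omega>)"
    and i: "integrable P (\<lambda>\<omega>. p T \<omega> * Y T \<omega>)" "integrable P (\<lambda>\<omega>. p T \<omega> * Z T \<omega>)"
  shows "(\<integral>\<omega>. g \<omega> (Y T \<omega>) \<partial>P) - (\<integral>\<omega>. g \<omega> (Z T \<omega>) \<partial>P) \<le> (\<integral>\<omega>. p T \<omega> * Y T \<omega> \<partial>P) - (\<integral>\<omega>. p T \<omega> * Z T \<omega> \<partial>P)"
proof -
  note gi = performance_regular(2)[OF u Y] performance_regular(2)[OF uh Z]
  have "(\<integral>\<omega>. g \<omega> (Y T \<omega>) - g \<omega> (Z T \<omega>) \<partial>P) \<le> (\<integral>\<omega>. p T \<omega> * Y T \<omega> - p T \<omega> * Z T \<omega> \<partial>P)"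
  proof (rule integral_mono_AE)
    show "AE \<omega> in P. g \<omega> (Y T \<omega>) - g \<omega> (Z T \<omega>) \<le> p T \<omega> * Y T \<omega> - p T \<omega> * Z T \<omega>"
      using conc p AE_space
    proof eventually_elim
      case (elim \<omega>)
      then show ?case using concave_tangent[of \<omega> "Y T \<omega>" "Z T \<omega>"] by (simp add: algebra_simps)
    qed
  qed (use gi i in auto)
  then show ?thesis using gi i by simp
qed

text \<open>The terms regroup as H(Y, u) - H(Z, uh) - D (Y - Z), with the Hamiltonian at the adjoint
  processes and D its x-derivative at the candidate, so that \<open>concave_maximum_bound\<close>
  applies pointwise.\<close>

lemma running_bound:
  assumes u: "u \<in> A" and uh: "uh \<in> A" and Y: "regular Y"
    and Z: "regular Z" "AE \<omega> in P. \<forall>t. Z t \<omega> = X uh t \<omega>"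
    and p: "regular p'" "AE \<omega> in P. \<forall>t. p' t \<omega> = p t \<omega>" and q: "pred q" and w: "pred w"
    and conc: "\<forall>t\<in>{0..T}. AE \<omega> in P. concave_on (UNIV \<times> V)
           (\<lambda>(x, v). hamiltonian lam b \<sigma> \<gamma> h t \<omega> x v (p t \<omega>) (q t \<omega>) (w t \<omega>))"
    and mx: "AE (t, \<omega>) in lborel \<Otimes>\<^sub>M P. t \<in> {0..T} \<longrightarrow>
           (\<forall>v\<in>V. hamiltonian lam b \<sigma> \<gamma> h t \<omega> (X uh t \<omega>) v (p t \<omega>) (q t \<omega>) (w t \<omega>)
                  \<le> hamiltonian lam b \<sigma> \<gamma> h t \<omega> (X uh t \<omega>) (uh t \<omega>) (p t \<omega>) (q t \<omega>) (w t \<omega>))"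
  defines "D \<equiv> \<lambda>t \<omega>. along (x_deriv h) Z uh t \<omega> + along (x_deriv b) Z uh t \<omega> * p' t \<omega> + along (x_deriv \<sigma>) Z uh t \<omega> * q t \<omega>
      + lam t \<omega> * along (x_deriv \<gamma>) Z uh t \<omega> * w t \<omega>"
  shows "AE x in R. at_pair (along h Y u) x - at_pair (along h Z uh) x
    + (- at_pair D x * at_pair Y x + at_pair (along b Y u) x * at_pair p' x + at_pair q x * at_pair (along \<sigma> Y u) x + at_pair w x * at_pair (along \<gamma> Y u) x * lamw x)
    - (- at_pair D x * at_pair Z x + at_pair (along b Z uh) x * at_pair p' x + at_pair q x * at_pair (along \<sigma> Z uh) x + at_pair w x * at_pair (along \<gamma> Z uh) x * lamw x)
    \<le> 0" (is "AE x in R. ?G x \<le> 0")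
proof (rule TP.AE_pair_measure)
  note bc = coefficientD(1,2)[OF b_coefficient] and sc = coefficientD(1,2)[OF sigma_coefficient] and gc = coefficientD(1,2)[OF gamma_coefficient]
    and hc = h_C1 h_predictable
  note [measurable] = along_R[OF bc u Y] along_R[OF sc u Y] along_R[OF gc u Y] along_R[OF hc u Y]
    along_R[OF bc uh Z(1)] along_R[OF sc uh Z(1)] along_R[OF gc uh Z(1)] along_R[OF hc uh Z(1)]
    regular_R[OF Y] regular_R[OF Z(1)] regular_R[OF p(1)] pred_R[OF q] pred_R[OF w]
  have [measurable]: "at_pair D \<in> borel_measurable R" unfolding D_def by measurable
  show "{x \<in> space R. ?G x \<le> 0} \<in> sets R" by measurable
  interpret LP: pair_sigma_finite lborel P by unfold_locales
  \<comment> \<open>Concavity holds almost surely for each t separately, with a null set depending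
    on t. The maximum condition is therefore disintegrated to fixed t first; measurability of the
    set where the bound holds, shown above, leads back to \<open>R\<close>.\<close>
  have "AE t in lborel. AE \<omega> in P. t \<in> {0..T} \<longrightarrow>
           (\<forall>v\<in>V. hamiltonian lam b \<sigma> \<gamma> h t \<omega> (X uh t \<omega>) v (p t \<omega>) (q t \<omega>) (w t \<omega>)
                  \<le> hamiltonian lam b \<sigma> \<gamma> h t \<omega> (X uh t \<omega>) (uh t \<omega>) (p t \<omega>) (q t \<omega>) (w t \<omega>))"
    using LP.AE_pair[OF mx] by simp
  then have "AE t in lborel. t \<in> {0..T} \<longrightarrow> (AE \<omega> in P. ?G (t, \<omega>) \<le> 0)"
  proof eventually_elim
    case (elim t)
    show ?case
    proof
      assume t: "t \<in> {0..T}"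
      from elim conc[rule_format, OF t] Z(2) p(2) AE_space show "AE \<omega> in P. ?G (t, \<omega>) \<le> 0"
      proof eventually_elim
        case (elim \<omega>)
        note v = admissible_values[OF uh t elim(5)] and v1 = admissible_values[OF u t elim(5)]
        let ?H = "\<lambda>x v. hamiltonian lam b \<sigma> \<gamma> h t \<omega> x v (p t \<omega>) (q t \<omega>) (w t \<omega>)"
        have Zt: "Z t \<omega> = X uh t \<omega>" and pt: "p' t \<omega> = p t \<omega>" using elim(3,4) by auto
        obtain E where E: "((\<lambda>(x, v). ?H x v) has_derivative (\<lambda>(dx, dv). D t \<omega> * dx + E * dv)) (at (Z t \<omega>, uh t \<omega>) within UNIV \<times> V)"
          using hamiltonian_derivative(2)[OF t elim(5) v, where x="Z t \<omega>" and p="p t \<omega>" and q="q t \<omega>" and w="w t \<omega>"] unfolding D_def pt by blast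
        have "?H (Y t \<omega>) (u t \<omega>) - ?H (Z t \<omega>) (uh t \<omega>) \<le> D t \<omega> * (Y t \<omega> - Z t \<omega>)"
          by (rule concave_maximum_bound[OF elim(2) convex_V v v1 E]) (use elim(1) t Zt in auto)
        then show ?case by (simp add: hamiltonian_def pt algebra_simps)
      qed
    qed
  qed
  then show "AE t in lbT. AE \<omega> in P. ?G (t, \<omega>) \<le> 0"
    by (subst AE_restrict_space_iff) auto
qed

lemma H2_square:
  assumes "q \<in> H2 P F T" shows "pred q" "integrable R (\<lambda>x. (at_pair q x)\<^sup>2)"
proof -
  show q: "pred q" using assms by (simp add: H2_def)
  note m[measurable] = pred_R[OF q]
  have "(\<integral>\<^sup>+x. ennreal ((at_pair q x)\<^sup>2) \<partial>R) = (\<integral>\<^sup>+\<omega>. (\<integral>\<^sup>+t\<in>{0..T}. ennreal (\<bar>q t \<omega>\<bar>\<^sup>2) \<partial>lborel) \<partial>P)"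
    by (subst nn_integral_R(1)) (simp_all add: nn_set_integral_lbT)
  also have "\<dots> < \<infinity>" using assms by (simp add: H2_def)
  finally show "integrable R (\<lambda>x. (at_pair q x)\<^sup>2)" by (rule nn_integral_power2_lessD[OF m])
qed

lemma H2_lam_square:
  assumes "w \<in> H2_lam P F lam T" shows "pred w" "integrable R (\<lambda>x. (at_pair w x)\<^sup>2 * lamw x)"
proof -
  show w: "pred w" using assms by (simp add: H2_lam_def)
  note [measurable] = pred_R[OF w]
  show "integrable R (\<lambda>x. (at_pair w x)\<^sup>2 * lamw x)"
  proof (rule integrableI_nonneg)
    have "(\<integral>\<^sup>+x. ennreal ((at_pair w x)\<^sup>2 * lamw x) \<partial>R) = (\<integral>\<^sup>+\<omega>. (\<integral>\<^sup>+t\<in>{0..T}. ennreal (lam t \<omega> * \<bar>w t \<omega>\<bar>\<^sup>2) \<partial>lborel) \<partial>P)"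
      by (subst nn_integral_R(1)) (simp_all add: nn_set_integral_lbT mult.commute[of "lam _ _"])
    also have "\<dots> < \<infinity>" using assms by (simp add: H2_lam_def)
    finally show "(\<integral>\<^sup>+x. ennreal ((at_pair w x)\<^sup>2 * lamw x) \<partial>R) < \<infinity>" .
    show "AE x in R. 0 \<le> (at_pair w x)\<^sup>2 * lamw x" using lamw_nonneg by (intro AE_I2) simp
  qed measurable
qed

lemma x_deriv_bound:
  assumes "C1_bounded_derivs P T V f" "u \<in> A"
  shows "\<exists>C\<ge>0. \<forall>t\<in>{0..T}. \<forall>\<omega>\<in>space P. \<forall>x. \<bar>x_deriv f t \<omega> x (u t \<omega>)\<bar> \<le> C"
proof -
  obtain e C where C: "0 \<le> C" "\<forall>t\<in>{0..T}. \<forall>\<omega>\<in>space P. continuous_on (UNIV \<times> V) (\<lambda>(x, v). f t \<omega> x v) \<and>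
      (\<forall>x. \<forall>v\<in>V. ((\<lambda>(x, v). f t \<omega> x v) has_derivative (\<lambda>(dx, dv). x_deriv f t \<omega> x v * dx + e t \<omega> x v * dv)) (at (x, v) within UNIV \<times> V) \<and>
      ((\<lambda>x. f t \<omega> x v) has_field_derivative x_deriv f t \<omega> x v) (at x) \<and> \<bar>x_deriv f t \<omega> x v\<bar> \<le> C)"
    using C1_bounded_derivsD[OF assms(1)] by (elim exE conjE)
  then show ?thesis using admissible_values[OF assms(2)] by blast
qed

lemma affine_bound:
  fixes d1 d2 d3 d4 p q l w :: real
  assumes "\<bar>d1\<bar> \<le> C1" "\<bar>d2\<bar> \<le> C2" "\<bar>d3\<bar> \<le> C3" "\<bar>d4\<bar> \<le> C4" "0 \<le> l"
  shows "\<bar>- (d1 + d2 * p + d3 * q + l * d4 * w)\<bar> \<le> (C1 + C2 + C3 + C4) * (1 + \<bar>p\<bar> + \<bar>q\<bar> + l * \<bar>w\<bar>)"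
proof -
  let ?m = "1 + \<bar>p\<bar> + \<bar>q\<bar> + l * \<bar>w\<bar>"
  have lw: "0 \<le> l * \<bar>w\<bar>" using assms by simp
  have "\<bar>d1\<bar> * 1 \<le> C1 * ?m" "\<bar>d2\<bar> * \<bar>p\<bar> \<le> C2 * ?m" "\<bar>d3\<bar> * \<bar>q\<bar> \<le> C3 * ?m" "\<bar>d4\<bar> * (l * \<bar>w\<bar>) \<le> C4 * ?m"
    by (rule mult_mono; use assms lw in linarith)+
  moreover have "\<bar>l * d4 * w\<bar> = \<bar>d4\<bar> * (l * \<bar>w\<bar>)" using assms by (simp add: abs_mult)
  ultimately have "\<bar>d1\<bar> + \<bar>d2 * p\<bar> + \<bar>d3 * q\<bar> + \<bar>l * d4 * w\<bar> \<le> (C1 + C2 + C3 + C4) * ?m"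
    unfolding distrib_right abs_mult[of d2 p] abs_mult[of d3 q] by linarith
  then show ?thesis by linarith
qed

theorem maximum_principle:
  assumes uh: "uh \<in> A" and adj: "adjoint_solution P W \<tau> lam T b \<sigma> \<gamma> h g uh (X uh) p q w"
    and cg: "AE \<omega> in P. concave_on UNIV (g \<omega>)"
    and conc: "\<forall>t\<in>{0..T}. AE \<omega> in P. concave_on (UNIV \<times> V)
           (\<lambda>(x, v). hamiltonian lam b \<sigma> \<gamma> h t \<omega> x v (p t \<omega>) (q t \<omega>) (w t \<omega>))"
    and mx: "AE (t, \<omega>) in lborel \<Otimes>\<^sub>M P. t \<in> {0..T} \<longrightarrow>
           (\<forall>v\<in>V. hamiltonian lam b \<sigma> \<gamma> h t \<omega> (X uh t \<omega>) v (p t \<omega>) (q t \<omega>) (w t \<omega>)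
                  \<le> hamiltonian lam b \<sigma> \<gamma> h t \<omega> (X uh t \<omega>) (uh t \<omega>) (p t \<omega>) (q t \<omega>) (w t \<omega>))"
    and u: "u \<in> A"
  shows "performance P T h g X u \<le> performance P T h g X uh"
proof -
  have p: "p \<in> S2 P F T" and q: "q \<in> H2 P F T" and w: "w \<in> H2_lam P F lam T"
    and dp: "has_stoch_differential P W \<tau> lam T p
       (\<lambda>t \<omega>. - deriv (\<lambda>x. hamiltonian lam b \<sigma> \<gamma> h t \<omega> x (uh t \<omega>) (p t \<omega>) (q t \<omega>) (w t \<omega>)) (X uh t \<omega>)) q w"
    and pT: "AE \<omega> in P. p T \<omega> = deriv (g \<omega>) (X uh T \<omega>)"
    using adj by (auto simp: adjoint_solution_def)
  note q2 = H2_square[OF q] and w2 = H2_lam_square[OF w]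
  obtain Y where Y: "regular Y" "AE \<omega> in P. \<forall>t. Y t \<omega> = X u t \<omega>" "AE \<omega> in P. Y 0 \<omega> = x0"
    "has_stoch_differential P W \<tau> lam T Y (along b Y u) (along \<sigma> Y u) (along \<gamma> (left_limit Y) u)"
    using state_regular[OF u] by blast
  obtain Z where Z: "regular Z" "AE \<omega> in P. \<forall>t. Z t \<omega> = X uh t \<omega>" "AE \<omega> in P. Z 0 \<omega> = x0"
    "has_stoch_differential P W \<tau> lam T Z (along b Z uh) (along \<sigma> Z uh) (along \<gamma> (left_limit Z) uh)"
    using state_regular[OF uh] by blast
  have "\<exists>p'. regular p' \<and> (AE \<omega> in P. \<forall>t. p' t \<omega> = p t \<omega>)"
  proof (rule S2_regular[OF p])
    fix N assume N: "N \<in> null_sets P" "regular (\<lambda>t \<omega>. if \<omega> \<in> N then 0 else p t \<omega>)"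
    have "AE \<omega> in P. \<forall>t. (if \<omega> \<in> N then 0 else p t \<omega>) = p t \<omega>"
      using AE_not_in[OF N(1)] by eventually_elim simp
    with N(2) show ?thesis by blast
  qed
  then obtain p' where p': "regular p'" "AE \<omega> in P. \<forall>t. p' t \<omega> = p t \<omega>" by blast
  \<comment> \<open>The x-derivative of the Hamiltonian, written out along the regular versions so
    that its adaptedness and its affine bound in p, q and \<lambda> w can be read off.\<close>
  define D where "D = (\<lambda>t \<omega>. along (x_deriv h) Z uh t \<omega> + along (x_deriv b) Z uh t \<omega> * p' t \<omega> + along (x_deriv \<sigma>) Z uh t \<omega> * q t \<omega>
      + lam t \<omega> * along (x_deriv \<gamma>) Z uh t \<omega> * w t \<omega>)"
  define \<alpha> where "\<alpha> = (\<lambda>t \<omega>. - D t \<omega>)"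
  note bc = coefficientD(1,2)[OF b_coefficient] and sc = coefficientD(1,2)[OF sigma_coefficient] and gc = coefficientD(1,2)[OF gamma_coefficient]
    and hc = h_C1 h_predictable
  have dp': "has_stoch_differential P W \<tau> lam T p' \<alpha> q w"
  proof (rule has_stoch_differential_cong[OF dp less_imp_le[OF horizon_pos]])
    show "AE \<omega> in P. \<forall>t\<in>{0..T}. p t \<omega> = p' t \<omega> \<and>
      - deriv (\<lambda>x. hamiltonian lam b \<sigma> \<gamma> h t \<omega> x (uh t \<omega>) (p t \<omega>) (q t \<omega>) (w t \<omega>)) (X uh t \<omega>) = \<alpha> t \<omega> \<and> q t \<omega> = q t \<omega> \<and> w t \<omega> = w t \<omega>"
      using p'(2) Z(2) AE_space
    proof eventually_elim
      case (elim \<omega>)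
      show ?case
      proof
        fix t assume t: "t \<in> {0..T}"
        show "p t \<omega> = p' t \<omega> \<and>
      - deriv (\<lambda>x. hamiltonian lam b \<sigma> \<gamma> h t \<omega> x (uh t \<omega>) (p t \<omega>) (q t \<omega>) (w t \<omega>)) (X uh t \<omega>) = \<alpha> t \<omega> \<and> q t \<omega> = q t \<omega> \<and> w t \<omega> = w t \<omega>"
          using elim(1,2) hamiltonian_derivative(1)[OF t elim(3) admissible_values[OF uh t elim(3)]]
          by (simp add: \<alpha>_def D_def)
      qed
    qed
  qed
  obtain Ch Cb Cs Cg where C: "\<forall>t\<in>{0..T}. \<forall>\<omega>\<in>space P. \<forall>x. \<bar>x_deriv h t \<omega> x (uh t \<omega>)\<bar> \<le> Ch"
    "\<forall>t\<in>{0..T}. \<forall>\<omega>\<in>space P. \<forall>x. \<bar>x_deriv b t \<omega> x (uh t \<omega>)\<bar> \<le> Cb"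
    "\<forall>t\<in>{0..T}. \<forall>\<omega>\<in>space P. \<forall>x. \<bar>x_deriv \<sigma> t \<omega> x (uh t \<omega>)\<bar> \<le> Cs"
    "\<forall>t\<in>{0..T}. \<forall>\<omega>\<in>space P. \<forall>x. \<bar>x_deriv \<gamma> t \<omega> x (uh t \<omega>)\<bar> \<le> Cg"
    using x_deriv_bound[OF hc(1) uh] x_deriv_bound[OF bc(1) uh] x_deriv_bound[OF sc(1) uh] x_deriv_bound[OF gc(1) uh] by (elim exE conjE)
  have \<alpha>1: "\<alpha> t \<in> borel_measurable (F t)" if t: "t \<in> {0..T}" for t
  proof -
    note [measurable] = along_adapted(2)[OF hc uh Z(1) t] along_adapted(2)[OF bc uh Z(1) t] along_adapted(2)[OF sc uh Z(1) t]
      along_adapted(2)[OF gc uh Z(1) t] regular_measurable_F[OF p'(1) t] pred_section[OF q2(1) t] pred_section[OF w2(1) t] lam_section[OF t]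
    show ?thesis unfolding \<alpha>_def D_def by measurable
  qed
  note [measurable] = along_R(2)[OF hc uh Z(1)] along_R(2)[OF bc uh Z(1)] along_R(2)[OF sc uh Z(1)]
      along_R(2)[OF gc uh Z(1)] regular_R[OF p'(1)] pred_R[OF q2(1)] pred_R[OF w2(1)]
  have \<alpha>2: "at_pair \<alpha> \<in> borel_measurable R" unfolding \<alpha>_def D_def by measurable
  have \<alpha>3: "\<bar>at_pair \<alpha> x\<bar> \<le> (Ch + Cb + Cs + Cg) * (1 + \<bar>at_pair p' x\<bar> + \<bar>at_pair q x\<bar> + lamw x * \<bar>at_pair w x\<bar>)"
    if x: "x \<in> space R" for x
    unfolding \<alpha>_def D_def by (rule affine_bound) (use C lamw_nonneg[OF x] x in auto)
  let ?K = "\<lambda>Y u x. at_pair \<alpha> x * at_pair Y x + at_pair (along b Y u) x * at_pair p' x + at_pair q x * at_pair (along \<sigma> Y u) x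
    + at_pair w x * at_pair (along \<gamma> Y u) x * lamw x"
  have dY: "integrable P (\<lambda>\<omega>. p' T \<omega> * Y T \<omega>)" "integrable R (?K Y u)"
    "(\<integral>\<omega>. p' T \<omega> * Y T \<omega> \<partial>P) = x0 * (\<integral>\<omega>. p' 0 \<omega> \<partial>P) + (\<integral>x. ?K Y u x \<partial>R)"
    by (rule state_duality[OF p'(1) dp' q2 w2 \<alpha>1 \<alpha>2 \<alpha>3 u Y(1,3,4)]; assumption)+
  have dZ: "integrable P (\<lambda>\<omega>. p' T \<omega> * Z T \<omega>)" "integrable R (?K Z uh)"
    "(\<integral>\<omega>. p' T \<omega> * Z T \<omega> \<partial>P) = x0 * (\<integral>\<omega>. p' 0 \<omega> \<partial>P) + (\<integral>x. ?K Z uh x \<partial>R)"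
    by (rule state_duality[OF p'(1) dp' q2 w2 \<alpha>1 \<alpha>2 \<alpha>3 uh Z(1,3,4)]; assumption)+
  note fY = performance_regular[OF u Y(1,2)] and fZ = performance_regular[OF uh Z(1,2)]
  have "AE \<omega> in P. p' T \<omega> = deriv (g \<omega>) (Z T \<omega>)"
    using pT p'(2) Z(2) by eventually_elim simp
  note tb = terminal_bound[where p=p', OF u uh Y(1,2) Z(1,2) cg this dY(1) dZ(1)]
  have "AE x in R. at_pair (along h Y u) x - at_pair (along h Z uh) x + ?K Y u x - ?K Z uh x \<le> 0"
    using running_bound[OF u uh Y(1) Z(1,2) p' q2(1) w2(1) conc mx] unfolding \<alpha>_def D_def by simp
  then have "0 \<le> (\<integral>x. - (at_pair (along h Y u) x - at_pair (along h Z uh) x + ?K Y u x - ?K Z uh x) \<partial>R)"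
    by (intro integral_nonneg_AE) simp
  then have "(\<integral>x. at_pair (along h Y u) x - at_pair (along h Z uh) x + ?K Y u x - ?K Z uh x \<partial>R) \<le> 0"
    unfolding Bochner_Integration.integral_minus neg_0_le_iff_le .
  also have "(\<integral>x. at_pair (along h Y u) x - at_pair (along h Z uh) x + ?K Y u x - ?K Z uh x \<partial>R)
    = (\<integral>x. at_pair (along h Y u) x \<partial>R) - (\<integral>x. at_pair (along h Z uh) x \<partial>R) + (\<integral>x. ?K Y u x \<partial>R) - (\<integral>x. ?K Z uh x \<partial>R)"
    unfolding Bochner_Integration.integral_diff[OF Bochner_Integration.integrable_add[OF Bochner_Integration.integrable_diff[OF fY(1) fZ(1)] dY(2)] dZ(2)]
      Bochner_Integration.integral_add[OF Bochner_Integration.integrable_diff[OF fY(1) fZ(1)] dY(2)]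
      Bochner_Integration.integral_diff[OF fY(1) fZ(1)] ..
  \<comment> \<open>Both states start at \<open>x0\<close>, so the terms \<open>x0\<close> times
    E[p' 0] in the two dualities cancel.\<close>
  finally show ?thesis using fY(3) fZ(3) tb dY(3) dZ(3) by linarith
qed

end

theorem theorem3p2:
  fixes P :: "'a measure"
    and W :: "real \<Rightarrow> 'a \<Rightarrow> real" and \<tau> :: "'a \<Rightarrow> real" and lam :: "real \<Rightarrow> 'a \<Rightarrow> real"
    and T :: real and V :: "real set" and A :: "(real \<Rightarrow> 'a \<Rightarrow> real) set" and x0 :: real
    and b \<sigma> \<gamma> h :: "real \<Rightarrow> 'a \<Rightarrow> real \<Rightarrow> real \<Rightarrow> real"
    and g :: "'a \<Rightarrow> real \<Rightarrow> real"
    and X :: "(real \<Rightarrow> 'a \<Rightarrow> real) \<Rightarrow> real \<Rightarrow> 'a \<Rightarrow> real"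
    and uh p q w :: "real \<Rightarrow> 'a \<Rightarrow> real"
  assumes "default_control_problem P W \<tau> lam T V A x0 b \<sigma> \<gamma> h g X"
    and "uh \<in> A"
    and "adjoint_solution P W \<tau> lam T b \<sigma> \<gamma> h g uh (X uh) p q w"
    and "AE \<omega> in P. concave_on UNIV (g \<omega>)"
    and "\<forall>t\<in>{0..T}. AE \<omega> in P. concave_on (UNIV \<times> V)
           (\<lambda>(x, v). hamiltonian lam b \<sigma> \<gamma> h t \<omega> x v (p t \<omega>) (q t \<omega>) (w t \<omega>))"
    and "AE (t, \<omega>) in lborel \<Otimes>\<^sub>M P. t \<in> {0..T} \<longrightarrow>
           (\<forall>v\<in>V. hamiltonian lam b \<sigma> \<gamma> h t \<omega> (X uh t \<omega>) v (p t \<omega>) (q t \<omega>) (w t \<omega>)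
                  \<le> hamiltonian lam b \<sigma> \<gamma> h t \<omega> (X uh t \<omega>) (uh t \<omega>) (p t \<omega>) (q t \<omega>) (w t \<omega>))"
  shows "\<forall>u\<in>A. performance P T h g X u \<le> performance P T h g X uh"
proof -
  interpret default_control_problem P W \<tau> lam T V A x0 b \<sigma> \<gamma> h g X by fact
  show ?thesis using maximum_principle assms(2-) by blast
qed

end
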